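(* Let $m,n\ge1$ and let $N=S^n/G$ be the orbit manifold of a free smooth action of a nontrivial finite group $G$ on $S^n$. Given $[f]\in\pi_m(S^n/G)$ and a lifting $[\tilde f]\in\pi_m(S^n)$ of $[f]$, the following conditions are equivalent: (i) $\partial_N(f)\ne0$ but $E\circ\partial_N(f)=0$; (ii) $MCC(f,f)\ne N^\#(f,f)$; (iii) $N^\#(f,f)=0$ but $f$ is coincidence producing (i.e. the pair $(f,f')$ is not loose for any map $f'\colon S^m\to N$; thus $MCC(f,f')\neq 0$); (iv) $MCC(f,f)>MCC(\tilde f,\tilde f)$; (v) $MC(f,f)>MC(\tilde f,\tilde f)$; (vi) $(\tilde f,\tilde f)$ is loose, but $(f,f)$ is not loose; (vii) $(\tilde f,\tilde f)$ is loose, but not by small deformation.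
   Context: $\partial_N\colon\pi_m(N)\to\pi_{m-1}(S^{n-1})$ is the boundary homomorphism in the exact homotopy sequence of the unit tangent sphere bundle $STN\to N$ with fiber $S^{n-1}$ (any Riemannian metric); for $m=1$ put $\partial_N\equiv0$. $E\colon\pi_{m-1}(S^{n-1})\to\pi_m(S^n)$ is the Freudenthal suspension. $\sim$ means homotopic (basepoint free). A pair $f_1,f_2\colon M\to N$ is loose if there are $f_1'\sim f_1$, $f_2'\sim f_2$ with $f_1'(x)\ne f_2'(x)$ for all $x\in M$. A pair $(f,f)$ is loose by small deformation if for every metric on the target and every $\varepsilon>0$ there is an $\varepsilon$-approximation $f'$ of $f$ with $f'(x)\neq f(x)$ for all $x\in M$. For continuous maps $f_1,f_2\colon M\to N$ between connected smooth manifolds without boundary of dimensions $m,n\ge1$, $M$ compact, let $C(f_1,f_2)=\{x\in M:f_1(x)=f_2(x)\}$; $MC(f_1,f_2)=\min\{\#C(f_1',f_2')\}$ and $MCC(f_1,f_2)=\min\{\#\pi_0(C(f_1',f_2'))\}$, minima over all $f_1'\sim f_1$, $f_2'\sim f_2$, where $\#\pi_0$ is the number of pathcomponents. Nielsen number $N^\#$: after a small homotopy assume $(f_1,f_2)\colon M\to N\times N$ is smooth and transverse to the diagonal $\Delta$, so $C=C(f_1,f_2)$ is a closed smooth $(m-n)$-dimensional submanifold of $M$ (empty if $m<n$). Let $E(f_1,f_2)=\{(x,\theta): x\in M,\ \theta\colon[0,1]\to N \text{ continuous},\ \theta(0)=f_1(x),\ \theta(1)=f_2(x)\}$ (compact-open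 topology on paths), with projection $\mathrm{pr}\colon E(f_1,f_2)\to M$, and $\tilde g\colon C\to E(f_1,f_2)$, $\tilde g(x)=(x,\text{constant path at }f_1(x)=f_2(x))$. There is a canonical isomorphism $\bar g^\#\colon \nu(C,M)\cong ((f_1,f_2)|_C)^*\nu(\Delta,N\times N)\cong f_1^*(TN)|_C$. For a pathcomponent $Q$ of $E(f_1,f_2)$ put $C_Q=\tilde g^{-1}(Q)$. Then $N^\#(f_1,f_2)$ is the number of pathcomponents $Q$ for which there is no compact smooth submanifold $B\subset M\times[0,1]$ with $\partial B=B\cap(M\times\{0,1\})=C_Q\times\{0\}$ (transversally) together with a map $\widetilde G\colon B\to E(f_1,f_2)$ extending $\tilde g|_{C_Q}$, with $\mathrm{pr}\circ\widetilde G$ equal to the projection $B\to M$, and an isomorphism of the normal bundle $\nu(B,M\times[0,1])$ with the pullback of $f_1^*TN$ extending $\bar g^\#|_{C_Q}$. *)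

theory Defs
  imports "HOL-Analysis.Analysis" "HOL-Library.Extended_Nat" "HOL-Algebra.Group_Action"
begin

section \<open>Smooth submanifolds of Euclidean spaces\<close>

text \<open>
  Smooth manifolds are smooth submanifolds of Euclidean spaces. By Whitney's embedding theorem
  this is no loss of generality, because the ambient space is an arbitrary type of class
  \<^class>\<open>euclidean_space\<close> throughout.
\<close>

primrec Ck_on :: "nat \<Rightarrow> 'a::real_normed_vector set \<Rightarrow> ('a \<Rightarrow> 'b::real_normed_vector) \<Rightarrow> bool" where
  "Ck_on 0 U f \<longleftrightarrow> continuous_on U f"
| "Ck_on (Suc k) U f \<longleftrightarrow>
     (\<forall>x\<in>U. f differentiable (at x)) \<and> (\<forall>v. Ck_on k U (\<lambda>x. frechet_derivative f (at x) v))"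

text \<open>
  \<^term>\<open>Ck_on\<close> is meant for open sets. On an arbitrary set, smoothness means that there are
  local extensions of class $C^\infty$ to open sets of the ambient space.
\<close>

definition smooth_on :: "'a::real_normed_vector set \<Rightarrow> ('a \<Rightarrow> 'b::real_normed_vector) \<Rightarrow> bool" where
  "smooth_on S f \<longleftrightarrow>
     (\<forall>x\<in>S. \<exists>U F. open U \<and> x \<in> U \<and> (\<forall>k. Ck_on k U F) \<and> (\<forall>y\<in>S \<inter> U. F y = f y))"

text \<open>
  A submanifold chart centred at \<open>x\<close> is a diffeomorphism \<open>\<phi>\<close> between open sets of the ambient
  space which carries the submanifold to the piece \<open>0 \<le> w \<bullet> z\<close> of a linear subspace \<open>L\<close>.
  This piece is all of \<open>L\<close> if \<open>w = 0\<close>, and a half space with \<open>\<phi> x = 0\<close> on its boundary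
  if \<open>w \<noteq> 0\<close>.
\<close>

definition submanifold_chart ::
    "'a::euclidean_space set \<Rightarrow> 'a \<Rightarrow> 'a set \<Rightarrow> 'a \<Rightarrow> bool" where
  "submanifold_chart S x L w \<longleftrightarrow>
     (\<exists>U V \<phi> \<psi>. open U \<and> open V \<and> x \<in> U \<and> homeomorphism U V \<phi> \<psi> \<and> smooth_on U \<phi> \<and> smooth_on V \<psi> \<and>
        subspace L \<and> w \<in> L \<and> \<phi> x = 0 \<and> \<phi> ` (S \<inter> U) = {z \<in> L. 0 \<le> w \<bullet> z} \<inter> V)"

definition submanifold_with_boundary :: "'a::euclidean_space set \<Rightarrow> bool" where
  "submanifold_with_boundary S \<longleftrightarrow> (\<forall>x\<in>S. \<exists>L w. submanifold_chart S x L w)"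

definition manifold_boundary :: "'a::euclidean_space set \<Rightarrow> 'a set" where
  "manifold_boundary S = {x \<in> S. \<exists>L w. submanifold_chart S x L w \<and> w \<noteq> 0}"

definition submanifold :: "nat \<Rightarrow> 'a::euclidean_space set \<Rightarrow> bool" where
  "submanifold k S \<longleftrightarrow> (\<forall>x\<in>S. \<exists>L. submanifold_chart S x L 0 \<and> dim L = k)"

text \<open>
  At a boundary point the one-sided velocities of curves in \<open>S\<close> form only a half space;
  taking the span yields the full tangent space there as well.
\<close>

definition tangent_space :: "'a::euclidean_space set \<Rightarrow> 'a \<Rightarrow> 'a set" where
  "tangent_space S x =
     span {v. \<exists>\<gamma>. smooth_on {0..1} \<gamma> \<and> \<gamma> ` {0..1} \<subseteq> S \<and> \<gamma> 0 = x \<and>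
                 (\<gamma> has_vector_derivative v) (at 0 within {0..1})}"

text \<open>The differential is determined, and to be used, only on \<^term>\<open>tangent_space S x\<close>.\<close>

definition differential ::
    "'a::euclidean_space set \<Rightarrow> ('a \<Rightarrow> 'b::euclidean_space) \<Rightarrow> 'a \<Rightarrow> 'a \<Rightarrow> 'b" where
  "differential S f x = (SOME D. (f has_derivative D) (at x within S))"

definition transverse_at ::
    "'a::euclidean_space set \<Rightarrow> ('a \<Rightarrow> 'b::euclidean_space) \<Rightarrow> 'b set \<Rightarrow> 'b set \<Rightarrow> 'a \<Rightarrow> bool" where
  "transverse_at M f P Z x \<longleftrightarrow>
     {differential M f x v + w |v w. v \<in> tangent_space M x \<and> w \<in> tangent_space Z (f x)}
       = tangent_space P (f x)"

definition transverse_to ::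
    "'a::euclidean_space set \<Rightarrow> ('a \<Rightarrow> 'b::euclidean_space) \<Rightarrow> 'b set \<Rightarrow> 'b set \<Rightarrow> bool" where
  "transverse_to M f P Z \<longleftrightarrow> (\<forall>x\<in>M. f x \<in> Z \<longrightarrow> transverse_at M f P Z x)"

definition riemannian_metric ::
    "'c::euclidean_space set \<Rightarrow> ('c \<Rightarrow> 'c \<Rightarrow> 'c \<Rightarrow> real) \<Rightarrow> bool" where
  "riemannian_metric N h \<longleftrightarrow>
     (\<forall>y\<in>N. \<forall>u\<in>tangent_space N y. \<forall>v\<in>tangent_space N y. \<forall>w\<in>tangent_space N y. \<forall>a b.
        h y (a *\<^sub>R u + b *\<^sub>R v) w = a * h y u w + b * h y v w \<and>
        h y v w = h y w v \<and> (v \<noteq> 0 \<longrightarrow> 0 < h y v v)) \<and>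
     smooth_on {(y, v, w). y \<in> N \<and> v \<in> tangent_space N y \<and> w \<in> tangent_space N y}
       (\<lambda>(y, v, w). h y v w)"

definition unit_tangent_bundle ::
    "'c::euclidean_space set \<Rightarrow> ('c \<Rightarrow> 'c \<Rightarrow> 'c \<Rightarrow> real) \<Rightarrow> ('c \<times> 'c) set" where
  "unit_tangent_bundle N h = {(y, v). y \<in> N \<and> v \<in> tangent_space N y \<and> h y v v = 1}"


section \<open>Coincidences\<close>

definition coincidence_set :: "'a set \<Rightarrow> ('a \<Rightarrow> 'c) \<Rightarrow> ('a \<Rightarrow> 'c) \<Rightarrow> 'a set" where
  "coincidence_set M f1 f2 = {x \<in> M. f1 x = f2 x}"

definition homotopic_maps ::
    "'a::topological_space set \<Rightarrow> 'c::topological_space set \<Rightarrow> ('a \<Rightarrow> 'c) \<Rightarrow> ('a \<Rightarrow> 'c) \<Rightarrow> bool" where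
  "homotopic_maps M N f g \<longleftrightarrow> homotopic_with_canon (\<lambda>_. True) M N f g"

text \<open>Minimum numbers may be infinite, and \<^term>\<open>card\<close> is \<open>0\<close> on infinite sets.\<close>

definition cardinality :: "'a set \<Rightarrow> enat" where
  "cardinality A = (if finite A then enat (card A) else \<infinity>)"

definition MC ::
    "'a::topological_space set \<Rightarrow> 'c::topological_space set \<Rightarrow> ('a \<Rightarrow> 'c) \<Rightarrow> ('a \<Rightarrow> 'c) \<Rightarrow> enat" where
  "MC M N f1 f2 = Inf {cardinality (coincidence_set M f1' f2') |f1' f2'.
     homotopic_maps M N f1 f1' \<and> homotopic_maps M N f2 f2'}"

definition MCC ::
    "'a::topological_space set \<Rightarrow> 'c::topological_space set \<Rightarrow> ('a \<Rightarrow> 'c) \<Rightarrow> ('a \<Rightarrow> 'c) \<Rightarrow> enat" where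
  "MCC M N f1 f2 =
     Inf {cardinality (path_components_of (top_of_set (coincidence_set M f1' f2'))) |f1' f2'.
       homotopic_maps M N f1 f1' \<and> homotopic_maps M N f2 f2'}"

definition loose ::
    "'a::topological_space set \<Rightarrow> 'c::topological_space set \<Rightarrow> ('a \<Rightarrow> 'c) \<Rightarrow> ('a \<Rightarrow> 'c) \<Rightarrow> bool" where
  "loose M N f1 f2 \<longleftrightarrow>
     (\<exists>f1' f2'. homotopic_maps M N f1 f1' \<and> homotopic_maps M N f2 f2' \<and> (\<forall>x\<in>M. f1' x \<noteq> f2' x))"

definition loose_by_small_deformation ::
    "'a::topological_space set \<Rightarrow> 'c::topological_space set \<Rightarrow> ('a \<Rightarrow> 'c) \<Rightarrow> bool" where
  "loose_by_small_deformation M N f \<longleftrightarrow>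
     (\<forall>d \<epsilon>. Metric_space N d \<and> Metric_space.mtopology N d = top_of_set N \<and> 0 < \<epsilon> \<longrightarrow>
        (\<exists>f'. continuous_map (top_of_set M) (top_of_set N) f' \<and>
              (\<forall>x\<in>M. d (f x) (f' x) < \<epsilon>) \<and> (\<forall>x\<in>M. f' x \<noteq> f x)))"

definition coincidence_producing ::
    "'a::topological_space set \<Rightarrow> 'c::topological_space set \<Rightarrow> ('a \<Rightarrow> 'c) \<Rightarrow> bool" where
  "coincidence_producing M N f \<longleftrightarrow>
     (\<forall>f'. continuous_map (top_of_set M) (top_of_set N) f' \<longrightarrow> \<not> loose M N f f')"


section \<open>The Nielsen number\<close>

definition path_space :: "'c::topological_space set \<Rightarrow> (real \<Rightarrow> 'c) set" where
  "path_space N = {\<theta> \<in> extensional {0..1}. continuous_on {0..1} \<theta> \<and> \<theta> ` {0..1} \<subseteq> N}"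

definition compact_open_topology :: "'c::topological_space set \<Rightarrow> (real \<Rightarrow> 'c) topology" where
  "compact_open_topology N = topology_generated_by
     {{\<theta> \<in> path_space N. \<theta> ` K \<subseteq> U} |K U. compact K \<and> K \<subseteq> {0..1} \<and> openin (top_of_set N) U}"

definition coincidence_path_space ::
    "'a::topological_space set \<Rightarrow> 'c::topological_space set \<Rightarrow> ('a \<Rightarrow> 'c) \<Rightarrow> ('a \<Rightarrow> 'c)
       \<Rightarrow> ('a \<times> (real \<Rightarrow> 'c)) topology" where
  "coincidence_path_space M N f1 f2 =
     subtopology (prod_topology (top_of_set M) (compact_open_topology N))
       {(x, \<theta>). \<theta> 0 = f1 x \<and> \<theta> 1 = f2 x}"

definition constant_path_lift :: "('a \<Rightarrow> 'c) \<Rightarrow> 'a \<Rightarrow> 'a \<times> (real \<Rightarrow> 'c)" where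
  "constant_path_lift f1 x = (x, \<lambda>t\<in>{0..1}. f1 x)"

text \<open>
  \<open>A\<close> is an isomorphism from the normal bundle of \<open>B\<close> in \<open>P\<close>, with fibre
  \<open>tangent_space P b / tangent_space B b\<close>, to the pullback of \<open>TN\<close> under \<open>u : B \<rightarrow> N\<close>.
  A linear map out of a fibre of the normal bundle is described by its lift to
  \<^term>\<open>tangent_space P b\<close>; the values of \<open>A b\<close> outside this subspace are irrelevant.
\<close>

definition normal_bundle_iso ::
    "'b::euclidean_space set \<Rightarrow> 'b set \<Rightarrow> 'c::euclidean_space set \<Rightarrow> ('b \<Rightarrow> 'c)
       \<Rightarrow> ('b \<Rightarrow> 'b \<Rightarrow> 'c) \<Rightarrow> bool" where
  "normal_bundle_iso B P N u A \<longleftrightarrow>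
     (\<forall>b\<in>B. linear (A b) \<and> A b ` tangent_space P b = tangent_space N (u b) \<and>
        {v \<in> tangent_space P b. A b v = 0} = tangent_space B b) \<and>
     continuous_on {(b, v). b \<in> B \<and> v \<in> tangent_space P b} (\<lambda>(b, v). A b v)"

text \<open>
  The canonical isomorphism of the normal bundle of the coincidence set with the pullback of \<open>TN\<close>
  sends the class of \<open>v\<close> to \<open>df2 v - df1 v\<close>: the normal bundle of the diagonal in \<open>N \<times> N\<close> is
  identified with \<open>TN\<close> by \<open>(a, b) \<mapsto> b - a\<close>. With the opposite sign convention all isomorphisms
  below change sign, so that the same pathcomponents are inessential.
\<close>

definition canonical_normal_map ::
    "'a::euclidean_space set \<Rightarrow> ('a \<Rightarrow> 'c::euclidean_space) \<Rightarrow> ('a \<Rightarrow> 'c) \<Rightarrow> 'a \<Rightarrow> 'a \<Rightarrow> 'c" where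
  "canonical_normal_map M f1 f2 x v = differential M f2 x v - differential M f1 x v"

definition inessential ::
    "'a::euclidean_space set \<Rightarrow> 'c::euclidean_space set \<Rightarrow> ('a \<Rightarrow> 'c) \<Rightarrow> ('a \<Rightarrow> 'c)
       \<Rightarrow> ('a \<times> (real \<Rightarrow> 'c)) set \<Rightarrow> bool" where
  "inessential M N f1 f2 Q \<longleftrightarrow>
     (let C = {x \<in> coincidence_set M f1 f2. constant_path_lift f1 x \<in> Q} in
      \<exists>B G A.
        B \<subseteq> M \<times> {0..1::real} \<and> compact B \<and> submanifold_with_boundary B \<and>
        manifold_boundary B = B \<inter> (M \<times> {0, 1}) \<and> B \<inter> (M \<times> {0, 1}) = C \<times> {0} \<and>
        (\<forall>b\<in>C \<times> {0}. transverse_at B id (M \<times> {0..1}) (M \<times> {0}) b) \<and>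
        continuous_map (top_of_set B) (coincidence_path_space M N f1 f2) G \<and>
        (\<forall>b\<in>B. fst (G b) = fst b) \<and>
        (\<forall>x\<in>C. G (x, 0) = constant_path_lift f1 x) \<and>
        normal_bundle_iso B (M \<times> {0..1}) N (\<lambda>b. f1 (fst b)) A \<and>
        (\<forall>x\<in>C. \<forall>v\<in>tangent_space M x. A (x, 0) (v, 0) = canonical_normal_map M f1 f2 x v))"

definition generic_pair ::
    "'a::euclidean_space set \<Rightarrow> 'c::euclidean_space set \<Rightarrow> ('a \<Rightarrow> 'c) \<Rightarrow> ('a \<Rightarrow> 'c) \<Rightarrow> bool" where
  "generic_pair M N f1 f2 \<longleftrightarrow>
     f1 ` M \<subseteq> N \<and> f2 ` M \<subseteq> N \<and> smooth_on M f1 \<and> smooth_on M f2 \<and>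
     transverse_to M (\<lambda>x. (f1 x, f2 x)) (N \<times> N) {(y, y) |y. y \<in> N}"

definition nielsen_count ::
    "'a::euclidean_space set \<Rightarrow> 'c::euclidean_space set \<Rightarrow> ('a \<Rightarrow> 'c) \<Rightarrow> ('a \<Rightarrow> 'c) \<Rightarrow> enat" where
  "nielsen_count M N f1 f2 =
     cardinality {Q \<in> path_components_of (coincidence_path_space M N f1 f2).
       \<not> inessential M N f1 f2 Q}"

definition small_homotopic ::
    "real \<Rightarrow> 'a::topological_space set \<Rightarrow> 'c::metric_space set \<Rightarrow> ('a \<Rightarrow> 'c) \<Rightarrow> ('a \<Rightarrow> 'c) \<Rightarrow> bool" where
  "small_homotopic \<epsilon> M N f g \<longleftrightarrow>
     homotopic_with_canon (\<lambda>h. \<forall>x\<in>M. dist (f x) (h x) < \<epsilon>) M N f g"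

text \<open>
  The number of essential pathcomponents is the same for all generic pairs which are reached
  from \<open>(f1, f2)\<close> by sufficiently small homotopies, and such generic pairs always exist.
\<close>

definition nielsen_number ::
    "'a::euclidean_space set \<Rightarrow> 'c::euclidean_space set \<Rightarrow> ('a \<Rightarrow> 'c) \<Rightarrow> ('a \<Rightarrow> 'c) \<Rightarrow> enat" where
  "nielsen_number M N f1 f2 =
     (THE k. \<exists>\<epsilon>>0. \<forall>f1' f2'. small_homotopic \<epsilon> M N f1 f1' \<and> small_homotopic \<epsilon> M N f2 f2' \<and>
        generic_pair M N f1' f2' \<longrightarrow> k = nielsen_count M N f1' f2')"


section \<open>Homotopy groups of spheres and boundary homomorphism\<close>

text \<open>
  \<open>'d\<close> and \<open>'e\<close> play the roles of \<open>\<real>\<^sup>m\<close> and \<open>\<real>\<^sup>n\<close>. Thus \<open>S\<^sup>m\<close> is the unit sphere of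
  \<open>'d \<times> real\<close>, based at the north pole, while the unit sphere of \<open>'d\<close> is the
  sphere of dimension \<open>m - 1\<close>, based at a standard basis vector.
\<close>

abbreviation usphere :: "'a::real_normed_vector set" where
  "usphere \<equiv> sphere 0 1"

abbreviation north :: "'d::real_normed_vector \<times> real" where
  "north \<equiv> (0, 1)"

definition e0 :: "'d::euclidean_space" where
  "e0 = (SOME b. b \<in> Basis)"

text \<open>
  Elements of \<open>\<pi>\<^sub>k(X, x)\<close> are classes of based maps \<open>S\<^sup>k \<rightarrow> X\<close> up to based homotopy; the neutral
  element is the class of the constant map.
\<close>

definition based_class ::
    "'a::topological_space set \<Rightarrow> 'a \<Rightarrow> 'c::topological_space set \<Rightarrow> ('a \<Rightarrow> 'c) \<Rightarrow> ('a \<Rightarrow> 'c) set" where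
  "based_class S s X f = {g. homotopic_with_canon (\<lambda>h. h s = f s) S X f g}"

definition suspend ::
    "('d::euclidean_space \<Rightarrow> 'e::euclidean_space) \<Rightarrow> 'd \<times> real \<Rightarrow> 'e \<times> real" where
  "suspend g = (\<lambda>(x, t). (norm x *\<^sub>R g (x /\<^sub>R norm x), t))"

definition freudenthal ::
    "('d::euclidean_space \<Rightarrow> 'e::euclidean_space) set \<Rightarrow> ('d \<times> real \<Rightarrow> 'e \<times> real) set" where
  "freudenthal \<beta> = (THE c. \<exists>g\<in>\<beta>. c = based_class usphere north usphere (suspend g))"

text \<open>
  The standard map from the disk to \<open>S\<^sup>m\<close>: it sends the boundary of the disk to the north pole and is
  a homeomorphism from the open disk onto the complement of the north pole.
\<close>

definition collapse :: "'d::euclidean_space \<Rightarrow> 'd \<times> real" where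
  "collapse x = ((2 * sqrt (1 - (norm x)\<^sup>2)) *\<^sub>R x, 2 * (norm x)\<^sup>2 - 1)"

text \<open>A linear isometry from \<open>\<real>\<^sup>n\<close> to the tangent space identifies the fibre sphere over
  \<open>y\<close> with the standard unit sphere.\<close>

definition tangent_frame ::
    "'c::euclidean_space set \<Rightarrow> ('c \<Rightarrow> 'c \<Rightarrow> 'c \<Rightarrow> real) \<Rightarrow> 'c \<Rightarrow> ('e::euclidean_space \<Rightarrow> 'c) \<Rightarrow> bool" where
  "tangent_frame N h y \<iota> \<longleftrightarrow>
     linear \<iota> \<and> range \<iota> = tangent_space N y \<and> (\<forall>u v. h y (\<iota> u) (\<iota> v) = u \<bullet> v)"

text \<open>
  The boundary homomorphism is the inverse of the isomorphism
  \<open>\<pi>\<^sub>m(STN, fibre) \<rightarrow> \<pi>\<^sub>m(N)\<close> followed by restriction to the boundary of the disk: lift the composite of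
  \<open>f\<close> and \<^term>\<open>collapse\<close> to a map \<open>F\<close> from the disk to \<open>STN\<close>, and restrict \<open>F\<close>.
\<close>

definition boundary_hom ::
    "'c::euclidean_space set \<Rightarrow> ('c \<Rightarrow> 'c \<Rightarrow> 'c \<Rightarrow> real) \<Rightarrow> 'c \<Rightarrow> ('e::euclidean_space \<Rightarrow> 'c)
       \<Rightarrow> ('d::euclidean_space \<times> real \<Rightarrow> 'c) set \<Rightarrow> ('d \<Rightarrow> 'e) set" where
  "boundary_hom N h y \<iota> \<alpha> =
     (if DIM('d) = 1 then based_class usphere e0 usphere (\<lambda>_. e0)
      else THE c. \<exists>f\<in>\<alpha>. \<exists>F g.
        continuous_on (cball 0 1) F \<and> F ` cball 0 1 \<subseteq> unit_tangent_bundle N h \<and>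
        (\<forall>x\<in>cball 0 1. fst (F x) = f (collapse x)) \<and>
        g ` usphere \<subseteq> usphere \<and> g e0 = e0 \<and> (\<forall>x\<in>usphere. F x = (y, \<iota> (g x))) \<and>
        c = based_class usphere e0 usphere g)"


section \<open>Orbit manifolds of spheres\<close>

definition free_smooth_action ::
    "('g, 'r) monoid_scheme \<Rightarrow> 'a::euclidean_space set \<Rightarrow> ('g \<Rightarrow> 'a \<Rightarrow> 'a) \<Rightarrow> bool" where
  "free_smooth_action G S \<phi> \<longleftrightarrow>
     group_action G S \<phi> \<and> (\<forall>g\<in>carrier G. smooth_on S (\<phi> g)) \<and>
     (\<forall>x\<in>S. stabilizer G \<phi> x = {\<one>\<^bsub>G\<^esub>})"

text \<open>
  \<open>N\<close> together with \<open>p : S \<rightarrow> N\<close> is the orbit manifold \<open>S/G\<close>: the points of \<open>N\<close> correspond to the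
  orbits, and the smooth structure of \<open>N\<close> is the one which makes \<open>p\<close> a local diffeomorphism.
  For a compact \<open>S\<close>, the subspace topology of \<open>N\<close> is the quotient topology.
\<close>

definition orbit_manifold ::
    "('g, 'r) monoid_scheme \<Rightarrow> nat \<Rightarrow> 'a::euclidean_space set \<Rightarrow> ('g \<Rightarrow> 'a \<Rightarrow> 'a)
       \<Rightarrow> 'c::euclidean_space set \<Rightarrow> ('a \<Rightarrow> 'c) \<Rightarrow> bool" where
  "orbit_manifold G n S \<phi> N p \<longleftrightarrow>
     submanifold n N \<and> p ` S = N \<and>
     (\<forall>x\<in>S. \<forall>x'\<in>S. p x = p x' \<longleftrightarrow> orbit G \<phi> x = orbit G \<phi> x') \<and>
     smooth_on S p \<and>
     (\<forall>x\<in>S. bij_betw (differential S p x) (tangent_space S x) (tangent_space N (p x)))"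

definition all_equivalent :: "bool list \<Rightarrow> bool" where
  "all_equivalent Ps \<longleftrightarrow> (\<forall>P\<in>set Ps. \<forall>Q\<in>set Ps. P \<longleftrightarrow> Q)"

end

theory Submission
  imports Defs
begin

text \<open>
  Call a continuous map \<open>s\<close> a tangent field along \<open>u\<close> if \<open>s x\<close> is orthogonal to \<open>u x\<close> and does not
  vanish for any \<open>x\<close>. With \<open>u\<close> the lift of \<open>f\<close>, each of the seven conditions says that \<open>u\<close> is homotopic
  to \<open>- u\<close> although there is no tangent field along \<open>u\<close>.

  Fields along \<open>u\<close> correspond to fields along \<open>f\<close> by the differential of the covering \<open>p\<close>, and a map is
  pushed off itself along a field by an arbitrarily small amount. Conversely, existence
  of a field is invariant under homotopy of \<open>u\<close>, and if \<open>f'\<close> has no coincidences with \<open>f\<close>, then a lift of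
  \<open>f'\<close> avoids both \<open>u\<close> and \<open>g \<circ> u\<close>, where \<open>g\<close> is a deck transformation without fixed points; stereographic projection from \<open>u x\<close> turns the
  difference of the other two points into a tangent vector at \<open>u x\<close> (\<open>three_maps_field\<close>). So \<open>(f, f)\<close>
  is loose, or \<open>f\<close> is not coincidence producing, exactly if there is a field (\<open>loose_iff_field\<close>,
  \<open>coincidence_producing_iff_no_field\<close>), and for \<open>(u, u)\<close> the same holds for small deformations
  (\<open>small_deformation_iff_field\<close>). On the other hand \<open>(u, u)\<close> is loose exactly if \<open>u\<close> is homotopic to
  \<open>- u\<close> (\<open>loose_antipodal\<close>). All minimum numbers are at most 1, since a field exists outside one point.

  The boundary homomorphism is computed by clutching: over a disk which covers the sphere, the
  tangent spaces along \<open>u\<close> are identified with one another by parallel transport, and the image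
  of a constant vector on the boundary of the disk represents \<open>\<partial> f\<close>. It vanishes exactly if
  there is a field (\<open>boundary_hom_zero_iff\<close>). Its suspension vanishes exactly if \<open>u\<close> is
  homotopic to \<open>- u\<close> (\<open>suspension_zero_iff\<close>), because a homotopy from \<open>u x\<close> to \<open>- u x\<close> becomes, in the
  same trivialisation, a map on the cylinder over the boundary of the disk.

  There remains the Nielsen number, which is 0 if \<open>(u, u)\<close> is loose and 1 otherwise
  (\<open>nielsen_number_self\<close>). All coincidences of a generic pair near \<open>(f, f)\<close> lie in one pathcomponent,
  so the question is when the coincidence manifold \<open>C\<close> of two maps \<open>u1\<close>, \<open>u2\<close> into the sphere bounds.
  If \<open>u2\<close> is homotopic to a map which avoids \<open>u1\<close>, then the coincidences of \<open>u1\<close> with a generic such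
  homotopy form a null bordism (\<open>inessential_from_continuous_homotopy\<close>). Conversely the normal
  data of a null bordism \<open>B\<close> give a vector field which points away from \<open>B\<close>; it is used to
  deform \<open>u2\<close> near \<open>B\<close> to a map without coincidences (\<open>homotopic_antipode\<close>). The transversality needed
  here does not rest on Sard's theorem but on a count of dimensions for affine
  perturbations (\<open>affine_perturbation_regular\<close>).
\<close>

section \<open>Calculus of smooth maps\<close>

notation scaleR (infixr "*R" 75) and divideR (infixl "'/R" 70)

abbreviation Df :: "('a::real_normed_vector => 'b::real_normed_vector) => 'a => 'a => 'b" where
  "Df f x == frechet_derivative f (at x)"

lemma Ck_on_SucD:
 "Ck_on (Suc k) U f ==> Ck_on k U f"
proof (induction k arbitrary: f)
 case 0
 then show ?case
  by (auto intro!: continuous_at_imp_continuous_on differentiable_imp_continuous_within)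
next
 case (Suc k)
 then show ?case by (metis Ck_on.simps(2))
qed

lemma Ck_on_mono: "Ck_on k U f ==> j <= k ==> Ck_on j U f"
proof (induction k)
 case (Suc k)
 then show ?case using Ck_on_SucD[of k U f] by (metis le_Suc_eq)
qed simp

lemma Ck_on_subset: "Ck_on k U f ==> V <= U ==> Ck_on k V f"
 by (induction k arbitrary: f) (auto intro: continuous_on_subset)

lemma Ck_on_continuous: "Ck_on k U f ==> continuous_on U f"
 using Ck_on_mono[of k U f 0] by simp

text \<open>
 Derivatives at a point of an open set depend only on the values nearby.
\<close>

lemma Ck_on_cong:
 assumes "open U" "!!x. x \<in> U ==> f x = g x" "Ck_on k U f"
 shows "Ck_on k U g"
 using assms(2,3)
proof (induction k arbitrary: f g)
 case 0
 then show ?case by (metis Ck_on.simps(1) continuous_on_cong)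
next
 case (Suc k)
 have d: "(g has_derivative Df f x) (at x)" if "x \<in> U" for x
 proof (rule has_derivative_transform_within_open[OF _ \<open>open U\<close> that])
  show "(f has_derivative Df f x) (at x)"
   using Suc.prems that frechet_derivative_works by auto
 qed (use Suc.prems in auto)
 have "Df g x = Df f x" if "x \<in> U" for x
  using frechet_derivative_at[OF d[OF that]] by simp
 moreover have "g differentiable (at x)" if "x \<in> U" for x
  using d[OF that] differentiableI by blast
 moreover have "Ck_on k U (%x. Df g x v)" for v
  by (rule Suc.IH[of "%x. Df f x v"]) (use Suc.prems calculation in auto)
 ultimately show ?case by simp
qed

lemma Ck_on_SucI:
 assumes "open U" "!!x. x \<in> U ==> (f has_derivative f' x) (at x)" "!!v. Ck_on k U (%x. f' x v)"
 shows "Ck_on (Suc k) U f"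
proof -
 have "Df f x = f' x" if "x \<in> U" for x
  using frechet_derivative_at[OF assms(2)[OF that]] by simp
 then have "Ck_on k U (%x. Df f x v)" for v
  by (intro Ck_on_cong[OF assms(1) _ assms(3)[of v]]) auto
 moreover have "f differentiable (at x)" if "x \<in> U" for x
  using assms(2)[OF that] differentiableI by blast
 ultimately show ?thesis by simp
qed

lemma Ck_on_has_derivative:
 assumes "Ck_on (Suc k) U f" "x \<in> U"
 shows "(f has_derivative Df f x) (at x)"
 using assms frechet_derivative_works by auto

lemma Ck_on_local:
 assumes "!!x. x \<in> U ==> \<exists>V. open V \<and> x \<in> V \<and> Ck_on k (U \<inter> V) f"
 shows "Ck_on k U f"
 using assms
proof (induction k arbitrary: f)
 case 0
 have "continuous (at x within U) f" if x: "x \<in> U" for x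
 proof -
  obtain V where V: "open V" "x \<in> V" "Ck_on 0 (U \<inter> V) f" using 0[OF x] by blast
  have "continuous (at x within U \<inter> V) f"
   using V x by (simp add: continuous_on_eq_continuous_within)
  moreover have "at x within U \<inter> V = at x within U"
   by (rule at_within_nhd[OF V(2,1)]) auto
  ultimately show ?thesis by simp
 qed
 then show ?case by (simp add: continuous_on_eq_continuous_within)
next
 case (Suc k)
 have "f differentiable (at x)" if x: "x \<in> U" for x
 using Suc.prems[OF x] x by auto
 moreover have "Ck_on k U (%x. Df f x v)" for v
 proof (rule Suc.IH)
  fix x assume x: "x \<in> U"
  obtain V where "open V" "x \<in> V" "Ck_on (Suc k) (U \<inter> V) f" using Suc.prems[OF x] by blast
  then show "\<exists>V. open V \<and> x \<in> V \<and> Ck_on k (U \<inter> V) (%x. Df f x v)"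
   by (intro exI[of _ V]) simp
 qed
 ultimately show ?case by simp
qed

lemma Ck_on_const: "open U ==> Ck_on k U (%x. c)"
proof (induction k arbitrary: c)
 case (Suc k)
 show ?case by (rule Ck_on_SucI[where f'="%x v. 0"]) (use Suc in auto)
qed auto

lemma Ck_on_linear:
 assumes "bounded_linear L" "open U"
 shows "Ck_on k U L"
proof (cases k)
 case 0
 then show ?thesis using assms linear_continuous_on by auto
next
 case (Suc j)
 show ?thesis unfolding Suc
  by (rule Ck_on_SucI[where f'="%x v. L v"])
    (use assms Ck_on_const bounded_linear_imp_has_derivative in auto)
qed

lemma Ck_on_comp_linear:
 assumes "bounded_linear L" "open U" "Ck_on k U f"
 shows "Ck_on k U (%x. L (f x))"
 using assms(3)
proof (induction k arbitrary: f)
 case 0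
 then show ?case
  using assms(1) by (simp add: bounded_linear.continuous_on)
next
 case (Suc k)
 show ?case
 proof (rule Ck_on_SucI[OF \<open>open U\<close>, where f'="%x v. L (Df f x v)"])
  fix x assume "x \<in> U"
  then show "((%x. L (f x)) has_derivative (%v. L (Df f x v))) (at x)"
   by (intro bounded_linear.has_derivative[OF assms(1)] Ck_on_has_derivative[OF Suc.prems])
 next
  fix v show "Ck_on k U (%x. L (Df f x v))"
   using Suc by (intro Suc.IH) auto
 qed
qed

lemma Ck_on_add:
 assumes "open U" "Ck_on k U f" "Ck_on k U g"
 shows "Ck_on k U (%x. f x + g x)"
 using assms(2,3)
proof (induction k arbitrary: f g)
 case 0
 then show ?case by (simp add: continuous_on_add)
next
 case (Suc k)
 show ?case
 proof (rule Ck_on_SucI[OF \<open>open U\<close>, where f'="%x v. Df f x v + Df g x v"])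
  fix x assume "x \<in> U"
  then show "((%x. f x + g x) has_derivative (%v. Df f x v + Df g x v)) (at x)"
   by (intro has_derivative_add Ck_on_has_derivative[OF Suc.prems(1)] Ck_on_has_derivative[OF Suc.prems(2)])
 next
  fix v show "Ck_on k U (%x. Df f x v + Df g x v)"
   using Suc by (intro Suc.IH) auto
 qed
qed

lemma Ck_on_bilinear:
 assumes "bounded_bilinear B" "open U" "Ck_on k U f" "Ck_on k U g"
 shows "Ck_on k U (%x. B (f x) (g x))"
 using assms(3,4)
proof (induction k arbitrary: f g)
 case 0
 then show ?case using bounded_bilinear.continuous_on[OF assms(1)] by simp
next
 case (Suc k)
 show ?case
 proof (rule Ck_on_SucI[OF \<open>open U\<close>, where f'="%x v. B (f x) (Df g x v) + B (Df f x v) (g x)"])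
  fix x assume "x \<in> U"
  then show "((%x. B (f x) (g x)) has_derivative (%v. B (f x) (Df g x v) + B (Df f x v) (g x))) (at x)"
   by (intro bounded_bilinear.FDERIV[OF assms(1)] Ck_on_has_derivative[OF Suc.prems(1)] Ck_on_has_derivative[OF Suc.prems(2)])
 next
  fix v
  have "Ck_on k U (%x. B (f x) (Df g x v))"
   using Suc Ck_on_SucD[OF Suc.prems(1)] by (intro Suc.IH) auto
  moreover have "Ck_on k U (%x. B (Df f x v) (g x))"
   using Suc Ck_on_SucD[OF Suc.prems(2)] by (intro Suc.IH) auto
  ultimately show "Ck_on k U (%x. B (f x) (Df g x v) + B (Df f x v) (g x))"
   using Ck_on_add assms(2) by blast
 qed
qed

lemma Ck_on_sum:
 assumes "open U" "finite I" "!!i. i \<in> I ==> Ck_on k U (f i)"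
 shows "Ck_on k U (%x. \<Sum>i\<in>I. f i x)"
 using assms(2,3)
 by (induction I rule: finite_induct) (simp_all add: Ck_on_add Ck_on_const \<open>open U\<close>)

text \<open>The chain rule writes the directional derivative of a composite as a finite sum of products
 of directional derivatives, so that the induction stays inside the directional formulation.\<close>

lemma Ck_on_compose:
 fixes g :: "'a::real_normed_vector => 'b::euclidean_space"
 assumes "open U" "open V" "Ck_on k U g" "Ck_on k V f" "g ` U <= V"
 shows "Ck_on k U (%x. f (g x))"
 using assms(3,4)
proof (induction k arbitrary: f)
 case 0
 then show ?case using assms(5) continuous_on_compose2 by auto
next
 case (Suc k)
 let ?f' = "%x v. \<Sum>b\<in>Basis. (Df g x v \<bullet> b) *R Df f (g x) b"
 show ?case
 proof (rule Ck_on_SucI[OF \<open>open U\<close>, where f'="?f'"])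
  fix x assume x: "x \<in> U"
  have dg: "(g has_derivative Df g x) (at x)"
   using Ck_on_has_derivative[OF Suc.prems(1) x] .
  have df: "(f has_derivative Df f (g x)) (at (g x))"
   using Ck_on_has_derivative[OF Suc.prems(2)] x assms(5) by blast
  let ?D = "Df f (g x)"
  have lin: "linear ?D" using has_derivative_linear[OF df] .
  have D: "?D w = (\<Sum>b\<in>Basis. (w \<bullet> b) *R ?D b)" for w
  proof -
   have "?D w = ?D (\<Sum>b\<in>Basis. (w \<bullet> b) *R b)" by (simp add: euclidean_representation)
   also have "\<dots> = (\<Sum>b\<in>Basis. (w \<bullet> b) *R ?D b)"
    by (simp add: linear_sum[OF lin] linear_cmul[OF lin])
   finally show ?thesis .
  qed
  then show "((%x. f (g x)) has_derivative ?f' x) (at x)"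
   using D[symmetric] diff_chain_at[OF dg df] by (simp add: fun_eq_iff o_apply o_def)
 next
  fix v
  have "Ck_on k U (%x. Df g x v \<bullet> b)" for b
   using Suc.prems(1) Ck_on_comp_linear[OF bounded_linear_inner_left \<open>open U\<close>, of k "%x. Df g x v" b] by simp
  moreover have "Ck_on k U (%x. Df f (g x) b)" for b
   using Suc.prems Ck_on_SucD[OF Suc.prems(1)] by (intro Suc.IH) auto
  ultimately show "Ck_on k U (%x. ?f' x v)"
   by (intro Ck_on_sum[OF \<open>open U\<close>] Ck_on_bilinear[OF bounded_bilinear_scaleR \<open>open U\<close>]) auto
 qed
qed

abbreviation Cinf_on :: "'a::real_normed_vector set => ('a => 'b::real_normed_vector) => bool" where
 "Cinf_on U f \<equiv> \<forall>k. Ck_on k U f"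

lemma Cinf_has_derivative:
 "Cinf_on U f ==> x \<in> U ==> (f has_derivative Df f x) (at x)"
 using Ck_on_has_derivative by blast

lemma Ck_on_mult:
 fixes f g :: "'a::real_normed_vector => real"
 shows "open U ==> Ck_on k U f ==> Ck_on k U g ==> Ck_on k U (%x. f x * g x)"
 using Ck_on_bilinear[OF bounded_bilinear_mult] by blast

lemma Ck_on_scaleR:
 "open U ==> Ck_on k U f ==> Ck_on k U g ==> Ck_on k U (%x. f x *R g x)"
 using Ck_on_bilinear[OF bounded_bilinear_scaleR] by blast

lemma Ck_on_inner:
 "open U ==> Ck_on k U f ==> Ck_on k U g ==> Ck_on k U (%x. f x \<bullet> g x)"
 using Ck_on_bilinear[OF bounded_bilinear_inner] by blast

lemma Ck_on_minus: "open U ==> Ck_on k U f ==> Ck_on k U (%x. - f x)"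
 using Ck_on_comp_linear[OF bounded_linear_minus[OF bounded_linear_ident]] by blast

lemma Ck_on_diff: "open U ==> Ck_on k U f ==> Ck_on k U g ==> Ck_on k U (%x. f x - g x)"
 using Ck_on_add[OF _ _ Ck_on_minus] by fastforce

lemma Ck_on_Pair:
 assumes "open U" "Ck_on k U f" "Ck_on k U g"
 shows "Ck_on k U (%x. (f x, g x))"
proof -
 have "bounded_linear (%x. (x, 0::'c))" "bounded_linear (%x. (0::'b, x))"
  by (auto intro!: bounded_linear_Pair bounded_linear_ident bounded_linear_zero)
 from Ck_on_add[OF assms(1) Ck_on_comp_linear[OF this(1) assms(1,2)] Ck_on_comp_linear[OF this(2) assms(1,3)]]
 show ?thesis by simp
qed

lemma Ck_on_inverse: "Ck_on k (- {0::real}) inverse"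
proof (induction k)
 case 0
 then show ?case by (auto intro!: continuous_intros)
next
 case (Suc k)
 show ?case
 proof (rule Ck_on_SucI[where f'="%x v. - (inverse x * v * inverse x)"])
  fix v show "Ck_on k (-{0::real}) (%x. - (inverse x * v * inverse x))"
   by (intro Ck_on_minus Ck_on_mult Suc Ck_on_const) auto
 qed (auto intro!: has_derivative_inverse')
qed

lemma Ck_on_sqrt: "Ck_on k {0::real<..} sqrt"
proof (induction k)
 case 0
 then show ?case by (auto intro!: continuous_intros)
next
 case (Suc k)
 show ?case
 proof (rule Ck_on_SucI[where f'="%x v. v * (inverse (sqrt x) / 2)"])
  fix x :: real assume "x \<in> {0<..}"
  then show "(sqrt has_derivative (%v. v * (inverse (sqrt x) / 2))) (at x)"
   using DERIV_real_sqrt[of x] unfolding has_field_derivative_def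
   by (simp add: mult.commute[of _ "inverse (sqrt x)"] times_divide_eq_left[symmetric] del: times_divide_eq_left)
 next
  fix v :: real
  have "Ck_on k {0::real<..} (%x. v * (inverse (sqrt x) * (1/2)))"
   by (intro Ck_on_compose[OF _ _ Suc Ck_on_inverse] Ck_on_mult Ck_on_const; auto)
  then show "Ck_on k {0<..} (%x. v * (inverse (sqrt x) / 2))" by simp
 qed auto
qed

lemma Ck_on_norm:
 assumes "open U" "Ck_on k U f" "!!x. x \<in> U ==> f x ~= 0"
 shows "Ck_on k U (%x. norm (f x :: 'b::euclidean_space))"
proof -
 have "Ck_on k U (%x. sqrt (f x \<bullet> f x))"
  by (rule Ck_on_compose[OF assms(1) _ _ Ck_on_sqrt]) (use assms in \<open>auto intro!: Ck_on_inner\<close>)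
 then show ?thesis by (simp add: norm_eq_sqrt_inner)
qed

lemma Ck_on_inverse_compose:
 assumes "open U" "Ck_on k U f" "!!x. x \<in> U ==> f x ~= 0"
 shows "Ck_on k U (%x. inverse (f x :: real))"
 by (rule Ck_on_compose[OF assms(1) _ assms(2) Ck_on_inverse]) (use assms in auto)

lemma Ck_on_normalise:
 assumes "open U" "Ck_on k U f" "!!x. x \<in> U ==> f x ~= 0"
 shows "Ck_on k U (%x. (f x :: 'b::euclidean_space) /R norm (f x))"
 by (intro Ck_on_scaleR Ck_on_inverse_compose Ck_on_norm) (use assms in auto)

section \<open>The inverse function theorem for smooth maps\<close>

text \<open>
 In the product rule the derivative of \<open>B\<close> is multiplied by \<open>h x0 = 0\<close>; hence continuity of \<open>B\<close> at
 the point suffices.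
\<close>

lemma has_derivative_bilinear_zero:
 assumes "bounded_bilinear P" "(h has_derivative h') (at x0)" "h x0 = 0" "isCont B x0"
 shows "((%x. P (B x) (h x)) has_derivative (%v. P (B x0) (h' v))) (at x0)"
proof -
 interpret P: bounded_bilinear P by fact
 obtain K where K: "K > 0" "!!a b. norm (P a b) <= norm a * norm b * K"
  using P.pos_bounded by blast
 obtain C where C: "C > 0" "!!v. norm (h' v) <= norm v * C"
  using assms(2) bounded_linear.pos_bounded by blast
 have "((%x. P (B x - B x0) (h x)) has_derivative (%v. 0)) (at x0)"
  unfolding has_derivative_at_alt
 proof (intro conjI allI impI)
  fix e :: real assume "e > 0"
  define e' where "e' = e / (K * (C + 1))"
  have "e' > 0" using \<open>e > 0\<close> K C by (auto simp: e'_def)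
  obtain d1 where d1: "d1 > 0" "!!y. norm (y - x0) < d1 ==> norm (h y - h x0 - h' (y - x0)) <= 1 * norm (y - x0)"
   using assms(2) unfolding has_derivative_at_alt by (meson zero_less_one)
  obtain d2 where d2: "d2 > 0" "!!y. norm (y - x0) < d2 ==> norm (B y - B x0) < e'"
   using assms(4) \<open>e' > 0\<close> unfolding isCont_def LIM_eq
   by (metis diff_self norm_zero)
  show "\<exists>d>0. \<forall>y. norm (y - x0) < d -->
      norm (P (B y - B x0) (h y) - P (B x0 - B x0) (h x0) - 0) <= e * norm (y - x0)"
  proof (intro exI[of _ "min d1 d2"] conjI allI impI)
   fix y assume y: "norm (y - x0) < min d1 d2"
   have "norm (h y) <= norm (h y - h' (y - x0)) + norm (h' (y - x0))"
    by (metis diff_add_cancel norm_triangle_ineq)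
   also have "\<dots> <= norm (y - x0) * (C + 1)"
    using d1(2)[of y] y C(2)[of "y - x0"] assms(3) by (simp add: algebra_simps)
   finally have hy: "norm (h y) <= norm (y - x0) * (C + 1)" .
   have "norm (P (B y - B x0) (h y)) <= norm (B y - B x0) * norm (h y) * K" by (rule K)
   also have "\<dots> <= e' * (norm (y - x0) * (C + 1)) * K"
    using d2(2)[of y] y hy K C \<open>e' > 0\<close> by (intro mult_mono, auto)
   also have "\<dots> = e * norm (y - x0)" using K(1) C(1) by (simp add: e'_def)
   finally show "norm (P (B y - B x0) (h y) - P (B x0 - B x0) (h x0) - 0) <= e * norm (y - x0)"
    by (simp add: P.zero_left)
  qed (use d1 d2 in auto)
 qed simp
 moreover have "((%x. P (B x0) (h x)) has_derivative (%v. P (B x0) (h' v))) (at x0)"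
  using bounded_linear.has_derivative[OF P.bounded_linear_right assms(2)] .
 ultimately have "((%x. P (B x - B x0) (h x) + P (B x0) (h x)) has_derivative (%v. 0 + P (B x0) (h' v))) (at x0)"
  by (rule has_derivative_add)
 then show ?thesis by (simp add: P.diff_left)
qed

text \<open>
 The resolvent identity \<open>B x - B x0 = - B x (A x - A x0) B x0\<close> bounds \<open>B\<close> near \<open>x0\<close> and shows that it
 is continuous.
\<close>

lemma continuous_on_blinfun_inverse:
 fixes A B :: "'z::real_normed_vector => 'a::real_normed_vector \<Rightarrow>\<^sub>L 'a"
 assumes "open V" "continuous_on V A"
  and inv: "!!x. x \<in> V ==> A x o\<^sub>L B x = id_blinfun \<and> B x o\<^sub>L A x = id_blinfun"
 shows "continuous_on V B"
proof -
 have id: "B x - B y = - (B x o\<^sub>L (A x - A y) o\<^sub>L B y)" if "x \<in> V" "y \<in> V" for x y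
 proof (rule blinfun_eqI)
  fix v
  have 1: "blinfun_apply (A y) (blinfun_apply (B y) v) = v" using inv[OF that(2)]
   by (metis blinfun_apply_blinfun_compose blinfun_apply_id_blinfun)
  have 2: "blinfun_apply (B x) (blinfun_apply (A x) w) = w" for w using inv[OF that(1)]
   by (metis blinfun_apply_blinfun_compose blinfun_apply_id_blinfun)
  show "blinfun_apply (B x - B y) v = blinfun_apply (- (B x o\<^sub>L (A x - A y) o\<^sub>L B y)) v"
   by (simp add: blinfun.bilinear_simps 1 2)
 qed
 have "isCont B y" if y: "y \<in> V" for y
  unfolding isCont_def
 proof (rule LIM_zero_cancel, rule Lim_null_comparison)
  let ?b = "norm (B y)"
  have lim: "((%x. norm (A x - A y)) \<longlongrightarrow> 0) (at y)"
   using assms(1,2) y by (metis LIM_zero_iff continuous_on_eq_continuous_at isCont_def tendsto_norm_zero)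
  have "eventually (%x. norm (A x - A y) < 1 / (2 * (?b + 1))) (at y)"
   using order_tendstoD(2)[OF lim, of "1 / (2 * (?b + 1))"] by (auto simp: add_nonneg_pos)
  moreover have "eventually (%x. x \<in> V) (at y)"
   using assms(1) y by (simp add: eventually_at_topological) blast
  ultimately show "eventually (%x. norm (B x - B y) <= 2 * ?b * ?b * norm (A x - A y)) (at y)"
  proof eventually_elim
   case (elim x)
   let ?a = "norm (A x - A y)"
   have le: "norm (B x - B y) <= norm (B x) * ?a * ?b"
   proof -
    have "norm (B x - B y) <= norm (B x o\<^sub>L (A x - A y)) * ?b"
     using id[OF elim(2) y] norm_blinfun_compose[of "B x o\<^sub>L (A x - A y)" "B y"] by simp
    also have "\<dots> <= norm (B x) * ?a * ?b"
     using norm_blinfun_compose[of "B x" "A x - A y"] by (intro mult_right_mono) auto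
    finally show ?thesis .
   qed
   have "?a * ?b <= 1 / (2 * (?b + 1)) * (?b + 1)"
    using elim(1) by (intro mult_mono) auto
   moreover have "1 / (2 * (?b + 1)) * (?b + 1) = 1/2"
   proof -
    have aux: "1 / (2 * c) * c = 1/2" if "c > 0" for c :: real using that by simp
    show ?thesis by (smt (verit) norm_ge_zero[of "B y"] aux)
   qed
   ultimately have "norm (B x) * (?a * ?b) <= norm (B x) * (1/2)"
    by (fastforce intro: ord_le_eq_trans mult_left_mono)
   moreover have "norm (B x) <= norm (B x - B y) + ?b"
    by (metis diff_add_cancel norm_triangle_ineq)
   ultimately have "norm (B x) * ?a * ?b <= 2 * ?b * ?a * ?b"
    using le by (intro mult_right_mono; simp)
   then show ?case using le by (simp add: algebra_simps)
  qed
  show "((%x. 2 * ?b * ?b * norm (A x - A y)) \<longlongrightarrow> 0) (at y)"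
   using tendsto_mult_left[OF lim, of "2 * ?b * ?b"] by simp
 qed
 then show ?thesis using continuous_at_imp_continuous_on by blast
qed

text \<open>
 The derivative of an inverse, \<open>- B A' B\<close>, is built from \<open>B\<close> itself and the derivative of \<open>A\<close>, so
 that the order of differentiability of \<open>B\<close> can be raised step by step.
\<close>

lemma Ck_on_blinfun_inverse:
 fixes A B :: "'z::real_normed_vector => 'a::real_normed_vector \<Rightarrow>\<^sub>L 'a"
 assumes "open V" "Ck_on k V A"
  and inv: "!!x. x \<in> V ==> A x o\<^sub>L B x = id_blinfun \<and> B x o\<^sub>L A x = id_blinfun"
 shows "Ck_on k V B"
 using assms(2)
proof (induction k)
 case 0
 then show ?case unfolding Ck_on.simps by (rule continuous_on_blinfun_inverse[OF assms(1) _ inv])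
next
 case (Suc k)
 let ?A' = "%x. Df A x"
 show ?case
 proof (rule Ck_on_SucI[OF assms(1), where f'="%x v. - (B x o\<^sub>L ?A' x v o\<^sub>L B x)"])
  fix x0 assume x0: "x0 \<in> V"
  have cont: "isCont B x0"
   using assms(1) x0 continuous_on_eq_continuous_at by (auto intro!: continuous_on_blinfun_inverse[OF assms(1) Ck_on_continuous[OF Suc.prems] inv])
  have dA: "((%x. A x - A x0) has_derivative ?A' x0) (at x0)"
   using Ck_on_has_derivative[OF Suc.prems x0] by (auto intro!: derivative_eq_intros)
  have 1: "((%x. B x o\<^sub>L (A x - A x0)) has_derivative (%v. B x0 o\<^sub>L ?A' x0 v)) (at x0)"
   by (rule has_derivative_bilinear_zero[OF bounded_bilinear_blinfun_compose dA _ cont]) simp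
  have 2: "((%x. B x0 - (B x o\<^sub>L (A x - A x0) o\<^sub>L B x0)) has_derivative (%v. 0 - (B x0 o\<^sub>L ?A' x0 v o\<^sub>L B x0))) (at x0)"
   by (intro has_derivative_diff has_derivative_const
     bounded_linear.has_derivative[OF bounded_bilinear.bounded_linear_left[OF bounded_bilinear_blinfun_compose] 1])
  show "(B has_derivative (%v. - (B x0 o\<^sub>L ?A' x0 v o\<^sub>L B x0))) (at x0)"
  proof (rule has_derivative_transform_within_open[OF _ assms(1) x0])
   show "((%x. B x0 - (B x o\<^sub>L (A x - A x0) o\<^sub>L B x0)) has_derivative (%v. - (B x0 o\<^sub>L ?A' x0 v o\<^sub>L B x0))) (at x0)"
    using 2 by simp
   fix x assume x: "x \<in> V"
   show "B x0 - (B x o\<^sub>L (A x - A x0) o\<^sub>L B x0) = B x"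
   proof (rule blinfun_eqI)
    fix v
    have 1: "blinfun_apply (A x0) (blinfun_apply (B x0) v) = v" using inv[OF x0]
     by (metis blinfun_apply_blinfun_compose blinfun_apply_id_blinfun)
    have 2: "blinfun_apply (B x) (blinfun_apply (A x) w) = w" for w using inv[OF x]
     by (metis blinfun_apply_blinfun_compose blinfun_apply_id_blinfun)
    show "blinfun_apply (B x0 - (B x o\<^sub>L (A x - A x0) o\<^sub>L B x0)) v = blinfun_apply (B x) v"
     by (simp add: blinfun.bilinear_simps 1 2)
   qed
  qed
 next
  fix v
  have B: "Ck_on k V B" using Suc.IH Ck_on_SucD[OF Suc.prems] by blast
  show "Ck_on k V (%x. - (B x o\<^sub>L ?A' x v o\<^sub>L B x))"
   using Suc.prems by (auto intro!: Ck_on_minus[OF assms(1)] Ck_on_bilinear[OF bounded_bilinear_blinfun_compose assms(1)] B)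
 qed
qed

definition frechet_blinfun :: "('a::real_normed_vector => 'b::real_normed_vector) => 'a => 'a \<Rightarrow>\<^sub>L 'b" where
 "frechet_blinfun f x = Blinfun (Df f x)"

lemma frechet_blinfun_apply:
 "f differentiable (at x) ==> blinfun_apply (frechet_blinfun f x) = Df f x"
 unfolding frechet_blinfun_def
 using bounded_linear_Blinfun_apply has_derivative_bounded_linear frechet_derivative_works by blast

lemma Ck_on_frechet_blinfun:
 fixes f :: "'a::euclidean_space => 'b::real_normed_vector"
 assumes "open U" "Ck_on (Suc k) U f"
 shows "Ck_on k U (frechet_blinfun f)"
proof -
 have "Ck_on k U (%x. \<Sum>b\<in>Basis. blinfun_scaleR_left (Df f x b) o\<^sub>L blinfun_inner_left b)"
  by (intro Ck_on_sum[OF assms(1)] Ck_on_comp_linear[OF bounded_linear_compose[OF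
     bounded_bilinear.bounded_linear_left[OF bounded_bilinear_blinfun_compose]
     bounded_linear_blinfun_scaleR_left] assms(1)])
    (use assms in auto)
 then show ?thesis
 proof (rule Ck_on_cong[OF assms(1), rotated])
  fix x assume "x \<in> U"
  then have df: "f differentiable (at x)" using assms(2) by auto
  have lin: "linear (Df f x)" using df linear_frechet_derivative by blast
  show "(\<Sum>b\<in>Basis. blinfun_scaleR_left (Df f x b) o\<^sub>L blinfun_inner_left b) = frechet_blinfun f x"
  proof (rule blinfun_eqI)
   fix v
   have "Df f x v = Df f x (\<Sum>b\<in>Basis. (v \<bullet> b) *R b)"
    by (simp add: euclidean_representation)
   also have "\<dots> = (\<Sum>b\<in>Basis. (v \<bullet> b) *R Df f x b)"
    by (simp add: linear_sum[OF lin] linear_cmul[OF lin])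
   finally show "blinfun_apply (\<Sum>b\<in>Basis. blinfun_scaleR_left (Df f x b) o\<^sub>L blinfun_inner_left b) v
     = blinfun_apply (frechet_blinfun f x) v"
    by (simp add: frechet_blinfun_apply[OF df] blinfun.sum_left)
  qed
 qed
qed

text \<open>
 The derivative of the local inverse is the inverse of the derivative, and is thus as often
 differentiable as the local inverse; this starts an induction.
\<close>

theorem smooth_inverse_function:
 fixes f :: "'a::euclidean_space => 'a"
 assumes "open U" "Cinf_on U f" "x0 \<in> U" "inj (Df f x0)"
 obtains U' V g where "open U'" "U' <= U" "x0 \<in> U'" "open V" "f x0 \<in> V" "homeomorphism U' V f g" "Cinf_on V g"
  "!!x. x \<in> U' ==> bij (Df f x)"
proof -
 let ?D = "%x. Df f x"
 have diff: "f differentiable (at x)" if "x \<in> U" for x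
  using assms(2) that differentiableI Cinf_has_derivative by blast
 have D: "(f has_derivative blinfun_apply (frechet_blinfun f x)) (at x)" if "x \<in> U" for x
  using Cinf_has_derivative[OF assms(2) that] frechet_blinfun_apply[OF diff[OF that]] by simp
 have lin0: "linear (?D x0)" using diff[OF assms(3)] linear_frechet_derivative by blast
 obtain L where L: "linear L" "L \<circ> ?D x0 = id"
  using linear_injective_left_inverse[OF lin0 assms(4)] by blast
 have comp: "Blinfun L o\<^sub>L frechet_blinfun f x0 = id_blinfun"
  by (rule blinfun_eqI)
    (use L in \<open>simp add: frechet_blinfun_apply[OF diff[OF assms(3)]] bounded_linear_Blinfun_apply linear_conv_bounded_linear fun_eq_iff\<close>)
 have cont: "continuous_on U (frechet_blinfun f)"
  using Ck_on_continuous[OF Ck_on_frechet_blinfun[OF assms(1)]] assms(2) by blast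
 obtain U' V g g' where UV: "open U'" "U' <= U" "x0 \<in> U'" "open V" "f x0 \<in> V" "homeomorphism U' V f g"
  and g': "!!y. y \<in> V ==> (g has_derivative (g' y)) (at y)"
  "!!y. y \<in> V ==> g' y = inv_into UNIV (blinfun_apply (frechet_blinfun f (g y)))"
  "!!y. y \<in> V ==> bij (blinfun_apply (frechet_blinfun f (g y)))"
  using inverse_function_theorem[OF assms(1) D cont assms(3) comp] by metis
 have gV: "g ` V <= U'" using UV(6) unfolding homeomorphism_def by blast
 define B where "B = (%y. Blinfun (g' y))"
 have Bapp: "blinfun_apply (B y) = g' y" if "y \<in> V" for y
  unfolding B_def using g'(1)[OF that] has_derivative_bounded_linear bounded_linear_Blinfun_apply by blast
 have inv: "frechet_blinfun f (g y) o\<^sub>L B y = id_blinfun \<and> B y o\<^sub>L frechet_blinfun f (g y) = id_blinfun"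
  if y: "y \<in> V" for y
 using g'(2,3)[OF y] Bapp[OF y] by (auto simp: bij_is_surj surj_f_inv_f bij_is_inj intro!: blinfun_eqI)
 have "Ck_on k V g" for k
 proof (induction k)
  case 0
  then show ?case using UV(6) homeomorphism_cont2 by auto
 next
  case (Suc k)
  have "Ck_on k V (%y. frechet_blinfun f (g y))"
   by (rule Ck_on_compose[OF \<open>open V\<close> assms(1) Suc]) (use Ck_on_frechet_blinfun[OF assms(1)] assms(2) gV UV(2) in blast)+
  then have B: "Ck_on k V B" by (rule Ck_on_blinfun_inverse[OF \<open>open V\<close> _ inv])
  show ?case
  proof (rule Ck_on_SucI[OF \<open>open V\<close> g'(1)])
   fix v
   show "Ck_on k V (%y. g' y v)"
    by (auto simp: Bapp intro: Ck_on_comp_linear[OF blinfun.bounded_linear_left \<open>open V\<close> B] Ck_on_cong[OF \<open>open V\<close>, rotated])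
  qed
 qed
 moreover have "bij (?D x)" if x: "x \<in> U'" for x
 using UV(6) x g'(3)[of "f x"] frechet_blinfun_apply[OF diff, of x] UV(2) by (auto simp: homeomorphism_def)
 ultimately show thesis using that[OF UV] by blast
qed

text \<open>Continuity of the derivative makes a map strictly differentiable: difference quotients are
 controlled at both of two moving points.\<close>

lemma Cinf_strict_derivative:
 fixes f :: "'a::euclidean_space => 'b::real_normed_vector"
 assumes "open U" "Cinf_on U f" "x0 \<in> U" "e > 0"
 obtains d where "d > 0" "ball x0 d <= U"
  "!!x y. x \<in> ball x0 d ==> y \<in> ball x0 d ==>
    norm (f y - f x - Df f x0 (y - x)) <= e * norm (y - x)"
proof -
 have diff: "f differentiable (at x)" if "x \<in> U" for x
  using assms(2) that differentiableI Cinf_has_derivative by blast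
 obtain d1 where d1: "d1 > 0" "!!x. dist x x0 < d1 ==> dist (frechet_blinfun f x) (frechet_blinfun f x0) < e"
  by (metis Ck_on_continuous[OF Ck_on_frechet_blinfun[OF assms(1)]] assms(2) assms(1,3) continuous_on_eq_continuous_at assms(4) continuous_at_eps_delta)
 obtain d2 where d2: "d2 > 0" "ball x0 d2 <= U" using assms(1,3) openE by blast
 let ?d = "min d1 d2"
 show thesis
 proof (rule that[of ?d])
  fix x y assume xy: "x \<in> ball x0 ?d" "y \<in> ball x0 ?d"
  let ?D = "frechet_blinfun f x0"
  let ?h = "%x. f x - blinfun_apply ?D x"
  have "norm (?h y - ?h x) <= e * norm (y - x)"
  proof (rule differentiable_bound[OF convex_ball, of x0 ?d ?h "%z. blinfun_apply (frechet_blinfun f z - ?D)"])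
   fix z assume z: "z \<in> ball x0 ?d"
   then have zU: "z \<in> U" using d2 by auto
   have "(?h has_derivative (%v. blinfun_apply (frechet_blinfun f z) v - blinfun_apply ?D v)) (at z)"
    using Cinf_has_derivative[OF assms(2) zU] frechet_blinfun_apply[OF diff[OF zU]] by (auto intro!: derivative_eq_intros)
   then show "(?h has_derivative blinfun_apply (frechet_blinfun f z - ?D)) (at z within ball x0 ?d)"
    by (auto simp: blinfun.bilinear_simps[abs_def] intro: has_derivative_at_withinI)
   show "onorm (blinfun_apply (frechet_blinfun f z - ?D)) <= e"
    using d1(2)[of z] z by (simp add: dist_norm norm_minus_commute norm_blinfun.rep_eq)
  qed (use xy in auto)
  then show "norm (f y - f x - Df f x0 (y - x)) <= e * norm (y - x)"
   by (simp add: frechet_blinfun_apply[OF diff[OF assms(3)], symmetric] blinfun.bilinear_simps algebra_simps)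
 qed (use d1 d2 in auto)
qed

section \<open>Affine perturbations\<close>

lemma frechet_derivative_eq: "(f has_derivative f') (at x) ==> Df f x u = f' u"
 using frechet_derivative_at by metis

text \<open>
 A finite type of the size of the dimension of \<open>'b\<close>. It makes the linear maps from \<open>'a\<close> to \<open>'b\<close>,
 given by their rows, a Euclidean space, to which negligible sets apply.
\<close>

typedef (overloaded) 'b basis = "Basis :: 'b::euclidean_space set"
 morphisms vec_of Abs_basis using nonempty_Basis by blast

lemma range_vec_of: "range (vec_of :: 'b::euclidean_space basis => 'b) = Basis"
 using type_definition.Rep_range[OF type_definition_basis] .

lemma inj_vec_of: "inj vec_of" by (metis injI vec_of_inject)

instance basis :: (euclidean_space) finite
proof
 show "finite (UNIV :: 'a basis set)"
  using finite_imageD[of vec_of "UNIV :: 'a basis set"] inj_vec_of by (simp add: range_vec_of)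
qed

lemma inner_vec_of: "vec_of i \<bullet> vec_of j = (if i = j then 1 else 0)"
 using inner_Basis[OF vec_of[of i] vec_of[of j]] by (simp add: vec_of_inject)

lemma sum_vec_of: "(\<Sum>j\<in>UNIV. h (vec_of j)) = (\<Sum>i\<in>Basis. h i)"
 using sum.reindex[OF inj_vec_of, of h] by (simp add: range_vec_of o_def)

definition rows_map :: "'a::euclidean_space ^ ('b::euclidean_space basis) => 'a => 'b" where
 "rows_map A x = (\<Sum>j\<in>UNIV. (A $ j \<bullet> x) *R vec_of j)"

lemma rows_map_inner [simp]: "rows_map A x \<bullet> vec_of j = A $ j \<bullet> x"
 by (simp add: rows_map_def inner_sum_left inner_vec_of if_distrib cong: if_cong)

lemma vec_of_eqI: "(!!j. x \<bullet> vec_of j = y \<bullet> vec_of j) ==> x = y"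
 by (metis euclidean_eqI range_vec_of imageE)

lemma linear_rows_map: "linear (rows_map A)"
 by (rule linearI; rule vec_of_eqI) (simp_all add: inner_add_left inner_add_right)

lemma norm_rows_map_le: "norm (rows_map A x) <= (real CARD('b basis) * norm A) * norm x"
 for A :: "'a::euclidean_space ^ ('b::euclidean_space basis)"
proof -
 have "norm (rows_map A x) <= (\<Sum>j\<in>UNIV. norm ((A $ j \<bullet> x) *R vec_of j))"
  unfolding rows_map_def by (rule norm_sum)
 also have "\<dots> <= (\<Sum>j\<in>(UNIV :: 'b basis set). norm A * norm x)"
 proof (rule sum_mono)
  fix j :: "'b basis"
  have "norm ((A $ j \<bullet> x) *R vec_of j) <= norm (A $ j) * norm x"
   using Cauchy_Schwarz_ineq2[of "A $ j" x] by (simp add: norm_Basis[OF vec_of])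
  also have "\<dots> <= norm A * norm x" by (intro mult_right_mono Finite_Cartesian_Product.norm_nth_le) simp
  finally show "norm ((A $ j \<bullet> x) *R vec_of j) <= norm A * norm x" .
 qed
 finally show ?thesis by simp
qed

text \<open>
 Suppose that \<open>(c, A)\<close> is bad: at some \<open>x\<close> with \<open>g x = c + A x\<close> the rows of \<open>T = Dg x - A\<close> are linearly
 dependent. Then one of them, the \<open>k\<close>-th, is the combination of the others with some coefficients
 \<open>l\<close>. So \<open>x\<close>, \<open>l\<close> and the rows of \<open>T\<close> other than the \<open>k\<close>-th determine \<open>T\<close>, hence \<open>A\<close> and then \<open>c\<close>. Writing \<open>x\<close> in
 place of the \<open>k\<close>-th row and putting the \<open>k\<close>-th coefficient equal to 0, the bad parameters become
 the image of a part of a hyperplane of the parameter space under a differentiable map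
 \<open>F k\<close>. Such an image is negligible.
\<close>

lemma affine_perturbation_regular:
 fixes g :: "'a::euclidean_space => 'b::euclidean_space"
 assumes "open U" and g: "Cinf_on U g" and "e > 0"
 obtains c L where "norm c < e" "linear L" "\<forall>x. norm (L x) <= e * norm x"
  "\<forall>x\<in>U. g x = c + L x --> surj (%v. Df g x v - L v)"
proof -
 let ?D = "%x. Df g x"
 define G where "G x j = (\<Sum>a\<in>Basis. (?D x a \<bullet> vec_of j) *R a)" for x and j :: "'b basis"
 have D: "(g has_derivative ?D x) (at x)" if "x \<in> U" for x by (rule Cinf_has_derivative[OF g that])
 have G: "G x j \<bullet> v = ?D x v \<bullet> vec_of j" if "x \<in> U" for x j v
 proof -
  have "?D x v = (\<Sum>a\<in>Basis. (v \<bullet> a) *R ?D x a)"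
   by (subst euclidean_representation[of v, symmetric])
    (simp add: linear_sum[OF has_derivative_linear[OF D[OF that]]] linear_cmul[OF has_derivative_linear[OF D[OF that]]])
  then have "?D x v \<bullet> vec_of j = (\<Sum>a\<in>Basis. (v \<bullet> a) * (?D x a \<bullet> vec_of j))" by (simp add: inner_sum_left)
  then show ?thesis unfolding G_def inner_sum_left inner_scaleR_left by (simp add: inner_commute[of _ v] mult.commute)
 qed
 define R where "R k j p = G (snd p $ k) j - (if j = k then \<Sum>i\<in>UNIV. (fst p \<bullet> vec_of i) *R (snd p $ i) else snd p $ j)"
  for k j and p :: "'b \<times> ('a ^ 'b basis)"
 define F where "F k p = (g (snd p $ k) - (\<Sum>j\<in>UNIV. (R k j p \<bullet> snd p $ k) *R vec_of j), \<Sum>j\<in>UNIV. axis j (R k j p))"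
  for k and p :: "'b \<times> ('a ^ 'b basis)"
 define S where "S k = {p :: 'b \<times> ('a ^ 'b basis). (vec_of k, 0) \<bullet> p = 0 \<and> snd p $ k \<in> U}" for k
 have "negligible (F k ` S k)" for k
 proof (rule negligible_differentiable_image_negligible[OF order_refl])
  show "negligible (S k)"
   by (rule negligible_subset[OF negligible_hyperplane[of "(vec_of k, 0)" 0]])
    (auto simp: S_def zero_prod_def nonzero_Basis[OF vec_of])
  have "F k differentiable (at p)" if "p \<in> S k" for p
  proof -
   define x where "x = snd p $ k"
   have x: "x \<in> U" using that by (simp add: S_def x_def)
   have nth: "(%p. snd p $ j) differentiable (at p)" for p :: "'b \<times> ('a ^ 'b basis)" and j
    by (intro linear_imp_differentiable linearI) auto
   have cmp: "(%p. h (snd p $ k)) differentiable (at p)" if "h differentiable (at x)" for h :: "'a => 'b"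
    using differentiable_chain_at[OF nth[of k p], of h] that unfolding x_def o_def by blast
   have "g differentiable (at x)" "(%x. ?D x a) differentiable (at x)" for a
    using g[rule_format, of 2] x by (auto simp: numeral_2_eq_2)
   from cmp[OF this(1)] cmp[OF this(2)] have dg: "(%p. g (snd p $ k)) differentiable (at p)"
    and "(%p. G (snd p $ k) j) differentiable (at p)" for j
    unfolding G_def by (auto intro!: differentiable_sum differentiable_scaleR differentiable_inner)
   then have dR: "R k j differentiable (at p)" for j
    unfolding R_def by (cases "j = k") (auto intro!: differentiable_diff differentiable_sum differentiable_scaleR differentiable_inner nth linear_imp_differentiable[OF linear_fst])
   have "(%p. axis j (R k j p)) differentiable (at p)" for j
    using differentiable_chain_at[OF dR[of j] linear_imp_differentiable[of "axis j"]]
    by (simp add: o_def linear_iff axis_def vec_eq_iff)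
   moreover have "(%p. (R k j p \<bullet> snd p $ k) *R vec_of j) differentiable (at p)" for j
    by (intro differentiable_scaleR differentiable_inner dR nth differentiable_const)
   ultimately show ?thesis unfolding F_def by (intro differentiable_Pair differentiable_diff differentiable_sum dg ballI) auto
  qed
  then show "F k differentiable_on S k" by (simp add: differentiable_at_imp_differentiable_on)
 qed
 then have N: "negligible (\<Union>k. F k ` S k)" by (intro negligible_Union) auto
 define d where "d = e / (real CARD('b basis) + 1)"
 have "d > 0" using assms(3) by (simp add: d_def)
 then have "\<not> negligible (ball (0 :: 'b \<times> ('a ^ 'b basis)) d)" by (intro open_not_negligible) auto
 then obtain p where "p \<in> ball 0 d" "p \<notin> (\<Union>k. F k ` S k)" using negligible_subset[OF N] by blast
 then obtain c A where p: "(c, A) \<in> ball 0 d" "(c, A) \<notin> (\<Union>k. F k ` S k)" by (cases p) blast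
 have d: "norm c < d" "norm A < d" using p(1) norm_fst_le[of c A] norm_snd_le[of A c] by auto
 have "surj (%v. ?D x v - rows_map A v)" if x: "x \<in> U" and c: "g x = c + rows_map A x" for x
 proof (rule ccontr)
  let ?T = "%v. ?D x v - rows_map A v"
  assume ns: "\<not> surj ?T"
  have lin: "linear ?T" by (intro linear_compose_sub has_derivative_linear[OF D[OF x]] linear_rows_map)
  have "span (range ?T) = range ?T" using linear_subspace_image[OF lin subspace_UNIV] by (simp only: span_eq_iff)
  then have "span (range ?T) ~= UNIV" using ns by metis
  from span_not_UNIV_orthogonal[OF this] obtain w where w0: "w ~= 0" "\<forall>y\<in>span (range ?T). w \<bullet> y = 0" by blast
  have w: "w \<bullet> ?T v = 0" for v by (rule w0(2)[rule_format]) (rule span_base[OF rangeI])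
  have "\<exists>k. w \<bullet> vec_of k ~= 0"
  proof (rule ccontr)
   assume "\<nexists>k. w \<bullet> vec_of k ~= 0"
   then have "w \<bullet> vec_of k = 0 \<bullet> vec_of k" for k by simp
   from vec_of_eqI[OF this] have "w = 0" .
   then show False using w0(1) by simp
  qed
  then obtain k where k: "w \<bullet> vec_of k ~= 0" by blast
  define l where "l = vec_of k - (1 / (w \<bullet> vec_of k)) *R w"
  define Q where "Q = (\<chi> j. if j = k then x else G x j - A $ j)"
  have Qk: "Q $ k = x" by (simp add: Q_def)
  have l: "l \<bullet> vec_of j = (if j = k then 0 else - (w \<bullet> vec_of j) / (w \<bullet> vec_of k))" for j
   using k by (simp add: l_def inner_diff_left inner_vec_of)
  have "(\<Sum>j\<in>UNIV. (w \<bullet> vec_of j) *R (G x j - A $ j)) \<bullet> v = 0" for v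
  proof -
   have "(\<Sum>j\<in>UNIV. (w \<bullet> vec_of j) *R (G x j - A $ j)) \<bullet> v = (\<Sum>j\<in>UNIV. (w \<bullet> vec_of j) * (?T v \<bullet> vec_of j))"
    by (simp add: inner_sum_left inner_diff_left G[OF x])
   also have "\<dots> = w \<bullet> ?T v" unfolding euclidean_inner[of w "?T v"] by (rule sum_vec_of)
   finally show ?thesis using w by simp
  qed
  then have sm: "(\<Sum>j\<in>UNIV. (w \<bullet> vec_of j) *R (G x j - A $ j)) = 0" by (metis inner_eq_zero_iff)
  have e: "G x k - A $ k = (\<Sum>i\<in>UNIV. (l \<bullet> vec_of i) *R (Q $ i))"
  proof -
   have "(w \<bullet> vec_of k) *R (\<Sum>i\<in>UNIV. (l \<bullet> vec_of i) *R (Q $ i))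
     = (\<Sum>i\<in>UNIV. (if i = k then (w \<bullet> vec_of k) *R (G x k - A $ k) else 0) - (w \<bullet> vec_of i) *R (G x i - A $ i))"
    unfolding scaleR_sum_right using k by (intro sum.cong) (auto simp: l Q_def)
   also have "\<dots> = (w \<bullet> vec_of k) *R (G x k - A $ k)" using sm by (simp add: sum_subtractf)
   finally show ?thesis using k by simp
  qed
  have "R k k (l, Q) = A $ k" by (simp add: R_def Qk e[symmetric])
  then have R1: "R k j (l, Q) = A $ j" for j by (cases "j = k") (simp_all add: R_def Q_def)
  have "F k (l, Q) = (c, A)" using c by (simp add: F_def R1 Qk rows_map_def vec_eq_iff axis_def)
  moreover have "(l, Q) \<in> S k" using l[of k] x Qk by (simp add: S_def inner_commute)
  ultimately have "(c, A) \<in> F k ` S k" by (metis imageI)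
  then show False using p(2) by blast
 qed
 note reg = this
 have de: "(real CARD('b basis) + 1) * d = e" by (simp add: d_def add_eq_0_iff2)
 have "real CARD('b basis) * norm A <= e"
  unfolding de[symmetric] using d(2) by (intro mult_mono) auto
 then have nb: "norm (rows_map A x) <= e * norm x" for x
  by (rule order_trans[OF norm_rows_map_le mult_right_mono]) simp
 have "d <= e" unfolding de[symmetric] using \<open>0 < d\<close> by (simp add: algebra_simps)
 then have "norm c < e" using d(1) by simp
 then show thesis by (intro that[of c "rows_map A"] linear_rows_map allI ballI impI nb reg)
qed

section \<open>Tangent spaces and submanifold charts\<close>

lemma smooth_onI:
 assumes "open U" "S <= U" "Cinf_on U f"
 shows "smooth_on S f"
 using assms by (auto simp: smooth_on_def intro!: exI[of _ U] exI[of _ f])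

lemma smooth_on_open_iff:
 assumes "open U"
 shows "smooth_on U f \<longleftrightarrow> Cinf_on U f"
proof
 assume s: "smooth_on U f"
 show "Cinf_on U f"
 proof
  fix k
  show "Ck_on k U f"
  proof (rule Ck_on_local)
   fix x assume x: "x \<in> U"
   then obtain W F where W: "open W" "x \<in> W" "Cinf_on W F" "\<forall>y\<in>U \<inter> W. F y = f y"
    using s unfolding smooth_on_def by blast
   have "Ck_on k (U \<inter> W) f"
    by (rule Ck_on_cong[of "U \<inter> W" F]) (use W assms Ck_on_subset[of k W F "U \<inter> W"] in auto)
   then show "\<exists>V. open V \<and> x \<in> V \<and> Ck_on k (U \<inter> V) f" using W by blast
  qed
 qed
qed (use assms smooth_onI in blast)

lemma smooth_on_obtain:
 assumes "smooth_on S f" "x \<in> S"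
 obtains U F where "open U" "x \<in> U" "Cinf_on U F" "!!y. y \<in> S ==> y \<in> U ==> F y = f y"
  "(f has_derivative Df F x) (at x within S)"
proof -
 obtain U F where U: "open U" "x \<in> U" "Cinf_on U F" "\<forall>y\<in>S \<inter> U. F y = f y"
  using assms unfolding smooth_on_def by blast
 have "(F has_derivative Df F x) (at x within S)"
  using Cinf_has_derivative[OF U(3,2)] has_derivative_at_withinI by blast
 moreover obtain e where e: "e > 0" "ball x e <= U" using U(1,2) openE by blast
 ultimately have "(f has_derivative Df F x) (at x within S)"
  using U(4) assms(2) by (elim has_derivative_transform_within[OF _ e(1)]) (auto simp: dist_commute subset_iff)
 then show thesis using that U by blast
qed

lemma smooth_on_continuous:
 assumes "smooth_on S f"
 shows "continuous_on S f"
 using assms by (auto simp: continuous_on_eq_continuous_within intro: smooth_on_obtain has_derivative_continuous)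

lemma smooth_on_compose:
 fixes f :: "'a::real_normed_vector => 'b::euclidean_space"
 assumes "smooth_on S f" "smooth_on T g" "f ` S <= T"
 shows "smooth_on S (%x. g (f x))"
 unfolding smooth_on_def
proof
 fix x assume x: "x \<in> S"
 obtain U F where U: "open U" "x \<in> U" "Cinf_on U F" "!!y. y \<in> S ==> y \<in> U ==> F y = f y"
  "(f has_derivative Df F x) (at x within S)"
  by (rule smooth_on_obtain[OF assms(1) x]) (rule that)
 have fx: "f x \<in> T" using x assms(3) by auto
 obtain V G where V: "open V" "f x \<in> V" "Cinf_on V G" "!!y. y \<in> T ==> y \<in> V ==> G y = g y"
  "(g has_derivative Df G (f x)) (at (f x) within T)"
  by (rule smooth_on_obtain[OF assms(2) fx]) (rule that)
 define W where "W = U \<inter> F -` V"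
 have oW: "open W"
  unfolding W_def using continuous_open_preimage[OF _ U(1) V(1)] U(3) Ck_on_continuous by blast
 have "Ck_on k W (%x. G (F x))" for k
  by (rule Ck_on_compose[OF oW V(1) Ck_on_subset[OF U(3)[rule_format]] V(3)[rule_format]]) (auto simp: W_def)
 moreover have "\<forall>y\<in>S \<inter> W. G (F y) = g (f y)"
  using U(4) V(4) assms(3) by (auto simp: W_def)
 ultimately show "\<exists>U Fa. open U \<and> x \<in> U \<and> Cinf_on U Fa \<and> (\<forall>y\<in>S \<inter> U. Fa y = g (f y))"
  using x U V oW by (auto simp: W_def intro!: exI[of _ W] exI[of _ "%x. G (F x)"])
qed

lemma smooth_on_Pair:
 assumes "smooth_on S f" "smooth_on S g"
 shows "smooth_on S (%x. (f x, g x))"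
 unfolding smooth_on_def
proof
 fix x assume x: "x \<in> S"
 obtain U F where U: "open U" "x \<in> U" "Cinf_on U F" "!!y. y \<in> S ==> y \<in> U ==> F y = f y"
  "(f has_derivative Df F x) (at x within S)"
  by (rule smooth_on_obtain[OF assms(1) x]) (rule that)
 obtain V G where V: "open V" "x \<in> V" "Cinf_on V G" "!!y. y \<in> S ==> y \<in> V ==> G y = g y"
  "(g has_derivative Df G x) (at x within S)"
  by (rule smooth_on_obtain[OF assms(2) x]) (rule that)
 have "Ck_on k (U \<inter> V) (%x. (F x, G x))" for k
  by (rule Ck_on_Pair) (use U V Ck_on_subset[of k U F "U \<inter> V"] Ck_on_subset[of k V G "U \<inter> V"] in auto)
 then show "\<exists>U Fa. open U \<and> x \<in> U \<and> Cinf_on U Fa \<and> (\<forall>y\<in>S \<inter> U. Fa y = (f y, g y))"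
  using U V by (intro exI[of _ "U \<inter> V"] exI[of _ "%x. (F x, G x)"]) auto
qed

lemma has_vector_derivative_compose:
 assumes "(ga has_vector_derivative v) (at t within I)" "(f has_derivative D) (at (ga t) within S)" "ga ` I <= S"
 shows "((%t. f (ga t)) has_vector_derivative D v) (at t within I)"
proof -
 have lin: "linear D" using assms(2) has_derivative_linear by blast
 have "(f has_derivative D) (at (ga t) within ga ` I)" using assms(2,3) has_derivative_subset by blast
 from has_derivative_in_compose[OF assms(1)[unfolded has_vector_derivative_def] this]
 show ?thesis unfolding has_vector_derivative_def by (simp add: linear_cmul[OF lin])
qed

text \<open>
 Tangent spaces are spans of one-sided velocities; it is more convenient to treat the
 velocities themselves.
\<close>

definition velocity :: "'a::euclidean_space set => 'a => 'a => bool" where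
 "velocity S x v \<longleftrightarrow> (\<exists>ga. smooth_on {0..1} ga \<and> ga ` {0..1} <= S \<and> ga 0 = x \<and>
   (ga has_vector_derivative v) (at 0 within {0..1}))"

lemma velocityE:
 assumes "velocity S x v"
 obtains ga where "smooth_on {0..1} ga" "ga ` {0..1} <= S" "ga 0 = x"
  "(ga has_vector_derivative v) (at 0 within {0..1})"
 using assms unfolding velocity_def by (elim exE conjE) (rule that)

lemma tangent_space_velocity: "tangent_space S x = span (Collect (velocity S x))"
 unfolding tangent_space_def velocity_def by simp

lemma velocity_tangent: "velocity S x v ==> v \<in> tangent_space S x"
 unfolding tangent_space_velocity by (simp add: span_base)

lemma subspace_tangent_space: "subspace (tangent_space S x)"
 unfolding tangent_space_def by (rule subspace_span)

lemma vector_derivative_unique_01: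
 assumes "(f has_vector_derivative a) (at (0::real) within {0..1})" "(f has_vector_derivative b) (at 0 within {0..1})"
 shows "a = b"
 by (rule vector_derivative_unique_within[OF _ assms]) (simp add: trivial_limit_within islimpt_Icc)

lemma tangent_space_subsetI:
 assumes "subspace T" "!!v. velocity S x v ==> v \<in> T"
 shows "tangent_space S x <= T"
 unfolding tangent_space_velocity by (rule span_minimal[OF _ assms(1)]) (use assms(2) in auto)

text \<open>
 Derivatives within \<open>S\<close> are determined only along \<open>S\<close>: each is fixed on the velocities of curves in \<open>S\<close>,
 and so on their span.
\<close>

lemma derivative_tangent_unique:
 assumes "(f has_derivative D) (at x within S)" "(f has_derivative D') (at x within S)" "v \<in> tangent_space S x"
 shows "D v = D' v"
proof -
 have lin: "linear D" "linear D'" using assms has_derivative_linear by blast+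
 have "subspace {v. D v = D' v}"
  by (auto simp: subspace_def linear_0[OF lin(1)] linear_0[OF lin(2)] linear_add[OF lin(1)] linear_add[OF lin(2)]
    linear_cmul[OF lin(1)] linear_cmul[OF lin(2)])
 moreover have "v \<in> {v. D v = D' v}" if v: "velocity S x v" for v
 proof -
  from v obtain ga where ga0: "smooth_on {0..1} ga" and ga: "ga ` {0..1} <= S" "ga 0 = x"
   "(ga has_vector_derivative v) (at 0 within {0..1})"
   by (rule velocityE)
  show ?thesis
   using has_vector_derivative_compose[OF ga(3) _ ga(1)] assms(1,2) ga(2) vector_derivative_unique_01 by blast
 qed
 ultimately show ?thesis using tangent_space_subsetI assms(3) by blast
qed

lemma differential_works:
 assumes "(f has_derivative D) (at x within S)"
 shows "(f has_derivative differential S f x) (at x within S)"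
 unfolding differential_def using someI[of "%D. (f has_derivative D) (at x within S)", OF assms] .

lemma differential_eq:
 assumes "(f has_derivative D) (at x within S)" "v \<in> tangent_space S x"
 shows "differential S f x v = D v"
 using derivative_tangent_unique[OF differential_works[OF assms(1)] assms] .

lemma smooth_on_differential:
 assumes "smooth_on S f" "x \<in> S"
 shows "(f has_derivative differential S f x) (at x within S)"
 by (rule smooth_on_obtain[OF assms]) (rule differential_works)

lemma velocity_image:
 fixes f :: "'a::euclidean_space => 'b::euclidean_space"
 assumes "velocity S x v" "smooth_on S f" "f ` S <= T" "x \<in> S"
 shows "velocity T (f x) (differential S f x v)"
proof -
 obtain ga where ga: "smooth_on {0..1} ga" "ga ` {0..1} <= S" "ga 0 = x" "(ga has_vector_derivative v) (at 0 within {0..1})"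
  using assms(1) by (rule velocityE)
 show ?thesis unfolding velocity_def
 proof (intro exI[of _ "%t. f (ga t)"] conjI)
  show "smooth_on {0..1} (%t. f (ga t))" by (rule smooth_on_compose[OF ga(1) assms(2) ga(2)])
  show "((%t. f (ga t)) has_vector_derivative differential S f x v) (at 0 within {0..1})"
   by (rule has_vector_derivative_compose[OF ga(4) _ ga(2)])
     (use smooth_on_differential[OF assms(2,4)] ga(3) in simp)
 qed (use ga assms(3) in auto)
qed

lemma differential_tangent:
 fixes f :: "'a::euclidean_space => 'b::euclidean_space"
 assumes "v \<in> tangent_space S x" "smooth_on S f" "f ` S <= T" "x \<in> S"
 shows "differential S f x v \<in> tangent_space T (f x)"
proof -
 let ?D = "differential S f x"
 have lin: "linear ?D" using smooth_on_differential[OF assms(2,4)] has_derivative_linear by blast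
 have "subspace (?D -` tangent_space T (f x))"
  by (rule linear_subspace_vimage[OF lin subspace_tangent_space])
 then have "tangent_space S x <= ?D -` tangent_space T (f x)"
  by (rule tangent_space_subsetI) (use velocity_image[OF _ assms(2-4)] velocity_tangent in blast)
 then show ?thesis using assms(1) by blast
qed

lemma differential_compose:
 fixes f :: "'a::euclidean_space => 'b::euclidean_space" and g :: "'b => 'c::euclidean_space"
 assumes "smooth_on S f" "smooth_on T g" "f ` S <= T" "x \<in> S" "v \<in> tangent_space S x"
 shows "differential S (%x. g (f x)) x v = differential T g (f x) (differential S f x v)"
proof -
 have "(g has_derivative differential T g (f x)) (at (f x) within f ` S)"
  using assms smooth_on_differential has_derivative_subset by blast
 from has_derivative_in_compose[OF smooth_on_differential[OF assms(1,4)] this]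
 show ?thesis using differential_eq[OF _ assms(5)] by blast
qed

lemma velocity_0: "x \<in> S ==> velocity S x 0"
 unfolding velocity_def
 by (intro exI[of _ "%t. x"] conjI smooth_onI[OF open_UNIV] allI Ck_on_const) auto

lemma velocity_Times:
 "velocity (A \<times> B) (a, b) (u, w) \<longleftrightarrow> velocity A a u \<and> velocity B b w"
proof
 assume "velocity (A \<times> B) (a, b) (u, w)"
 then obtain ga where ga: "smooth_on {0..1} ga" "ga ` {0..1} <= A \<times> B" "ga 0 = (a, b)"
   "(ga has_vector_derivative (u, w)) (at 0 within {0..1})"
  by (rule velocityE)
 have "smooth_on UNIV (fst :: 'a \<times> 'b => 'a)" "smooth_on UNIV (snd :: 'a \<times> 'b => 'b)"
  by (auto intro!: smooth_onI[OF open_UNIV] Ck_on_linear bounded_linear_fst bounded_linear_snd)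
 then have s: "smooth_on {0..1} (%t. fst (ga t))" "smooth_on {0..1} (%t. snd (ga t))"
  using smooth_on_compose[OF ga(1)] by blast+
 have d: "((%t. fst (ga t)) has_vector_derivative u) (at 0 within {0..1})"
  "((%t. snd (ga t)) has_vector_derivative w) (at 0 within {0..1})"
  using bounded_linear.has_vector_derivative[OF bounded_linear_fst ga(4)] bounded_linear.has_vector_derivative[OF bounded_linear_snd ga(4)] by auto
 show "velocity A a u \<and> velocity B b w"
  unfolding velocity_def
  by (intro conjI exI[of _ "%t. fst (ga t)"] exI[of _ "%t. snd (ga t)"] s d)
    (use ga(2,3) in \<open>auto simp: image_subset_iff mem_Times_iff\<close>)
next
 assume "velocity A a u \<and> velocity B b w"
 then have v: "velocity A a u" "velocity B b w" by auto
 from v(1) obtain ga where ga: "smooth_on {0..1} ga" "ga ` {0..1} <= A" "ga 0 = a"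
  "(ga has_vector_derivative u) (at 0 within {0..1})" by (rule velocityE)
 from v(2) obtain de where de: "smooth_on {0..1} de" "de ` {0..1} <= B" "de 0 = b"
  "(de has_vector_derivative w) (at 0 within {0..1})" by (rule velocityE)
 show "velocity (A \<times> B) (a, b) (u, w)" unfolding velocity_def
  by (intro exI[of _ "%t. (ga t, de t)"] conjI smooth_on_Pair[OF ga(1) de(1)] has_vector_derivative_Pair[OF ga(4) de(4)])
    (use ga de in auto)
qed

lemma tangent_space_Times:
 assumes "a \<in> A" "b \<in> B"
 shows "tangent_space (A \<times> B) (a, b) = tangent_space A a \<times> tangent_space B b"
proof
 show "tangent_space (A \<times> B) (a, b) <= tangent_space A a \<times> tangent_space B b"
 proof (rule tangent_space_subsetI)
  show "subspace (tangent_space A a \<times> tangent_space B b)"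
   by (intro subspace_Times subspace_tangent_space)
  fix v :: "'a \<times> 'b" assume "velocity (A \<times> B) (a, b) v"
  then show "v \<in> tangent_space A a \<times> tangent_space B b"
   by (cases v) (auto simp: velocity_Times intro: velocity_tangent)
 qed
 have 1: "tangent_space A a <= {u. (u, 0) \<in> tangent_space (A \<times> B) (a, b)}"
 proof (rule tangent_space_subsetI)
  show "subspace {u. (u, 0) \<in> tangent_space (A \<times> B) (a, b)}"
   using subspace_tangent_space[of "A \<times> B" "(a, b)"] unfolding subspace_def zero_prod_def
   by (auto, metis add_Pair add_0, metis scaleR_Pair scaleR_zero_right)
  fix v assume "velocity A a v"
  then show "v \<in> {u. (u, 0) \<in> tangent_space (A \<times> B) (a, b)}"
   using velocity_0[OF assms(2)] by (auto intro!: velocity_tangent simp: velocity_Times)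
 qed
 have 2: "tangent_space B b <= {u. (0, u) \<in> tangent_space (A \<times> B) (a, b)}"
 proof (rule tangent_space_subsetI)
  show "subspace {u. (0, u) \<in> tangent_space (A \<times> B) (a, b)}"
   using subspace_tangent_space[of "A \<times> B" "(a, b)"] unfolding subspace_def zero_prod_def
   by (auto, metis add_Pair add_0, metis scaleR_Pair scaleR_zero_right)
  fix v assume "velocity B b v"
  then show "v \<in> {u. (0, u) \<in> tangent_space (A \<times> B) (a, b)}"
   using velocity_0[OF assms(1)] by (auto intro!: velocity_tangent simp: velocity_Times)
 qed
 show "tangent_space A a \<times> tangent_space B b <= tangent_space (A \<times> B) (a, b)"
 using 1 2 subspace_add[OF subspace_tangent_space] by fastforce
qed

lemma tangent_space_singleton: "tangent_space {a} a = {0}"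
proof -
 have "velocity {a} a v ==> v = 0" for v
 proof -
  assume "velocity {a} a v"
  then obtain ga where ga0: "smooth_on {0..1} ga" and ga: "ga ` {0..1} <= {a}" "ga 0 = a"
   "(ga has_vector_derivative v) (at 0 within {0..1})"
   by (rule velocityE)
  have "((%t. a) has_vector_derivative v) (at 0 within {0..1})"
   by (rule has_vector_derivative_transform_within[OF ga(3) zero_less_one]) (use ga(1) in \<open>auto simp: image_subset_iff\<close>)
  then show "v = 0" using vector_derivative_unique_01 has_vector_derivative_const by blast
 qed
 then have "tangent_space {a} a <= {0}" by (intro tangent_space_subsetI) auto
 then show ?thesis using subspace_0[OF subspace_tangent_space] by blast
qed

lemma tangent_space_interval:
 assumes "t \<in> {0..1::real}"
 shows "tangent_space {0..1} t = UNIV"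
proof -
 have "\<exists>c\<noteq>0. velocity {0..1} t c"
 proof -
  define c :: real where "c = (if t = 1 then -1 else 1 - t)"
  have "velocity {0..1} t c" unfolding velocity_def
  proof (intro exI[of _ "%s. t + s * c"] conjI)
   show "smooth_on {0..1} (%s. t + s * c)"
    by (intro smooth_onI[OF open_UNIV] allI Ck_on_add Ck_on_mult Ck_on_const Ck_on_linear, auto)
   show "((%s. t + s * c) has_vector_derivative c) (at 0 within {0..1})"
    by (auto intro!: derivative_eq_intros)
   show "(%s. t + s * c) ` {0..1} <= {0..1}"
   proof clarify
    fix s :: real assume s: "s \<in> {0..1}"
    have "t + s * (1 - t) <= t + 1 * (1 - t)" using s assms by (intro add_left_mono mult_right_mono) auto
    moreover have "0 <= s * (1 - t)" using s assms by auto
    ultimately show "t + s * c \<in> {0..1}" using s assms by (auto simp: c_def)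
   qed
  qed simp
  moreover have "c ~= 0" by (simp add: c_def)
  ultimately show ?thesis by blast
 qed
 then obtain c where c: "c ~= 0" "c \<in> tangent_space {0..1} t" using velocity_tangent by blast
 have "x \<in> tangent_space {0..1} t" for x
  using subspace_scale[OF subspace_tangent_space c(2), of "x / c"] c(1) by simp
 then show ?thesis by blast
qed

text \<open>
 A curve on the sphere has constant norm, which gives one inclusion; the other one is given by
 curves through \<open>x\<close> in the direction of \<open>v\<close>.
\<close>

lemma tangent_space_sphere:
 assumes "x \<in> usphere"
 shows "tangent_space usphere x = {v. v \<bullet> x = 0}"
proof
 have x1: "x \<bullet> x = 1" using assms by (simp add: dot_square_norm)
 show "tangent_space usphere x <= {v. v \<bullet> x = 0}"
 proof (rule tangent_space_subsetI)
  show "subspace {v. v \<bullet> x = 0}" by (simp add: subspace_hyperplane2)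
  fix v assume "velocity usphere x v"
  then obtain ga where ga0: "smooth_on {0..1} ga" and ga: "ga ` {0..1} <= usphere" "ga 0 = x"
   "(ga has_vector_derivative v) (at 0 within {0..1})"
   by (rule velocityE)
  have "((%t. ga t \<bullet> ga t) has_vector_derivative (ga 0 \<bullet> v + v \<bullet> ga 0)) (at 0 within {0..1})"
   by (rule bounded_bilinear.has_vector_derivative[OF bounded_bilinear_inner ga(3,3)])
  then have "((%t. 1::real) has_vector_derivative (ga 0 \<bullet> v + v \<bullet> ga 0)) (at 0 within {0..1})"
   by (rule has_vector_derivative_transform_within[OF _ zero_less_one])
     (use ga(1) in \<open>auto simp: image_subset_iff dot_square_norm\<close>)
  then show "v \<in> {v. v \<bullet> x = 0}"
   using vector_derivative_unique_01 has_vector_derivative_const ga(2) by (fastforce simp: inner_commute)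
 qed
 show "{v. v \<bullet> x = 0} <= tangent_space usphere x"
 proof clarify
  fix v assume v: "v \<bullet> x = 0"
  let ?ga = "%t::real. (x + t *R v) /R norm (x + t *R v)"
  have sq: "(norm (x + t *R v))\<^sup>2 = 1 + t\<^sup>2 * (v \<bullet> v)" for t
   using v x1 unfolding power2_norm_eq_inner
   by (simp add: inner_add_left inner_add_right inner_commute[of x v] power2_eq_square)
  have nz: "x + t *R v ~= 0" for t
  proof
   assume "x + t *R v = 0"
   then have "1 + t\<^sup>2 * (v \<bullet> v) = 0" using sq[of t] by simp
   moreover have "0 <= t\<^sup>2 * (v \<bullet> v)" by simp
   ultimately show False by linarith
  qed
  have "velocity usphere x v" unfolding velocity_def
  proof (intro exI[of _ ?ga] conjI)
   show "smooth_on {0..1} ?ga"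
    by (intro smooth_onI[OF open_UNIV] allI Ck_on_normalise Ck_on_add Ck_on_scaleR Ck_on_const Ck_on_linear bounded_linear_ident nz) auto
   show "?ga ` {0..1} <= usphere" using nz by auto
   show "?ga 0 = x" using assms by simp
   have n: "norm (x + t *R v) = sqrt (1 + t\<^sup>2 * (v \<bullet> v))" for t
    using sq[of t] by (metis norm_ge_zero real_sqrt_unique)
   have "((%t. inverse (sqrt (1 + t\<^sup>2 * (v \<bullet> v)))) has_real_derivative 0) (at 0 within {0..1})"
    by (auto intro!: derivative_eq_intros)
   then have 1: "((%t. inverse (norm (x + t *R v))) has_vector_derivative 0) (at 0 within {0..1})"
    by (simp add: n has_real_derivative_iff_has_vector_derivative)
   have 2: "((%t. x + t *R v) has_vector_derivative v) (at 0 within {0..1})"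
    by (auto intro!: derivative_eq_intros)
   show "(?ga has_vector_derivative v) (at 0 within {0..1})"
    using bounded_bilinear.has_vector_derivative[OF bounded_bilinear_scaleR 1 2] assms by simp
  qed
  then show "v \<in> tangent_space usphere x" by (rule velocity_tangent)
 qed
qed

lemma tangent_space_diagonal:
 assumes "y \<in> N"
 shows "tangent_space {(z, z) |z. z \<in> N} (y, y) = {(v, v) |v. v \<in> tangent_space N y}" (is "?T = ?R")
proof
 let ?Dl = "{(z, z) |z. z \<in> N}"
 have lin: "linear (%v::'a. (v, v))" by (auto intro!: linearI)
 have sub: "subspace {(v, v) |v. v \<in> tangent_space N y}"
 proof -
  have "{(v, v) |v. v \<in> tangent_space N y} = (%v. (v, v)) ` tangent_space N y" by auto
  then show ?thesis using linear_subspace_image[OF lin subspace_tangent_space] by simp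
 qed
 show "?T <= ?R"
 proof (rule tangent_space_subsetI[OF sub])
  fix v :: "'a \<times> 'a" assume "velocity ?Dl (y, y) v"
  then obtain ga where ga: "smooth_on {0..1} ga" "ga ` {0..1} <= ?Dl" "ga 0 = (y, y)"
   "(ga has_vector_derivative v) (at 0 within {0..1})" by (rule velocityE)
  have "velocity (N \<times> N) (y, y) (fst v, snd v)"
   unfolding velocity_def using ga by (intro exI[of _ ga]) auto
  from iffD1[OF velocity_Times this] have 1: "fst v \<in> tangent_space N y" using velocity_tangent by blast
  have d: "((%t. fst (ga t)) has_vector_derivative fst v) (at 0 within {0..1})"
   "((%t. snd (ga t)) has_vector_derivative snd v) (at 0 within {0..1})"
   using bounded_linear.has_vector_derivative[OF bounded_linear_fst ga(4)] bounded_linear.has_vector_derivative[OF bounded_linear_snd ga(4)] by auto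
  have "fst v = snd v"
   using ga(2) vector_derivative_unique_01[OF d(1)] by (fastforce intro: has_vector_derivative_transform_within[OF d(2) zero_less_one])
  then show "v \<in> ?R" using 1 by (cases v) auto
 qed
 show "?R <= ?T"
 proof clarify
  fix v assume v: "v \<in> tangent_space N y"
  have "tangent_space N y <= {v. (v, v) \<in> ?T}"
  proof (rule tangent_space_subsetI)
   show "subspace {v. (v, v) \<in> ?T}"
    using linear_subspace_vimage[OF lin subspace_tangent_space[of ?Dl "(y, y)"]] by (simp add: vimage_def)
   fix u assume "velocity N y u"
   then obtain ga where ga: "smooth_on {0..1} ga" "ga ` {0..1} <= N" "ga 0 = y"
    "(ga has_vector_derivative u) (at 0 within {0..1})" by (rule velocityE)
   have "velocity ?Dl (y, y) (u, u)" unfolding velocity_def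
    by (intro exI[of _ "%t. (ga t, ga t)"] conjI smooth_on_Pair[OF ga(1,1)] has_vector_derivative_Pair[OF ga(4,4)])
      (use ga in auto)
   then show "u \<in> {v. (v, v) \<in> ?T}" using velocity_tangent by blast
  qed
  then show "(v, v) \<in> ?T" using v by blast
 qed
qed

text \<open>
 The maps which witness a submanifold chart, as a relation, so that they can be fixed once and
 used in several lemmas.
\<close>

definition chart_data ::
 "'a::euclidean_space set => 'a => 'a set => 'a => 'a set => 'a set => ('a => 'a) => ('a => 'a) => bool" where
 "chart_data S x L w U V ph ps \<longleftrightarrow> open U \<and> open V \<and> x \<in> U \<and> homeomorphism U V ph ps \<and>
   Cinf_on U ph \<and> Cinf_on V ps \<and> subspace L \<and> w \<in> L \<and> ph x = 0 \<and>
   ph ` (S \<inter> U) = {z \<in> L. 0 <= w \<bullet> z} \<inter> V"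

lemma chart_dataI:
 "chart_data S x L w U V ph ps ==> submanifold_chart S x L w"
 unfolding chart_data_def submanifold_chart_def
 by (intro exI[of _ U] exI[of _ V] exI[of _ ph] exI[of _ ps]) (simp add: smooth_on_open_iff)

lemma chart_dataE:
 assumes "submanifold_chart S x L w"
 obtains U V ph ps where "chart_data S x L w U V ph ps"
using assms by (auto simp: submanifold_chart_def chart_data_def smooth_on_open_iff intro: that)

context
 fixes S :: "'a::euclidean_space set" and x L w U V ph ps
 assumes chart: "chart_data S x L w U V ph ps"
begin

lemma chart_simps:
 shows chart_open: "open U" "open V" and chart_x: "x \<in> U" and chart_hom: "homeomorphism U V ph ps"
  and chart_smooth: "Cinf_on U ph" "Cinf_on V ps" and chart_sub: "subspace L" "w \<in> L"
  and chart_0: "ph x = 0" and chart_image: "ph ` (S \<inter> U) = {z \<in> L. 0 <= w \<bullet> z} \<inter> V"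
 using chart unfolding chart_data_def by auto

lemma chart_maps:
 shows chart_phV: "z \<in> U ==> ph z \<in> V" and chart_psU: "u \<in> V ==> ps u \<in> U"
  and chart_psph: "z \<in> U ==> ps (ph z) = z" and chart_phps: "u \<in> V ==> ph (ps u) = u"
  and chart_0V: "0 \<in> V" and chart_ps0: "ps 0 = x"
proof -
 show "z \<in> U ==> ph z \<in> V" "u \<in> V ==> ps u \<in> U" "z \<in> U ==> ps (ph z) = z" "u \<in> V ==> ph (ps u) = u"
  using chart_hom unfolding homeomorphism_def by auto
 have "ph x \<in> V" "ps (ph x) = x" using chart_hom chart_x unfolding homeomorphism_def by auto
 then show "0 \<in> V" "ps 0 = x" by (simp_all add: chart_0)
qed

lemma chart_mem:
 assumes "u \<in> V" "u \<in> L" "0 <= w \<bullet> u"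
 shows "ps u \<in> S"
proof -
 obtain z where "z \<in> S" "z \<in> U" "u = ph z" using assms chart_image by blast
 then show ?thesis using chart_psph by simp
qed

lemma chart_coord:
 assumes "z \<in> S" "z \<in> U"
 shows "ph z \<in> L" "0 <= w \<bullet> ph z"
proof -
 have "ph z \<in> ph ` (S \<inter> U)" using assms by simp
 then show "ph z \<in> L" "0 <= w \<bullet> ph z" unfolding chart_image by auto
qed

lemma chart_derivative_inverse:
 shows chart_Dpsph: "Df ps 0 (Df ph x v) = v"
  and chart_Dphps: "Df ph x (Df ps 0 u) = u"
proof -
 have 1: "(ph has_derivative Df ph x) (at x)" by (rule Cinf_has_derivative[OF chart_smooth(1) chart_x])
 have 2: "(ps has_derivative Df ps 0) (at 0)" by (rule Cinf_has_derivative[OF chart_smooth(2) chart_0V])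
 have "(ps \<circ> ph has_derivative (Df ps 0 \<circ> Df ph x)) (at x)"
  by (rule diff_chain_at[OF 1]) (simp add: chart_0 2)
 moreover have "(ps \<circ> ph has_derivative (%v. v)) (at x)"
  by (rule has_derivative_transform_within_open[OF has_derivative_ident chart_open(1) chart_x]) (simp add: chart_psph)
 ultimately have "Df ps 0 \<circ> Df ph x = (%v. v)"
  by (rule has_derivative_unique)
 then show "Df ps 0 (Df ph x v) = v" by (simp add: fun_eq_iff)
 have "(ph \<circ> ps has_derivative (Df ph x \<circ> Df ps 0)) (at 0)"
  by (rule diff_chain_at[OF 2]) (simp add: chart_ps0 1)
 moreover have "(ph \<circ> ps has_derivative (%v. v)) (at 0)"
  by (rule has_derivative_transform_within_open[OF has_derivative_ident chart_open(2) chart_0V]) (simp add: chart_phps)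
 ultimately have "Df ph x \<circ> Df ps 0 = (%v. v)"
  by (rule has_derivative_unique)
 then show "Df ph x (Df ps 0 u) = u" by (simp add: fun_eq_iff)
qed

text \<open>
 The chart and its inverse carry velocities of curves to one another, and the half space spans \<open>L\<close>.
\<close>

lemma chart_tangent_space:
 shows "tangent_space S x = Df ps 0 ` L"
proof
 have 1: "(ph has_derivative Df ph x) (at x)" by (rule Cinf_has_derivative[OF chart_smooth(1) chart_x])
 have 2: "(ps has_derivative Df ps 0) (at 0)" by (rule Cinf_has_derivative[OF chart_smooth(2) chart_0V])
 have lin: "linear (Df ph x)" "linear (Df ps 0)"
  using 1 2 has_derivative_linear by auto
 show "tangent_space S x <= Df ps 0 ` L"
 proof (rule tangent_space_subsetI)
  show "subspace (Df ps 0 ` L)" by (rule linear_subspace_image[OF lin(2) chart_sub(1)])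
  fix v assume "velocity S x v"
  then obtain ga where ga: "smooth_on {0..1} ga" "ga ` {0..1} <= S" "ga 0 = x" "(ga has_vector_derivative v) (at 0 within {0..1})"
   by (rule velocityE)
  have "continuous_on {0..1} ga" using ga(1) by (rule smooth_on_continuous)
  then have "continuous (at 0 within {0..1}) ga" by (simp add: continuous_on_eq_continuous_within)
  then obtain d where d: "d > 0" "!!t. t \<in> {0..1} ==> t ~= 0 ==> dist t 0 < d ==> ga t \<in> U"
   by (smt (verit) chart_open(1) chart_x ga(3) topological_tendstoD continuous_within eventually_at)
  have "((%t. ph (ga t)) has_vector_derivative Df ph x v) (at 0 within {0..1})"
   by (rule has_vector_derivative_compose[OF ga(4), where S=UNIV]) (use 1 ga(3) in auto)
  note der = this
  obtain l z where lz: "Df ph x v = l + z" "l \<in> span L" "!!u. u \<in> span L ==> orthogonal z u"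
   using orthogonal_subspace_decomp_exists[of L "Df ph x v"] by metis
  have sL: "span L = L" using chart_sub(1) by auto
  have "((%t. z \<bullet> ph (ga t)) has_vector_derivative z \<bullet> Df ph x v) (at 0 within {0..1})"
   by (rule bounded_linear.has_vector_derivative[OF bounded_linear_inner_right der])
  then have "((%t. 0) has_vector_derivative z \<bullet> Df ph x v) (at 0 within {0..1})"
  proof (rule has_vector_derivative_transform_within[OF _ d(1)])
   fix t :: real assume t: "t \<in> {0..1}" "dist t 0 < d"
   show "z \<bullet> ph (ga t) = 0"
   proof (cases "t = 0")
    case False
    show ?thesis
     using ga(2) t(1) d(2)[OF t(1) False t(2)] lz(3) sL orthogonal_def chart_coord(1) by blast
   qed (simp add: ga(3) chart_0)
  qed simp
  then have "Df ph x v \<in> L"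
   using vector_derivative_unique_01[OF _ has_vector_derivative_const] lz(2,3) lz(1,2) sL by (fastforce simp: orthogonal_def inner_add_right)
  then show "v \<in> Df ps 0 ` L" using chart_Dpsph[of v] by (metis imageI)
 qed
 have half: "Df ps 0 y \<in> tangent_space S x" if y: "y \<in> L" "0 <= w \<bullet> y" for y
 proof -
  obtain r where r: "r > 0" "ball 0 r <= V" using chart_open(2) chart_0V openE by blast
  define e where "e = r / (2 * (norm y + 1))"
  have np: "norm y + 1 > 0" using norm_ge_zero[of y] by linarith
  then have e: "e > 0" "e * norm y < r" using r(1)
   by (auto simp: e_def field_simps) (smt (verit) mult_nonneg_nonneg norm_ge_zero)
  have lin': "bounded_linear (%t::real. (t * e) *R y)"
   by (intro bounded_linear_compose[OF bounded_linear_scaleR_left bounded_linear_mult_left])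
  define W where "W = (%t::real. (t * e) *R y) -` V"
  have oW: "open W" unfolding W_def
   by (rule open_vimage[OF chart_open(2)]) (intro continuous_intros)
  have tV: "(t * e) *R y \<in> V" if "t \<in> {0..1}" for t
  proof -
   have "\<bar>t * e\<bar> * norm y <= 1 * e * norm y"
    using that e by (intro mult_right_mono) auto
   then show ?thesis using e r(2) by auto
  qed
  have "velocity S x (e *R Df ps 0 y)" unfolding velocity_def
  proof (intro exI[of _ "%t. ps ((t * e) *R y)"] conjI)
   show "smooth_on {0..1} (%t. ps ((t * e) *R y))"
   using tV W_def Ck_on_compose[OF oW chart_open(2) Ck_on_linear[OF lin' oW] chart_smooth(2)[rule_format]] by (auto intro!: smooth_onI[OF oW])
   show "(%t. ps ((t * e) *R y)) ` {0..1} <= S"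
   proof (rule image_subsetI)
    fix t :: real assume t: "t \<in> {0..1}"
    show "ps ((t * e) *R y) \<in> S"
     by (rule chart_mem[OF tV[OF t]]) (use y t e(1) chart_sub(1) in \<open>auto simp: subspace_scale\<close>)
   qed
   have "((%t. (t * e) *R y) has_vector_derivative e *R y) (at 0 within {0..1})"
    by (auto intro!: derivative_eq_intros)
   from has_vector_derivative_compose[OF this, of ps "Df ps 0" UNIV] 2
   show "((%t. ps ((t * e) *R y)) has_vector_derivative e *R Df ps 0 y) (at 0 within {0..1})"
    by (simp add: linear_cmul[OF lin(2)])
  qed (simp add: chart_ps0)
  then have "e *R Df ps 0 y \<in> tangent_space S x" by (rule velocity_tangent)
  from subspace_scale[OF subspace_tangent_space this, of "1 / e"] e(1) show ?thesis by simp
 qed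
 show "Df ps 0 ` L <= tangent_space S x"
 proof (rule image_subsetI)
  fix y assume y: "y \<in> L"
  show "Df ps 0 y \<in> tangent_space S x"
  proof (cases "0 <= w \<bullet> y")
   case False
   then have "Df ps 0 (- y) \<in> tangent_space S x"
    using y chart_sub(1) by (intro half) (auto simp: subspace_neg)
   then show ?thesis
    using subspace_neg[OF subspace_tangent_space] by (fastforce simp: linear_neg[OF lin(2)])
  qed (use half y in blast)
 qed
qed

text \<open>
 A chart centred at one point gives charts centred at the nearby points.
\<close>

lemma chart_shift:
 assumes "u \<in> V" "u \<in> L" "w \<bullet> u = 0"
 shows "submanifold_chart S (ps u) L w"
proof -
 let ?V = "(%z. z + u) -` V"
 have "chart_data S (ps u) L w U ?V (%z. ph z - u) (%z. ps (z + u))"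
  unfolding chart_data_def
 proof (intro conjI allI)
  show oV: "open ?V" by (rule open_vimage[OF chart_open(2)]) (intro continuous_intros)
  show "ps u \<in> U" using chart_psU[OF assms(1)] .
  show "homeomorphism U ?V (%z. ph z - u) (%z. ps (z + u))"
  proof (rule homeomorphismI)
   show "continuous_on U (%z. ph z - u)"
    using homeomorphism_cont1[OF chart_hom] by (intro continuous_intros)
   show "continuous_on ?V (%z. ps (z + u))"
    by (rule continuous_on_compose2[OF homeomorphism_cont2[OF chart_hom]]) (auto intro!: continuous_intros)
  qed (auto simp: chart_psU chart_phV chart_psph chart_phps)
  show "Ck_on k U (%z. ph z - u)" for k
   by (intro Ck_on_diff Ck_on_const chart_open chart_smooth(1)[rule_format])
  show "Ck_on k ?V (%z. ps (z + u))" for k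
   by (rule Ck_on_compose[OF oV chart_open(2) _ chart_smooth(2)[rule_format]])
     (auto intro!: Ck_on_add[OF oV Ck_on_linear[OF bounded_linear_ident oV] Ck_on_const[OF oV]])
  have L1: "z - u \<in> L \<longleftrightarrow> z \<in> L" for z
   using assms(2) chart_sub(1) by (metis diff_add_cancel subspace_add subspace_diff)
  have "(%z. ph z - u) ` (S \<inter> U) = (%z. z - u) ` (ph ` (S \<inter> U))" by auto
  also have "\<dots> = {z \<in> L. 0 <= w \<bullet> z} \<inter> ?V"
   unfolding chart_image
  proof (intro equalityI subsetI)
   fix z assume "z \<in> (%z. z - u) ` ({z \<in> L. 0 <= w \<bullet> z} \<inter> V)"
   then show "z \<in> {z \<in> L. 0 <= w \<bullet> z} \<inter> ?V" using L1 assms(3) by (auto simp: inner_diff_right)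
  next
   fix z assume z: "z \<in> {z \<in> L. 0 <= w \<bullet> z} \<inter> ?V"
   then show "z \<in> (%z. z - u) ` ({z \<in> L. 0 <= w \<bullet> z} \<inter> V)"
    using L1[of "z + u"] assms(3) by (auto simp: inner_add_right intro!: image_eqI[of _ _ "z + u"])
  qed
  finally show "(%z. ph z - u) ` (S \<inter> U) = {z \<in> L. 0 <= w \<bullet> z} \<inter> ?V" .
 qed (use chart_open chart_sub chart_phps[OF assms(1)] in auto)
 then show ?thesis by (rule chart_dataI)
qed

end

text \<open>At a point with a chart onto a full linear subspace, curves leave in both of two opposite
 directions, so that no chart there is a half space.\<close>

lemma interior_chart_unique:
 assumes c: "submanifold_chart S x L 0" and c': "submanifold_chart S x L' w'"
 shows "w' = 0"
proof -
 obtain U V ph ps where C: "chart_data S x L 0 U V ph ps" using c by (rule chart_dataE)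
 obtain U' V' ph' ps' where C': "chart_data S x L' w' U' V' ph' ps'" using c' by (rule chart_dataE)
 let ?D = "Df ps 0" and ?D' = "Df ps' 0"
 obtain l where l: "l \<in> L" "?D' w' = ?D l"
  using chart_tangent_space[OF C] chart_tangent_space[OF C'] chart_sub(2)[OF C'] by auto
 have 2: "(ps has_derivative ?D) (at 0)" by (rule Cinf_has_derivative[OF chart_smooth(2)[OF C] chart_0V[OF C]])
 have 1: "(ph' has_derivative Df ph' x) (at x)"
  by (rule Cinf_has_derivative[OF chart_smooth(1)[OF C'] chart_x[OF C']])
 have lin: "linear ?D" using 2 has_derivative_linear by blast
 let ?p = "%t::real. ps (t *R l)"
 have dp: "(?p has_vector_derivative ?D l) (at 0)"
 proof -
  have "((%t::real. t *R l) has_vector_derivative l) (at 0)" by (auto intro!: derivative_eq_intros)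
  from has_vector_derivative_compose[OF this, of ps ?D UNIV] 2 show ?thesis by simp
 qed
 have "((%t. ph' (?p t)) has_vector_derivative Df ph' x (?D l)) (at 0)"
  by (rule has_vector_derivative_compose[OF dp, where S=UNIV]) (use 1 chart_ps0[OF C] in auto)
 then have "((%t. ph' (?p t)) has_vector_derivative w') (at 0)"
  using chart_Dphps[OF C', of w'] l(2) by simp
 from bounded_linear.has_vector_derivative[OF bounded_linear_inner_right this, of w']
 have d: "((%t. w' \<bullet> ph' (?p t)) has_real_derivative w' \<bullet> w') (at 0)"
  by (simp add: has_real_derivative_iff_has_vector_derivative)
 have "isCont ?p 0" using dp has_vector_derivative_continuous by blast
 moreover have "?p 0 = x" using chart_ps0[OF C] by simp
 ultimately have ev1: "eventually (%t. ?p t \<in> U') (at 0)"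
  using chart_open(1)[OF C'] chart_x[OF C'] unfolding isCont_def by (metis topological_tendstoD)
 have "((%t::real. t *R l) \<longlongrightarrow> 0 *R l) (at 0)" by (intro tendsto_intros)
 then have ev2: "eventually (%t::real. t *R l \<in> V) (at 0)"
  using topological_tendstoD[OF _ chart_open(2)[OF C]] chart_0V[OF C] by simp
 obtain e where e: "e > 0" "!!t. t ~= 0 ==> dist t 0 < e ==> ?p t \<in> U' \<and> t *R l \<in> V"
  using eventually_conj[OF ev1 ev2] unfolding eventually_at by auto
 have "w' \<bullet> w' = 0"
 proof (rule DERIV_local_min[OF d e(1)], intro allI impI)
  fix t :: real assume t: "\<bar>0 - t\<bar> < e"
  have "0 <= w' \<bullet> ph' (?p t)"
  proof (cases "t = 0")
   case False
   then have "?p t \<in> U'" "t *R l \<in> V" using e(2)[of t] t by auto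
   moreover from this(2) have "?p t \<in> S"
    by (rule chart_mem[OF C]) (use l(1) chart_sub(1)[OF C] in \<open>auto simp: subspace_scale\<close>)
   ultimately show ?thesis using chart_coord(2)[OF C'] by blast
  qed (simp add: chart_ps0[OF C] chart_0[OF C'])
  then show "w' \<bullet> ph' (?p 0) <= w' \<bullet> ph' (?p t)" by (simp add: chart_ps0[OF C] chart_0[OF C'])
 qed
 then show ?thesis by simp
qed

text \<open>The preimage of a regular value, cut off by a linear inequality with boundary hyperplane
 transverse to it. The right inverse \<open>J\<close> of the derivative takes its values in that hyperplane,
 so that the straightening map leaves the linear function unchanged.\<close>

lemma regular_preimage_chart:
 fixes Ps :: "'a::euclidean_space => 'b::euclidean_space"
 assumes "open U" "Cinf_on U Ps" "b \<in> U" "Ps b = 0"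
  and surj: "!!y. \<exists>v. e \<bullet> v = 0 \<and> Df Ps b v = y"
  and S: "S \<inter> U = {z \<in> U. Ps z = 0 \<and> 0 <= e \<bullet> (z - b)}"
 defines "L \<equiv> {v. Df Ps b v = 0}"
 obtains w where "submanifold_chart S b L w" "tangent_space S b = L" "w = 0 \<longleftrightarrow> e = 0"
proof -
 let ?D = "Df Ps b"
 have D: "(Ps has_derivative ?D) (at b)" by (rule Cinf_has_derivative[OF assms(2,3)])
 have lin: "linear ?D" using D has_derivative_linear by blast
 have subL: "subspace L" unfolding L_def using linear_subspace_kernel[OF lin] by simp
 obtain j where j: "!!y. e \<bullet> j y = 0 \<and> ?D (j y) = y" using surj by metis
 define J where "J = (%y. \<Sum>i\<in>Basis. (y \<bullet> i) *R j i)"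
 have linJ: "bounded_linear J" unfolding J_def
  by (intro bounded_linear_sum bounded_linear_compose[OF bounded_linear_scaleR_left bounded_linear_inner_left])
 have DJ: "?D (J y) = y" for y
 by (simp add: J_def linear_sum[OF lin] linear_cmul[OF lin] j euclidean_representation)
 have eJ: "e \<bullet> J y = 0" for y unfolding J_def by (simp add: inner_sum_right j)
 have bD: "bounded_linear ?D" using D has_derivative_bounded_linear by blast
 define ph where "ph = (%z. (z - b) - J (?D (z - b)) + J (Ps z))"
 have Cph: "Cinf_on U ph" unfolding ph_def
  by (intro allI Ck_on_add Ck_on_diff Ck_on_const assms(1) Ck_on_linear[OF bounded_linear_ident]
    Ck_on_comp_linear[OF linJ] Ck_on_comp_linear[OF bD] assms(2)[rule_format])
 have dph: "Df ph b v = v" for v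
 proof -
  have "(ph has_derivative (%v. v - J (?D v) + J (?D v))) (at b)" unfolding ph_def
   by (intro has_derivative_add has_derivative_diff bounded_linear.has_derivative[OF linJ] D
     bounded_linear.has_derivative[OF bD]) (auto intro!: derivative_eq_intros)
  from frechet_derivative_eq[OF this] show ?thesis by simp
 qed
 have "inj (Df ph b)" using dph by (simp add: inj_def)
 then obtain U' V ps where UV: "open U'" "U' <= U" "b \<in> U'" "open V" "homeomorphism U' V ph ps" "Cinf_on V ps"
  using smooth_inverse_function[OF assms(1) Cph assms(3)] by metis
 have b0: "ph b = 0" using linear_0[OF lin] assms(4) by (auto simp: ph_def)
 have Dph: "?D (ph z) = Ps z" for z
  unfolding ph_def by (simp add: linear_add[OF lin] linear_diff[OF lin] DJ)
 have eph: "e \<bullet> ph z = e \<bullet> (z - b)" for z unfolding ph_def by (simp add: inner_add_right inner_diff_right eJ)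
 obtain w0 z0 where wz: "e = w0 + z0" "w0 \<in> span L" "!!v. v \<in> span L ==> orthogonal z0 v"
  using orthogonal_subspace_decomp_exists[of L e] by metis
 have sL: "span L = L" using subL by auto
 have w0: "w0 \<bullet> v = e \<bullet> v" if "v \<in> L" for v
  using wz(3)[of v] that sL by (simp add: wz(1) inner_add_left orthogonal_def)
 have "chart_data S b L w0 U' V ph ps"
  unfolding chart_data_def
 proof (intro conjI)
  show "Cinf_on U' ph" using Cph UV(2) Ck_on_subset by blast
  have V: "z \<in> U' ==> ph z \<in> V" "u \<in> V ==> ps u \<in> U'" "u \<in> V ==> ph (ps u) = u" for z u
   using UV(5) unfolding homeomorphism_def by auto
  show "ph ` (S \<inter> U') = {z \<in> L. 0 <= w0 \<bullet> z} \<inter> V"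
  proof (intro equalityI subsetI)
   fix u assume "u \<in> ph ` (S \<inter> U')"
   then obtain z where z: "z \<in> S" "z \<in> U'" "u = ph z" by auto
   have "z \<in> S \<inter> U" using z UV(2) by auto
   then have "Ps z = 0" "0 <= e \<bullet> (z - b)" unfolding S by auto
   moreover have "u \<in> L" using Dph[of z] calculation z(3) by (simp add: L_def)
   ultimately show "u \<in> {z \<in> L. 0 <= w0 \<bullet> z} \<inter> V" using V(1)[OF z(2)] z(3) eph[of z] w0 by auto
  next
   fix u assume u: "u \<in> {z \<in> L. 0 <= w0 \<bullet> z} \<inter> V"
   let ?z = "ps u"
   have z: "?z \<in> U'" "ph ?z = u" using V(2,3) u by auto
   have "Ps ?z = 0" using Dph[of ?z] u z(2) by (simp add: L_def)
   moreover have "0 <= e \<bullet> (?z - b)" using eph[of ?z] z(2) u w0[of u] by simp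
   ultimately have "?z \<in> S \<inter> U" unfolding S using z(1) UV(2) by auto
   then show "u \<in> ph ` (S \<inter> U')" using z by (intro image_eqI[of _ _ ?z]) auto
  qed
 qed (use UV subL wz(2) sL b0 in auto)
 note ch = this
 have "tangent_space S b = L"
 proof -
  have "Df ps 0 v = v" for v using chart_Dpsph[OF ch, of v] dph by simp
  then show ?thesis using chart_tangent_space[OF ch] by simp
 qed
 moreover have "w0 = 0 \<longleftrightarrow> e = 0"
 proof
  assume "w0 = 0"
  obtain u where u: "e \<bullet> u = 0" "?D u = ?D e" using surj by metis
  then have "e - u \<in> L" by (simp add: L_def linear_diff[OF lin])
  then show "e = 0" using w0 \<open>w0 = 0\<close> u(1) by (fastforce simp: inner_diff_right)
 next
  assume "e = 0"
  then show "w0 = 0" using w0[of w0] wz(2) sL by simp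
 qed
 ultimately show thesis using that[OF chart_dataI[OF ch]] by blast
qed

section \<open>Coverings by a sphere\<close>

text \<open>
 The orbit map of a free action of a finite group enters only through the following properties.
 The number \<open>et\<close> bounds from below the distance of two points with the same image.
\<close>

lemma compact_pair_limit:
 fixes y y' :: "nat => 'a::metric_space"
 assumes "compact K" "!!n. y n \<in> K" "(%n. dist (y n) (y' n)) \<longlonglongrightarrow> 0"
 obtains l r where "l \<in> K" "strict_mono (r :: nat => nat)" "(%n. y (r n)) \<longlonglongrightarrow> l" "(%n. y' (r n)) \<longlonglongrightarrow> l"
proof -
 obtain l r where l: "l \<in> K" "strict_mono (r :: nat => nat)" "(y \<circ> r) \<longlonglongrightarrow> l"
  using assms(1,2) unfolding compact_def by metis
 have d1: "(%n. dist (y (r n)) (y' (r n))) \<longlonglongrightarrow> 0"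
  using LIMSEQ_subseq_LIMSEQ[OF assms(3) l(2)] by (simp add: o_def)
 have l3: "(%n. y (r n)) \<longlonglongrightarrow> l" using l(3) by (simp add: o_def)
 then have "(%n. dist (y (r n)) l) \<longlonglongrightarrow> 0" by (simp add: tendsto_dist_iff[symmetric])
 from tendsto_add[OF d1 this] have sum0: "(%n. dist (y (r n)) (y' (r n)) + dist (y (r n)) l) \<longlonglongrightarrow> 0" by simp
 show thesis
  by (smt (verit) that l(1,2) l3 dist_commute dist_triangle real_tendsto_sandwich[OF _ _ tendsto_const sum0] always_eventually allI tendsto_dist_iff[of _ l])
qed

lemma dist_inverse_Suc_tendsto:
 assumes "!!n. dist (y n) (y' n) < 1 / real (Suc n)"
 shows "(%n. dist (y n) (y' n)) \<longlonglongrightarrow> 0"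
 by (rule real_tendsto_sandwich[OF _ _ tendsto_const LIMSEQ_inverse_real_of_nat])
   (use assms in \<open>auto intro!: always_eventually less_imp_le simp: inverse_eq_divide\<close>)

text \<open>
 The number \<open>et\<close> bounds the distance of distinct points of a fibre from below.
\<close>

locale spherical_cover =
 fixes p :: "'f::euclidean_space => 'c::euclidean_space" and N :: "'c set" and et :: real
 assumes smooth_p: "smooth_on usphere p"
  and p_image: "p ` usphere = N"
  and covering: "covering_space usphere p N"
  and et_pos: "0 < et"
  and sheets: "y \<in> usphere ==> y' \<in> usphere ==> p y = p y' ==> y = y' \<or> et <= dist y y'"
  and bij_dp: "y \<in> usphere ==>
   bij_betw (differential usphere p y) (tangent_space usphere y) (tangent_space N (p y))"
begin

abbreviation S where "S \<equiv> usphere :: 'f set"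

text \<open>
 The differential of \<open>p\<close>, extended from the tangent space of the sphere at \<open>y\<close> to the ambient
 space by orthogonal projection. In this way its argument may be any vector.
\<close>

definition Dp :: "'f => 'f => 'c" where
 "Dp y v = differential S p y (v - (v \<bullet> y) *R y)"

lemma continuous_p: "continuous_on S p"
 using smooth_p by (rule smooth_on_continuous)

lemma p_in_N: "y \<in> S ==> p y \<in> N"
 using p_image by blast

lemma S_inner: "y \<in> S ==> y \<bullet> y = 1"
 by (simp add: dot_square_norm)

lemma tangent_proj: "y \<in> S ==> v - (v \<bullet> y) *R y \<in> tangent_space S y"
 using tangent_space_sphere[of y] S_inner[of y] by (auto simp: inner_diff_left)

lemma linear_differential_p: "y \<in> S ==> linear (differential S p y)"
 using smooth_on_differential[OF smooth_p] has_derivative_linear by blast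

lemma linear_Dp:
 assumes "y \<in> S"
 shows "linear (Dp y)"
proof -
 have "linear (%v. v - (v \<bullet> y) *R y)"
  by (auto intro!: linearI simp: algebra_simps)
 from linear_compose[OF this linear_differential_p[OF assms]] show ?thesis
  by (simp add: o_def Dp_def[abs_def])
qed

lemma Dp_tangent: "y \<in> S ==> v \<bullet> y = 0 ==> Dp y v = differential S p y v"
 by (simp add: Dp_def)

lemma Dp_in: "y \<in> S ==> Dp y v \<in> tangent_space N (p y)"
 unfolding Dp_def using tangent_proj bij_dp bij_betw_apply by metis

lemma Dp_self: "y \<in> S ==> Dp y y = 0"
 by (simp add: Dp_def S_inner linear_0[OF linear_differential_p])

lemma Dp_eq_0:
 assumes "y \<in> S" "v \<bullet> y = 0" "Dp y v = 0"
 shows "v = 0"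
using assms tangent_space_sphere[OF assms(1)] Dp_tangent linear_0[OF linear_differential_p[OF assms(1)]] bij_dp[OF assms(1)] by (simp add: bij_betw_def inj_on_def)

lemma Dp_surj:
 assumes "y \<in> S" "w \<in> tangent_space N (p y)"
 obtains v where "v \<bullet> y = 0" "Dp y v = w"
proof -
 obtain v where "v \<in> tangent_space S y" "w = differential S p y v"
  using bij_dp[OF assms(1)] assms(2) by (auto simp: bij_betw_def)
 then show thesis using that[of v] assms(1) tangent_space_sphere[OF assms(1)] Dp_tangent by auto
qed

lemma p_extension:
 assumes "y0 \<in> S"
 obtains U P where "open U" "y0 \<in> U" "Cinf_on U P" "!!y. y \<in> S ==> y \<in> U ==> P y = p y"
  "!!y v. y \<in> S ==> y \<in> U ==> v \<bullet> y = 0 ==> differential S p y v = Df P y v"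
proof -
 obtain U P where U: "open U" "y0 \<in> U" "Cinf_on U P" "!!y. y \<in> S ==> y \<in> U ==> P y = p y"
  "(p has_derivative Df P y0) (at y0 within S)"
  by (rule smooth_on_obtain[OF smooth_p assms]) (rule that)
 have "differential S p y v = Df P y v" if y: "y \<in> S" "y \<in> U" and v: "v \<bullet> y = 0" for y v
 proof -
  have "(P has_derivative Df P y) (at y within S)"
   using Cinf_has_derivative[OF U(3) y(2)] by (rule has_derivative_at_withinI)
  moreover obtain e where "e > 0" "ball y e <= U" using U(1) y(2) openE by blast
  ultimately have "(p has_derivative Df P y) (at y within S)"
   using U(4) y by (elim has_derivative_transform_within) (auto simp: dist_commute subset_iff)
  then show ?thesis using differential_eq tangent_space_sphere[OF y(1)] v by blast
 qed
 then show thesis using that[OF U(1-4)] by blast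
qed

lemma continuous_Dp: "continuous_on (S \<times> UNIV) (%z. Dp (fst z) (snd z))"
 unfolding continuous_on_eq_continuous_within
proof
 fix z :: "'f \<times> 'f" assume z: "z \<in> S \<times> UNIV"
 then obtain U P where U: "open U" "fst z \<in> U" "Cinf_on U P" "!!y. y \<in> S ==> y \<in> U ==> P y = p y"
  "!!y v. y \<in> S ==> y \<in> U ==> v \<bullet> y = 0 ==> differential S p y v = Df P y v"
  by (auto intro: p_extension)
 have diff: "P differentiable (at y)" if "y \<in> U" for y
  using Cinf_has_derivative[OF U(3) that] differentiableI by blast
 let ?g = "%z. blinfun_apply (frechet_blinfun P (fst z)) (snd z - (snd z \<bullet> fst z) *R fst z)"
 have cP: "continuous_on U (frechet_blinfun P)"
  using Ck_on_continuous[OF Ck_on_frechet_blinfun[OF U(1)]] U(3) by blast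
 have "continuous_on (U \<times> UNIV) ?g"
  by (intro continuous_intros continuous_on_compose2[OF cP]) auto
 moreover have "z \<in> U \<times> UNIV" "open (U \<times> (UNIV :: 'f set))" using U(1,2) by (auto simp: mem_Times_iff open_Times)
 ultimately have 1: "continuous (at z within S \<times> UNIV) ?g"
  using continuous_on_eq_continuous_at by (auto intro: continuous_at_imp_continuous_within)
 obtain e where e: "e > 0" "ball z e <= U \<times> UNIV"
  using \<open>open (U \<times> UNIV)\<close> \<open>z \<in> U \<times> UNIV\<close> openE by blast
 show "continuous (at z within S \<times> UNIV) (%z. Dp (fst z) (snd z))"
 proof (rule continuous_transform_within[OF 1 e(1) z])
  fix x :: "'f \<times> 'f" assume x: "x \<in> S \<times> UNIV" "dist x z < e"
  then have x': "fst x \<in> S" "fst x \<in> U" using e(2) x(1) by (auto simp: dist_commute)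
  show "?g x = Dp (fst x) (snd x)"
   using S_inner[OF x'(1)] U(5)[OF x'] by (simp add: inner_diff_left Dp_def frechet_blinfun_apply[OF diff[OF x'(2)]])
 qed
qed

lemma continuous_on_Dp_compose:
 assumes "continuous_on X g" "continuous_on X h" "!!x. x \<in> X ==> g x \<in> S"
 shows "continuous_on X (%x. Dp (g x) (h x))"
proof -
 have "(%x. (g x, h x)) ` X <= S \<times> UNIV" using assms(3) by auto
 from continuous_on_compose2[OF continuous_Dp continuous_on_Pair[OF assms(1,2)] this]
 show ?thesis by simp
qed

end

lemma homotopic_withI:
 assumes "continuous_on ({0..1::real} \<times> X) h" "h ` ({0..1} \<times> X) <= Y"
  "!!x. x \<in> X ==> h (0, x) = f x" "!!x. x \<in> X ==> h (1, x) = g x"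
  "!!t. t \<in> {0..1} ==> P (%x. h (t, x))"
  "!!u v. (!!x. x \<in> X ==> u x = v x) ==> P u \<longleftrightarrow> P v"
 shows "homotopic_with_canon P X Y f g"
proof (rule iffD2[OF homotopic_with])
 show "P u \<longleftrightarrow> P v" if "!!x. x \<in> topspace (top_of_set X) ==> u x = v x" for u v
  by (rule assms(6)) (use that in simp)
 show "\<exists>h. continuous_map (prod_topology (top_of_set {0..1::real}) (top_of_set X)) (top_of_set Y) h \<and>
    (\<forall>x \<in> topspace (top_of_set X). h (0, x) = f x) \<and> (\<forall>x \<in> topspace (top_of_set X). h (1, x) = g x) \<and>
    (\<forall>t \<in> {0..1}. P (%x. h (t, x)))"
 proof (intro exI[of _ h] conjI ballI)
  show "continuous_map (prod_topology (top_of_set {0..1::real}) (top_of_set X)) (top_of_set Y) h"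
   using assms(1,2) by auto
 qed (use assms(3-5) in auto)
qed

lemma homotopic_withE:
 assumes "homotopic_with_canon P X Y f g"
 obtains h where "continuous_on ({0..1::real} \<times> X) h" "h ` ({0..1} \<times> X) <= Y"
  "!!x. h (0, x) = f x" "!!x. h (1, x) = g x" "!!t. t \<in> {0..1} ==> P (%x. h (t, x))"
using assms by (auto simp: homotopic_with_def intro!: that)

context spherical_cover
begin

lemma fibre_near:
 assumes "0 < de"
 shows "\<exists>ep>0. \<forall>y\<in>S. \<forall>y'\<in>S. dist (p y) (p y') < ep --> (\<exists>z\<in>S. p z = p y \<and> dist z y' < de)"
proof (rule ccontr)
 assume "\<not> ?thesis"
 then have "\<forall>n. \<exists>y y'. y \<in> S \<and> y' \<in> S \<and> dist (p y) (p y') < 1 / real (Suc n) \<and>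
   \<not> (\<exists>z\<in>S. p z = p y \<and> dist z y' < de)"
  by (metis of_nat_0_less_iff zero_less_Suc zero_less_divide_1_iff)
 then obtain y y' where y: "!!n. y n \<in> S" "!!n. y' n \<in> S" "!!n. dist (p (y n)) (p (y' n)) < 1 / real (Suc n)"
  "!!n. \<not> (\<exists>z\<in>S. p z = p (y n) \<and> dist z (y' n) < de)" by metis
 obtain l r where l: "l \<in> S" "strict_mono (r :: nat => nat)" "(%n. y' (r n)) \<longlonglongrightarrow> l"
  using compact_pair_limit[where y=y' and y'=y', OF compact_sphere y(2)] by auto
 let ?W = "p ` (S \<inter> ball l (de / 2))"
 obtain T where T: "open T" "?W = N \<inter> T"
  using covering_space_open_map[OF covering] by (auto simp:_Int openin_open)
 have lim: "(%n. p (y' (r n))) \<longlonglongrightarrow> p l"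
  by (rule continuous_on_tendsto_compose[OF continuous_p l(3,1)]) (use y(2) in \<open>auto intro!: always_eventually\<close>)
 have "(%n. dist (p (y' n)) (p (y n))) \<longlonglongrightarrow> 0"
  by (rule dist_inverse_Suc_tendsto) (use y(3) in \<open>simp add: dist_commute\<close>)
 from LIMSEQ_subseq_LIMSEQ[OF this l(2)]
 have d0: "(%n. dist (p (y' (r n))) (p (y (r n)))) \<longlonglongrightarrow> 0" by (simp add: o_def)
 have lim2: "(%n. p (y (r n))) \<longlonglongrightarrow> p l"
 proof -
  have "(%n. dist (p (y' (r n))) (p l)) \<longlonglongrightarrow> 0" using lim by (simp add: tendsto_dist_iff[symmetric])
  from tendsto_add[OF d0 this]
  have s: "(%n. dist (p (y' (r n))) (p (y (r n))) + dist (p (y' (r n))) (p l)) \<longlonglongrightarrow> 0" by simp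
  show ?thesis
   by (smt (verit) dist_commute dist_triangle real_tendsto_sandwich[OF _ _ tendsto_const s] always_eventually tendsto_dist_iff[of _ "p l"])
 qed
 have "eventually (%n. p (y (r n)) \<in> T \<and> dist (y' (r n)) l < de / 2) sequentially"
  using l(1) assms T(2) topological_tendstoD[OF lim2 T(1)] tendstoD[OF l(3), of "de / 2"] by (fastforce intro: eventually_conj)
 then obtain n where n: "p (y (r n)) \<in> T" "dist (y' (r n)) l < de / 2" using eventually_sequentially by auto
 have "p (y (r n)) \<in> ?W" using p_in_N y(1) n(1) T(2) by simp
 then obtain z where z: "z \<in> S" "dist l z < de / 2" "p z = p (y (r n))" by auto
 show False
  using dist_triangle_half_l[of z l de "y' (r n)"] n(2) y(4)[of "r n"] z by (simp add: dist_commute)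
qed

text \<open>
 A homotopy which moves points of \<open>N\<close> very little lifts to a homotopy which moves the lift by less
 than a given amount: continuity of the lift prevents it from jumping to another point of the fibre.
\<close>

lemma small_homotopy_lift:
 assumes "0 < de" "de <= et / 2"
 shows "\<exists>ep>0. \<forall>(X :: 'm::euclidean_space set) u f1. continuous_on X u --> u ` X <= S -->
  small_homotopic ep X N (%x. p (u x)) f1 -->
  (\<exists>u1. continuous_on X u1 \<and> u1 ` X <= S \<and> (\<forall>x\<in>X. p (u1 x) = f1 x \<and> dist (u x) (u1 x) < de) \<and>
   homotopic_with_canon (%_. True) X S u u1)"
proof -
 obtain ep where ep: "ep > 0" "!!y y'. y \<in> S ==> y' \<in> S ==> dist (p y) (p y') < ep ==> \<exists>z\<in>S. p z = p y \<and> dist z y' < de"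
  using fibre_near[OF assms(1)] by auto
 have "\<exists>u1. continuous_on X u1 \<and> u1 ` X <= S \<and> (\<forall>x\<in>X. p (u1 x) = f1 x \<and> dist (u x) (u1 x) < de) \<and>
   homotopic_with_canon (%_. True) X S u u1"
  if X: "continuous_on X u" "u ` X <= S" "small_homotopic ep X N (%x. p (u x)) f1" for X :: "'m set" and u f1
 proof -
  obtain h where h: "continuous_on ({0..1::real} \<times> X) h" "h ` ({0..1} \<times> X) <= N"
   "!!x. h (0, x) = p (u x)" "!!x. h (1, x) = f1 x" "!!t. t \<in> {0..1} ==> \<forall>x\<in>X. dist (p (u x)) (h (t, x)) < ep"
   using X(3) unfolding small_homotopic_def by (rule homotopic_withE) (rule that)
  obtain k where k: "continuous_on ({0..1} \<times> X) k" "k \<in> ({0..1} \<times> X) \<rightarrow> S"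
   "!!y. y \<in> X ==> k (0, y) = u y" "!!z. z \<in> {0..1} \<times> X ==> h z = p (k z)"
   by (rule covering_space_lift_homotopy[OF covering h(1) _ _ X(1)])
     (use h(2,3) X(2) in auto)
  have kS: "k (t, x) \<in> S" if "t \<in> {0..1}" "x \<in> X" for t x using k(2) that by auto
  have near: "dist (u x) (k (1, x)) < de" if x: "x \<in> X" for x
  proof (rule ccontr)
   assume far: "\<not> dist (u x) (k (1, x)) < de"
   have "continuous_on {0..1} (%t. dist (u x) (k (t, x)))"
    by (intro continuous_intros continuous_on_compose2[OF k(1)]) (use x in auto)
   moreover have "dist (u x) (k (0, x)) <= de" using k(3)[OF x] assms(1) by simp
   ultimately obtain t where t: "0 <= t" "t <= 1" "dist (u x) (k (t, x)) = de"
    using IVT'[of "%t. dist (u x) (k (t, x))" 0 de 1] far by auto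
   have tx: "t \<in> {0..1}" using t by simp
   have ux: "u x \<in> S" using x X(2) by auto
   obtain z where z: "z \<in> S" "p z = p (u x)" "dist z (k (t, x)) < de"
    using k(4)[of "(t, x)"] tx x h(5)[OF tx] ep(2)[OF ux kS[OF tx x]] by fastforce
   from sheets[OF z(1) ux z(2)] show False
   proof
    assume "z = u x"
    then show False using z(3) t(3) by simp
   next
    assume "et <= dist z (u x)"
    moreover have "dist z (u x) <= dist z (k (t, x)) + dist (u x) (k (t, x))" by (rule dist_triangle2)
    ultimately show False using z(3) t(3) assms(2) by auto
   qed
  qed
  have "homotopic_with_canon (%_. True) X S u (%x. k (1, x))"
   by (rule homotopic_withI[OF k(1)]) (use k kS in \<open>auto simp: image_subset_iff\<close>)
  moreover have "continuous_on X (%x. k (1, x))"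
   by (intro continuous_on_compose2[OF k(1)] continuous_intros) auto
  moreover have "\<forall>x\<in>X. p (k (1, x)) = f1 x" using k(4) h(4) by (metis SigmaI atLeastAtMost_iff order_refl zero_le_one)
  ultimately show ?thesis using near kS by auto
 qed
 then show ?thesis using ep(1) by blast
qed

text \<open>A local inverse of \<open>p\<close> is the composite of a linear map and of the inverse of a local
 diffeomorphism of the ambient space of the sphere.\<close>

lemma smooth_local_inverse:
 assumes y0: "y0 \<in> S"
 obtains W Y q where "open W" "y0 \<in> W" "open Y" "Cinf_on Y q"
  "!!y. y \<in> S ==> y \<in> W ==> p y \<in> Y \<and> q (p y) = y"
proof -
 obtain U P where U: "open U" "y0 \<in> U" "Cinf_on U P" "!!y. y \<in> S ==> y \<in> U ==> P y = p y"
  "!!y v. y \<in> S ==> y \<in> U ==> v \<bullet> y = 0 ==> differential S p y v = Df P y v"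
  by (rule p_extension[OF y0]) (rule that)
 let ?T = "{v. v \<bullet> y0 = 0}"
 have subT: "subspace ?T" by (rule subspace_hyperplane2)
 obtain La where La: "range La <= ?T" "linear La" "!!v. v \<in> ?T ==> La (differential S p y0 v) = v"
  using bij_dp[OF y0] linear_exists_left_inverse_on[OF linear_differential_p[OF y0] subT] by (auto simp: bij_betw_def tangent_space_sphere[OF y0])
 have bLa: "bounded_linear La" using La(2) linear_conv_bounded_linear by blast
 define k where "k = (%y. La (P y) + ((y \<bullet> y - 1) * (1/2)) *R y0)"
 have Ck: "Cinf_on U k" unfolding k_def
  by (intro allI Ck_on_add Ck_on_comp_linear[OF bLa] Ck_on_scaleR Ck_on_mult Ck_on_diff Ck_on_inner Ck_on_const
    Ck_on_linear[OF bounded_linear_ident] U(1) U(3)[rule_format])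
 have dk: "Df k y0 v = La (Df P y0 v) + (v \<bullet> y0) *R y0" for v
 proof -
  have dP: "(P has_derivative Df P y0) (at y0)" by (rule Cinf_has_derivative[OF U(3,2)])
  have "((%y. ((y \<bullet> y - 1) * (1/2)) *R y0) has_derivative (%v. (v \<bullet> y0) *R y0)) (at y0)"
   by (auto intro!: derivative_eq_intros simp: inner_commute)
  from has_derivative_add[OF bounded_linear.has_derivative[OF bLa dP] this]
  have "(k has_derivative (%v. La (Df P y0 v) + (v \<bullet> y0) *R y0)) (at y0)"
   unfolding k_def .
  from frechet_derivative_eq[OF this] show ?thesis .
 qed
 have lin: "linear (Df k y0)"
  using Cinf_has_derivative[OF Ck U(2)] has_derivative_linear by blast
 have "inj (Df k y0)"
  unfolding linear_injective_0[OF lin]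
 proof (intro allI impI)
  fix v assume v: "Df k y0 v = 0"
  have "La (Df P y0 v) \<bullet> y0 = 0" using La(1) by auto
  then show "v = 0"
   using arg_cong[OF v[unfolded dk], of "%z. z \<bullet> y0"] S_inner[OF y0] v dk[of v] U(5)[OF y0 U(2), of v] La(3)[of v] by (simp add: inner_add_left)
 qed
 then obtain U' V g where g: "open U'" "U' <= U" "y0 \<in> U'" "open V" "homeomorphism U' V k g" "Cinf_on V g"
  using smooth_inverse_function[OF U(1) Ck U(2)] by metis
 have kp: "k y = La (p y)" if "y \<in> S" "y \<in> U" for y
  using U(4)[OF that] S_inner[OF that(1)] by (simp add: k_def)
 let ?Y = "La -` V"
 have oY: "open ?Y" by (rule open_vimage[OF g(4)]) (use bLa linear_continuous_on in blast)
 have "Cinf_on ?Y (%z. g (La z))"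
 by (auto intro!: Ck_on_compose[OF oY g(4) Ck_on_linear[OF bLa oY] g(6)[rule_format]])
 moreover have "p y \<in> ?Y \<and> g (La (p y)) = y" if y: "y \<in> S" "y \<in> U'" for y
 proof -
  have "y \<in> U" using y(2) g(2) by blast
  moreover have "k y \<in> V" "g (k y) = y" using g(5) y(2) unfolding homeomorphism_def by auto
  ultimately show ?thesis using kp[OF y(1)] by simp
 qed
 ultimately show thesis using that[OF g(1,3) oY] by blast
qed

lemma smooth_lift:
 fixes X :: "'m::euclidean_space set"
 assumes "continuous_on X u" "u ` X <= S" "smooth_on X f" "!!x. x \<in> X ==> p (u x) = f x"
 shows "smooth_on X u"
 unfolding smooth_on_def
proof
 fix x assume x: "x \<in> X"
 then obtain W Y q where q: "open W" "u x \<in> W" "open Y" "Cinf_on Y q"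
  "!!y. y \<in> S ==> y \<in> W ==> p y \<in> Y \<and> q (p y) = y"
  using assms(2) smooth_local_inverse by blast
 obtain U F where U: "open U" "x \<in> U" "Cinf_on U F" "!!y. y \<in> X ==> y \<in> U ==> F y = f y"
  "(f has_derivative Df F x) (at x within X)"
  by (rule smooth_on_obtain[OF assms(3) x]) (rule that)
 obtain Z where Z: "open Z" "X \<inter> u -` W = X \<inter> Z"
  using continuous_openin_preimage_gen[OF assms(1) q(1)] unfolding openin_open by auto
 define O' where "O' = (U \<inter> F -` Y) \<inter> Z"
 have oO: "open O'"
  using continuous_open_preimage[OF _ U(1) q(3)] U(3) Ck_on_continuous Z(1) O'_def by blast
 have Fu: "F z \<in> Y \<and> q (F z) = u z" if z: "z \<in> X" "z \<in> U" "z \<in> Z" for z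
 using z assms(2) Z(2) q(5)[of "u z"] assms(4)[OF z(1)] U(4)[OF z(1,2)] by fastforce
 have xZ: "x \<in> Z" using x q(2) Z(2) by blast
 have "Ck_on k O' (%z. q (F z))" for k
  by (rule Ck_on_compose[OF oO q(3) Ck_on_subset[OF U(3)[rule_format]] q(4)[rule_format]]) (auto simp: O'_def)
 moreover have "\<forall>z\<in>X \<inter> O'. q (F z) = u z" using Fu by (auto simp: O'_def)
 ultimately show "\<exists>U F. open U \<and> x \<in> U \<and> Cinf_on U F \<and> (\<forall>y\<in>X \<inter> U. F y = u y)"
  using Fu[OF x U(2) xZ] U(2) xZ oO by (auto simp: O'_def intro!: exI[of _ O'] exI[of _ "%z. q (F z)"])
qed

end

section \<open>Null bordisms from homotopies\<close>

lemma tangent_space_mono: "S <= T ==> tangent_space S x <= tangent_space T x"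
 unfolding tangent_space_velocity velocity_def by (rule span_mono) blast

lemma continuous_map_paths:
 fixes Ga :: "'a::topological_space \<times> real => 'c::topological_space"
 assumes "continuous_on (X \<times> {0..1}) Ga" "Ga ` (X \<times> {0..1}) <= N"
 shows "continuous_map (top_of_set X) (compact_open_topology N) (%x. \<lambda>s\<in>{0..1}. Ga (x, s))"
 unfolding compact_open_topology_def
proof (rule continuous_on_generated_topo)
 let ?F = "%x. \<lambda>s\<in>{0..1}. Ga (x, s)"
 let ?B = "{{th \<in> path_space N. th ` K <= U} |K U. compact K \<and> K <= {0..1} \<and> openin (top_of_set N) U}"
 have path: "?F x \<in> path_space N" if "x \<in> X" for x
 proof -
  have "continuous_on {0..1} (%s. Ga (x, s))"
   by (rule continuous_on_compose2[OF assms(1)]) (use that in \<open>auto intro!: continuous_intros\<close>)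
  then show ?thesis using assms(2) that by (auto simp: path_space_def intro: continuous_on_eq)
 qed
 fix V assume "V \<in> ?B"
 then obtain K U where KU: "V = {th \<in> path_space N. th ` K <= U}" "compact K" "K <= {0..1}" "openin (top_of_set N) U"
  by auto
 have "\<exists>T. open T \<and> x0 \<in> T \<and> X \<inter> T <= ?F -` V" if x0: "x0 \<in> X" "?F x0 \<in> V" for x0
 proof -
  obtain U' where U': "open U'" "U = N \<inter> U'" using KU(4) unfolding openin_open by auto
  obtain W where W: "open W" "(X \<times> {0..1}) \<inter> Ga -` U' = (X \<times> {0..1}) \<inter> W"
   using continuous_openin_preimage_gen[OF assms(1) U'(1)] unfolding openin_open by auto
  have "{x0} \<times> K <= W"
  proof
   fix z assume "z \<in> {x0} \<times> K"
   then obtain s where s: "z = (x0, s)" "s \<in> K" by auto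
   have "?F x0 s \<in> U" using x0(2) s(2) KU(1) by blast
   then have "z \<in> (X \<times> {0..1}) \<inter> Ga -` U'" using s KU(3) x0(1) U'(2) by auto
   then show "z \<in> W" unfolding W(2) by blast
  qed
  then obtain T where T: "x0 \<in> T" "open T" "T \<times> K <= W"
   using Elementary_Topology.tube_lemma[OF KU(2) W(1)] by metis
  have "?F x \<in> V" if x: "x \<in> X" "x \<in> T" for x
  using KU(3) x T(3) W(2)[symmetric] assms(2) U'(2) path[OF x(1)] by (auto simp: KU(1))
  then show ?thesis using T(1,2) by auto
 qed
 have nb: "\<exists>T. openin (top_of_set X) T \<and> x \<in> T \<and> T <= ?F -` V \<inter> X" if x: "x \<in> ?F -` V \<inter> X" for x
 proof -
  obtain T where "open T" "x \<in> T" "X \<inter> T <= ?F -` V"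
   using \<open>\<And>x0. x0 \<in> X \<Longrightarrow> ?F x0 \<in> V \<Longrightarrow> \<exists>T. open T \<and> x0 \<in> T \<and> X \<inter> T \<subseteq> ?F -` V\<close> x by auto
  then show ?thesis using x by auto
 qed
 have "openin (top_of_set X) (?F -` V \<inter> X)"
  by (subst openin_subopen) (use nb in blast)
 then show "openin (top_of_set X) (?F -` V \<inter> topspace (top_of_set X))" by simp
next
 let ?F = "%x. \<lambda>s\<in>{0..1}. Ga (x, s)"
 let ?B = "{{th \<in> path_space N. th ` K <= U} |K U. compact K \<and> K <= {0..1} \<and> openin (top_of_set N) U}"
 have "?F x \<in> path_space N" if "x \<in> X" for x
 proof -
  have "continuous_on {0..1} (%s. Ga (x, s))"
   by (rule continuous_on_compose2[OF assms(1)]) (use that in \<open>auto intro!: continuous_intros\<close>)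
  then show ?thesis using assms(2) that by (auto simp: path_space_def intro: continuous_on_eq)
 qed
 moreover have "path_space N \<in> ?B"
  by (intro CollectI exI[of _ "{}"], auto)
 ultimately show "?F ` topspace (top_of_set X) <= \<Union> ?B" by auto
qed

lemma smooth_radial:
 fixes u :: "'m::euclidean_space => 'b::euclidean_space"
 assumes "smooth_on usphere u"
 shows "Cinf_on (- {0}) (%X. u (X /R norm X))"
proof -
 have "smooth_on (- {0}) (%X::'m. X /R norm X)"
  by (rule smooth_onI[of "-{0}"]) (auto intro!: Ck_on_normalise Ck_on_linear[OF bounded_linear_ident])
 moreover have "(%X::'m. X /R norm X) ` (- {0}) <= usphere"
  by auto (metis left_inverse norm_eq_zero)
 ultimately show ?thesis using smooth_on_open_iff[symmetric] smooth_on_compose[OF _ assms] by blast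
qed

text \<open>
 Two maps into the sphere so close to each other that their projections coincide only where
 they do.
\<close>

locale sphere_maps = spherical_cover p N et
 for p :: "'f::euclidean_space => 'c::euclidean_space" and N et +
 fixes u1 :: "'m::euclidean_space => 'f" and u2 :: "'m => 'f"
 assumes smooth_u: "smooth_on usphere u1" "smooth_on usphere u2"
  and u_sphere: "u1 ` usphere <= S" "u2 ` usphere <= S"
  and u_close: "!!x. x \<in> usphere ==> dist (u1 x) (u2 x) < et"
begin

abbreviation M where "M \<equiv> usphere :: 'm set"

definition r1 :: "'m => 'f" where "r1 X = u1 (X /R norm X)"
definition r2 :: "'m => 'f" where "r2 X = u2 (X /R norm X)"

abbreviation "dr1 x \<equiv> Df r1 x"
abbreviation "dr2 x \<equiv> Df r2 x"

lemma Cinf_r: "Cinf_on (- {0}) r1" "Cinf_on (- {0}) r2"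
 using smooth_radial[OF smooth_u(1)] smooth_radial[OF smooth_u(2)] unfolding r1_def[abs_def] r2_def[abs_def] by auto

lemma M_nz: "x \<in> M ==> x \<in> - {0}" by auto

lemma M_inner: "x \<in> M ==> x \<bullet> x = 1" by (simp add: dot_square_norm)

lemma r_M: "x \<in> M ==> r1 x = u1 x" "x \<in> M ==> r2 x = u2 x"
 by (simp_all add: r1_def r2_def)

lemma u_S: "x \<in> M ==> u1 x \<in> S" "x \<in> M ==> u2 x \<in> S"
 using u_sphere by blast+

lemma r_S: "X ~= 0 ==> r1 X \<in> S" "X ~= 0 ==> r2 X \<in> S"
 unfolding r1_def r2_def by (rule u_S; simp)+

lemma dr_has_derivative:
 assumes "x \<in> M"
 shows "(r1 has_derivative dr1 x) (at x)" "(r2 has_derivative dr2 x) (at x)"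
 using Cinf_has_derivative[OF Cinf_r(1) M_nz[OF assms]] Cinf_has_derivative[OF Cinf_r(2) M_nz[OF assms]] by auto

lemma linear_dr:
 assumes "x \<in> M"
 shows "linear (dr1 x)" "linear (dr2 x)"
 using dr_has_derivative[OF assms] has_derivative_linear by auto

lemma differential_u:
 assumes "x \<in> M" "v \<bullet> x = 0"
 shows "differential M u1 x v = dr1 x v" "differential M u2 x v = dr2 x v"
proof -
 have v: "v \<in> tangent_space M x" using tangent_space_sphere[OF assms(1)] assms(2) by simp
 have "(u1 has_derivative dr1 x) (at x within M)"
  by (rule has_derivative_transform_within[OF has_derivative_at_withinI[OF dr_has_derivative(1)[OF assms(1)]] zero_less_one assms(1)])
    (simp add: r_M)
 from differential_eq[OF this v] show "differential M u1 x v = dr1 x v" .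
 have "(u2 has_derivative dr2 x) (at x within M)"
  by (rule has_derivative_transform_within[OF has_derivative_at_withinI[OF dr_has_derivative(2)[OF assms(1)]] zero_less_one assms(1)])
    (simp add: r_M)
 from differential_eq[OF this v] show "differential M u2 x v = dr2 x v" .
qed

lemma dr_radial:
 assumes x: "x \<in> M"
 shows "dr1 x x = 0" "dr2 x x = 0"
proof -
 have c: "((%t. x + t *R x) has_vector_derivative x) (at (0::real))"
  by (auto intro!: derivative_eq_intros)
 have e: "(x + t *R x) /R norm (x + t *R x) = x" if "dist t 0 < 1" for t :: real
 proof -
  have "0 < 1 + t" using that by auto
  moreover have "x + t *R x = (1 + t) *R x" by (simp add: scaleR_add_left)
  ultimately show ?thesis using x by simp
 qed
 have "((%t. r1 (x + t *R x)) has_vector_derivative dr1 x x) (at 0)"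
  by (rule has_vector_derivative_compose[OF c, where S=UNIV]) (use dr_has_derivative[OF x] in auto)
 then have "((%t. u1 x) has_vector_derivative dr1 x x) (at 0)"
  by (rule has_vector_derivative_transform_within[OF _ zero_less_one]) (auto simp: r1_def e)
 then show "dr1 x x = 0" using vector_derivative_unique_at has_vector_derivative_const by blast
 have "((%t. r2 (x + t *R x)) has_vector_derivative dr2 x x) (at 0)"
  by (rule has_vector_derivative_compose[OF c, where S=UNIV]) (use dr_has_derivative[OF x] in auto)
 then have "((%t. u2 x) has_vector_derivative dr2 x x) (at 0)"
  by (rule has_vector_derivative_transform_within[OF _ zero_less_one]) (auto simp: r2_def e)
 then show "dr2 x x = 0" using vector_derivative_unique_at has_vector_derivative_const by blast
qed

definition f1 :: "'m => 'c" where "f1 x = p (u1 x)"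
definition f2 :: "'m => 'c" where "f2 x = p (u2 x)"

lemma coincidence_u: "coincidence_set M f1 f2 = {x \<in> M. u1 x = u2 x}"
 unfolding coincidence_set_def f1_def f2_def
 using sheets[OF u_S] u_close by (auto simp del: mem_sphere_0 mem_sphere) (meson not_le)

lemma smooth_f: "smooth_on M f1" "smooth_on M f2"
 using smooth_on_compose[OF smooth_u(1) smooth_p u_sphere(1)] smooth_on_compose[OF smooth_u(2) smooth_p u_sphere(2)]
 unfolding f1_def[abs_def] f2_def[abs_def] by auto

lemma dr_tangent:
 assumes x: "x \<in> M" and v: "v \<bullet> x = 0"
 shows "dr1 x v \<bullet> u1 x = 0" "dr2 x v \<bullet> u2 x = 0"
proof -
 have v': "v \<in> tangent_space M x" using tangent_space_sphere[OF x] v by simp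
 show "dr1 x v \<bullet> u1 x = 0"
  using differential_tangent[OF v' smooth_u(1) u_sphere(1) x] differential_u[OF x v] tangent_space_sphere[OF u_S(1)[OF x]] by simp
 show "dr2 x v \<bullet> u2 x = 0"
  using differential_tangent[OF v' smooth_u(2) u_sphere(2) x] differential_u[OF x v] tangent_space_sphere[OF u_S(2)[OF x]] by simp
qed

lemma differential_f:
 assumes x: "x \<in> M" and v: "v \<bullet> x = 0"
 shows "differential M f1 x v = Dp (u1 x) (dr1 x v)" "differential M f2 x v = Dp (u2 x) (dr2 x v)"
proof -
 have v': "v \<in> tangent_space M x" using tangent_space_sphere[OF x] v by simp
 show "differential M f1 x v = Dp (u1 x) (dr1 x v)"
  using differential_compose[OF smooth_u(1) smooth_p u_sphere(1) x v'] differential_u[OF x v]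
   Dp_tangent[OF u_S(1)[OF x] dr_tangent(1)[OF x v]] unfolding f1_def[abs_def] by simp
 show "differential M f2 x v = Dp (u2 x) (dr2 x v)"
  using differential_compose[OF smooth_u(2) smooth_p u_sphere(2) x v'] differential_u[OF x v]
   Dp_tangent[OF u_S(2)[OF x] dr_tangent(2)[OF x v]] unfolding f2_def[abs_def] by simp
qed

lemma canonical_normal_map_u:
 assumes x: "x \<in> M" and v: "v \<bullet> x = 0" and c: "u1 x = u2 x"
 shows "canonical_normal_map M f1 f2 x v = Dp (u1 x) (dr2 x v - dr1 x v)"
 unfolding canonical_normal_map_def differential_f[OF x v]
 using c linear_diff[OF linear_Dp[OF u_S(1)[OF x]]] by simp

definition transverse_u :: bool where
 "transverse_u \<longleftrightarrow> (\<forall>x\<in>M. u1 x = u2 x --> (\<forall>ze. ze \<bullet> u1 x = 0 --> (\<exists>v. v \<bullet> x = 0 \<and> dr2 x v - dr1 x v = ze)))"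

text \<open>
 At a coincidence both maps are followed by the differential of \<open>p\<close> at the same point, which is an
 isomorphism of tangent spaces.
\<close>

lemma generic_iff: "generic_pair M N f1 f2 \<longleftrightarrow> transverse_u"
proof -
 let ?F = "%x. (f1 x, f2 x)"
 let ?Dl = "{(y, y) |y. y \<in> N}"
 have im: "f1 ` M <= N" "f2 ` M <= N" unfolding f1_def f2_def using u_S p_in_N by auto
 have "transverse_at M ?F (N \<times> N) ?Dl x \<longleftrightarrow> (\<forall>ze. ze \<bullet> u1 x = 0 --> (\<exists>v. v \<bullet> x = 0 \<and> dr2 x v - dr1 x v = ze))"
  if x: "x \<in> M" and c: "u1 x = u2 x" for x
 proof -
  let ?y = "f1 x"
  let ?T = "tangent_space N ?y"
  have y: "?y \<in> N" "f2 x = ?y" "u1 x \<in> S" using im x c u_S(1)[OF x] by (auto simp: f1_def f2_def)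
  have TM: "tangent_space M x = {v. v \<bullet> x = 0}" by (rule tangent_space_sphere[OF x])
  have dF: "differential M ?F x v = (Dp (u1 x) (dr1 x v), Dp (u1 x) (dr2 x v))" if v: "v \<bullet> x = 0" for v
  proof -
   have "(?F has_derivative (%v. (differential M f1 x v, differential M f2 x v))) (at x within M)"
    by (intro has_derivative_Pair smooth_on_differential smooth_f x)
   from differential_eq[OF this] show ?thesis using v TM differential_f[OF x v] c by simp
  qed
  have T1: "tangent_space ?Dl (?F x) = {(w, w) |w. w \<in> ?T}"
   using tangent_space_diagonal[OF y(1)] y(2) by simp
  have lD: "linear (Dp (u1 x))" by (rule linear_Dp[OF y(3)])
  have DT: "Dp (u1 x) z \<in> ?T" for z using Dp_in[OF y(3)] by (simp add: f1_def)
  let ?L = "{differential M ?F x v + w |v w. v \<in> tangent_space M x \<and> w \<in> tangent_space ?Dl (?F x)}"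
  have Lsub: "?L <= ?T \<times> ?T"
   unfolding T1 TM by (auto simp: plus_prod_def dF intro!: subspace_add[OF subspace_tangent_space] DT)
  have key: "transverse_at M ?F (N \<times> N) ?Dl x \<longleftrightarrow> ?L = ?T \<times> ?T"
   using tangent_space_Times[OF y(1) y(1)] y(2) by (simp add: transverse_at_def)
  show ?thesis unfolding key
  proof
   assume L: "?L = ?T \<times> ?T"
   show "\<forall>ze. ze \<bullet> u1 x = 0 --> (\<exists>v. v \<bullet> x = 0 \<and> dr2 x v - dr1 x v = ze)"
   proof (intro allI impI)
    fix ze assume ze: "ze \<bullet> u1 x = 0"
    have "(0, Dp (u1 x) ze) \<in> ?L" unfolding L using DT subspace_0[OF subspace_tangent_space] by auto
    then obtain v w where vw: "v \<bullet> x = 0" "(0, Dp (u1 x) ze) = differential M ?F x v + (w, w)"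
     unfolding T1 TM by auto
    have "Dp (u1 x) (ze - (dr2 x v - dr1 x v)) = 0"
     using vw(2) dF[OF vw(1)] by (simp add: add_eq_0_iff2 linear_diff[OF lD])
    moreover have "(ze - (dr2 x v - dr1 x v)) \<bullet> u1 x = 0"
     using ze dr_tangent[OF x vw(1)] c by (simp add: inner_diff_left)
    ultimately show "\<exists>v. v \<bullet> x = 0 \<and> dr2 x v - dr1 x v = ze"
     using Dp_eq_0[OF y(3)] vw(1) by fastforce
   qed
  next
   assume R: "\<forall>ze. ze \<bullet> u1 x = 0 --> (\<exists>v. v \<bullet> x = 0 \<and> dr2 x v - dr1 x v = ze)"
   show "?L = ?T \<times> ?T"
   proof (rule equalityI[OF Lsub])
    show "?T \<times> ?T <= ?L"
    proof (rule subsetI)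
     fix z assume "z \<in> ?T \<times> ?T"
     then obtain a b where z: "z = (a, b)" and ab: "a \<in> ?T" "b \<in> ?T" by auto
     obtain ze where ze: "ze \<bullet> u1 x = 0" "Dp (u1 x) ze = b - a"
      using ab subspace_diff[OF subspace_tangent_space] by (force simp: f1_def intro: Dp_surj[OF y(3)])
     obtain v where v: "v \<bullet> x = 0" "dr2 x v - dr1 x v = ze" using R ze(1) by blast
     have "(a, b) = differential M ?F x v + (a - Dp (u1 x) (dr1 x v), a - Dp (u1 x) (dr1 x v))"
      using v(2) ze(2) linear_diff[OF lD] by (fastforce simp: dF[OF v(1)] algebra_simps)
     moreover have "a - Dp (u1 x) (dr1 x v) \<in> ?T"
      using ab(1) DT subspace_diff[OF subspace_tangent_space] by blast
     ultimately show "z \<in> ?L" unfolding z T1 TM using v(1) by blast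
    qed
   qed
  qed
 qed
 moreover have "?F x \<in> ?Dl \<longleftrightarrow> u1 x = u2 x" if x: "x \<in> M" for x
 using coincidence_u x im by (fastforce simp: coincidence_set_def)
 ultimately show ?thesis
  unfolding generic_pair_def transverse_to_def transverse_u_def using im smooth_f by (auto simp del: mem_sphere_0 mem_sphere)
qed

end

context sphere_maps
begin

definition bounded_by_all :: "('m \<times> (real => 'c)) set => bool" where
 "bounded_by_all Q \<longleftrightarrow> {x \<in> coincidence_set M f1 f2. constant_path_lift f1 x \<in> Q} = coincidence_set M f1 f2"

text \<open>
 Where \<open>W\<close> does not vanish, its zeros \<open>(X, t)\<close> are the points with \<open>X\<close> on the unit sphere at which \<open>W\<close> has the
 direction of \<open>u1\<close>: the factor \<open>norm (fst z)\<close> makes \<open>norm X = 1\<close> a part of the equation. So the null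
 bordism becomes the preimage of a regular value in an open set of the ambient space.
\<close>

definition Theta :: "('m \<times> real => 'f) => 'm \<times> real => 'f" where
 "Theta W z = (norm (W z) * norm (fst z)) *R r1 (fst z) - W z"

lemma Theta_M: "fst z \<in> M ==> Theta W z = 0 \<longleftrightarrow> W z = norm (W z) *R u1 (fst z)"
 by (auto simp: Theta_def r_M)

lemma Theta_zero_norm:
 assumes "Theta W z = 0" "W z ~= 0" "fst z ~= 0"
 shows "fst z \<in> M"
proof -
 have r: "norm (r1 (fst z)) = 1" using r_S(1)[OF assms(3)] by simp
 have "W z = (norm (W z) * norm (fst z)) *R r1 (fst z)" using assms(1) by (simp add: Theta_def)
 from arg_cong[OF this, of norm] show ?thesis using assms(2) by (simp add: r)
qed

text \<open>
 A smooth homotopy \<open>W\<close>, in the ambient space, from \<open>u2\<close> to a map which nowhere points in the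
 direction of \<open>u1\<close> yields a null bordism: its zero set of \<^term>\<open>Theta W\<close> consists of the points
 where the directions of \<open>W\<close> and of \<open>u1\<close> agree.
\<close>

lemma inessential_from_homotopy:
 assumes W: "open Om" "Cinf_on Om W" "M \<times> {0..1} <= Om" "!!z. z \<in> Om ==> fst z ~= 0 \<and> W z ~= 0"
  and W0: "!!x. x \<in> M ==> W (x, 0) = u2 x"
  and W1: "!!x. x \<in> M ==> Theta W (x, 1) ~= 0"
  and reg: "!!z y. z \<in> M \<times> {0<..<1} ==> Theta W z = 0 ==> \<exists>v. Df (Theta W) z v = y"
  and reg0: "!!x y. x \<in> M ==> Theta W (x, 0) = 0 ==> \<exists>v. Df (Theta W) (x, 0) (v, 0) = y"
  and Q: "bounded_by_all Q"
 shows "inessential M N f1 f2 Q"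
proof -
 let ?Th = "Theta W"
 let ?D = "%z. Df ?Th z"
 let ?P = "M \<times> {0..1::real}"
 define C where "C = coincidence_set M f1 f2"
 define B where "B = {z \<in> ?P. ?Th z = 0}"
 have CTh: "Cinf_on Om ?Th"
 proof
  fix k
  have 1: "Ck_on k Om (%z. norm (W z))" by (rule Ck_on_norm[OF W(1)]) (use W in auto)
  have 2: "Ck_on k Om (%z. norm (fst z))"
   by (rule Ck_on_norm[OF W(1) Ck_on_linear[OF bounded_linear_fst W(1)]]) (use W in auto)
  have 3: "Ck_on k Om (%z. r1 (fst z))"
   by (rule Ck_on_compose[OF W(1) _ Ck_on_linear[OF bounded_linear_fst W(1)] Cinf_r(1)[rule_format]]) (use W(4) in auto)
  show "Ck_on k Om ?Th" unfolding Theta_def[abs_def]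
   by (intro Ck_on_diff Ck_on_scaleR Ck_on_mult 1 2 3 W(1) W(2)[rule_format])
 qed
 have D: "(?Th has_derivative ?D z) (at z)" if "z \<in> Om" for z
  by (rule Cinf_has_derivative[OF CTh that])
 have linD: "linear (?D z)" if "z \<in> Om" for z using D[OF that] has_derivative_linear by blast
 have POm: "z \<in> Om" if "z \<in> ?P" for z using W(3) that by blast
 have contTh: "continuous_on Om ?Th" using CTh Ck_on_continuous by blast
 have compB: "compact B"
  using closedin_compact by (auto simp: B_def intro!: continuous_closedin_preimage_constant[OF continuous_on_subset[OF contTh W(3)]] compact_Times compact_sphere)
 have BP: "B <= ?P" by (auto simp: B_def)
 have Beq: "W z = norm (W z) *R u1 (fst z)" if "z \<in> B" for z
  using that Theta_M[of z W] by (auto simp: B_def)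
 have u_eq: "x \<in> C \<longleftrightarrow> x \<in> M \<and> u1 x = u2 x" for x by (simp add: C_def coincidence_u)
 have B0: "(x, 0) \<in> B \<longleftrightarrow> x \<in> C" for x
 using W0 u_S(2) Theta_M[of "(x, 0)" W] u_eq[of x] by (auto simp: B_def u_eq)
 have B1: "(x, 1) \<notin> B" for x using W1[of x] by (auto simp: B_def)
 have Bends: "B \<inter> (M \<times> {0, 1}) = C \<times> {0}" using B0 B1 u_eq by auto
 \<comment> \<open>zeros at the time 0 give charts onto half spaces, later zeros charts onto linear subspaces\<close>
 have ch0: "\<exists>w. submanifold_chart B (x, 0) {v. ?D (x, 0) v = 0} w \<and> tangent_space B (x, 0) = {v. ?D (x, 0) v = 0} \<and> w ~= 0"
  if x: "x \<in> C" for x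
 proof -
  define U where "U = Om \<inter> (UNIV \<times> {..<1})"
  have xB: "(x, 0) \<in> B" using x B0 by blast
  have oU: "open U" unfolding U_def using W(1) by (intro open_Int open_Times) auto
  have xU: "(x, 0) \<in> U" using xB BP POm by (auto simp: U_def)
  have z0: "?Th (x, 0) = 0" using xB by (simp add: B_def)
  have S: "B \<inter> U = {z \<in> U. ?Th z = 0 \<and> 0 <= (0, 1) \<bullet> (z - (x, 0))}"
  proof (intro equalityI subsetI)
   fix z assume "z \<in> {z \<in> U. ?Th z = 0 \<and> 0 <= (0, 1) \<bullet> (z - (x, 0))}"
   then have z: "z \<in> U" "?Th z = 0" "0 <= snd z" "snd z < 1" by (auto simp: U_def inner_prod_def)
   then show "z \<in> B \<inter> U"
    using Theta_zero_norm[of W z] W(4)[of z] z by (simp add: U_def B_def mem_Times_iff)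
  qed (auto simp: B_def U_def inner_prod_def)
  have sj: "\<exists>v. (0, 1) \<bullet> v = 0 \<and> ?D (x, 0) v = y" for y
  using reg0[OF _ z0] x u_eq by (simp add: inner_prod_def)
  obtain w where "submanifold_chart B (x, 0) {v. ?D (x, 0) v = 0} w" "tangent_space B (x, 0) = {v. ?D (x, 0) v = 0}"
   "w = 0 \<longleftrightarrow> (0, 1) = (0 :: 'm \<times> real)"
   by (rule regular_preimage_chart[OF oU _ xU z0 sj S]) (use CTh Ck_on_subset[of _ Om ?Th U] in \<open>auto simp: U_def\<close>)
  then show ?thesis by (intro exI[of _ w]) (auto simp: zero_prod_def)
 qed
 have ch1: "submanifold_chart B z {v. ?D z v = 0} 0 \<and> tangent_space B z = {v. ?D z v = 0}"
  if zB: "z \<in> B" and z0: "snd z ~= 0" for z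
 proof -
  define U where "U = Om \<inter> (UNIV \<times> {0<..<1})"
  have oU: "open U" unfolding U_def using W(1) by (intro open_Int open_Times) auto
  have "snd z ~= 1" using B1[of "fst z"] zB by (metis prod.collapse)
  then have z01: "snd z \<in> {0<..<1}" "fst z \<in> M" using zB BP z0 by auto
  then have zU: "z \<in> U" using zB BP POm by (auto simp: U_def mem_Times_iff)
  have Th0: "?Th z = 0" using zB by (simp add: B_def)
  have S: "B \<inter> U = {z' \<in> U. ?Th z' = 0 \<and> 0 <= 0 \<bullet> (z' - z)}"
  proof (intro equalityI subsetI)
   fix z' assume "z' \<in> {z' \<in> U. ?Th z' = 0 \<and> 0 <= 0 \<bullet> (z' - z)}"
   then have z': "z' \<in> U" "?Th z' = 0" "0 < snd z'" "snd z' < 1" by (auto simp: U_def)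
   then show "z' \<in> B \<inter> U"
    using Theta_zero_norm[of W z'] W(4)[of z'] z' by (simp add: U_def B_def mem_Times_iff)
  qed (auto simp: B_def U_def)
  have sj: "\<exists>v. 0 \<bullet> v = 0 \<and> ?D z v = y" for y
   using reg[OF _ Th0, of y] z01 by (auto simp: mem_Times_iff)
  obtain w where "submanifold_chart B z {v. ?D z v = 0} w" "tangent_space B z = {v. ?D z v = 0}"
   "w = 0 \<longleftrightarrow> (0 :: 'm \<times> real) = 0"
   by (rule regular_preimage_chart[OF oU _ zU Th0 sj S]) (use CTh Ck_on_subset[of _ Om ?Th U] in \<open>auto simp: U_def\<close>)
  then show ?thesis by auto
 qed
 have B_cases: "(\<exists>x. z = (x, 0) \<and> x \<in> C) \<or> snd z ~= 0" if "z \<in> B" for z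
  using that B0[of "fst z"] by (metis prod.collapse)
 have TB: "tangent_space B z = {v. ?D z v = 0}" if "z \<in> B" for z
  using B_cases[OF that] ch0 ch1[OF that] by blast
 have sub: "submanifold_with_boundary B"
  unfolding submanifold_with_boundary_def
 proof
  fix z assume z: "z \<in> B"
  show "\<exists>L w. submanifold_chart B z L w" using B_cases[OF z] ch0 ch1[OF z] by blast
 qed
 have bd: "manifold_boundary B = B \<inter> (M \<times> {0, 1})"
 proof (intro equalityI subsetI)
  fix z assume "z \<in> manifold_boundary B"
  then obtain L w where z: "z \<in> B" "submanifold_chart B z L w" "w ~= 0" unfolding manifold_boundary_def by auto
  show "z \<in> B \<inter> (M \<times> {0, 1})"
   using interior_chart_unique[OF conjunct1[OF ch1[OF z(1)]] z(2)] z(3) z(1) BP by (auto simp: mem_Times_iff intro: ccontr)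
 next
  fix z assume "z \<in> B \<inter> (M \<times> {0, 1})"
  then obtain x where x: "z = (x, 0)" "x \<in> C" unfolding Bends by auto
  then show "z \<in> manifold_boundary B"
   unfolding manifold_boundary_def using ch0[OF x(2)] B0[of x] by auto
 qed
 have TP: "tangent_space ?P z = {v. fst v \<bullet> fst z = 0}" if z: "z \<in> ?P" for z
 proof -
  have "tangent_space ?P (fst z, snd z) = tangent_space M (fst z) \<times> tangent_space {0..1} (snd z)"
   by (rule tangent_space_Times) (use z in \<open>auto simp: mem_Times_iff\<close>)
  then show ?thesis using z tangent_space_sphere[of "fst z"] tangent_space_interval[of "snd z"]
   by (auto simp: mem_Times_iff)
 qed
 have TB_TP: "?D z v = 0 ==> fst v \<bullet> fst z = 0" if z: "z \<in> B" for z v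
  using tangent_space_mono[OF BP, of z] TB[OF z] TP[of z] z BP by blast
 \<comment> \<open>a certain inner product with \<open>Theta W\<close> is a multiple of \<open>fst z \<bullet> fst z - 1\<close>, constant along the sphere\<close>
 have Dtan: "?D z v \<bullet> u1 (fst z) = 0" if z: "z \<in> B" and v: "fst v \<bullet> fst z = 0" for z v
 proof -
  have zOm: "z \<in> Om" using z BP POm by blast
  have zM: "fst z \<in> M" using z BP by (auto simp: mem_Times_iff)
  have eq: "Theta W z \<bullet> ((norm (W z) * norm (fst z)) *R r1 (fst z) + W z) = (W z \<bullet> W z) * (fst z \<bullet> fst z - 1)"
   if "z \<in> Om" for z
  using W(4)[OF that] r_S(1) S_inner by (simp add: Theta_def inner_diff_left inner_add_right inner_commute power2_norm_eq_inner[symmetric] algebra_simps power2_eq_square)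
  let ?h = "%z. (norm (W z) * norm (fst z)) *R r1 (fst z) + W z"
  have h: "?h z = 2 *R W z" using Beq[OF z] zM by (simp add: r_M scaleR_2)
  have "isCont ?h z"
  proof -
   have "continuous_on Om ?h"
    by (intro continuous_intros continuous_on_compose2[OF Ck_on_continuous[OF Cinf_r(1)[rule_format, of 0]]]
      Ck_on_continuous[OF W(2)[rule_format, of 0]]) (use W(4) in auto)
   then show ?thesis using W(1) zOm continuous_on_eq_continuous_at by blast
  qed
  from has_derivative_bilinear_zero[OF bounded_bilinear_inner D[OF zOm] _ this]
  have "((%z. ?h z \<bullet> ?Th z) has_derivative (%v. ?h z \<bullet> ?D z v)) (at z)" using z by (simp add: B_def)
  then have d1: "((%z. (W z \<bullet> W z) * (fst z \<bullet> fst z - 1)) has_derivative (%v. ?h z \<bullet> ?D z v)) (at z)"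
   by (rule has_derivative_transform_within_open[OF _ W(1) zOm]) (simp only: inner_commute[of "?h _"] eq)
  have d2: "((%z. (W z \<bullet> W z) * (fst z \<bullet> fst z - 1)) has_derivative
    (%v. (W z \<bullet> W z) * (2 * (fst v \<bullet> fst z)))) (at z)"
  using has_derivative_continuous has_derivative_bilinear_zero[OF bounded_bilinear_mult, of "%z. fst z \<bullet> fst z - 1" _ z "%z. W z \<bullet> W z"] M_inner[OF zM] by (auto simp: inner_commute intro!: derivative_eq_intros Cinf_has_derivative[OF W(2) zOm] continuous_intros)
  have "?h z \<bullet> ?D z v = (W z \<bullet> W z) * (2 * (fst v \<bullet> fst z))" using has_derivative_unique[OF d1 d2] by (rule fun_cong)
  then have "W z \<bullet> ?D z v = 0" using v unfolding h by simp
  then have "norm (W z) * (u1 (fst z) \<bullet> ?D z v) = 0" using Beq[OF z] by (metis inner_scaleR_left)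
  then show ?thesis using W(4)[OF zOm] by (simp add: inner_commute)
 qed
 define A where "A = (%z v. Dp (u1 (fst z)) (- ?D z v))"
 have u1S: "u1 (fst z) \<in> S" if "z \<in> B" for z using that BP u_S(1) by (auto simp: mem_Times_iff simp del: mem_sphere mem_sphere_0)
 have linA: "linear (A z)" if "z \<in> B" for z
 proof -
  have "linear (%v. - ?D z v)" using linear_compose_neg[OF linD[OF POm]] that BP by blast
  from linear_compose[OF this linear_Dp[OF u1S[OF that]]] show ?thesis by (simp add: A_def o_def)
 qed
 have kerA: "A z v = 0 \<longleftrightarrow> ?D z v = 0" if z: "z \<in> B" and v: "fst v \<bullet> fst z = 0" for z v
 proof
  assume "A z v = 0"
  then have "- ?D z v = 0" unfolding A_def by (intro Dp_eq_0[OF u1S[OF z]]) (use Dtan[OF z v] in auto)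
  then show "?D z v = 0" by simp
 qed (simp add: A_def linear_0[OF linear_Dp[OF u1S[OF z]]])
 have surjD: "\<exists>v. ?D z v = y" if z: "z \<in> B" for z y
 proof (cases "snd z = 0")
  case True
  then obtain x where x: "z = (x, 0)" "x \<in> C" using B_cases[OF z] by auto
  show ?thesis using z x u_eq reg0[of x y] x(1) by (auto simp: B_def)
 next
  case False
  moreover have "snd z ~= 1" using B1[of "fst z"] z by (metis prod.collapse)
  ultimately show ?thesis using reg[of z y] z BP by (auto simp: B_def mem_Times_iff)
 qed
 \<comment> \<open>a vector with prescribed derivative tangential to the target can be chosen tangent to the sphere\<close>
 have surjT: "\<exists>v. fst v \<bullet> fst z = 0 \<and> ?D z v = y" if z: "z \<in> B" and y: "y \<bullet> u1 (fst z) = 0" for z y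
 proof -
  obtain v where v: "?D z v = y" using surjD[OF z] by blast
  have zM: "fst z \<in> M" using z BP by (auto simp: mem_Times_iff)
  let ?x = "(fst z, 0 :: real)"
  let ?c = "fst v \<bullet> fst z"
  have lz: "linear (?D z)" using linD POm z BP by blast
  have t: "fst (v - ?c *R ?x) \<bullet> fst z = 0" using M_inner[OF zM] by (simp add: inner_diff_left)
  have "?D z (v - ?c *R ?x) = y - ?c *R ?D z ?x" by (simp only: v linear_diff[OF lz] linear_cmul[OF lz])
  then have "?c * (?D z ?x \<bullet> u1 (fst z)) = 0" using Dtan[OF z t] y by (simp add: inner_diff_left)
  moreover have "?D z ?x \<bullet> u1 (fst z) ~= 0"
  proof
   assume "?D z ?x \<bullet> u1 (fst z) = 0"
   obtain v' where v': "?D z v' = u1 (fst z)" using surjD[OF z] by blast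
   let ?c' = "fst v' \<bullet> fst z"
   have t': "fst (v' - ?c' *R ?x) \<bullet> fst z = 0" using M_inner[OF zM] by (simp add: inner_diff_left)
   have "?D z (v' - ?c' *R ?x) = u1 (fst z) - ?c' *R ?D z ?x" by (simp only: v' linear_diff[OF lz] linear_cmul[OF lz])
   then show False
    using Dtan[OF z t'] \<open>?D z ?x \<bullet> u1 (fst z) = 0\<close> S_inner[OF u1S[OF z]] by (simp add: inner_diff_left)
  qed
  ultimately show ?thesis using v by fastforce
 qed
 have iso: "normal_bundle_iso B ?P N (%b. f1 (fst b)) A"
  unfolding normal_bundle_iso_def
 proof (intro conjI ballI)
  fix z assume z: "z \<in> B"
  have zP: "z \<in> ?P" using z BP by blast
  show "linear (A z)" by (rule linA[OF z])
  show "A z ` tangent_space ?P z = tangent_space N (f1 (fst z))"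
  proof (intro equalityI subsetI)
   fix w assume "w \<in> A z ` tangent_space ?P z"
   then show "w \<in> tangent_space N (f1 (fst z))" using Dp_in[OF u1S[OF z]] by (auto simp: A_def f1_def)
  next
   fix w assume "w \<in> tangent_space N (f1 (fst z))"
   then obtain y where y: "y \<bullet> u1 (fst z) = 0" "Dp (u1 (fst z)) y = w"
    by (auto simp: f1_def intro: Dp_surj[OF u1S[OF z]])
   have "(- y) \<bullet> u1 (fst z) = 0" using y(1) by simp
   then obtain v where v: "fst v \<bullet> fst z = 0" "?D z v = - y" using surjT[OF z] by blast
   show "w \<in> A z ` tangent_space ?P z" using v(2) y(2) v(1) TP[OF zP] by (force simp: A_def)
  qed
  show "{v \<in> tangent_space ?P z. A z v = 0} = tangent_space B z"
   unfolding TB[OF z] TP[OF zP] using kerA[OF z] TB_TP[OF z] by blast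
 next
  let ?X = "{(b, v). b \<in> B \<and> v \<in> tangent_space ?P b}"
  have diff: "?Th differentiable (at z)" if "z \<in> B" for z using D POm that BP differentiableI by blast
  have cB: "continuous_on Om (frechet_blinfun ?Th)"
   using Ck_on_continuous[OF Ck_on_frechet_blinfun[OF W(1)]] CTh by blast
  have 1: "continuous_on ?X (%z. - blinfun_apply (frechet_blinfun ?Th (fst z)) (snd z))"
   by (intro continuous_intros continuous_on_compose2[OF cB]) (use BP POm in auto)
  have cu: "continuous_on M u1" using smooth_u(1) by (rule smooth_on_continuous)
  have 2: "continuous_on ?X (%z. u1 (fst (fst z)))"
   by (intro continuous_on_compose2[OF cu] continuous_intros) (use BP in auto)
  have "continuous_on ?X (%z. Dp (u1 (fst (fst z))) (- blinfun_apply (frechet_blinfun ?Th (fst z)) (snd z)))"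
   by (rule continuous_on_Dp_compose[OF 2 1]) (use u1S in auto)
  then show "continuous_on ?X (%(b, v). A b v)"
  using frechet_blinfun_apply[OF diff] by (auto simp: A_def intro: continuous_on_eq)
 qed
 have can: "A (x, 0) (v, 0) = canonical_normal_map M f1 f2 x v" if x: "x \<in> C" and v: "v \<in> tangent_space M x" for x v
 proof -
  have xM: "x \<in> M" and xu: "u1 x = u2 x" using x u_eq by auto
  have vx: "v \<bullet> x = 0" using v tangent_space_sphere[OF xM] by simp
  have xB: "(x, 0) \<in> B" using x B0 by blast
  \<comment> \<open>along the sphere the function is the difference of the two maps\<close>
  have e1: "((%x'. ?Th (x', 0)) has_derivative (%v. ?D (x, 0) (v, 0))) (at x within M)"
  proof -
   have "((%x'. (x', 0::real)) has_derivative (%v. (v, 0))) (at x within M)" by (auto intro!: derivative_eq_intros)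
   from has_derivative_compose[OF this D[OF POm]] show ?thesis using xB BP by blast
  qed
  have e2: "((%x'. u1 x' - u2 x') has_derivative (%v. differential M u1 x v - differential M u2 x v)) (at x within M)"
   by (intro has_derivative_diff smooth_on_differential smooth_u xM)
  have e3: "((%x'. ?Th (x', 0)) has_derivative (%v. differential M u1 x v - differential M u2 x v)) (at x within M)"
   by (rule has_derivative_transform_within[OF e2 zero_less_one xM])
     (simp add: Theta_def W0 r_M u_S(2)[unfolded mem_sphere_0])
  show ?thesis
   using derivative_tangent_unique[OF e1 e3 v] differential_u[OF xM vx] by (simp add: canonical_normal_map_u[OF xM vx xu] A_def)
 qed
 have trans: "transverse_at B id ?P (M \<times> {0}) b" if b: "b \<in> C \<times> {0}" for b
 proof -
  obtain x where x: "b = (x, 0)" "x \<in> C" using b by auto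
  have bB: "b \<in> B" using x B0 by blast
  have bP: "b \<in> ?P" using bB BP by blast
  have xM: "x \<in> M" using x u_eq by auto
  have did: "differential B id b v = v" if "v \<in> tangent_space B b" for v
   using differential_eq[OF has_derivative_id that] by simp
  have T0: "tangent_space (M \<times> {0}) b = {v. fst v \<bullet> x = 0 \<and> snd v = 0}"
   unfolding x(1) using tangent_space_Times[OF xM, of "0::real" "{0}"] tangent_space_sphere[OF xM] tangent_space_singleton[of "0::real"]
   by auto
  have lb: "linear (?D b)" using linD POm bP by blast
  have "{differential B id b v + w |v w. v \<in> tangent_space B b \<and> w \<in> tangent_space (M \<times> {0}) b} = tangent_space ?P b"
  proof (intro equalityI subsetI)
   fix y assume "y \<in> {differential B id b v + w |v w. v \<in> tangent_space B b \<and> w \<in> tangent_space (M \<times> {0}) b}"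
   then obtain v w where y: "y = v + w" "v \<in> tangent_space B b" "w \<in> tangent_space (M \<times> {0}) b" using did by auto
   then have "fst v \<bullet> x = 0" "fst w \<bullet> x = 0" using T0 TB_TP[OF bB, of v] TB[OF bB] x(1) by auto
   then show "y \<in> tangent_space ?P b" unfolding TP[OF bP] using y(1) x(1) by (simp add: inner_add_left)
  next
   fix y assume "y \<in> tangent_space ?P b"
   then have y: "fst y \<bullet> x = 0" unfolding TP[OF bP] using x(1) by simp
   obtain v' where v': "?D b (v', 0) = ?D b (0, 1)"
    using reg0[OF xM, of "?D b (0, 1)"] bB x(1) by (auto simp: B_def)
   define v where "v = snd y *R (- v', 1::real)"
   have "?D b (- v', 1) = ?D b ((0, 1) - (v', 0))" by simp
   also have "\<dots> = ?D b (0, 1) - ?D b (v', 0)" by (rule linear_diff[OF lb])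
   finally have "?D b (- v', 1) = 0" using v' by simp
   then have "?D b v = 0" unfolding v_def by (simp only: linear_cmul[OF lb]) simp
   then have v: "v \<in> tangent_space B b" "fst v \<bullet> x = 0" using TB[OF bB] TB_TP[OF bB] x(1) by auto
   have "y - v \<in> tangent_space (M \<times> {0}) b"
    using y v(2) by (simp add: fst_diff inner_diff_left diff_self v_def T0 mem_Collect_eq simp_thms algebra_simps)
   moreover have "y = differential B id b v + (y - v)" using did[OF v(1)] by simp
   ultimately show "y \<in> {differential B id b v + w |v w. v \<in> tangent_space B b \<and> w \<in> tangent_space (M \<times> {0}) b}"
    using v(1) by blast
  qed
  then show ?thesis unfolding transverse_at_def by simp
 qed
 define Ga where "Ga = (%(z, s). let y = W (fst z, snd z * (1 - s)) in p (y /R norm y))"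
 define G where "G = (%z. (fst z, \<lambda>s\<in>{0..1}. Ga (z, s)))"
 have inOm: "(fst z, snd z * (1 - s)) \<in> Om" if "z \<in> B" "s \<in> {0..1}" for z s
 proof -
  have "snd z * (1 - s) <= 1 * 1" using that BP by (intro mult_mono) auto
  then have "(fst z, snd z * (1 - s)) \<in> ?P" using that BP by (auto simp: mem_Times_iff)
  then show ?thesis by (rule POm)
 qed
 have contG: "continuous_on (B \<times> {0..1}) Ga"
 proof -
  have cW: "continuous_on (B \<times> {0..1}) (%z. W (fst (fst z), snd (fst z) * (1 - snd z)))"
   by (intro continuous_on_compose2[OF Ck_on_continuous[OF W(2)[rule_format, of 0]]] continuous_intros) (use inOm in auto)
  have nz: "W (fst (fst z), snd (fst z) * (1 - snd z)) ~= 0" if "z \<in> B \<times> {0..1}" for z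
   using inOm[of "fst z" "snd z"] that W(4) by (auto simp: mem_Times_iff)
  have "continuous_on (B \<times> {0..1}) (%z. p (W (fst (fst z), snd (fst z) * (1 - snd z)) /R norm (W (fst (fst z), snd (fst z) * (1 - snd z)))))"
   by (rule continuous_on_compose2[OF continuous_p]) (use nz in \<open>auto intro!: continuous_intros cW\<close>)
  then show ?thesis by (simp add: Ga_def case_prod_unfold Let_def)
 qed
 have GaN: "Ga ` (B \<times> {0..1}) <= N"
 proof (rule image_subsetI)
  fix z assume "z \<in> B \<times> {0..1::real}"
  then have "W (fst (fst z), snd (fst z) * (1 - snd z)) ~= 0" using inOm[of "fst z" "snd z"] W(4) by (auto simp: mem_Times_iff)
  then show "Ga z \<in> N" unfolding Ga_def case_prod_unfold Let_def by (intro p_in_N) simp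
 qed
 have G01: "Ga (z, 0) = f1 (fst z)" "Ga (z, 1) = f2 (fst z)" if z: "z \<in> B" for z
 proof -
  have zM: "fst z \<in> M" "z \<in> Om" using z BP POm by (auto simp: mem_Times_iff)
  have "W z /R norm (W z) = u1 (fst z)" using Beq[OF z] W(4)[OF zM(2)]
   by (metis divideR_right norm_eq_zero)
  then show "Ga (z, 0) = f1 (fst z)" by (simp add: Ga_def Let_def f1_def)
  show "Ga (z, 1) = f2 (fst z)" using W0[OF zM(1)] u_S(2)[OF zM(1)] by (simp add: Ga_def Let_def f2_def)
 qed
 have cG: "continuous_map (top_of_set B) (coincidence_path_space M N f1 f2) G"
  using BP continuous_map_paths[OF contG GaN] G01 by (fastforce simp: coincidence_path_space_def continuous_map_in_subtopology mem_Times_iff G_def continuous_map_pairedI intro: continuous_intros)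
 have Gc: "G (x, 0) = constant_path_lift f1 x" if x: "x \<in> C" for x
 proof -
  have "Ga ((x, 0), s) = f1 x" for s
  proof -
   have "Ga ((x, 0), s) = Ga ((x, 0), 0)" by (simp add: Ga_def)
   then show ?thesis using G01(1)[of "(x, 0)"] x B0 by simp
  qed
  then show ?thesis by (simp add: G_def constant_path_lift_def)
 qed
 have CQ: "{x \<in> coincidence_set M f1 f2. constant_path_lift f1 x \<in> Q} = C"
  using Q unfolding bounded_by_all_def C_def .
 show ?thesis unfolding inessential_def Let_def CQ
  using BP compB sub bd Bends trans cG iso can Gc
  by (intro exI[of _ B] exI[of _ G] exI[of _ A] conjI ballI) (auto simp: G_def)
qed

end

lemma has_derivative_norm_nonzero:
 "x ~= 0 ==> (norm has_derivative (%V. V \<bullet> x / norm x)) (at x)"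
 by (rule has_derivative_eq_rhs[OF has_derivative_norm])
   (auto simp: fun_eq_iff sgn_div_norm inner_commute divide_inverse mult.commute)

lemma Cinf_polynomial_function:
 fixes P :: "'a::euclidean_space => 'b::euclidean_space"
 assumes "polynomial_function P"
 shows "Cinf_on UNIV P"
proof -
 have real: "Cinf_on UNIV g" if "real_polynomial_function g" for g :: "'a => real"
  using that
 proof (induction rule: real_polynomial_function.induct)
  case (linear f)
  then show ?case by (intro allI Ck_on_linear) auto
 qed (auto intro!: Ck_on_const Ck_on_add Ck_on_mult)
 have "Cinf_on UNIV (%x. P x \<bullet> b)" for b
  using assms bounded_linear_inner_left[of b] unfolding polynomial_function_def by (intro real) (auto simp: o_def)
 then have "Ck_on k UNIV (%x. \<Sum>b\<in>Basis. (P x \<bullet> b) *R b)" for k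
  by (intro Ck_on_sum Ck_on_scaleR Ck_on_const) auto
 then show ?thesis by (simp add: euclidean_representation)
qed

definition reflect :: "'a::real_inner => 'a => 'a" where
 "reflect n v = v - (2 * (v \<bullet> n) / (n \<bullet> n)) *R n"

lemma reflect_reflect [simp]: "reflect n (reflect n v) = v"
 by (cases "n = 0") (simp_all add: reflect_def inner_diff_left field_simps)

lemma reflect_inner: "reflect n v \<bullet> reflect n w = v \<bullet> w"
 by (cases "n = 0") (simp_all add: reflect_def inner_diff_left inner_diff_right inner_commute field_simps)

lemma norm_reflect [simp]: "norm (reflect n v) = norm v"
 by (simp add: norm_eq_sqrt_inner reflect_inner)

lemma linear_reflect: "linear (reflect n)"
 by (rule linearI) (simp_all add: reflect_def inner_add_left algebra_simps add_divide_distrib)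

lemma reflect_self: "reflect n n = - n"
 by (cases "n = 0") (simp_all add: reflect_def scaleR_2[symmetric] algebra_simps)

lemma reflect_sum:
 assumes "norm a = norm b" "a + b ~= 0"
 shows "reflect (a + b) a = - b"
proof -
 have "(a + b) \<bullet> (a + b) = 2 * (a \<bullet> (a + b))"
  using dot_square_norm[of a] dot_square_norm[of b] assms(1) by (simp add: inner_add_left inner_add_right inner_commute)
 then show ?thesis using assms(2) by (auto simp: reflect_def)
qed

lemma Ck_on_reflect:
 fixes n v :: "'a::real_normed_vector => 'b::euclidean_space"
 assumes "open U" "Ck_on k U n" "Ck_on k U v" "!!x. x \<in> U ==> n x ~= 0"
 shows "Ck_on k U (%x. reflect (n x) (v x))"
 unfolding reflect_def divide_inverse
 by (intro Ck_on_diff Ck_on_scaleR Ck_on_mult Ck_on_inner Ck_on_inverse_compose Ck_on_const assms) (use assms(4) in auto)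

lemma has_derivative_reflect_zero:
 fixes n k :: "'a::euclidean_space => 'b::euclidean_space"
 assumes n: "isCont n z" "n z ~= 0" and k: "(k has_derivative k') (at z)" "k z = 0"
 shows "((%x. reflect (n x) (k x)) has_derivative (%w. reflect (n z) (k' w))) (at z)"
proof -
 have "isCont (%x. (2 / (n x \<bullet> n x)) *R n x) z" using n by auto
 from has_derivative_bilinear_zero[OF bounded_bilinear_inner k this]
 have "((%x. (2 * (k x \<bullet> n x) / (n x \<bullet> n x)) *R n x) has_derivative (%w. (2 * (k' w \<bullet> n z) / (n z \<bullet> n z)) *R n z)) (at z)"
  using has_derivative_bilinear_zero[OF bounded_bilinear.flip[OF bounded_bilinear_scaleR] _ _ n(1)] k(2) by (simp add: inner_commute)
 from has_derivative_diff[OF k(1) this] show ?thesis by (simp add: reflect_def)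
qed

lemma normalise_near:
 assumes "norm (y :: 'a::real_normed_vector) = 1" "w ~= 0"
 shows "norm (w /R norm w - y) <= 2 * norm (w - y)"
proof -
 have "w /R norm w - w = (inverse (norm w) - 1) *R w" by (simp add: algebra_simps)
 also have "norm \<dots> = \<bar>1 - norm w\<bar>"
  using assms(2) by (simp add: abs_mult left_diff_distrib field_simps)
 finally show ?thesis
  using norm_triangle_ineq[of "w /R norm w - w" "w - y"] norm_triangle_ineq3[of w y] assms(1) by (simp add: abs_minus_commute)
qed

context sphere_maps
begin

text \<open>
 To make a homotopy transverse without moving its beginning, \<open>t\<close> times an affine map of
 the ambient space is added to it. In terms of \<open>X = s x\<close>, the linear part of this map contributes
 \<open>t s L(x)\<close>, which makes the direction \<open>u1 x\<close> move to that of \<open>q = u1 x - t L(x)\<close>; a product of two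
 reflections moves it back. The times \<open>t > 0\<close> are handled by a generic affine perturbation of
 the quotient by \<open>t\<close>, the time \<open>0\<close> by the transversality of the given pair.
\<close>

lemma inessential_from_continuous_homotopy:
 assumes tr: "transverse_u"
  and H: "continuous_on ({0..1::real} \<times> M) H" "H ` ({0..1} \<times> M) <= S"
  and H0: "!!x. x \<in> M ==> H (0, x) = u2 x" and H1: "!!x. x \<in> M ==> H (1, x) ~= u1 x"
  and Q: "bounded_by_all Q"
 shows "inessential M N f1 f2 Q"
proof -
 have cu: "continuous_on M u1" "continuous_on M u2" using smooth_u by (auto intro: smooth_on_continuous)
 have "closed ((%x. dist (H (1, x)) (u1 x)) ` M)" by (auto intro!: compact_continuous_image compact_sphere continuous_intros cu continuous_on_compose2[OF H(1)] compact_imp_closed)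
 moreover have "0 \<notin> (%x. dist (H (1, x)) (u1 x)) ` M" using H1 by fastforce
 ultimately obtain c0 where c0: "c0 > 0" "ball 0 c0 \<inter> (%x. dist (H (1, x)) (u1 x)) ` M = {}"
  using openE[of "- ((%x. dist (H (1, x)) (u1 x)) ` M)" 0] by (auto simp: open_Compl disjoint_eq_subset_Compl)
 define c where "c = min c0 1"
 have c: "0 < c" "c <= 1" using c0(1) by (auto simp: c_def)
 have cH: "c <= dist (H (1, x)) (u1 x)" if x: "x \<in> M" for x
 using c0(2) x by (force simp: c_def)
 define de where "de = c / 16"
 have de: "0 < de" "de <= 1/16" using c by (auto simp: de_def)
 let ?P = "M \<times> {0..1::real}"
 define H' where "H' = (%z. H (max 0 (2 * snd z - 1), fst z))"
 define R where "R = (%z. (1 / max (1/2) (snd z)) *R (H' z - u2 (fst z)))"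
 obtain P where P: "polynomial_function P" "!!z. z \<in> ?P ==> norm (R z - P z) < de"
  using Stone_Weierstrass_polynomial_function[of ?P R de] de(1) compact_Times[OF compact_sphere compact_Icc] by (fastforce simp: H'_def R_def intro: continuous_on_compose2[OF H(1)] continuous_intros continuous_on_compose2[OF cu(2)])
 have tR: "snd z *R R z = H' z - u2 (fst z)" if z: "z \<in> ?P" for z
 proof (cases "snd z <= 1/2")
  case True
  then show ?thesis using H0 z by (auto simp: H'_def R_def)
 next
  case False
  then show ?thesis by (simp add: R_def)
 qed
 have CP: "Cinf_on UNIV P" by (rule Cinf_polynomial_function[OF P(1)])
 define nx where "nx = (%z::'m \<times> real. (fst z /R norm (fst z), snd z))"
 let ?U0 = "{z :: 'm \<times> real. fst z ~= 0}"
 have oU0: "open ?U0"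
 using open_vimage_fst[of "- {0 :: 'm}"] by (auto simp: vimage_def)
 have Cfst: "Ck_on k V fst" and Csnd: "Ck_on k V snd" if "open V" for k and V :: "('m \<times> real) set"
  using Ck_on_linear[OF bounded_linear_fst that] Ck_on_linear[OF bounded_linear_snd that] by auto
 have Cnx: "Ck_on k ?U0 nx" for k
  unfolding nx_def by (intro Ck_on_Pair Ck_on_normalise oU0 Cfst Csnd) auto
 have CPn: "Ck_on k ?U0 (%z. P (nx z))" for k
  by (rule Ck_on_compose[OF oU0 open_UNIV Cnx CP[rule_format]]) auto
 have Cr1: "Ck_on k ?U0 (%z. r1 (fst z))" for k
  by (rule Ck_on_compose[OF oU0 _ Cfst[OF oU0] Cinf_r(1)[rule_format]]) auto
 have Cr2: "Ck_on k ?U0 (%z. r2 (fst z))" for k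
  by (rule Ck_on_compose[OF oU0 _ Cfst[OF oU0] Cinf_r(2)[rule_format]]) auto
 define U1 where "U1 = {z :: 'm \<times> real. fst z ~= 0 \<and> 0 < snd z}"
 have oU1: "open U1"
 proof -
  have "U1 = ?U0 \<inter> (UNIV \<times> {0<..})" by (auto simp: U1_def)
  then show ?thesis using oU0 by (simp add: open_Int open_Times)
 qed
 have U10: "U1 <= ?U0" by (auto simp: U1_def)
 define Ps where "Ps = (%z. inverse (snd z) *R (norm (fst z) *R r1 (fst z) - r2 (fst z)) - P (nx z))"
 have CPs: "Cinf_on U1 Ps"
 proof
  fix k
  show "Ck_on k U1 Ps" unfolding Ps_def
   by (intro Ck_on_diff Ck_on_scaleR Ck_on_inverse_compose Ck_on_norm oU1 Cfst Csnd
     Ck_on_subset[OF Cr1 U10] Ck_on_subset[OF Cr2 U10] Ck_on_subset[OF CPn U10]) (auto simp: U1_def)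
 qed
 obtain a L where a: "norm a < de" and L: "linear L" "\<forall>z. norm (L z) <= de * norm z"
  and reg: "\<forall>z\<in>U1. Ps z = a + L z --> surj (%v. Df Ps z v - L v)"
  by (rule affine_perturbation_regular[OF oU1 CPs de(1)])
 have bL: "bounded_linear L" using L(1) linear_conv_bounded_linear by blast
 define q where "q = (%z. r1 (fst z) - snd z *R L (fst (nx z), 0))"
 define V where "V = (%z. r2 (fst z) + snd z *R (P (nx z) + a + snd z *R L (0, 1)))"
 define n where "n = (%z. q z + norm (q z) *R r1 (fst z))"
 define W where "W = (%z. reflect (n z) (reflect (q z) (V z)))"
 let ?Om1 = "{z \<in> ?U0. V z ~= 0 \<and> q z ~= 0}"
 define Om where "Om = {z \<in> ?Om1. n z ~= 0}"
 have Cq0: "Ck_on k ?U0 q" for k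
  unfolding q_def nx_def fst_conv
  by (intro Ck_on_diff Ck_on_scaleR Ck_on_comp_linear[OF bL] Ck_on_Pair Ck_on_normalise Ck_on_const oU0 Cfst Csnd Cr1) auto
 have CV0: "Ck_on k ?U0 V" for k
  unfolding V_def by (intro Ck_on_add Ck_on_scaleR Ck_on_const oU0 Csnd Cr2 CPn)
 have o1: "open ?Om1"
 proof -
  have "?Om1 = ?U0 \<inter> (%z. (V z, q z)) -` ((- {0}) \<times> (- {0}))" by auto
  then show ?thesis
   using continuous_open_preimage[OF Ck_on_continuous[OF Ck_on_Pair[OF oU0 CV0 Cq0]] oU0, of "(- {0}) \<times> (- {0})"]
   by (simp add: open_Times open_Compl)
 qed
 have Cn1: "Ck_on k ?Om1 n" for k
  unfolding n_def
  by (intro Ck_on_add Ck_on_scaleR Ck_on_norm o1 Ck_on_subset[OF Cq0] Ck_on_subset[OF Cr1]) auto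
 have oOm: "open Om"
 proof -
  have "Om = ?Om1 \<inter> n -` (- {0})" by (auto simp: Om_def)
  then show ?thesis using continuous_open_preimage[OF Ck_on_continuous[OF Cn1] o1, of "- {0}"] by auto
 qed
 have Om0: "Om <= ?U0" by (auto simp: Om_def)
 have Cq: "Ck_on k Om q" and CV: "Ck_on k Om V" and Cn: "Ck_on k Om n" for k
  using Ck_on_subset[OF Cq0 Om0] Ck_on_subset[OF CV0 Om0] Ck_on_subset[OF Cn1, of Om] by (auto simp: Om_def)
 have Omnz: "fst z ~= 0" "V z ~= 0" "q z ~= 0" "n z ~= 0" if "z \<in> Om" for z using that by (auto simp: Om_def)
 have CW: "Cinf_on Om W"
  unfolding W_def by (intro allI Ck_on_reflect oOm Cq CV Cn) (auto simp: Om_def)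
 have nW: "norm (W z) = norm (V z)" for z by (simp add: W_def)
 have turn: "reflect (n z) (reflect (q z) (q z)) = norm (q z) *R r1 (fst z)" if "z \<in> Om" for z
 proof -
  have "norm (q z) = norm (norm (q z) *R r1 (fst z))" using r_S(1)[OF Omnz(1)[OF that]] by simp
  from reflect_sum[OF this] have "reflect (n z) (q z) = - (norm (q z) *R r1 (fst z))"
   using Omnz(4)[OF that] by (simp add: n_def)
  then show ?thesis by (simp add: reflect_self linear_neg[OF linear_reflect])
 qed
 have VH: "norm (V z - H' z) <= 3 * de" if z: "z \<in> ?P" for z
 proof -
  have "V z - H' z = snd z *R ((P z - R z) + a + snd z *R L (0, 1))"
   using z tR[OF z] by (simp add: nx_def mem_Times_iff V_def r_M algebra_simps)
  also have "norm \<dots> <= 1 * (norm (P z - R z) + norm a + 1 * norm (L (0, 1)))"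
   unfolding norm_scaleR using z
   by (intro mult_mono order_trans[OF norm_triangle_ineq] add_mono order_refl) (auto intro: mult_left_le_one_le)
  also have "\<dots> <= 3 * de" using P(2)[OF z] a L(2)[rule_format, of "(0, 1)"] by (simp add: norm_minus_commute)
  finally show ?thesis .
 qed
 have H'S: "norm (H' z) = 1" if z: "z \<in> ?P" for z
 proof -
  have "(max 0 (2 * snd z - 1), fst z) \<in> {0..1} \<times> M" using z by auto
  then show ?thesis using H(2) by (fastforce simp: H'_def)
 qed
 have nV: "\<bar>norm (V z) - 1\<bar> <= 3 * de" if z: "z \<in> ?P" for z
  using norm_triangle_ineq3[of "V z" "H' z"] VH[OF z] H'S[OF z] by auto
 have qu: "norm (q z - u1 (fst z)) <= de" if z: "z \<in> ?P" for z
 proof -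
  have "norm (q z - u1 (fst z)) = \<bar>snd z\<bar> * norm (L (fst z, 0))"
   using z by (simp add: nx_def mem_Times_iff q_def r_M)
  also have "\<dots> <= 1 * de"
   using z L(2)[rule_format, of "(fst z, 0)"] by (intro mult_mono, auto simp: mem_Times_iff)
  finally show ?thesis by simp
 qed
 have POm: "?P <= Om"
 proof
  fix z assume z: "z \<in> ?P"
  have u: "norm (u1 (fst z)) = 1" "fst z \<in> M" using z u_S(1)[of "fst z"] by auto
  have q: "\<bar>norm (q z) - 1\<bar> <= de" using norm_triangle_ineq3[of "q z" "u1 (fst z)"] qu[OF z] u by auto
  have "norm ((1 + norm (q z)) *R u1 (fst z)) <= norm (n z) + norm (q z - u1 (fst z))"
   using norm_triangle_ineq4[of "n z" "q z - u1 (fst z)"] r_M(1)[OF u(2)] by (simp add: n_def algebra_simps)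
  then show "z \<in> Om"
   using qu[OF z] q u de nV[OF z] de(2) z by (auto simp: Om_def)
 qed
 have W0: "W (X, 0) = r2 X" if "X ~= 0" for X
 proof -
  have "q (X, 0) = r1 X" "n (X, 0) = 2 *R r1 X" "V (X, 0) = r2 X"
   using r_S(1)[OF that] by (simp_all add: q_def n_def V_def scaleR_2)
  then show ?thesis by (simp add: W_def, simp add: reflect_def inner_diff_left)
 qed
 have Wnz: "W z ~= 0" if "z \<in> Om" for z using Omnz(2)[OF that] nW[of z] by auto
 have CTheta: "Cinf_on Om (Theta W)"
  unfolding Theta_def[abs_def]
  by (intro allI Ck_on_diff Ck_on_scaleR Ck_on_mult Ck_on_norm oOm Cfst Ck_on_subset[OF Cr1 Om0] CW[rule_format])
   (use Omnz(1) Wnz in auto)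
 define nu where "nu = (%z. norm (V z) * inverse (norm (q z)))"
 have Theta_eq: "Theta W z = reflect (n z) (reflect (q z) ((nu z * norm (fst z)) *R q z - V z))" if z: "z \<in> Om" for z
  unfolding linear_diff[OF linear_reflect] linear_cmul[OF linear_reflect] turn[OF z]
  using Omnz[OF z] by (simp add: Theta_def nW nu_def W_def)
 show ?thesis
 proof (rule inessential_from_homotopy[OF oOm CW POm _ _ _ _ _ Q])
  show "fst z ~= 0 \<and> W z ~= 0" if "z \<in> Om" for z using Omnz(1)[OF that] Wnz[OF that] by simp
  show "W (x, 0) = u2 x" if "x \<in> M" for x using W0[of x] r_M(2)[OF that] that by (cases "x = 0") auto
 next
  fix x assume x: "x \<in> M"
  have z: "(x, 1) \<in> ?P" using x by simp
  show "Theta W (x, 1) ~= 0"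
  proof
   assume "Theta W (x, 1) = 0"
   then have "reflect (q (x, 1)) (reflect (n (x, 1)) (Theta W (x, 1))) = 0" by (simp add: linear_0[OF linear_reflect])
   then have e: "V (x, 1) = norm (V (x, 1)) *R (q (x, 1) /R norm (q (x, 1)))"
    using POm z x by (subst (asm) Theta_eq) (auto simp: nu_def)
   let ?r = "q (x, 1) /R norm (q (x, 1))"
   have q0: "q (x, 1) ~= 0" using Omnz(3) POm z by blast
   have u: "norm (u1 x) = 1" using u_S(1)[OF x] by simp
   have r: "norm (?r - u1 x) <= 2 * de" "norm ?r = 1"
    using normalise_near[OF u q0] qu[OF z] q0 by auto
   have "norm (V (x, 1) - ?r) = \<bar>norm (V (x, 1)) - 1\<bar>"
    by (subst e) (metis r(2) mult.right_neutral norm_scaleR scaleR_left_diff_distrib scaleR_one)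
   then have Vr: "norm (V (x, 1) - ?r) <= 3 * de" using nV[OF z] by simp
   have "norm (H (1, x) - u1 x) = norm ((H' (x, 1) - V (x, 1)) + (V (x, 1) - ?r) + (?r - u1 x))" by (simp add: H'_def)
   also have "\<dots> <= norm (H' (x, 1) - V (x, 1)) + norm (V (x, 1) - ?r) + norm (?r - u1 x)"
    by (intro order_trans[OF norm_triangle_ineq] add_mono norm_triangle_ineq order_refl)
   finally show False using cH[OF x] c(1) r(1) Vr VH[OF z] by (simp add: de_def dist_norm norm_minus_commute)
  qed
 next
  fix z y assume z: "z \<in> M \<times> {0<..<1::real}" and Th0: "Theta W z = 0"
  have zP: "z \<in> ?P" and zt: "0 < snd z" and zM: "fst z \<in> M" using z by auto
  have zOm: "z \<in> Om" using zP POm by blast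
  define ka where "ka = (%z. (nu z *R fst z, snd z))"
  let ?Om1 = "Om \<inter> (UNIV \<times> {0<..})"
  have o1: "open ?Om1" using oOm by (intro open_Int open_Times) auto
  have z1: "z \<in> ?Om1" using zOm zt by (auto simp: mem_Times_iff)
  have nupos: "0 < nu z" if "z \<in> Om" for z using Omnz[OF that] by (simp add: nu_def)
  have Cnu: "Ck_on k Om nu" for k
   unfolding nu_def by (intro Ck_on_mult Ck_on_inverse_compose Ck_on_norm oOm Cq CV) (auto simp: Om_def)
  have Cka: "Cinf_on Om ka"
   unfolding ka_def by (intro allI Ck_on_Pair Ck_on_scaleR oOm Cfst Csnd Cnu)
  have kaU: "ka z' \<in> U1" if "z' \<in> ?Om1" for z'
   using nupos[of z'] Omnz(1)[of z'] that by (auto simp: ka_def U1_def)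
  define g where "g = (%z. snd z *R (Ps (ka z) - a - L (ka z)))"
  have eq: "g z' = (nu z' * norm (fst z')) *R q z' - V z'" if z': "z' \<in> ?Om1" for z'
  proof -
   let ?X = "nu z' *R fst z'" and ?l = "L (fst (nx z'), 0)"
   have nz: "fst z' ~= 0" "0 < snd z'" "0 < nu z'" using z' Omnz nupos by auto
   have sc: "?X /R norm ?X = fst z' /R norm (fst z')" using nz by simp
   have r: "r1 ?X = r1 (fst z')" "r2 ?X = r2 (fst z')" "nx (?X, snd z') = nx z'"
    by (simp_all only: r1_def r2_def nx_def sc fst_conv snd_conv)
   have "(?X, snd z') = (nu z' * norm (fst z')) *R (fst (nx z'), 0) + snd z' *R (0, 1)" using nz by (simp add: nx_def)
   then have "L (?X, snd z') = (nu z' * norm (fst z')) *R ?l + snd z' *R L (0, 1)"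
    by (simp only: linear_add[OF L(1)] linear_cmul[OF L(1)])
   moreover have "snd z' *R Ps (?X, snd z') = (nu z' * norm (fst z')) *R r1 (fst z') - r2 (fst z') - snd z' *R P (nx z')"
    using nz by (simp add: Ps_def r scaleR_diff_right)
   ultimately show ?thesis by (simp add: g_def ka_def q_def V_def scaleR_diff_right scaleR_add_right mult.commute mult.left_commute)
  qed
  have "reflect (q z) (reflect (n z) (Theta W z)) = 0" using Th0 by (simp add: linear_0[OF linear_reflect])
  then have g0: "g z = 0" using eq[OF z1] by (simp add: Theta_eq[OF zOm])
  then have "Ps (ka z) - a - L (ka z) = 0" using zt by (simp add: g_def)
  then have Psv: "Ps (ka z) = a + L (ka z)" by (simp add: algebra_simps)
  let ?T = "%v. Df Ps (ka z) v - L v" and ?ka' = "Df ka z"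
  have Dka: "(ka has_derivative ?ka') (at z)" by (rule Cinf_has_derivative[OF Cka zOm])
  have "((%z. Ps (ka z) - a - L (ka z)) has_derivative (%w. Df Ps (ka z) (?ka' w) - 0 - L (?ka' w))) (at z)"
   by (intro has_derivative_diff has_derivative_const bounded_linear.has_derivative[OF bL] Dka
     has_derivative_compose[OF Dka Cinf_has_derivative[OF CPs kaU[OF z1]]])
  then have "(g has_derivative (%w. snd z *R ?T (?ka' w))) (at z)"
   unfolding g_def by (intro has_derivative_bilinear_zero[OF bounded_bilinear_scaleR]) (simp_all add: Psv)
  moreover have "isCont q z" "isCont n z"
   using Ck_on_continuous[OF Cq[of 0]] Ck_on_continuous[OF Cn[of 0]] continuous_on_eq_continuous_at[OF oOm] zOm by auto
  ultimately have "((%z. reflect (n z) (reflect (q z) (g z))) has_derivative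
    (%w. reflect (n z) (reflect (q z) (snd z *R ?T (?ka' w))))) (at z)"
   using Omnz[OF zOm] g0 by (intro has_derivative_reflect_zero) (simp_all add: linear_0[OF linear_reflect])
  then have "(Theta W has_derivative (%w. reflect (n z) (reflect (q z) (snd z *R ?T (?ka' w))))) (at z)"
   by (rule has_derivative_transform_within_open[OF _ o1 z1]) (simp add: eq Theta_eq)
  from frechet_derivative_eq[OF this]
  have DTh: "Df (Theta W) z w = reflect (n z) (reflect (q z) (snd z *R ?T (?ka' w)))" for w .
  define nu' where "nu' = Df nu z"
  have Dnu: "(nu has_derivative nu') (at z)" unfolding nu'_def by (rule Cinf_has_derivative[OF _ zOm]) (simp add: Cnu)
  have linnu: "linear nu'" using Dnu has_derivative_linear by blast
  have "(ka has_derivative (%w. (nu z *R fst w + nu' w *R fst z, snd w))) (at z)"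
   unfolding ka_def by (auto intro!: derivative_eq_intros Dnu)
  from frechet_derivative_eq[OF this] have dka: "?ka' w = (nu z *R fst w + nu' w *R fst z, snd w)" for w .
  have nu0: "nu' (fst z, 0) = 0"
  proof -
   have curve: "((%t. z + t *R (fst z, 0)) has_vector_derivative (fst z, 0)) (at (0::real))"
    by (auto intro!: derivative_eq_intros)
   have "((%t. nu (z + t *R (fst z, 0))) has_vector_derivative nu' (fst z, 0)) (at 0)"
    by (rule has_vector_derivative_compose[OF curve, where S=UNIV]) (use Dnu in \<open>simp_all add: zero_prod_def[symmetric]\<close>)
   then have "((%t. nu z) has_vector_derivative nu' (fst z, 0)) (at 0)"
   proof (rule has_vector_derivative_transform_within[OF _ zero_less_one])
    fix t :: real assume "dist t 0 < 1"
    then have t: "0 < 1 + t" by (simp add: dist_real_def)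
    have "fst z + t *R fst z = (1 + t) *R fst z" by (simp add: scaleR_add_left)
    then have "(fst z + t *R fst z) /R norm (fst z + t *R fst z) = fst z /R norm (fst z)" using t by simp
    then show "nu (z + t *R (fst z, 0)) = nu z" by (simp add: nu_def V_def q_def nx_def r1_def r2_def)
   qed simp
   then show ?thesis using vector_derivative_unique_at has_vector_derivative_const by blast
  qed
  have linka: "linear ?ka'" using Dka has_derivative_linear by blast
  have "inj ?ka'"
   unfolding linear_injective_0[OF linka]
  proof (intro allI impI)
   fix w assume "?ka' w = 0"
   then have w: "nu z *R fst w + nu' w *R fst z = 0" "snd w = 0" by (simp_all add: dka zero_prod_def)
   define b where "b = - nu' w / nu z"
   have "nu z *R fst w = nu z *R (b *R fst z)" using w(1) nupos[OF zOm] by (simp add: b_def add_eq_0_iff2)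
   then have "fst w = b *R fst z" using nupos[OF zOm] unfolding scaleR_cancel_left by simp
   then have ww: "w = b *R (fst z, 0)" using w(2) by (simp add: prod_eq_iff)
   have "nu' w = 0" using linear_cmul[OF linnu, of b "(fst z, 0)"] nu0 ww by simp
   then have "b = 0" by (simp add: b_def)
   then show "w = 0" by (subst ww) (simp only: scaleR_zero_left)
  qed
  then have s: "surj ?ka'" using linear_injective_imp_surjective[OF linka] by blast
  have "surj ?T" using reg kaU[OF z1] Psv by blast
  then obtain v where "reflect (q z) (reflect (n z) y) /R snd z = ?T v" by (rule surjE)
  moreover obtain w where "v = ?ka' w" using s by (rule surjE)
  ultimately have "?T (?ka' w) = reflect (q z) (reflect (n z) y) /R snd z" by simp
  then show "\<exists>w. Df (Theta W) z w = y"
   by (intro exI[of _ w]) (use zt in \<open>simp add: DTh\<close>)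
 next
  fix x y assume x: "x \<in> M" and Th0: "Theta W (x, 0) = 0"
  have xP: "(x, 0) \<in> Om" and x0: "x ~= 0" using x POm by auto
  have W0x: "W (x, 0) = u2 x" using W0[OF x0] x by (simp add: r_M)
  have "norm (W (x, 0)) = 1" using W0x u_S(2)[OF x] by simp
  then have cu: "u1 x = u2 x" using Th0 Theta_M[of "(x, 0)" W] x W0x by simp
  have DTh: "(Theta W has_derivative Df (Theta W) (x, 0)) (at (x, 0))" by (rule Cinf_has_derivative[OF CTheta xP])
  have "((%X. (X, 0::real)) has_derivative (%V. (V, 0))) (at x)" by (auto intro!: derivative_eq_intros)
  from has_derivative_compose[OF this DTh]
  have d1: "((%X. Theta W (X, 0)) has_derivative (%V. Df (Theta W) (x, 0) (V, 0))) (at x)" .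
  have "((%X. norm X *R r1 X - r2 X) has_derivative (%V. (norm x *R dr1 x V + (V \<bullet> x / norm x) *R r1 x) - dr2 x V)) (at x)"
  by (auto intro!: has_derivative_diff has_derivative_scaleR dr_has_derivative[OF x] has_derivative_norm_nonzero[OF x0])
  then have d2: "((%X. Theta W (X, 0)) has_derivative (%V. (norm x *R dr1 x V + (V \<bullet> x / norm x) *R r1 x) - dr2 x V)) (at x)"
   by (rule has_derivative_transform_within_open[of _ _ _ UNIV "- {0}"])
     (use r_S(2) x0 in \<open>auto simp: Theta_def W0\<close>)
  have D0: "Df (Theta W) (x, 0) (V, 0) = dr1 x V + (V \<bullet> x) *R u1 x - dr2 x V" for V
   using fun_cong[OF has_derivative_unique[OF d1 d2], of V] x by (simp add: r_M)
  obtain V where V: "V \<bullet> x = 0" "dr2 x V - dr1 x V = - (y - (y \<bullet> u1 x) *R u1 x)" using S_inner[OF u_S(1)[OF x]] tr x cu by (force simp: inner_diff_left transverse_u_def)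
  let ?V = "V + (y \<bullet> u1 x) *R x"
  have "Df (Theta W) (x, 0) (?V, 0) = y"
   using V(1) M_inner[OF x] V(2) by (simp add: linear_add[OF linear_dr(1)[OF x]] linear_add[OF linear_dr(2)[OF x]] linear_cmul[OF linear_dr(1)[OF x]] linear_cmul[OF linear_dr(2)[OF x]] dr_radial[OF x] inner_add_left D0 algebra_simps)
  then show "\<exists>V. Df (Theta W) (x, 0) (V, 0) = y" by blast
 qed
qed

end

context spherical_cover
begin

text \<open>
 Nearby maps into the sphere are joined by normalised segments.
\<close>

lemma near_small_homotopic:
 assumes "0 < ep"
 obtains d where "0 < d" "d < 1"
  "!!(X :: 'm::euclidean_space set) u u'. continuous_on X u ==> u ` X <= S ==> continuous_on X u' ==> u' ` X <= S ==>
   (!!x. x \<in> X ==> norm (u' x - u x) < d) ==> small_homotopic ep X N (%x. p (u x)) (%x. p (u' x))"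
proof -
 obtain d0 where d0: "d0 > 0" "!!y y'. y \<in> S ==> y' \<in> S ==> dist y' y < d0 ==> dist (p y') (p y) < ep"
  using assms compact_uniformly_continuous[OF continuous_p compact_sphere] by (auto simp: uniformly_continuous_on_def)
 define d where "d = min (d0 / 2) (1/2)"
 have d: "0 < d" "d < 1" "2 * d <= d0" using d0(1) by (auto simp: d_def)
 show thesis
 proof (rule that[OF d(1,2)])
  fix X :: "'m set" and u u'
  assume u: "continuous_on X u" "u ` X <= S" "continuous_on X u'" "u' ` X <= S"
   and near: "!!x. x \<in> X ==> norm (u' x - u x) < d"
  define w where "w = (%z. u (snd z) + fst z *R (u' (snd z) - u (snd z)))"
  have wn: "norm (w z - u (snd z)) < d" if "z \<in> {0..1::real} \<times> X" for z
  proof -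
   have "norm (w z - u (snd z)) = \<bar>fst z\<bar> * norm (u' (snd z) - u (snd z))" by (simp add: w_def)
   also have "\<dots> <= 1 * norm (u' (snd z) - u (snd z))" using that by (intro mult_right_mono, auto)
   finally show ?thesis using near[of "snd z"] that by auto
  qed
  have uS: "norm (u x) = 1" "norm (u' x) = 1" if "x \<in> X" for x using u(2,4) that by auto
  have w0: "w z ~= 0" if z: "z \<in> {0..1::real} \<times> X" for z
   using wn[OF z] d(2) uS(1)[of "snd z"] z by auto
  define h where "h = (%z. p (w z /R norm (w z)))"
  have cw: "continuous_on ({0..1::real} \<times> X) w"
   unfolding w_def by (intro continuous_intros continuous_on_compose2[OF u(1)] continuous_on_compose2[OF u(3)]) auto
  have nS: "w z /R norm (w z) \<in> S" if "z \<in> {0..1::real} \<times> X" for z using w0[OF that] by simp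
  show "small_homotopic ep X N (%x. p (u x)) (%x. p (u' x))"
   unfolding small_homotopic_def
  proof (rule homotopic_withI[of _ h])
   show "continuous_on ({0..1::real} \<times> X) h"
    unfolding h_def by (intro continuous_on_compose2[OF continuous_p] continuous_intros cw) (use w0 nS in auto)
   show "h ` ({0..1::real} \<times> X) <= N"
   by (auto simp: h_def intro!: p_in_N nS)
   show "h (0, x) = p (u x)" "h (1, x) = p (u' x)" if "x \<in> X" for x using uS[OF that] by (simp_all add: h_def w_def)
   show "\<forall>x\<in>X. dist (p (u x)) (h (t, x)) < ep" if t: "t \<in> {0..1}" for t
   proof
    fix x assume x: "x \<in> X"
    have z: "(t, x) \<in> {0..1::real} \<times> X" using t x by simp
    show "dist (p (u x)) (h (t, x)) < ep"
     using wn[OF z] d(3) u(2) x nS[OF z] d0(2) normalise_near[OF uS(1)[OF x] w0[OF z]] by (auto simp: dist_norm norm_minus_commute h_def)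
   qed
  qed auto
 qed
qed

text \<open>
 After a polynomial approximation \<open>u\<close> is smooth, say \<open>u1\<close>; its two perturbations are the normalised
 \<open>u1 x - L x\<close> and \<open>u1 x + a\<close>. They agree at \<open>x\<close> exactly if \<open>mu (u1 x - L x) = u1 x + a\<close> for some
 \<open>mu > 0\<close>, which says that \<open>(norm X - 1) u1 (X / norm X) = a + L X\<close> at \<open>X = mu x\<close>. For generic \<open>a\<close> and \<open>L\<close> the
 solutions \<open>X\<close> of this equation are regular, and this turns out to be transversality at \<open>x\<close>.
\<close>

lemma generic_pairs_exist:
 fixes u :: "'m::euclidean_space => 'f"
 assumes u: "continuous_on usphere u" "u ` usphere <= S" and "0 < ep"
 shows "\<exists>g1 g2. small_homotopic ep usphere N (%x. p (u x)) g1 \<and>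
  small_homotopic ep usphere N (%x. p (u x)) g2 \<and> generic_pair usphere N g1 g2"
proof -
 let ?M = "usphere :: 'm set"
 obtain d where d: "0 < d" "d < 1"
  "!!(X :: 'm set) u u'. continuous_on X u ==> u ` X <= S ==> continuous_on X u' ==> u' ` X <= S ==>
   (!!x. x \<in> X ==> norm (u' x - u x) < d) ==> small_homotopic ep X N (%x. p (u x)) (%x. p (u' x))"
  using near_small_homotopic[OF assms(3)] by metis
 define de where "de = min (d / 8) (et / 8)"
 have de: "0 < de" "de <= d / 8" "de <= et / 8" "de < 1/8" using d et_pos by (auto simp: de_def)
 obtain P where P: "polynomial_function P" "!!x. x \<in> ?M ==> norm (u x - P x) < de"
  using Stone_Weierstrass_polynomial_function[OF compact_sphere u(1) de(1)] by metis
 have uS: "norm (u x) = 1" if "x \<in> ?M" for x using u(2) that by (auto simp: image_subset_iff)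
 have P0: "P x ~= 0" if x: "x \<in> ?M" for x using P(2)[OF x] uS[OF x] de(4) by auto
 have CP: "Cinf_on UNIV P" by (rule Cinf_polynomial_function[OF P(1)])
 define u1 where "u1 = (%x. P x /R norm (P x))"
 have oP: "open (P -` (- {0}))"
  using open_vimage[OF _ Ck_on_continuous[OF CP[rule_format, of 0]]] by auto
 have n1: "norm (u1 x) = 1" if "x \<in> ?M" for x
  using P0 that by (simp add: u1_def image_subset_iff)
 have near1: "norm (u1 x - u x) <= 2 * de" if x: "x \<in> ?M" for x
  using normalise_near[OF uS[OF x] P0[OF x]] P(2)[OF x] by (simp add: u1_def norm_minus_commute)
 define r where "r X = u1 (X /R norm X)" for X
 have Cr: "Cinf_on (- {0}) r"
  using P0 by (auto simp: u1_def r_def[abs_def] intro!: smooth_onI[OF] Ck_on_normalise oP Ck_on_subset[OF CP[rule_format]] smooth_radial)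
 have o0: "open (- {0 :: 'm})" by auto
 have Cid: "Ck_on k (- {0 :: 'm}) (%X. X)" for k by (rule Ck_on_linear[OF bounded_linear_ident o0])
 define Ps where "Ps = (%X. (norm X - 1) *R r X)"
 have CPs: "Cinf_on (- {0}) Ps"
  unfolding Ps_def by (intro allI Ck_on_scaleR Ck_on_diff Ck_on_norm Ck_on_const Cid o0 Cr[rule_format]) auto
 obtain a L where a: "norm a < de" and L: "linear L" "\<forall>X. norm (L X) <= de * norm X"
  and reg: "\<forall>X\<in>- {0}. Ps X = a + L X --> surj (%v. Df Ps X v - L v)"
  by (rule affine_perturbation_regular[OF o0 CPs de(1)])
 have bL: "bounded_linear L" using L(1) linear_conv_bounded_linear by blast
 define q1 where "q1 X = r X - L (X /R norm X)" for X
 define q2 where "q2 X = r X + a" for X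
 define v1 where "v1 X = q1 X /R norm (q1 X)" for X
 define v2 where "v2 X = q2 X /R norm (q2 X)" for X
 have hom: "(X /R norm X) /R norm (X /R norm X) = X /R norm X" for X :: 'm by (cases "X = 0") auto
 have v_hom: "v1 (X /R norm X) = v1 X" "v2 (X /R norm X) = v2 X" for X
  by (simp_all only: v1_def v2_def q1_def q2_def r_def hom)
 have near_q: "norm (q1 X - u1 (X /R norm X)) <= de" "norm (q2 X - u1 (X /R norm X)) <= de" if "X ~= 0" for X
  using L(2)[rule_format, of "X /R norm X"] a that by (simp_all add: q1_def q2_def r_def)
 have ur: "norm (u1 (X /R norm X)) = 1" if "X ~= 0" for X by (rule n1) (use that in simp)
 have q0: "q1 X ~= 0" "q2 X ~= 0" if "X ~= 0" for X
  using near_q[OF that] ur[OF that] de(4) by auto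
 have near_v: "norm (v1 x - u1 x) <= 2 * de" "norm (v2 x - u1 x) <= 2 * de" if x: "x \<in> ?M" for x
 proof -
  have "x ~= 0" "x /R norm x = x" using x by auto
  then show "norm (v1 x - u1 x) <= 2 * de" "norm (v2 x - u1 x) <= 2 * de"
   using normalise_near[OF n1[OF x] q0(1)] normalise_near[OF n1[OF x] q0(2)] near_q[of x]
   unfolding v1_def v2_def by force+
 qed
 have "v1 X \<in> S" "v2 X \<in> S" if "X ~= 0" for X using q0[OF that] by (simp_all add: v1_def v2_def)
 moreover have "x ~= 0" if "x \<in> ?M" for x using that by auto
 ultimately have vS: "v1 ` ?M <= S" "v2 ` ?M <= S" by blast+
 have Cq: "Ck_on k (- {0}) q1" "Ck_on k (- {0}) q2" for k
  unfolding q1_def[abs_def] q2_def[abs_def]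
  by (intro Ck_on_diff Ck_on_add Ck_on_const Ck_on_comp_linear[OF bL] Ck_on_normalise Cid o0 Cr[rule_format]; simp)+
 have sv: "smooth_on ?M v1" "smooth_on ?M v2"
  unfolding v1_def[abs_def] v2_def[abs_def]
  by (rule smooth_onI[OF o0], force, intro allI Ck_on_normalise o0 Cq q0, simp)+
 interpret sphere_maps p N et v1 v2
 proof
  show "smooth_on ?M v1" "smooth_on ?M v2" "v1 ` ?M <= S" "v2 ` ?M <= S" by (rule sv vS)+
  show "dist (v1 x) (v2 x) < et" if "x \<in> ?M" for x
   using norm_triangle_ineq4[of "v1 x - u1 x" "v2 x - u1 x"] near_v[OF that] de(3) et_pos by (simp add: dist_norm)
 qed
 have r_eq: "r1 = v1" "r2 = v2" by (simp_all only: fun_eq_iff r1_def r2_def v_hom simp_thms)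
 have "transverse_u" unfolding transverse_u_def
 proof (intro ballI allI impI)
  fix x ze assume x: "x \<in> ?M" and c: "v1 x = v2 x" and ze: "ze \<bullet> v1 x = 0"
  have x0: "x ~= 0" "norm x = 1" using x by auto
  let ?n = "%X. norm (q1 X)" and ?m = "%X. norm (q2 X)"
  define mu where "mu = ?m x / ?n x"
  have mu: "0 < mu" "?m x = mu * ?n x" using q0[OF x0(1)] by (simp_all add: mu_def)
  let ?X = "mu *R x"
  have X: "?X \<in> - {0}" using mu(1) x0 by simp
  have F: "Ps (mu *R Y) - a - L (mu *R Y) = (mu * norm Y * ?n Y) *R r1 Y - ?m Y *R r2 Y" if "Y ~= 0" for Y
  proof -
   have "r (mu *R Y) = r Y" using mu(1) by (simp add: r_def field_simps)
   moreover have "L (mu *R Y) = (mu * norm Y) *R L (Y /R norm Y)" using that by (simp add: linear_cmul[OF L(1)])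
   moreover have q: "?n Y *R r1 Y = q1 Y" "?m Y *R r2 Y = q2 Y" using q0[OF that] by (simp_all add: r_eq v1_def v2_def)
   then have "(mu * norm Y * ?n Y) *R r1 Y = (mu * norm Y) *R q1 Y" unfolding scaleR_scaleR[symmetric] by simp
   moreover have "norm (mu *R Y) = mu * norm Y" using mu(1) by simp
   ultimately show ?thesis
    by (simp only: q Ps_def) (simp add: q1_def q2_def scaleR_diff_left scaleR_diff_right)
  qed
  obtain Z where Z: "- ?m x *R ze = Df Ps ?X Z - L Z"
   using F[OF x0(1)] c mu(2) x0(2) reg X by (fastforce simp: r_eq algebra_simps)
  have sc: "((%Y. mu *R Y) has_derivative (%V. mu *R V)) (at x)" by (auto intro!: derivative_eq_intros)
  have "((%Y. Ps (mu *R Y) - a - L (mu *R Y)) has_derivative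
    (%V. Df Ps ?X (mu *R V) - 0 - L (mu *R V))) (at x)"
   by (intro has_derivative_diff has_derivative_const bounded_linear.has_derivative[OF bL] sc
     has_derivative_compose[OF sc Cinf_has_derivative[OF CPs X]])
  then have d1: "((%Y. (mu * norm Y * ?n Y) *R r1 Y - ?m Y *R r2 Y) has_derivative
    (%V. Df Ps ?X (mu *R V) - 0 - L (mu *R V))) (at x)"
   by (rule has_derivative_transform_within_open[OF _ o0]) (use x0 F in auto)
  have "Cinf_on (- {0}) (%Y. mu * norm Y * ?n Y)" "Cinf_on (- {0}) ?m"
   by (intro allI Ck_on_mult Ck_on_const Ck_on_norm Cid Cq; use q0 in force)+
  then obtain n' m' where n': "((%Y. mu * norm Y * ?n Y) has_derivative n') (at x)" "(?m has_derivative m') (at x)"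
   using Cinf_has_derivative[of "- {0}" _ x] x0 by blast
  from has_derivative_unique[OF d1 has_derivative_diff[OF has_derivative_scaleR[OF n'(1) dr_has_derivative(1)[OF x]]
    has_derivative_scaleR[OF n'(2) dr_has_derivative(2)[OF x]]]]
  have D: "Df Ps ?X (mu *R V) - L (mu *R V) = ?m x *R (dr1 x V - dr2 x V) + (n' V - m' V) *R v1 x" for V
   using mu(2) x0(2) c by (auto simp: fun_eq_iff r_eq algebra_simps)
  define V where "V = Z /R mu"
  define V0 where "V0 = V - (V \<bullet> x) *R x"
  have V0: "V0 \<bullet> x = 0" using M_inner[OF x] by (simp add: V0_def inner_diff_left)
  have e: "- ?m x *R ze = ?m x *R (dr1 x V0 - dr2 x V0) + (n' V - m' V) *R v1 x"
   using D[of V] Z mu(1) by (simp add: V0_def linear_diff[OF linear_dr(1)[OF x]] linear_diff[OF linear_dr(2)[OF x]] linear_cmul[OF linear_dr(1)[OF x]] linear_cmul[OF linear_dr(2)[OF x]] dr_radial[OF x] V_def)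
  have "?m x *R ze = ?m x *R (dr2 x V0 - dr1 x V0)"
   using S_inner vS(1) x arg_cong[OF e, of "%z. z \<bullet> v1 x"] ze dr_tangent[OF x V0] c e by (auto simp: inner_add_left inner_diff_left algebra_simps)
  then show "\<exists>v. v \<bullet> x = 0 \<and> dr2 x v - dr1 x v = ze"
   using q0(2)[OF x0(1)] V0 by auto
 qed
 then have gen: "generic_pair ?M N f1 f2" by (simp add: generic_iff)
 have near_u: "norm (v x - u x) < d" if "x \<in> ?M" "norm (v x - u1 x) <= 2 * de" for x and v :: "'m => 'f"
  using norm_triangle_ineq[of "v x - u1 x" "u1 x - u x"] near1[OF that(1)] that(2) de(1,2) d(1) by simp
 show ?thesis
  using gen by (auto simp: f1_def[abs_def] f2_def[abs_def] intro!: d(3)[OF u] smooth_on_continuous sv vS near_u near_v)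
qed

end

section \<open>Homotopies from null bordisms\<close>

lemma strict_quotient_limit:
 fixes f :: "'a::euclidean_space => 'b::euclidean_space" and r :: "nat => real"
 assumes f: "open U" "Cinf_on U f" "x0 \<in> U" and xy: "x \<longlonglongrightarrow> x0" "y \<longlonglongrightarrow> x0" and r: "!!n. 0 < r n"
  and v: "(%n. (y n - x n) /R r n) \<longlonglongrightarrow> v"
 shows "(%n. (f (y n) - f (x n)) /R r n) \<longlonglongrightarrow> Df f x0 v"
proof -
 let ?D = "Df f x0" and ?v = "%n. (y n - x n) /R r n"
 have bl: "bounded_linear ?D" using Cinf_has_derivative[OF f(2,3)] has_derivative_bounded_linear by blast
 have "(%n. (f (y n) - f (x n)) /R r n - ?D (?v n)) \<longlonglongrightarrow> 0"
 proof (rule tendstoI)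
  fix ep :: real assume ep: "0 < ep"
  have K: "0 < norm v + 1" using norm_ge_zero[of v] by linarith
  obtain d where d: "0 < d" "!!x y. x \<in> ball x0 d ==> y \<in> ball x0 d ==>
    norm (f y - f x - ?D (y - x)) <= ep / (norm v + 1) * norm (y - x)"
   using Cinf_strict_derivative[OF f divide_pos_pos[OF ep K]] by metis
  have "\<forall>\<^sub>F n in sequentially. x n \<in> ball x0 d" "\<forall>\<^sub>F n in sequentially. y n \<in> ball x0 d"
   using topological_tendstoD[OF xy(1), of "ball x0 d"] topological_tendstoD[OF xy(2), of "ball x0 d"] d(1) by auto
  moreover have "\<forall>\<^sub>F n in sequentially. norm (?v n) < norm v + 1"
   using tendsto_norm[OF v] by (rule order_tendstoD) simp
  ultimately show "\<forall>\<^sub>F n in sequentially. dist ((f (y n) - f (x n)) /R r n - ?D (?v n)) 0 < ep"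
  proof eventually_elim
   case (elim n)
   have "(f (y n) - f (x n)) /R r n - ?D (?v n) = (f (y n) - f (x n) - ?D (y n - x n)) /R r n"
    by (simp only: linear_cmul[OF bounded_linear.linear[OF bl]]) (simp add: scaleR_diff_right)
   then have "norm ((f (y n) - f (x n)) /R r n - ?D (?v n)) <= ep / (norm v + 1) * norm (y n - x n) / r n"
    using d(2)[OF elim(1,2)] r[of n] by (simp add: divide_right_mono divide_inverse)
   also have "\<dots> = ep / (norm v + 1) * norm (?v n)" using r[of n] by (simp add: divide_inverse)
   also have "\<dots> < ep / (norm v + 1) * (norm v + 1)" using elim(3) ep K by (intro mult_strict_left_mono) auto
   also have "\<dots> = ep" using K by simp
   finally show ?case by simp
  qed
 qed
 from tendsto_add[OF this bounded_linear.tendsto[OF bl v]] show ?thesis by simp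
qed

lemma Cinf_lipschitz:
 fixes f :: "'a::euclidean_space => 'b::euclidean_space"
 assumes "open U" "Cinf_on U f" "x0 \<in> U"
 obtains d K where "0 < d" "0 < K" "ball x0 d <= U"
  "!!x y. x \<in> ball x0 d ==> y \<in> ball x0 d ==> norm (f y - f x) <= K * norm (y - x)"
proof -
 obtain d where d: "0 < d" "ball x0 d <= U"
  "!!x y. x \<in> ball x0 d ==> y \<in> ball x0 d ==>
    norm (f y - f x - Df f x0 (y - x)) <= 1 * norm (y - x)"
  using Cinf_strict_derivative[OF assms, of 1] by auto
 obtain K where K: "K > 0" "!!v. norm (Df f x0 v) <= norm v * K"
  using Cinf_has_derivative[OF assms(2,3)] bounded_linear.pos_bounded by blast
 show thesis
 proof (rule that[of d "K + 1"])
  fix x y assume xy: "x \<in> ball x0 d" "y \<in> ball x0 d"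
  have "norm (f y - f x) <= norm (f y - f x - Df f x0 (y - x)) + norm (Df f x0 (y - x))"
   by (metis diff_add_cancel norm_triangle_ineq)
  also have "\<dots> <= (K + 1) * norm (y - x)" using d(3)[OF xy] K(2)[of "y - x"] by (simp add: algebra_simps)
  finally show "norm (f y - f x) <= (K + 1) * norm (y - x)" .
 qed (use d K in auto)
qed

lemma abs_snd_le: "\<bar>snd z\<bar> <= norm (z :: 'a::real_normed_vector \<times> real)"
 by (metis norm_snd_le prod.collapse real_norm_def)

text \<open>
 The normal bundle of \<open>B\<close> is given by the linear maps \<open>A b\<close>, which vanish on the
 tangent space of \<open>B\<close>.
\<close>

locale null_bordism = sphere_maps p N et u1 u2
 for p :: "'f::euclidean_space => 'c::euclidean_space" and N et
  and u1 :: "'m::euclidean_space => 'f" and u2 +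
 fixes B :: "('m \<times> real) set" and A :: "'m \<times> real => 'm \<times> real => 'c"
 assumes B_sub: "B <= usphere \<times> {0..1}" and compact_B: "compact B"
  and B_manifold: "submanifold_with_boundary B"
  and B_boundary: "manifold_boundary B = B \<inter> (usphere \<times> {0, 1})"
  and B_ends: "B \<inter> (usphere \<times> {0, 1}) = coincidence_set usphere f1 f2 \<times> {0}"
  and B_transverse: "!!b. b \<in> coincidence_set usphere f1 f2 \<times> {0} ==>
    transverse_at B id (usphere \<times> {0..1}) (usphere \<times> {0}) b"
  and B_iso: "normal_bundle_iso B (usphere \<times> {0..1}) N (%b. f1 (fst b)) A"
  and A_canonical: "!!x v. x \<in> coincidence_set usphere f1 f2 ==> v \<in> tangent_space usphere x ==>
    A (x, 0) (v, 0) = canonical_normal_map usphere f1 f2 x v"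
begin

abbreviation "P \<equiv> M \<times> {0..1::real}"
definition "C = coincidence_set M f1 f2"

lemma C_iff: "x \<in> C \<longleftrightarrow> x \<in> M \<and> u1 x = u2 x"
 by (simp add: C_def coincidence_u)

lemma B_zero: "b \<in> B ==> snd b = 0 ==> fst b \<in> C"
 and C_in_B: "x \<in> C ==> (x, 0) \<in> B"
 and B_one: "b \<in> B ==> snd b ~= 1"
proof -
 assume b: "b \<in> B" and "snd b = 0"
 then show "fst b \<in> C" using B_sub B_ends by (fastforce simp: C_def)
next
 assume "x \<in> C"
 then show "(x, 0) \<in> B" using B_ends by (auto simp: C_def)
next
 assume b: "b \<in> B"
 show "snd b ~= 1"
 proof
  assume "snd b = 1"
  then have "b \<in> B \<inter> (M \<times> {0, 1})" using B_sub b by auto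
  then show False using B_ends \<open>snd b = 1\<close> by (auto simp: mem_Times_iff)
 qed
qed

lemma tangent_P: "z \<in> P ==> tangent_space P z = {v. fst v \<bullet> fst z = 0}"
proof -
 assume z: "z \<in> P"
 have "tangent_space P (fst z, snd z) = tangent_space M (fst z) \<times> tangent_space {0..1} (snd z)"
  by (rule tangent_space_Times) (use z in \<open>auto simp: mem_Times_iff\<close>)
 then show ?thesis using z tangent_space_sphere[of "fst z"] tangent_space_interval[of "snd z"]
  by (auto simp: mem_Times_iff)
qed

lemma B_in: "b \<in> B ==> b \<in> P" "b \<in> B ==> fst b \<in> M" "b \<in> B ==> 0 <= snd b" "b \<in> B ==> u1 (fst b) \<in> S"
 using B_sub u_S(1) by (auto simp: mem_Times_iff simp del: mem_sphere mem_sphere_0)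

lemma tangent_B: "b \<in> B ==> v \<in> tangent_space B b \<longleftrightarrow> fst v \<bullet> fst b = 0 \<and> A b v = 0"
 using B_iso tangent_P[OF B_in(1)] unfolding normal_bundle_iso_def by blast

lemma local_chart:
 assumes b0: "b0 \<in> B"
 obtains L w U V ph ps where "chart_data B b0 L w U V ph ps" "snd b0 ~= 0 ==> w = 0" "snd b0 = 0 ==> w ~= 0"
proof (cases "snd b0 = 0")
 case True
 then have "b0 \<in> manifold_boundary B"
  unfolding B_boundary using b0 B_sub by (auto simp: mem_Times_iff)
 then obtain L w where "submanifold_chart B b0 L w" "w ~= 0" unfolding manifold_boundary_def by auto
 moreover from this(1) obtain U V ph ps where "chart_data B b0 L w U V ph ps" by (rule chart_dataE)
 ultimately show ?thesis using that True by blast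
next
 case False
 obtain L w where c: "submanifold_chart B b0 L w" using B_manifold b0 unfolding submanifold_with_boundary_def by blast
 then obtain U V ph ps where "chart_data B b0 L w U V ph ps" by (rule chart_dataE)
 moreover have "w = 0"
 proof (rule ccontr)
  assume "w ~= 0"
  then have "b0 \<in> manifold_boundary B" unfolding manifold_boundary_def using b0 c by blast
  then show False unfolding B_boundary using False B_one[OF b0] by (auto simp: mem_Times_iff)
 qed
 ultimately show ?thesis using that False by blast
qed

text \<open>
 The time vanishes on the boundary hyperplane of the chart, and by transversality its derivative
 does not. So it is a positive multiple of \<open>w \<bullet> u\<close>, with an error of at most one half.
\<close>

lemma boundary_chart_time:
 assumes b0: "b0 \<in> B" "snd b0 = 0" and ch: "chart_data B b0 L w U V ph ps" and w: "w ~= 0"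
 obtains r ka where "0 < r" "0 < ka" "ball 0 r <= V"
  "!!u. u \<in> L ==> norm u < r ==> w \<bullet> u = 0 ==> ps u \<in> C \<times> {0}"
  "!!u. u \<in> L ==> norm u < r ==> \<bar>snd (ps u) - 2 * ka * (w \<bullet> u)\<bar> <= ka * \<bar>w \<bullet> u\<bar>"
proof -
 let ?D = "Df ps 0"
 have V: "open V" "0 \<in> V" "Cinf_on V ps" "ps 0 = b0" "subspace L" "w \<in> L"
  using chart_open[OF ch] chart_0V[OF ch] chart_smooth[OF ch] chart_ps0[OF ch] chart_sub[OF ch] by auto
 have dD: "(ps has_derivative ?D) (at 0)" by (rule Cinf_has_derivative[OF V(3,2)])
 have lin: "linear ?D" using dD has_derivative_linear by blast
 have zero: "ps u \<in> C \<times> {0}" if u: "u \<in> L" "u \<in> V" "w \<bullet> u = 0" for u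
 proof -
  have "ps u \<in> B" by (rule chart_mem[OF ch u(2,1)]) (use u(3) in simp)
  moreover have "submanifold_chart B (ps u) L w" by (rule chart_shift[OF ch u(2,1,3)])
  ultimately have "ps u \<in> manifold_boundary B" unfolding manifold_boundary_def using w by blast
  then show ?thesis unfolding B_boundary B_ends C_def .
 qed
 have tan0: "snd (?D u) = 0" if u: "u \<in> L" "w \<bullet> u = 0" for u
 proof -
  obtain r0 where r0: "0 < r0" "ball 0 r0 <= V" using V(1,2) openE by blast
  have "((%t::real. t *R u) has_vector_derivative u) (at 0)" by (auto intro!: derivative_eq_intros)
  from has_vector_derivative_compose[OF this, of ps ?D UNIV] dD
  have "((%t. ps (t *R u)) has_vector_derivative ?D u) (at 0)" by simp
  from bounded_linear.has_vector_derivative[OF bounded_linear_snd this]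
  have "((%t. snd (ps (t *R u))) has_vector_derivative snd (?D u)) (at 0)" .
  moreover have "0 < r0 / (norm u + 1)" using r0(1) norm_ge_zero[of u] by (intro divide_pos_pos) linarith+
  ultimately have "((%t. 0) has_vector_derivative snd (?D u)) (at 0)"
  proof (rule has_vector_derivative_transform_within)
   fix t :: real assume "dist t 0 < r0 / (norm u + 1)"
   then have "ps (t *R u) \<in> C \<times> {0}"
    using norm_ge_zero[of u] r0(2) u V(5) by (auto simp: field_simps subspace_scale intro!: zero)
   then show "snd (ps (t *R u)) = 0" by auto
  qed simp
  then show ?thesis using vector_derivative_unique_at has_vector_derivative_const by blast
 qed
 have ww: "0 < w \<bullet> w" using w by simp
 define c where "c = snd (?D w)"
 have decomp: "snd (?D u) = (w \<bullet> u) / (w \<bullet> w) * c" if u: "u \<in> L" for u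
 proof -
  let ?u0 = "u - ((w \<bullet> u) / (w \<bullet> w)) *R w"
  have "snd (?D ?u0) = 0"
   using u V(5,6) by (auto simp: inner_diff_right intro!: subspace_diff subspace_scale tan0)
  then show ?thesis by (simp add: linear_diff[OF lin] linear_cmul[OF lin] c_def)
 qed
 have "c ~= 0"
 proof
  assume c0: "c = 0"
  have tr: "{differential B id b0 v + w |v w. v \<in> tangent_space B b0 \<and> w \<in> tangent_space (M \<times> {0}) b0} = tangent_space P b0"
   using B_zero[OF b0] b0(2) B_transverse by (simp add: mem_Times_iff C_def transverse_at_def)
  obtain v y where vy: "(0, 1) = differential B id b0 v + y" "v \<in> tangent_space B b0" "y \<in> tangent_space (M \<times> {0}) b0"
   using tangent_P[OF B_in(1)[OF b0(1)]] by (fastforce simp: tr[symmetric])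
  have "tangent_space (M \<times> {0::real}) (fst b0, 0) = tangent_space M (fst b0) \<times> {0}"
   using tangent_space_Times[of "fst b0" M "0::real" "{0}"] B_in(2)[OF b0(1)] tangent_space_singleton[of "0::real"] by simp
  then have "snd y = 0" using vy(3) b0(2) by (metis mem_Times_iff prod.collapse singletonD)
  moreover have "differential B id b0 v = v" using differential_eq[OF has_derivative_id vy(2)] by simp
  moreover obtain u where "u \<in> L" "v = ?D u" using vy(2) chart_tangent_space[OF ch] by blast
  ultimately have "snd (0 :: 'm, 1 :: real) = 0" using vy(1) decomp[of u] c0 by auto
  then show False by simp
 qed
 then have k0: "c / (2 * (w \<bullet> w)) ~= 0" using ww by simp
 define ka where "ka = c / (2 * (w \<bullet> w))"
 define e where "e = \<bar>ka\<bar> * norm w"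
 have e0: "0 < e" using k0 w by (simp add: e_def ka_def)
 obtain d where d: "0 < d" "ball 0 d <= V" "!!x y. x \<in> ball 0 d ==> y \<in> ball 0 d ==>
    norm (ps y - ps x - ?D (y - x)) <= e * norm (y - x)"
  using Cinf_strict_derivative[OF V(1,3,2) e0] by metis
 define r where "r = d / 2"
 have main: "\<bar>snd (ps u) - 2 * ka * (w \<bullet> u)\<bar> <= \<bar>ka\<bar> * \<bar>w \<bullet> u\<bar>" if u: "u \<in> L" "norm u < r" for u
 proof -
  let ?t = "(w \<bullet> u) / (w \<bullet> w)"
  let ?u0 = "u - ?t *R w"
  have nt: "norm (?t *R w) = \<bar>w \<bullet> u\<bar> / norm w"
   by (simp add: dot_square_norm power2_eq_square)
  also have "\<dots> <= norm u" using Cauchy_Schwarz_ineq2[of w u] w by (simp add: field_simps)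
  finally have "norm ?u0 < d" using u(2) norm_triangle_ineq4[of u "?t *R w"] by (simp add: r_def)
  moreover have "norm u < d" using u(2) d(1) by (simp add: r_def)
  ultimately have *: "norm (ps u - ps ?u0 - ?D (u - ?u0)) <= e * norm (u - ?u0)" by (intro d(3)) auto
  have "snd (ps ?u0) = 0"
   using u(1) V(5,6) ww \<open>norm ?u0 < d\<close> d(2) zero[of ?u0] by (fastforce simp: inner_diff_right intro: subspace_diff subspace_scale)
  moreover have "u - ?u0 = ?t *R w" by simp
  moreover have "snd (?D (?t *R w)) = 2 * ka * (w \<bullet> u)"
   by (simp add: linear_cmul[OF lin] c_def[symmetric] ka_def)
  moreover have "e * norm (?t *R w) = \<bar>ka\<bar> * \<bar>w \<bullet> u\<bar>" unfolding nt e_def using w by simp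
  ultimately show ?thesis using * abs_snd_le[of "ps u - ps ?u0 - ?D (u - ?u0)"] by simp
 qed
 have "0 < ka"
 proof (rule ccontr)
  assume "\<not> 0 < ka"
  define s where "s = d / (4 * norm w)"
  have s: "0 < s" "norm (s *R w) < r" using d(1) w by (auto simp: s_def r_def)
  have sL: "s *R w \<in> L" using V(5,6) by (auto simp: subspace_scale)
  have "ps (s *R w) \<in> B" by (rule chart_mem[OF ch _ sL]) (use s d in \<open>auto simp: r_def\<close>)
  then have "0 <= snd (ps (s *R w))" by (rule B_in)
  moreover have "0 < s * (w \<bullet> w)" using s(1) ww by simp
  moreover have "ka < 0" using \<open>\<not> 0 < ka\<close> k0 unfolding ka_def by linarith
  moreover have "ka * (s * (w \<bullet> w)) < 0" using \<open>ka < 0\<close> \<open>0 < s * (w \<bullet> w)\<close> by (rule mult_neg_pos)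
  moreover have "2 * ka * (w \<bullet> s *R w) = 2 * (ka * (s * (w \<bullet> w)))" "\<bar>ka\<bar> * \<bar>w \<bullet> s *R w\<bar> = - (ka * (s * (w \<bullet> w)))"
   using \<open>ka < 0\<close> s(1) by auto
  ultimately show False using main[OF sL s(2)] by auto
 qed
 show thesis
 proof (rule that[of r ka])
  show "0 < r" "ball 0 r <= V" using d(1,2) by (auto simp: r_def)
  fix u assume u: "u \<in> L" "norm u < r"
  show "ps u \<in> C \<times> {0}" if "w \<bullet> u = 0"
   by (rule zero[OF u(1) _ that]) (use u(2) d(1,2) in \<open>auto simp: r_def\<close>)
  show "\<bar>snd (ps u) - 2 * ka * (w \<bullet> u)\<bar> <= ka * \<bar>w \<bullet> u\<bar>" using main[OF u] \<open>0 < ka\<close> by simp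
 qed (rule \<open>0 < ka\<close>)
qed

text \<open>A point \<open>u\<close> of \<open>L\<close> outside the half space is moved to its boundary hyperplane. Its image
 has negative time, proportional to the distance of that move.\<close>

lemma boundary_projection:
 assumes b0: "b0 \<in> B" "snd b0 = 0" and ch: "chart_data B b0 L w U V ph ps" and w: "w ~= 0"
 obtains r K where "0 < r" "0 < K" "ball 0 r <= V"
  "!!u. u \<in> L ==> norm u < r ==> \<exists>x\<in>C. dist (ps u) (x, 0) <= K * \<bar>snd (ps u)\<bar>"
  "!!u. u \<in> L ==> norm u < r ==> w \<bullet> u < 0 ==> snd (ps u) < 0"
proof -
 obtain r ka where r: "0 < r" "0 < ka" "ball 0 r <= V"
  "!!u. u \<in> L ==> norm u < r ==> w \<bullet> u = 0 ==> ps u \<in> C \<times> {0}"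
  "!!u. u \<in> L ==> norm u < r ==> \<bar>snd (ps u) - 2 * ka * (w \<bullet> u)\<bar> <= ka * \<bar>w \<bullet> u\<bar>"
  by (rule boundary_chart_time[OF b0 ch w]) (rule that)
 obtain d K where d: "0 < d" "0 < K" "!!x y. x \<in> ball 0 d ==> y \<in> ball 0 d ==> norm (ps y - ps x) <= K * norm (y - x)"
  using Cinf_lipschitz[OF chart_open(2)[OF ch] chart_smooth(2)[OF ch] chart_0V[OF ch]] by metis
 let ?m = "min r d / 2"
 show thesis
 proof (rule that[of ?m "K / (ka * norm w)"])
  show "0 < ?m" "0 < K / (ka * norm w)" "ball 0 ?m <= V" using r(1-3) d(1,2) w by auto
  fix u assume u: "u \<in> L" "norm u < ?m"
  then have ur: "norm u < r" "norm u < d" using r(1) d(1) by auto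
  let ?u = "u - ((w \<bullet> u) / (w \<bullet> w)) *R w"
  have nt: "norm (((w \<bullet> u) / (w \<bullet> w)) *R w) = \<bar>w \<bullet> u\<bar> / norm w"
   by (simp add: dot_square_norm power2_eq_square)
  also have "\<dots> <= norm u" using Cauchy_Schwarz_ineq2[of w u] w by (simp add: field_simps)
  finally have nu: "norm ?u < r" "norm ?u < d"
   using u(2) norm_triangle_ineq4[of u "((w \<bullet> u) / (w \<bullet> w)) *R w"] by auto
  have "ps ?u \<in> C \<times> {0}"
   by (rule r(4)[OF _ nu(1)])
    (use u(1) chart_sub[OF ch] w in \<open>auto simp: inner_diff_right intro!: subspace_diff subspace_scale\<close>)
  moreover have "dist (ps u) (ps ?u) <= K * (\<bar>w \<bullet> u\<bar> / norm w)"
   using d(3)[of ?u u] nu ur unfolding nt[symmetric] dist_norm by simp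
  moreover have "K * (\<bar>w \<bullet> u\<bar> / norm w) <= K / (ka * norm w) * \<bar>snd (ps u)\<bar>"
   using r(5)[OF u(1) ur(1)] r(2) d(2) w by (simp add: field_simps)
  ultimately have *: "ps ?u \<in> C \<times> {0}" "dist (ps u) (ps ?u) <= K / (ka * norm w) * \<bar>snd (ps u)\<bar>"
   by auto
  then show "\<exists>x\<in>C. dist (ps u) (x, 0) <= K / (ka * norm w) * \<bar>snd (ps u)\<bar>"
   by auto
  show "snd (ps u) < 0" if "w \<bullet> u < 0" 
  proof -
   have "ka * (w \<bullet> u) < 0" using that r(2) by (simp add: mult_pos_neg)
   then show ?thesis using r(5)[OF u(1) ur(1)] that by auto
  qed
 qed
qed

lemma chart_distance:
 assumes b0: "b0 \<in> B"
 obtains L w U V ph ps r K where "chart_data B b0 L w U V ph ps" "0 < r" "0 < K" "ball 0 r <= V"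
  "!!u z. u \<in> L ==> norm u < r ==> 0 <= snd z ==> infdist z B <= K * dist z (ps u)"
proof -
 obtain L w U V ph ps where ch: "chart_data B b0 L w U V ph ps" "snd b0 ~= 0 ==> w = 0" "snd b0 = 0 ==> w ~= 0"
  by (rule local_chart[OF b0]) (rule that)
 show thesis
 proof (cases "snd b0 = 0")
  case False
  obtain r where r: "0 < r" "ball 0 r <= V" using chart_open[OF ch(1)] chart_0V[OF ch(1)] openE by blast
  have "infdist z B <= 1 * dist z (ps u)" if "u \<in> L" "norm u < r" for u z
   using infdist_le[OF chart_mem[OF ch(1), of u], of z] that ch(2) False r(2) by auto
  then show ?thesis using that[OF ch(1) r(1) _ r(2), of 1] by auto
 next
  case True
  obtain r K where r: "0 < r" "0 < K" "ball 0 r <= V"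
   "!!u. u \<in> L ==> norm u < r ==> \<exists>x\<in>C. dist (ps u) (x, 0) <= K * \<bar>snd (ps u)\<bar>"
   "!!u. u \<in> L ==> norm u < r ==> w \<bullet> u < 0 ==> snd (ps u) < 0"
   by (rule boundary_projection[OF b0 True ch(1) ch(3)[OF True]]) (rule that)
  have "infdist z B <= (K + 1) * dist z (ps u)" if u: "u \<in> L" "norm u < r" and z: "0 <= snd z" for u z
  proof (cases "0 <= w \<bullet> u")
   case True
   have "infdist z B <= dist z (ps u)"
    by (intro infdist_le chart_mem[OF ch(1) _ u(1) True]) (use u(2) r(3) in auto)
   moreover have "0 <= K * dist z (ps u)" using r(2) by simp
   ultimately show ?thesis by (simp add: algebra_simps)
  next
   case False
   obtain x where x: "x \<in> C" "dist (ps u) (x, 0) <= K * \<bar>snd (ps u)\<bar>" using r(4)[OF u] by auto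
   have "K * \<bar>snd (ps u)\<bar> <= K * dist z (ps u)"
    using r(5)[OF u] False z abs_snd_le[of "z - ps u"] r(2) by (intro mult_left_mono; simp add: dist_norm)
   then show ?thesis using infdist_le[OF C_in_B[OF x(1)], of z] x(2) dist_triangle[of z "(x, 0)" "ps u"]
    by (simp add: algebra_simps)
  qed
  then show ?thesis using that[OF ch(1) r(1) _ r(3), of "K + 1"] r(2) by auto
 qed
qed

text \<open>
 By the same estimate a point of \<open>B\<close> at a small time has a distance from \<open>C\<close> which is at most
 proportional to the time.
\<close>

lemma near_ends:
 obtains K where "0 < K" "!!b. b \<in> B ==> K * snd b < 1 ==> \<exists>x\<in>C. dist b (x, 0) <= K * snd b"
proof (rule ccontr)
 assume "\<not> thesis"
 then have "\<forall>n. \<exists>b. b \<in> B \<and> real (Suc n) * snd b < 1 \<and> (\<forall>x\<in>C. real (Suc n) * snd b < dist b (x, 0))"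
  using that by (meson not_less of_nat_0_less_iff zero_less_Suc)
 from choice[OF this] obtain b where b: "!!n. b n \<in> B" "!!n. real (Suc n) * snd (b n) < 1"
  "!!n x. x \<in> C ==> real (Suc n) * snd (b n) < dist (b n) (x, 0)" by auto
 obtain b0 s where b0: "b0 \<in> B" "strict_mono s" "(b \<circ> s) \<longlonglongrightarrow> b0"
  using compact_B b(1) unfolding compact_def by blast
 have "(%n. snd (b (s n))) \<longlonglongrightarrow> 0"
 proof (rule tendsto_sandwich[OF _ _ tendsto_const])
  show "(%n. 1 / real (Suc (s n))) \<longlonglongrightarrow> 0"
   using LIMSEQ_subseq_LIMSEQ[OF lim_1_over_n[THEN LIMSEQ_Suc] b0(2)] by (simp add: o_def)
 qed (use b(2) B_in(3)[OF b(1)] in \<open>auto simp: field_simps less_imp_le intro!: always_eventually\<close>)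
 then have 0: "snd b0 = 0" using tendsto_snd[OF b0(3)] LIMSEQ_unique by auto
 obtain L w U V ph ps where ch: "chart_data B b0 L w U V ph ps" "snd b0 = 0 ==> w ~= 0"
  by (rule local_chart[OF b0(1)]) (rule that)
 obtain r K where r: "0 < r" "0 < K" "ball 0 r <= V"
  "!!u. u \<in> L ==> norm u < r ==> \<exists>x\<in>C. dist (ps u) (x, 0) <= K * \<bar>snd (ps u)\<bar>"
  by (rule boundary_projection[OF b0(1) 0 ch(1) ch(2)[OF 0]]) (rule that)
 have "(%n. ph (b (s n))) \<longlonglongrightarrow> 0"
  using chart_smooth(1)[OF ch(1)] chart_open(1)[OF ch(1)] chart_x[OF ch(1)] Ck_on_continuous continuous_on_eq_continuous_at isCont_tendsto_compose[OF _ b0(3), of ph] chart_0[OF ch(1)] by fastforce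
 then have "\<forall>\<^sub>F n in sequentially. ph (b (s n)) \<in> ball 0 r" by (rule topological_tendstoD) (use r(1) in auto)
 moreover have "\<forall>\<^sub>F n in sequentially. b (s n) \<in> U"
  using topological_tendstoD[OF b0(3) chart_open(1)[OF ch(1)] chart_x[OF ch(1)]] by simp
 moreover have "\<forall>\<^sub>F n in sequentially. K < real (Suc (s n))"
 proof -
  have "\<forall>\<^sub>F n in sequentially. nat \<lceil>K\<rceil> <= n" by (rule eventually_ge_at_top)
  then show ?thesis by eventually_elim (use seq_suble[OF b0(2)] in \<open>smt (verit) of_nat_Suc of_nat_mono real_nat_ceiling_ge\<close>)
 qed
 ultimately have "\<forall>\<^sub>F n in sequentially. ph (b (s n)) \<in> ball 0 r \<and> b (s n) \<in> U \<and> K < real (Suc (s n))"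
  by eventually_elim simp
 from eventually_happens'[OF sequentially_bot this] obtain n where
  n: "ph (b (s n)) \<in> ball 0 r" "b (s n) \<in> U" "K < real (Suc (s n))" by auto
 obtain x where x: "x \<in> C" "dist (ps (ph (b (s n)))) (x, 0) <= K * \<bar>snd (ps (ph (b (s n))))\<bar>"
  using r(4)[OF chart_coord(1)[OF ch(1) b(1) n(2)]] n(1) by auto
 have "dist (b (s n)) (x, 0) <= K * snd (b (s n))"
  using x(2) B_in(3)[OF b(1)[of "s n"]] by (simp add: chart_psph[OF ch(1) n(2)])
 also have "\<dots> <= real (Suc (s n)) * snd (b (s n))" using n(3) B_in(3)[OF b(1)] by (intro mult_right_mono) auto
 finally show False using b(3)[OF x(1), of "s n"] by simp
qed

text \<open>Blown up around a point of \<open>B\<close>, the set \<open>B\<close> converges to its tangent space there.\<close>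

lemma chord_limit_tangent:
 assumes b: "!!n. b n \<in> B" "!!n. b' n \<in> B" "b \<longlonglongrightarrow> b0" "b' \<longlonglongrightarrow> b0" "b0 \<in> B"
  and r: "!!n. 0 < r n" and v: "(%n. (b' n - b n) /R r n) \<longlonglongrightarrow> v"
 shows "v \<in> tangent_space B b0"
proof -
 obtain L w U V ph ps where ch: "chart_data B b0 L w U V ph ps" by (rule local_chart[OF b(5)]) (rule that)
 have "(%n. (ph (b' n) - ph (b n)) /R r n) \<longlonglongrightarrow> Df ph b0 v"
  by (rule strict_quotient_limit[OF chart_open(1)[OF ch] chart_smooth(1)[OF ch] chart_x[OF ch] b(3,4) r v])
 moreover have "\<forall>\<^sub>F n in sequentially. (ph (b' n) - ph (b n)) /R r n \<in> L"
  using topological_tendstoD[OF b(3) chart_open(1)[OF ch] chart_x[OF ch]]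
   topological_tendstoD[OF b(4) chart_open(1)[OF ch] chart_x[OF ch]]
  by eventually_elim (intro subspace_scale subspace_diff chart_coord(1)[OF ch] chart_sub[OF ch] b(1,2))
 ultimately have "Df ph b0 v \<in> L"
  by (intro Lim_in_closed_set[OF closed_subspace[OF chart_sub(1)[OF ch]]]) auto
 then show ?thesis unfolding chart_tangent_space[OF ch] by (metis chart_Dpsph[OF ch] imageI)
qed

text \<open>
 Points which lie in a tangent direction from \<open>B\<close> are much nearer to \<open>B\<close> than \<open>r\<close>. Their times must not
 be negative, since \<open>B\<close> may end at the time 0.
\<close>

lemma tangent_approximation:
 assumes b: "!!n. b n \<in> B" "b \<longlonglongrightarrow> b0" "b0 \<in> B" and r: "!!n. 0 < r n" "r \<longlonglongrightarrow> 0"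
  and z: "!!n. 0 <= snd (z n)" and v: "(%n. (z n - b n) /R r n) \<longlonglongrightarrow> v" "v \<in> tangent_space B b0"
 shows "(%n. infdist (z n) B / r n) \<longlonglongrightarrow> 0"
proof -
 obtain L w U V ph ps rh K where ch: "chart_data B b0 L w U V ph ps" and rh: "0 < rh" "0 < K" "ball 0 rh <= V"
  "!!u z. u \<in> L ==> norm u < rh ==> 0 <= snd z ==> infdist z B <= K * dist z (ps u)"
  by (rule chart_distance[OF b(3)]) (rule that)
 obtain u0 where u0: "u0 \<in> L" "v = Df ps 0 u0" using v(2) unfolding chart_tangent_space[OF ch] by blast
 define u where "u n = ph (b n) + r n *R u0" for n
 have phb: "(%n. ph (b n)) \<longlonglongrightarrow> 0"
  using chart_smooth(1)[OF ch] chart_open(1)[OF ch] chart_x[OF ch] Ck_on_continuous continuous_on_eq_continuous_at isCont_tendsto_compose[OF _ b(2), of ph] chart_0[OF ch] by fastforce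
 then have u: "u \<longlonglongrightarrow> 0" unfolding u_def using tendsto_add[OF phb tendsto_scaleR[OF r(2) tendsto_const[of u0]]] by simp
 have "(u n - ph (b n)) /R r n = u0" for n using r(1)[of n] by (simp add: u_def)
 then have "(%n. (ps (u n) - ps (ph (b n))) /R r n) \<longlonglongrightarrow> v"
  unfolding u0(2) using chart_0V[OF ch]
  by (intro strict_quotient_limit[OF chart_open(2)[OF ch] chart_smooth(2)[OF ch] _ phb u r(1)]) auto
 from tendsto_mult_left[OF tendsto_norm[OF tendsto_diff[OF v(1) this]], of K]
 have lim: "(%n. K * norm ((z n - b n) /R r n - (ps (u n) - ps (ph (b n))) /R r n)) \<longlonglongrightarrow> 0" by simp
 show ?thesis
 proof (rule Lim_null_comparison[OF _ lim])
  have "\<forall>\<^sub>F n in sequentially. u n \<in> ball 0 rh" by (rule topological_tendstoD[OF u]) (use rh(1) in auto)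
  then show "\<forall>\<^sub>F n in sequentially. norm (infdist (z n) B / r n)
    <= K * norm ((z n - b n) /R r n - (ps (u n) - ps (ph (b n))) /R r n)"
   using topological_tendstoD[OF b(2) chart_open(1)[OF ch] chart_x[OF ch]]
  proof eventually_elim
   case (elim n)
   have "u n \<in> L" unfolding u_def
    by (intro subspace_add subspace_scale chart_coord(1)[OF ch b(1) elim(2)] u0(1) chart_sub[OF ch])
   then have "infdist (z n) B <= K * dist (z n) (ps (u n))" using rh(4) elim(1) z by auto
   moreover have "(z n - b n) /R r n - (ps (u n) - ps (ph (b n))) /R r n = (z n - ps (u n)) /R r n"
    by (simp add: chart_psph[OF ch elim(2)] flip: scaleR_diff_right)
   ultimately show ?case using r(1)[of n] infdist_nonneg[of "z n" B] by (simp add: dist_norm divide_inverse mult.assoc[symmetric] mult.commute[of "inverse (r n)"])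
  qed
 qed
qed

end

lemma homotopic_maps_refl:
 "continuous_on X f ==> f ` X <= Y ==> homotopic_maps X Y f f"
 and homotopic_maps_sym: "homotopic_maps X Y f g ==> homotopic_maps X Y g f"
 and homotopic_maps_trans [trans]: "homotopic_maps X Y f g ==> homotopic_maps X Y g k ==> homotopic_maps X Y f k"
 unfolding homotopic_maps_def by (auto simp: homotopic_with_refl homotopic_with_sym image_subset_iff_funcset intro: homotopic_with_trans)

lemma homotopic_maps_imp:
 assumes "homotopic_maps X Y f g"
 shows "continuous_on X f" "continuous_on X g" "f ` X <= Y" "g ` X <= Y"
 using homotopic_with_imp_continuous[OF assms[unfolded homotopic_maps_def]]
  homotopic_with_imp_subset1[OF assms[unfolded homotopic_maps_def]] homotopic_with_imp_subset2[OF assms[unfolded homotopic_maps_def]]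
 by auto

lemma homotopic_mapsI:
 assumes "continuous_on ({0..1::real} \<times> X) h" "h ` ({0..1} \<times> X) <= Y"
  "!!x. x \<in> X ==> h (0, x) = f x" "!!x. x \<in> X ==> h (1, x) = g x"
 shows "homotopic_maps X Y f g"
 unfolding homotopic_maps_def by (rule homotopic_withI[OF assms]) auto

lemma homotopic_mapsE:
 assumes "homotopic_maps X Y f g"
 obtains h where "continuous_on ({0..1::real} \<times> X) h" "h ` ({0..1} \<times> X) <= Y"
  "!!x. h (0, x) = f x" "!!x. h (1, x) = g x"
 using assms unfolding homotopic_maps_def by (rule homotopic_withE) (rule that)

lemma homotopic_maps_cong:
 assumes "homotopic_maps X Y f g" "!!x. x \<in> X ==> f x = f' x" "!!x. x \<in> X ==> g x = g' x"
 shows "homotopic_maps X Y f' g'"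
 using assms unfolding homotopic_maps_def by (elim homotopic_with_eq) auto

lemma homotopic_maps_compose_left:
 assumes "homotopic_maps X Y f g" "continuous_on Y k" "k ` Y <= Z"
 shows "homotopic_maps X Z (%x. k (f x)) (%x. k (g x))"
 using homotopic_with_compose_continuous_left[OF assms(1)[unfolded homotopic_maps_def] assms(2)] assms(3)
 unfolding homotopic_maps_def by (auto simp: o_def image_subset_iff_funcset)

lemma sgn_in_sphere [simp]: "sgn v \<in> usphere \<longleftrightarrow> v ~= (0::'a::real_normed_vector)"
 by (simp add: norm_sgn)

lemma homotopic_maps_sgn:
 fixes W :: "real \<times> 'a::topological_space => 'b::euclidean_space"
 assumes "continuous_on ({0..1} \<times> X) W" "!!t x. t \<in> {0..1} ==> x \<in> X ==> W (t, x) ~= 0"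
 shows "homotopic_maps X usphere (%x. sgn (W (0, x))) (%x. sgn (W (1, x)))"
 by (rule homotopic_mapsI[of _ "%z. sgn (W z)"])
  (use assms in \<open>auto intro!: continuous_on_sgn simp: norm_sgn\<close>)

lemma homotopic_maps_nonopposite:
 fixes f g :: "'a::topological_space => 'b::euclidean_space"
 assumes "continuous_on X f" "f ` X <= usphere" "continuous_on X g" "g ` X <= usphere"
  and "!!x. x \<in> X ==> f x ~= - g x"
 shows "homotopic_maps X usphere f g"
proof -
 have n: "norm (f x) = 1" "norm (g x) = 1" if "x \<in> X" for x using assms(2,4) that by auto
 let ?W = "%z. (1 - fst z) *R f (snd z) + fst z *R g (snd z)"
 have "continuous_on ({0..1} \<times> X) ?W"
  by (intro continuous_intros continuous_on_compose2[OF assms(1)] continuous_on_compose2[OF assms(3)]) auto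
 moreover have "?W (t, x) ~= 0" if "t \<in> {0..1}" "x \<in> X" for t x
 proof
  assume "?W (t, x) = 0"
  then have e: "(1 - t) *R f x = - t *R g x" by (simp add: eq_neg_iff_add_eq_0)
  then have "norm ((1 - t) *R f x) = norm (- t *R g x)" by (rule arg_cong)
  then have "t = 1 / 2" using that n by simp
  then have "(1 / 2) *R f x = (1 / 2) *R - g x" using e unfolding \<open>t = 1 / 2\<close> by simp
  then have "f x = - g x" by (simp only: scaleR_cancel_left) simp
  then show False using assms(5)[OF that(2)] by simp
 qed
 ultimately show ?thesis
  by (rule homotopic_maps_cong[OF homotopic_maps_sgn]) (use n in \<open>auto simp: sgn_div_norm\<close>)
qed

context null_bordism
begin

text \<open>The dual of \<open>A b\<close>, carried to the tangent space of the sphere at \<open>u1 (fst b)\<close>: it spares the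
 inverse of the differential of \<open>p\<close>.\<close>

definition dual_normal :: "'m \<times> real => 'm \<times> real => 'f" where
 "dual_normal b v = (\<Sum>i\<in>Basis. (A b (fst v - (fst v \<bullet> fst b) *R fst b, snd v) \<bullet> Dp (u1 (fst b)) i) *R i)"

lemma linear_A: "b \<in> B ==> linear (A b)"
 using B_iso unfolding normal_bundle_iso_def by blast

lemma dual_inner:
 assumes b: "b \<in> B"
 shows "dual_normal b v \<bullet> ze = A b (fst v - (fst v \<bullet> fst b) *R fst b, snd v) \<bullet> Dp (u1 (fst b)) ze"
proof -
 have lin: "linear (Dp (u1 (fst b)))" by (rule linear_Dp[OF B_in(4)[OF b]])
 have "Dp (u1 (fst b)) ze = (\<Sum>i\<in>Basis. (ze \<bullet> i) *R Dp (u1 (fst b)) i)"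
  by (subst euclidean_representation[of ze, symmetric]) (simp add: linear_sum[OF lin] linear_cmul[OF lin])
 then show ?thesis by (simp add: dual_normal_def inner_sum_left inner_sum_right inner_commute mult.commute)
qed

lemma dual_diff:
 assumes b: "b \<in> B"
 shows "dual_normal b (v - w) = dual_normal b v - dual_normal b w"
proof (rule euclidean_eqI)
 fix i :: 'f
 have "(fst (v - w) - (fst (v - w) \<bullet> fst b) *R fst b, snd (v - w)) =
  (fst v - (fst v \<bullet> fst b) *R fst b, snd v) - (fst w - (fst w \<bullet> fst b) *R fst b, snd w)"
  by (simp add: algebra_simps)
 then show "dual_normal b (v - w) \<bullet> i = (dual_normal b v - dual_normal b w) \<bullet> i"
  by (simp only: inner_diff_left dual_inner[OF b] linear_diff[OF linear_A[OF b]])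
qed

lemma dual_scale:
 assumes b: "b \<in> B"
 shows "dual_normal b (c *R v) = c *R dual_normal b v"
proof (rule euclidean_eqI)
 fix i :: 'f
 have "(fst (c *R v) - (fst (c *R v) \<bullet> fst b) *R fst b, snd (c *R v)) =
  c *R (fst v - (fst v \<bullet> fst b) *R fst b, snd v)"
  by (simp add: algebra_simps)
 then show "dual_normal b (c *R v) \<bullet> i = (c *R dual_normal b v) \<bullet> i"
  by (simp only: inner_scaleR_left dual_inner[OF b] linear_cmul[OF linear_A[OF b]])
qed

lemma dual_orthogonal: "b \<in> B ==> dual_normal b v \<bullet> u1 (fst b) = 0"
 by (simp add: dual_inner Dp_self B_in(4) del: mem_sphere mem_sphere_0)

lemma dual_zero_iff:
 assumes b: "b \<in> B" and v: "fst v \<bullet> fst b = 0"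
 shows "dual_normal b v = 0 \<longleftrightarrow> v \<in> tangent_space B b"
proof
 assume 0: "dual_normal b v = 0"
 have "A b v \<in> tangent_space N (p (u1 (fst b)))"
  using tangent_P[OF B_in(1)[OF b]] v B_iso b by (auto simp: normal_bundle_iso_def f1_def)
 then obtain ze where ze: "Dp (u1 (fst b)) ze = A b v" using Dp_surj[OF B_in(4)[OF b]] by metis
 show "v \<in> tangent_space B b"
  using dual_inner[OF b, of v ze] 0 v ze tangent_B[OF b] by simp
next
 assume "v \<in> tangent_space B b"
 then show "dual_normal b v = 0" using tangent_B[OF b] v by (simp add: dual_normal_def)
qed

lemma continuous_dual: "continuous_on (B \<times> UNIV) (%z. dual_normal (fst z) (snd z))"
proof -
 let ?g = "%z :: ('m \<times> real) \<times> ('m \<times> real). (fst z, (fst (snd z) - (fst (snd z) \<bullet> fst (fst z)) *R fst (fst z), snd (snd z)))"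
 have "continuous_on {(b, v). b \<in> B \<and> v \<in> tangent_space P b} (%(b, v). A b v)"
  using B_iso unfolding normal_bundle_iso_def by blast
 moreover have "?g ` (B \<times> UNIV) <= {(b, v). b \<in> B \<and> v \<in> tangent_space P b}"
  using tangent_P[OF B_in(1)] M_inner[OF B_in(2)] by (auto simp: inner_diff_left)
 moreover have "continuous_on (B \<times> UNIV) ?g" by (intro continuous_intros)
 ultimately have "continuous_on (B \<times> UNIV) (%z. (%(b, v). A b v) (?g z))"
  using continuous_on_compose2 by blast
 moreover have "continuous_on (B \<times> (UNIV :: ('m \<times> real) set)) (%z. Dp (u1 (fst (fst z))) i)" for i
  using B_in(2,4) by (intro continuous_on_Dp_compose continuous_intros continuous_on_compose2[OF smooth_on_continuous[OF smooth_u(1)]], auto simp del: mem_sphere mem_sphere_0)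
 ultimately show ?thesis unfolding dual_normal_def by (intro continuous_intros) auto
qed

lemma dual_tendsto:
 assumes "!!n. b n \<in> B" "b \<longlonglongrightarrow> b0" "b0 \<in> B" "v \<longlonglongrightarrow> v0"
 shows "(%n. dual_normal (b n) (v n)) \<longlonglongrightarrow> dual_normal b0 v0"
 using continuous_on_tendsto_compose[OF continuous_dual tendsto_Pair[OF assms(2,4)]] assms(1,3) by simp

text \<open>
 Divided by \<open>r n\<close>, the vectors from \<open>b n\<close> and from \<open>b' n\<close> to \<open>z n\<close> have limits. The limits differ by a tangent vector, and they
 are not tangent themselves, since the distance of \<open>z n\<close> from \<open>B\<close> is at least \<open>r n / 2\<close>. Therefore
 the dual map takes the same nonzero value on both.
\<close>

lemma blow_up:
 assumes r: "!!n. 0 < r n" "r \<longlonglongrightarrow> 0" and z: "!!n. z n \<in> P" "!!n. r n / 2 <= infdist (z n) B"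
  and b: "!!n. b n \<in> B" "!!n. dist (z n) (b n) <= K * r n"
  and b': "!!n. b' n \<in> B" "!!n. dist (z n) (b' n) <= K * r n"
 obtains s b0 v v' where "strict_mono (s :: nat => nat)" "b0 \<in> B" "(%n. z (s n)) \<longlonglongrightarrow> b0"
  "(%n. b (s n)) \<longlonglongrightarrow> b0" "(%n. b' (s n)) \<longlonglongrightarrow> b0"
  "(%n. (z (s n) - b (s n)) /R r (s n)) \<longlonglongrightarrow> v" "(%n. (z (s n) - b' (s n)) /R r (s n)) \<longlonglongrightarrow> v'"
  "dual_normal b0 v' = dual_normal b0 v" "dual_normal b0 v ~= 0" "fst v \<bullet> fst b0 = 0"
proof -
 let ?v = "%n. (z n - b n) /R r n" and ?v' = "%n. (z n - b' n) /R r n"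
 have in_K: "(z n - c) /R r n \<in> cball 0 K" if "dist (z n) c <= K * r n" for n c
  using that r(1)[of n] by (simp add: dist_norm divide_simps del: scaleR_diff_right)
 have "compact (B \<times> cball (0 :: 'm \<times> real) K \<times> cball (0 :: 'm \<times> real) K)" by (intro compact_Times compact_B compact_cball)
 moreover have "\<forall>n. (b n, ?v n, ?v' n) \<in> B \<times> cball 0 K \<times> cball 0 K"
  using in_K[OF b(2)] in_K[OF b'(2)] b(1) by auto
 ultimately obtain l s where l: "l \<in> B \<times> cball 0 K \<times> cball 0 K" and s: "strict_mono (s :: nat => nat)"
  and lim: "((%n. (b n, ?v n, ?v' n)) \<circ> s) \<longlonglongrightarrow> l"
  unfolding compact_def by (elim allE[of _ "%n. (b n, ?v n, ?v' n)"] impE bexE exE conjE) (assumption, rule that)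
 obtain b0 v v' where l_eq: "l = (b0, v, v')" by (metis prod.collapse)
 have b0: "b0 \<in> B" using l l_eq by simp
 have 1: "(%n. b (s n)) \<longlonglongrightarrow> b0" and 2: "(%n. ?v (s n)) \<longlonglongrightarrow> v" and 3: "(%n. ?v' (s n)) \<longlonglongrightarrow> v'"
  using tendsto_fst[OF lim] tendsto_fst[OF tendsto_snd[OF lim]] tendsto_snd[OF tendsto_snd[OF lim]] by (simp_all add: l_eq)
 have rs: "(%n. r (s n)) \<longlonglongrightarrow> 0" using LIMSEQ_subseq_LIMSEQ[OF r(2) s] by (simp add: o_def)
 have r0: "r n ~= 0" for n using r(1)[of n] by simp
 have 4: "(%n. z (s n)) \<longlonglongrightarrow> b0" using tendsto_add[OF 1 tendsto_scaleR[OF rs 2]] by (simp add: r0)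
 have 5: "(%n. b' (s n)) \<longlonglongrightarrow> b0" using tendsto_diff[OF 4 tendsto_scaleR[OF rs 3]] by (simp add: r0)
 have "(%n. (b' (s n) - b (s n)) /R r (s n)) \<longlonglongrightarrow> v - v'"
  using tendsto_diff[OF 2 3] by (simp add: scaleR_diff_right)
 from chord_limit_tangent[OF b(1) b'(1) 1 5 b0 r(1) this] have T: "v - v' \<in> tangent_space B b0" .
 have perp: "w \<bullet> fst b0 = 0" if c: "!!n. c n \<in> B" "(%n. c (s n)) \<longlonglongrightarrow> b0" "(%n. fst ((z (s n) - c (s n)) /R r (s n))) \<longlonglongrightarrow> w" for c w
 proof -
  have "fst ((z n - c n) /R r n) \<bullet> (fst (z n) + fst (c n)) = 0" for n
   using M_inner[of "fst (z n)"] M_inner[OF B_in(2)[OF c(1)]] z(1)[of n] by (simp add: mem_Times_iff inner_diff_right inner_add_right inner_commute)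
  moreover have "(%n. fst ((z (s n) - c (s n)) /R r (s n)) \<bullet> (fst (z (s n)) + fst (c (s n)))) \<longlonglongrightarrow> w \<bullet> (fst b0 + fst b0)"
   by (intro tendsto_intros c(3) 4 c(2))
  ultimately show ?thesis by (simp add: LIMSEQ_const_iff inner_add_right)
 qed
 have p: "fst v \<bullet> fst b0 = 0" "fst v' \<bullet> fst b0 = 0"
  using perp[OF b(1) 1 tendsto_fst[OF 2]] perp[OF b'(1) 5 tendsto_fst[OF 3]] by auto
 have "dual_normal b0 (v - v') = 0" using dual_zero_iff[OF b0] T p by (simp add: inner_diff_left)
 then have eq: "dual_normal b0 v' = dual_normal b0 v" using dual_diff[OF b0, of v v'] by simp
 have "dual_normal b0 v ~= 0"
 proof
  assume "dual_normal b0 v = 0"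
  then have "v \<in> tangent_space B b0" using dual_zero_iff[OF b0 p(1)] by simp
  moreover have "0 <= snd (z n)" for n using z(1)[of n] by auto
  ultimately have "(%n. infdist (z (s n)) B / r (s n)) \<longlonglongrightarrow> 0"
   using tangent_approximation[OF b(1) 1 b0 r(1) rs _ 2] by simp
  moreover have "1 / 2 <= infdist (z n) B / r n" for n using z(2)[of n] r(1)[of n] by auto
  ultimately have "(1 / 2 :: real) <= 0" by (intro LIMSEQ_le_const) auto
  then show False by simp
 qed
 then show thesis using that[OF s b0 4 1 5 2 3 eq] p(1) by simp
qed

lemma nearest: "B ~= {} ==> \<exists>b\<in>B. infdist z B = dist z b"
 using infdist_attains_inf[OF compact_imp_closed[OF compact_B]] by metis

text \<open>
 Near \<open>B\<close> the vectors dual to the directions from the points \<open>b\<close> of \<open>B\<close> which are near \<open>z\<close> lie in an open half space;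
 otherwise a blow-up would produce a limit with nonpositive square.
\<close>

lemma cone_interior:
 assumes "B ~= {}"
 shows "\<exists>r0>0. \<forall>r z. 0 < r --> r < r0 --> z \<in> P --> infdist z B = r / 2 -->
  (\<exists>e. e \<bullet> u1 (fst z) = 0 \<and> (\<forall>b\<in>B. dist z b < 3 * r --> 0 < dual_normal b (z - b) \<bullet> e))"
proof (rule ccontr)
 assume "\<not> ?thesis"
 then have "\<forall>n. \<exists>r z. 0 < r \<and> r < 1 / real (Suc n) \<and> z \<in> P \<and> infdist z B = r / 2 \<and>
  (\<forall>e. e \<bullet> u1 (fst z) = 0 --> (\<exists>b\<in>B. dist z b < 3 * r \<and> dual_normal b (z - b) \<bullet> e <= 0))"
  by (metis not_less of_nat_0_less_iff zero_less_Suc zero_less_divide_1_iff)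
 then obtain r z where r: "!!n. 0 < r n" "!!n. r n < 1 / real (Suc n)" and z: "!!n. z n \<in> P" "!!n. infdist (z n) B = r n / 2"
  and bad: "!!n e. e \<bullet> u1 (fst (z n)) = 0 ==> \<exists>b\<in>B. dist (z n) b < 3 * r n \<and> dual_normal b (z n - b) \<bullet> e <= 0"
  by metis
 have r0: "r \<longlonglongrightarrow> 0"
  by (rule tendsto_sandwich[OF _ _ tendsto_const lim_1_over_n[THEN LIMSEQ_Suc]]) (use r in \<open>auto intro!: always_eventually less_imp_le\<close>)
 have "\<forall>n. \<exists>b. b \<in> B \<and> infdist (z n) B = dist (z n) b" using nearest[OF assms] by blast
 from choice[OF this] obtain b where b: "!!n. b n \<in> B" "!!n. infdist (z n) B = dist (z n) (b n)" by auto
 define g where "g n = dual_normal (b n) ((z n - b n) /R r n)" for n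
 define e where "e n = g n - (g n \<bullet> u1 (fst (z n))) *R u1 (fst (z n))" for n
 have zM: "fst (z n) \<in> M" for n using z(1)[of n] by auto
 have "e n \<bullet> u1 (fst (z n)) = 0" for n
  using S_inner[OF u_S(1)[OF zM[of n]]] by (simp add: e_def inner_diff_left)
 from bad[OF this] obtain b' where b': "!!n. b' n \<in> B" "!!n. dist (z n) (b' n) < 3 * r n"
  "!!n. dual_normal (b' n) (z n - b' n) \<bullet> e n <= 0" by metis
 obtain s b0 v v' where s: "strict_mono (s :: nat => nat)" and b0: "b0 \<in> B" and
  lim: "(%n. z (s n)) \<longlonglongrightarrow> b0" "(%n. b (s n)) \<longlonglongrightarrow> b0" "(%n. b' (s n)) \<longlonglongrightarrow> b0"
   "(%n. (z (s n) - b (s n)) /R r (s n)) \<longlonglongrightarrow> v" "(%n. (z (s n) - b' (s n)) /R r (s n)) \<longlonglongrightarrow> v'"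
  and d: "dual_normal b0 v' = dual_normal b0 v" "dual_normal b0 v ~= 0"
 proof (rule blow_up[OF r(1) r0 z(1) _ b(1) _ b'(1), where K = 3])
  show "r n / 2 <= infdist (z n) B" "dist (z n) (b n) <= 3 * r n" "dist (z n) (b' n) <= 3 * r n" for n
   using z(2)[of n] b(2)[of n] b'(2)[of n] r(1)[of n] by auto
 qed (rule that)
 have 1: "(%n. g (s n)) \<longlonglongrightarrow> dual_normal b0 v"
  unfolding g_def by (rule dual_tendsto[OF b(1) lim(2) b0 lim(4)])
 have 2: "(%n. u1 (fst (z (s n)))) \<longlonglongrightarrow> u1 (fst b0)"
  using continuous_on_tendsto_compose[OF smooth_on_continuous[OF smooth_u(1)] tendsto_fst[OF lim(1)] B_in(2)[OF b0]] zM by simp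
 have "(%n. e (s n)) \<longlonglongrightarrow> dual_normal b0 v - (dual_normal b0 v \<bullet> u1 (fst b0)) *R u1 (fst b0)"
  unfolding e_def by (intro tendsto_intros 1 2)
 then have "(%n. e (s n)) \<longlonglongrightarrow> dual_normal b0 v" by (simp add: dual_orthogonal[OF b0])
 from tendsto_inner[OF dual_tendsto[OF b'(1) lim(3) b0 lim(5)] this]
 have "(%n. dual_normal (b' (s n)) ((z (s n) - b' (s n)) /R r (s n)) \<bullet> e (s n)) \<longlonglongrightarrow> dual_normal b0 v \<bullet> dual_normal b0 v"
  unfolding d(1) .
 moreover have "dual_normal (b' n) ((z n - b' n) /R r n) \<bullet> e n <= 0" for n
  using b'(3)[of n] r(1)[of n] by (simp add: dual_scale[OF b'(1)] mult_nonneg_nonpos del: scaleR_diff_right)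
 ultimately have "dual_normal b0 v \<bullet> dual_normal b0 v <= 0" by (intro LIMSEQ_le_const2) auto
 then show False using d(2) inner_gt_zero_iff[of "dual_normal b0 v"] by linarith
qed

text \<open>
 At the time 0 the half space is moreover known: its direction is that from \<open>u1\<close> to \<open>u2\<close>, because there
 \<open>A\<close> is the difference of the differentials.
\<close>

lemma cone_end:
 assumes "B ~= {}"
 shows "\<exists>r0>0. \<forall>r x. 0 < r --> r < r0 --> x \<in> M --> r / 2 <= infdist (x, 0) B --> infdist (x, 0) B <= r -->
  (\<forall>b\<in>B. dist (x, 0) b < 3 * r --> 0 < dual_normal b ((x, 0) - b) \<bullet> (u2 x - (u2 x \<bullet> u1 x) *R u1 x))"
proof (rule ccontr)
 obtain K where K: "0 < K" "!!b. b \<in> B ==> K * snd b < 1 ==> \<exists>x\<in>C. dist b (x, 0) <= K * snd b"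
  by (rule near_ends) (rule that)
 assume "\<not> ?thesis"
 moreover have "0 < 1 / (real (Suc n) + K)" for n using K(1) by auto
 ultimately have "\<forall>n. \<exists>r x b. 0 < r \<and> r < 1 / (real (Suc n) + K) \<and> x \<in> M \<and> r / 2 <= infdist (x, 0) B \<and> infdist (x, 0) B <= r \<and>
  b \<in> B \<and> dist (x, 0) b < 3 * r \<and> dual_normal b ((x, 0) - b) \<bullet> (u2 x - (u2 x \<bullet> u1 x) *R u1 x) <= 0"
  by (meson not_less)
 then obtain r x b' where r: "!!n. 0 < r n" "!!n. r n < 1 / (real (Suc n) + K)" and x: "!!n. x n \<in> M"
  and d: "!!n. r n / 2 <= infdist (x n, 0) B" "!!n. infdist (x n, 0) B <= r n"
  and b': "!!n. b' n \<in> B" "!!n. dist (x n, 0) (b' n) < 3 * r n"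
   "!!n. dual_normal (b' n) ((x n, 0) - b' n) \<bullet> (u2 (x n) - (u2 (x n) \<bullet> u1 (x n)) *R u1 (x n)) <= 0"
  by metis
 have rK: "r n < 1 / real (Suc n)" "K * r n < 1" for n
 proof -
  have *: "real (Suc n) * r n + K * r n < 1" using r(2)[of n] K(1) by (simp add: field_simps)
  have "0 < K * r n" "0 < real (Suc n) * r n" using K(1) r(1)[of n] by auto
  then show "r n < 1 / real (Suc n)" "K * r n < 1" using * by (auto simp: field_simps)
 qed
 have r0: "r \<longlonglongrightarrow> 0"
  by (rule tendsto_sandwich[OF _ _ tendsto_const lim_1_over_n[THEN LIMSEQ_Suc]]) (use r(1) rK(1) in \<open>auto intro!: always_eventually less_imp_le\<close>)
 have "\<exists>y\<in>C. dist (x n, 0) (y, 0 :: real) <= (K + 1) * r n" for n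
 proof -
  obtain b where b: "b \<in> B" "infdist (x n, 0) B = dist (x n, 0) b" using nearest[OF assms] by blast
  have Ks: "K * snd b <= K * r n"
   using abs_snd_le[of "(x n, 0) - b"] d(2)[of n] b(2) K(1) by (simp add: dist_norm)
  then obtain y where y: "y \<in> C" "dist b (y, 0) <= K * snd b" using K(2)[OF b(1)] rK(2)[of n] by auto
  then show ?thesis using dist_triangle[of "(x n, 0)" "(y, 0)" b] Ks d(2)[of n] b(2)
   by (intro bexI[of _ y]) (auto simp: algebra_simps)
 qed
 then obtain y where y: "!!n. y n \<in> C" "!!n. dist (x n, 0) (y n, 0 :: real) <= (K + 1) * r n" by metis
 obtain s b0 v v' where s: "strict_mono (s :: nat => nat)" and b0: "b0 \<in> B" and
  lim: "(%n. (x (s n), 0)) \<longlonglongrightarrow> b0" "(%n. (y (s n), 0)) \<longlonglongrightarrow> b0" "(%n. b' (s n)) \<longlonglongrightarrow> b0"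
   "(%n. ((x (s n), 0) - (y (s n), 0)) /R r (s n)) \<longlonglongrightarrow> v" "(%n. ((x (s n), 0) - b' (s n)) /R r (s n)) \<longlonglongrightarrow> v'"
  and dn: "dual_normal b0 v' = dual_normal b0 v" "dual_normal b0 v ~= 0" "fst v \<bullet> fst b0 = 0"
 proof (rule blow_up[OF r(1) r0 _ d(1) C_in_B[OF y(1)] _ b'(1), where K = "K + 3"])
  fix n
  show "(x n, 0) \<in> P" using x by simp
  show "dist (x n, 0) (y n, 0 :: real) <= (K + 3) * r n" "dist (x n, 0) (b' n) <= (K + 3) * r n"
   using y(2)[of n] b'(2)[of n] r(1)[of n] mult_pos_pos[OF K(1) r(1)[of n]] by (auto simp: algebra_simps)
 qed (rule that)
 define c where "c = fst b0"
 have c: "b0 = (c, 0)" "c \<in> C" "c \<in> M"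
  using LIMSEQ_unique[OF tendsto_snd[OF lim(1)]] B_zero[OF b0] B_in(2)[OF b0] by (auto simp: c_def prod_eq_iff)
 have cu: "u1 c = u2 c" using c(2) C_iff by simp
 have "snd v = 0" using LIMSEQ_unique[OF tendsto_snd[OF lim(4)]] by simp
 then have v: "v = (fst v, 0)" by (simp add: prod_eq_iff)
 have cl: "(%n. x (s n)) \<longlonglongrightarrow> c" "(%n. y (s n)) \<longlonglongrightarrow> c" "(%n. (x (s n) - y (s n)) /R r (s n)) \<longlonglongrightarrow> fst v"
  using tendsto_fst[OF lim(1)] tendsto_fst[OF lim(2)] tendsto_fst[OF lim(4)] by (simp_all add: c_def)
 define q where "q = dr2 c (fst v) - dr1 c (fst v)"
 have "(%n. (r2 (x (s n)) - r2 (y (s n))) /R r (s n) - (r1 (x (s n)) - r1 (y (s n))) /R r (s n)) \<longlonglongrightarrow> q"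
  unfolding q_def using M_nz[OF c(3)]
  by (intro tendsto_diff strict_quotient_limit[OF _ Cinf_r(1) _ cl(2,1) r(1) cl(3)] strict_quotient_limit[OF _ Cinf_r(2) _ cl(2,1) r(1) cl(3)]) auto
 moreover have "(r2 (x n) - r2 (y n)) /R r n - (r1 (x n) - r1 (y n)) /R r n = (u2 (x n) - u1 (x n)) /R r n" for n
  using y(1)[of n] by (simp add: r_M[OF x] r_M C_iff scaleR_diff_right)
 ultimately have q: "(%n. (u2 (x (s n)) - u1 (x (s n))) /R r (s n)) \<longlonglongrightarrow> q" by simp
 have vc: "fst v \<bullet> c = 0" using dn(3) by (simp add: c_def)
 have qc: "q \<bullet> u1 c = 0" using dr_tangent[OF c(3) vc] cu by (simp add: q_def inner_diff_left)
 have dual: "dual_normal b0 v \<bullet> ze = Dp (u1 c) q \<bullet> Dp (u1 c) ze" for ze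
 proof -
  show ?thesis
   using A_canonical[of c "fst v"] canonical_normal_map_u[OF c(3) vc cu] c(2) vc tangent_space_sphere[OF c(3)] dual_inner[OF b0, of v ze] \<open>snd v = 0\<close> by (simp add: C_def q_def c(1))
 qed
 define g where "g n = (u2 (x n) - u1 (x n)) /R r n" for n
 have "(%n. g (s n) - (g (s n) \<bullet> u1 (x (s n))) *R u1 (x (s n))) \<longlonglongrightarrow> q - (q \<bullet> u1 c) *R u1 c"
  using continuous_on_tendsto_compose[OF smooth_on_continuous[OF smooth_u(1)] cl(1) c(3)] x by (fastforce simp: g_def intro: tendsto_intros q)
 from tendsto_inner[OF dual_tendsto[OF b'(1) lim(3) b0 lim(5)] this]
 have "(%n. dual_normal (b' (s n)) (((x (s n), 0) - b' (s n)) /R r (s n)) \<bullet> (g (s n) - (g (s n) \<bullet> u1 (x (s n))) *R u1 (x (s n))))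
   \<longlonglongrightarrow> dual_normal b0 v \<bullet> q" by (simp add: dn(1) qc)
 moreover have "dual_normal (b' n) (((x n, 0) - b' n) /R r n) \<bullet> (g n - (g n \<bullet> u1 (x n)) *R u1 (x n)) <= 0" for n
 proof -
  have "g n - (g n \<bullet> u1 (x n)) *R u1 (x n) = (u2 (x n) - (u2 (x n) \<bullet> u1 (x n)) *R u1 (x n)) /R r n"
   using S_inner[OF u_S(1)[OF x[of n]]] by (simp add: g_def algebra_simps)
  then show ?thesis using b'(3)[of n] r(1)[of n]
   by (simp add: dual_scale[OF b'(1)] mult_nonneg_nonpos del: scaleR_diff_right)
 qed
 ultimately have "dual_normal b0 v \<bullet> q <= 0" by (intro LIMSEQ_le_const2) auto
 then have "dual_normal b0 v \<bullet> dual_normal b0 v = 0"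
  using inner_gt_zero_iff[of "Dp (u1 c) q"] by (fastforce simp: dual)
 then show False using dn(2) by auto
qed

text \<open>
 The map \<open>X\<close> runs from \<open>u1 + ta\<close> on \<open>B\<close> to \<open>- u1\<close> away from \<open>B\<close>, where \<open>ta\<close> is normal to \<open>u1\<close> and keeps \<open>X\<close> from
 vanishing in between; it is obtained from a sum of the values of \<^const>\<open>dual_normal\<close> over a net of
 points of \<open>B\<close>. At the time 0 it points to the side of \<open>u2\<close>, so that \<open>X\<close> is nowhere opposite to \<open>u2\<close>.
\<close>

theorem homotopic_antipode:
 assumes close: "!!x. x \<in> M ==> dist (u1 x) (u2 x) < 1"
 shows "homotopic_maps M S u2 (%x. - u1 x)"
proof (cases "B = {}")
 case True
 then have "u1 x ~= u2 x" if "x \<in> M" for x using C_in_B[of x] that unfolding C_iff by auto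
 then have "u2 x ~= - (- u1 x)" if "x \<in> M" for x using that by (metis minus_minus)
 then show ?thesis using u_sphere by (intro homotopic_maps_nonopposite continuous_intros smooth_on_continuous smooth_u, auto)
next
 case False
 obtain ra where ra: "0 < ra" "!!r z. 0 < r ==> r < ra ==> z \<in> P ==> infdist z B = r / 2 ==>
  \<exists>e. e \<bullet> u1 (fst z) = 0 \<and> (\<forall>b\<in>B. dist z b < 3 * r --> 0 < dual_normal b (z - b) \<bullet> e)"
  using cone_interior[OF False] by auto
 obtain rb where rb: "0 < rb" "!!r x b. 0 < r ==> r < rb ==> x \<in> M ==> r / 2 <= infdist (x, 0) B ==> infdist (x, 0) B <= r ==>
  b \<in> B ==> dist (x, 0) b < 3 * r ==> 0 < dual_normal b ((x, 0) - b) \<bullet> (u2 x - (u2 x \<bullet> u1 x) *R u1 x)"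
  using cone_end[OF False] by auto
 obtain rc where rc: "0 < rc" "!!x. x \<in> M ==> rc <= infdist (x, 1) B"
 proof (cases "M = {}")
  case False
  have "compact (M \<times> {1::real})" by (intro compact_Times) auto
  from continuous_attains_inf[OF this _ continuous_on_infdist[OF continuous_on_id]] obtain z where z: "z \<in> M \<times> {1}"
   "!!y. y \<in> M \<times> {1} ==> infdist z B <= infdist y B"
   using False by (metis Times_empty insert_not_empty)
  show ?thesis
   using z(1) B_one[of z] that[of "infdist z B"] z(2) infdist_pos_not_in_closed[OF compact_imp_closed[OF compact_B] \<open>B \<noteq> {}\<close>] by fastforce
 qed (use that[of 1] in auto)
 define r where "r = min rc (min (ra / 2) (rb / 2))"
 have r: "0 < r" "r < ra" "r < rb" "r <= rc" using ra(1) rb(1) rc(1) by (auto simp: r_def)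
 obtain J where J: "J <= B" "finite J" "B <= (\<Union>b\<in>J. ball b r)"
  using r(1) compactE_image[OF compact_B, of B "%b. ball b r"] by force
 define si where "si z = (\<Sum>b\<in>J. max 0 (3 * r - dist z b) *R dual_normal b (z - b))" for z
 have positive: "0 < si z \<bullet> e" if z: "infdist z B <= r" and e: "!!b. b \<in> B ==> dist z b < 3 * r ==> 0 < dual_normal b (z - b) \<bullet> e" for z e
 proof -
  obtain b where b: "b \<in> B" "infdist z B = dist z b" using nearest[OF False] by blast
  then obtain c where c: "c \<in> J" "dist c b < r" using J(3) by fastforce
  have "0 < max 0 (3 * r - dist z c) * (dual_normal c (z - c) \<bullet> e)"
   using z b(2) c(2) dist_triangle[of z c b] r(1) e[of c] c(1) J(1) by (auto simp: dist_commute)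
  moreover have "0 <= max 0 (3 * r - dist z b) * (dual_normal b (z - b) \<bullet> e)" if "b \<in> J" for b
   using e[of b] that J(1) by (cases "dist z b < 3 * r", auto)
  ultimately show ?thesis unfolding si_def inner_sum_left inner_scaleR_left
   by (intro sum_pos2[OF J(2) c(1)]) auto
 qed
 define ta where "ta z = si z - (si z \<bullet> u1 (fst z)) *R u1 (fst z)" for z
 define ka where "ka z = min 1 (infdist z B / r)" for z
 define X where "X z = (1 - 2 * ka z) *R u1 (fst z) + (1 - ka z) *R ta z" for z
 have c1: "continuous_on P (%z. u1 (fst z))"
  by (intro continuous_on_compose2[OF smooth_on_continuous[OF smooth_u(1)]] continuous_intros) auto
 have "continuous_on P (%z. dual_normal b (z - b))" if "b \<in> J" for b
 proof -
  have "continuous_on P (%z. (b, z - b))" by (rule continuous_on_Pair[OF continuous_on_const continuous_on_diff[OF continuous_on_id continuous_on_const]])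
  from continuous_on_compose2[OF continuous_dual this] show ?thesis using that J(1) by auto
 qed
 then have cX: "continuous_on P X" unfolding X_def ta_def si_def ka_def using r(1) by (intro continuous_intros c1) auto
 have u1u1: "u1 (fst z) \<bullet> u1 (fst z) = 1" if "z \<in> P" for z using S_inner[OF u_S(1)] that by auto
 have tau: "ta z \<bullet> u1 (fst z) = 0" if "z \<in> P" for z using u1u1[OF that] by (simp add: ta_def inner_diff_left)
 have Xnz: "X z ~= 0" if z: "z \<in> P" for z
 proof
  assume 0: "X z = 0"
  then have "X z \<bullet> u1 (fst z) = 0" by simp
  then have half: "ka z = 1 / 2" using tau[OF z] u1u1[OF z] by (simp add: X_def inner_add_left)
  then have "infdist z B = r / 2" by (simp add: ka_def min_def split: if_splits)
  then obtain e where e: "e \<bullet> u1 (fst z) = 0" "!!b. b \<in> B ==> dist z b < 3 * r ==> 0 < dual_normal b (z - b) \<bullet> e"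
   using ra(2)[OF r(1,2) z] by blast
  have "0 < si z \<bullet> e" using positive[OF _ e(2)] \<open>infdist z B = r / 2\<close> r(1) by simp
  also have "\<dots> = ta z \<bullet> e" using e(1) by (simp add: ta_def inner_diff_right inner_commute[of _ e])
  also have "ta z = 0" using 0 unfolding X_def half by simp
  finally show False by simp
 qed
 have "continuous_on ({0..1} \<times> M) (%z. X (snd z, fst z))"
  by (intro continuous_on_compose2[OF cX] continuous_intros) auto
 from homotopic_maps_sgn[OF this] have h: "homotopic_maps M S (%x. sgn (X (x, 0))) (%x. sgn (X (x, 1)))"
  using Xnz by simp
 have end1: "sgn (X (x, 1)) = - u1 x" if "x \<in> M" for x
 proof -
  have "ka (x, 1) = 1" using rc(2)[OF that] r(4) r(1) by (simp add: ka_def)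
  then show ?thesis using u_S(1)[OF that] by (simp add: X_def sgn_div_norm)
 qed
 have end0: "u2 x ~= - sgn (X (x, 0))" if x: "x \<in> M" for x
 proof
  assume e: "u2 x = - sgn (X (x, 0))"
  have z: "(x, 0) \<in> P" using x by simp
  define l where "l = norm (X (x, 0))"
  have l: "0 < l" "X (x, 0) = - l *R u2 x" using Xnz[OF z] by (auto simp: l_def e sgn_div_norm)
  have n: "u1 x \<bullet> u1 x = 1" "u2 x \<bullet> u2 x = 1" using S_inner u_S[OF x] by blast+
  have pos: "0 < u1 x \<bullet> u2 x"
   using close[OF x] power_strict_mono[of "dist (u1 x) (u2 x)" 1 2] n by (simp add: dist_norm power2_norm_eq_inner inner_diff_right inner_commute)
  have le1: "u1 x \<bullet> u2 x <= 1" using norm_cauchy_schwarz[of "u1 x" "u2 x"] u_S[OF x] by simp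
  have ka: "0 <= ka (x, 0)" "ka (x, 0) <= 1" using r(1) infdist_nonneg[of "(x, 0)" B] by (auto simp: ka_def)
  have "X (x, 0) \<bullet> u1 x = 1 - 2 * ka (x, 0)" using tau[OF z] n(1) by (simp add: X_def inner_add_left)
  then have half: "1 / 2 < ka (x, 0)" using mult_pos_pos[OF l(1) pos] unfolding l(2) by (simp add: inner_commute)
  show False
  proof (cases "ka (x, 0) < 1")
   case True
   then have d: "r / 2 <= infdist (x, 0) B" "infdist (x, 0) B <= r"
    using half r(1) by (auto simp: ka_def min_def split: if_splits)
   have "0 < si (x, 0) \<bullet> (u2 x - (u2 x \<bullet> u1 x) *R u1 x)"
    by (rule positive[OF d(2) rb(2)[OF r(1,3) x d]])
   also have "\<dots> = ta (x, 0) \<bullet> (u2 x - u1 x)"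
    using n(1) by (simp add: ta_def inner_commute algebra_simps)
   finally have "0 < (1 - ka (x, 0)) * (ta (x, 0) \<bullet> (u2 x - u1 x))" using True by simp
   moreover have "0 <= (1 - 2 * ka (x, 0)) * (u1 x \<bullet> (u2 x - u1 x))"
    using half le1 n by (intro mult_nonpos_nonpos) (auto simp: inner_diff_right)
   ultimately have "0 < X (x, 0) \<bullet> (u2 x - u1 x)" by (simp add: X_def inner_add_left)
   moreover have "0 <= l * (1 - u1 x \<bullet> u2 x)" using l(1) le1 by simp
   ultimately show False unfolding l(2) using n by (simp add: inner_diff_right inner_commute algebra_simps)
  next
   case False
   then have "ka (x, 0) = 1" using ka by simp
   then have "u1 x = l *R u2 x" using l(2) by (simp add: X_def)
   then have "(l - 1) * (l + 1) = 0" using n by (simp add: algebra_simps)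
   then show False
    using l(1) \<open>u1 x = l *R u2 x\<close> x C_in_B C_iff \<open>ka (x, 0) = 1\<close> by (simp add: ka_def)
  qed
 qed
 have "homotopic_maps M S u2 (%x. sgn (X (x, 0)))"
  by (rule homotopic_maps_nonopposite)
   (use homotopic_maps_imp[OF h] u_sphere end0 smooth_on_continuous[OF smooth_u(2)] in auto)
 also have "homotopic_maps M S (%x. sgn (X (x, 0))) (%x. - u1 x)"
  by (rule homotopic_maps_cong[OF h]) (auto simp: end1)
 finally show ?thesis .
qed

end

section \<open>The Nielsen number\<close>

lemma differential_cong:
 assumes "!!x. x \<in> S ==> f x = g x" "x \<in> S"
 shows "differential S f x = differential S g x"
proof -
 have "(f has_derivative D) (at x within S) \<longleftrightarrow> (g has_derivative D) (at x within S)" for D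
  using has_derivative_transform[of x S f g D] has_derivative_transform[of x S g f D] assms by auto
 then show ?thesis unfolding differential_def by simp
qed

lemma generic_pair_cong:
 assumes "!!x. x \<in> M ==> f1 x = g1 x" "!!x. x \<in> M ==> f2 x = g2 x"
  and f: "generic_pair M N f1 f2"
 shows "generic_pair M N g1 g2"
proof -
 have "smooth_on M g" if "smooth_on M f" "!!x. x \<in> M ==> f x = g x" for f g :: "'a => 'b"
  using that unfolding smooth_on_def by (metis IntD1)
 moreover have "differential M (%x. (f1 x, f2 x)) x = differential M (%x. (g1 x, g2 x)) x" if "x \<in> M" for x
  by (rule differential_cong[OF _ that]) (simp add: assms)
 ultimately show ?thesis
  using f assms(1,2) unfolding generic_pair_def transverse_to_def transverse_at_def
  by (auto simp: image_subset_iff)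
qed

lemma nielsen_count_cong:
 assumes f1: "!!x. x \<in> M ==> f1 x = g1 x" and f2: "!!x. x \<in> M ==> f2 x = g2 x"
 shows "nielsen_count M N f1 f2 = nielsen_count M N g1 g2"
proof -
 let ?T = "prod_topology (top_of_set M) (compact_open_topology N)"
 have "topspace ?T \<inter> {(x, th). th 0 = f1 x \<and> th 1 = f2 x} = topspace ?T \<inter> {(x, th). th 0 = g1 x \<and> th 1 = g2 x}"
  using assms by auto
 from arg_cong[OF this, of "subtopology ?T"] have E: "coincidence_path_space M N f1 f2 = coincidence_path_space M N g1 g2"
  by (simp only: subtopology_restrict coincidence_path_space_def)
 have L: "constant_path_lift f1 x = constant_path_lift g1 x" if "x \<in> coincidence_set M g1 g2" for x
  using that f1 by (auto simp: coincidence_set_def constant_path_lift_def)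
 have K: "canonical_normal_map M f1 f2 x = canonical_normal_map M g1 g2 x" if "x \<in> coincidence_set M g1 g2" for x
  using that differential_cong[of M f1 g1 x] differential_cong[of M f2 g2 x] assms
  by (auto simp: canonical_normal_map_def coincidence_set_def)
 have "{x \<in> coincidence_set M f1 f2. constant_path_lift f1 x \<in> Q} = {x \<in> coincidence_set M g1 g2. constant_path_lift g1 x \<in> Q}" for Q
  using assms L by (auto simp: coincidence_set_def)
 moreover have "normal_bundle_iso B (M \<times> {0..1}) N (%b. f1 (fst b)) A \<longleftrightarrow> normal_bundle_iso B (M \<times> {0..1}) N (%b. g1 (fst b)) A"
  if "B <= M \<times> {0..1::real}" for B A
  using that f1 unfolding normal_bundle_iso_def
  by (intro conj_cong ball_cong refl) (metis mem_Times_iff subsetD)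
 ultimately have "inessential M N f1 f2 Q \<longleftrightarrow> inessential M N g1 g2 Q" for Q
  unfolding inessential_def Let_def E by (intro ex_cong1 conj_cong refl) (auto simp: L K)
 then show ?thesis unfolding nielsen_count_def E by simp
qed

lemma homotopic_maps_uminus:
 fixes f g :: "'a::topological_space => 'b::euclidean_space"
 assumes "homotopic_maps X usphere f g"
 shows "homotopic_maps X usphere (%x. - f x) (%x. - g x)"
 by (rule homotopic_maps_compose_left[OF assms]) (auto intro!: continuous_intros)

lemma unit_neq_uminus: "norm (v :: 'a::real_normed_vector) = 1 ==> v ~= - v"
proof
 assume "norm v = 1" "v = - v"
 then have "2 *R v = 0" unfolding scaleR_2 by (simp add: eq_neg_iff_add_eq_0)
 then show False using \<open>norm v = 1\<close> by simp
qed

text \<open>Two maps into a sphere without coincidences are antipodal up to homotopy.\<close>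

lemma loose_antipodal:
 fixes u :: "'a::topological_space => 'b::euclidean_space"
 assumes u: "continuous_on X u" "u ` X <= usphere"
 shows "loose X usphere u u \<longleftrightarrow> homotopic_maps X usphere u (%x. - u x)"
proof
 assume "loose X usphere u u"
 then obtain a b where ab: "homotopic_maps X usphere u a" "homotopic_maps X usphere u b" "!!x. x \<in> X ==> a x ~= b x"
  unfolding loose_def by auto
 note ab(2)
 also have "homotopic_maps X usphere b (%x. - a x)"
  by (rule homotopic_maps_nonopposite)
   (use homotopic_maps_imp[OF ab(1)] homotopic_maps_imp[OF ab(2)] ab(3) in \<open>auto intro: continuous_intros, metis\<close>)
 also have "homotopic_maps X usphere (%x. - a x) (%x. - u x)"
  by (rule homotopic_maps_uminus[OF homotopic_maps_sym[OF ab(1)]])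
 finally show "homotopic_maps X usphere u (%x. - u x)" .
next
 assume "homotopic_maps X usphere u (%x. - u x)"
 moreover have "u x ~= - u x" if "x \<in> X" for x by (rule unit_neq_uminus) (use u(2) that in auto)
 ultimately show "loose X usphere u u" unfolding loose_def using homotopic_maps_refl[OF u] by blast
qed

lemma inessentialE:
 assumes "inessential M N f1 f2 Q"
 obtains B A where "B <= M \<times> {0..1::real}" "compact B" "submanifold_with_boundary B"
  "manifold_boundary B = B \<inter> (M \<times> {0, 1})"
  "B \<inter> (M \<times> {0, 1}) = {x \<in> coincidence_set M f1 f2. constant_path_lift f1 x \<in> Q} \<times> {0}"
  "\<forall>b\<in>{x \<in> coincidence_set M f1 f2. constant_path_lift f1 x \<in> Q} \<times> {0}. transverse_at B id (M \<times> {0..1}) (M \<times> {0}) b"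
  "normal_bundle_iso B (M \<times> {0..1}) N (%b. f1 (fst b)) A"
  "\<forall>x\<in>{x \<in> coincidence_set M f1 f2. constant_path_lift f1 x \<in> Q}. \<forall>v\<in>tangent_space M x.
    A (x, 0) (v, 0) = canonical_normal_map M f1 f2 x v"
 using assms unfolding inessential_def Let_def by (elim exE conjE) (rule that)

context sphere_maps
begin

text \<open>
 Over a path in \<open>M\<close> from \<open>x\<close> to \<open>y\<close>, the projections of the short arcs from \<open>u1\<close> to \<open>u2\<close> form a path from the one
 constant path to the other.
\<close>

lemma coincidence_lifts_connected:
 assumes conn: "path_connected M" and close: "!!x. x \<in> M ==> dist (u1 x) (u2 x) < 1"
  and xy: "x \<in> coincidence_set M f1 f2" "y \<in> coincidence_set M f1 f2"
 shows "path_component_of (coincidence_path_space M N f1 f2) (constant_path_lift f1 x) (constant_path_lift f1 y)"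
proof -
 have xy': "x \<in> M" "y \<in> M" "u1 x = u2 x" "u1 y = u2 y" using xy coincidence_u by auto
 then obtain g where "path g" "path_image g <= M" "pathstart g = x" "pathfinish g = y"
  using conn unfolding path_connected_def by blast
 then have g: "continuous_on {0..1} g" "!!s. s \<in> {0..1} ==> g s \<in> M" "g 0 = x" "g 1 = y"
  by (auto simp: path_def path_image_def pathstart_def pathfinish_def simp del: mem_sphere mem_sphere_0)
 define W where "W z = u1 (g (fst z)) + snd z *R (u2 (g (fst z)) - u1 (g (fst z)))" for z :: "real \<times> real"
 define Ga where "Ga z = p (sgn (W z))" for z
 have W0: "W (s, t) ~= 0" if "s \<in> {0..1}" "t \<in> {0..1}" for s t
 proof
  assume "W (s, t) = 0"
  then have "u1 (g s) = t *R (u1 (g s) - u2 (g s))" by (simp add: W_def algebra_simps)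
  then have "norm (u1 (g s)) = t * dist (u1 (g s)) (u2 (g s))" using that(2) by (metis abs_of_nonneg atLeastAtMost_iff dist_norm norm_scaleR)
  also have "\<dots> <= 1 * dist (u1 (g s)) (u2 (g s))" using that(2) by (intro mult_right_mono) auto
  also have "\<dots> < 1" using close g(2)[OF that(1)] by simp
  finally show False using u_S(1)[OF g(2)[OF that(1)]] by simp
 qed
 have "continuous_on ({0..1} \<times> {0..1}) W" unfolding W_def
  by (intro continuous_intros continuous_on_compose2[OF smooth_on_continuous[OF smooth_u(1)]]
   continuous_on_compose2[OF smooth_on_continuous[OF smooth_u(2)]] continuous_on_compose2[OF g(1)])
   (use g(2) in \<open>auto simp del: mem_sphere mem_sphere_0\<close>)
 then have "continuous_on ({0..1} \<times> {0..1}) Ga" unfolding Ga_def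
  by (intro continuous_on_compose2[OF continuous_p] continuous_on_sgn) (use W0 in \<open>auto simp: norm_sgn\<close>)
 moreover have "Ga ` ({0..1} \<times> {0..1}) <= N"
  using W0 p_in_N unfolding Ga_def by (auto simp: norm_sgn)
 ultimately have "continuous_map (top_of_set {0..1}) (prod_topology (top_of_set M) (compact_open_topology N))
   (%s. (g s, \<lambda>t\<in>{0..1}. Ga (s, t)))"
  using g(1,2) by (auto intro!: continuous_map_paths continuous_map_pairedI)
 moreover have ends: "Ga (s, 0) = f1 (g s)" "Ga (s, 1) = f2 (g s)" if "s \<in> {0..1}" for s
  using u_S[OF g(2)[OF that]] by (simp_all add: Ga_def W_def f1_def f2_def sgn_div_norm)
 ultimately have "pathin (coincidence_path_space M N f1 f2) (%s. (g s, \<lambda>t\<in>{0..1}. Ga (s, t)))"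
  unfolding pathin_def coincidence_path_space_def continuous_map_in_subtopology by auto
 moreover have "(\<lambda>t\<in>{0..1}. Ga (s, t)) = (\<lambda>t\<in>{0..1}. f1 (g s))" if "s = 0 \<or> s = 1" for s
  using that xy' g(3,4) u_S(1)[OF xy'(1)] u_S(1)[OF xy'(2)] by (auto simp: Ga_def W_def f1_def sgn_div_norm)
 ultimately show ?thesis unfolding path_component_of_def constant_path_lift_def
  using g(3,4) by (intro exI[of _ "%s. (g s, \<lambda>t\<in>{0..1}. Ga (s, t))"]) auto
qed

lemma inessential_disjoint:
 assumes "{x \<in> coincidence_set M f1 f2. constant_path_lift f1 x \<in> Q} = {}"
 shows "inessential M N f1 f2 Q"
 unfolding inessential_def Let_def assms
 by (intro exI[of _ "{}"]) (auto simp: submanifold_with_boundary_def manifold_boundary_def normal_bundle_iso_def)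

lemma inessential_loose:
 assumes "bounded_by_all Q" "inessential M N f1 f2 Q" and close: "!!x. x \<in> M ==> dist (u1 x) (u2 x) < 1"
 shows "homotopic_maps M S u2 (%x. - u1 x)"
proof -
 obtain B A where B: "B <= M \<times> {0..1::real}" "compact B" "submanifold_with_boundary B"
  "manifold_boundary B = B \<inter> (M \<times> {0, 1})" "B \<inter> (M \<times> {0, 1}) = coincidence_set M f1 f2 \<times> {0}"
  "\<forall>b\<in>coincidence_set M f1 f2 \<times> {0}. transverse_at B id (M \<times> {0..1}) (M \<times> {0}) b"
  "normal_bundle_iso B (M \<times> {0..1}) N (%b. f1 (fst b)) A"
  "\<forall>x\<in>coincidence_set M f1 f2. \<forall>v\<in>tangent_space M x. A (x, 0) (v, 0) = canonical_normal_map M f1 f2 x v"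
  by (rule inessentialE[OF assms(2), unfolded assms(1)[unfolded bounded_by_all_def]]) (rule that)
 interpret null_bordism p N et u1 u2 B A
  by unfold_locales (rule B | rule B(6)[rule_format] | rule B(8)[rule_format] | assumption)+
 show ?thesis by (rule homotopic_antipode[OF close])
qed

text \<open>
 If there are coincidences, just one pathcomponent contains all of them, and it
 is inessential exactly if the whole coincidence set bounds.
\<close>

lemma nielsen_count_generic:
 assumes conn: "path_connected M" and tr: "transverse_u" and close: "!!x. x \<in> M ==> dist (u1 x) (u2 x) < 1"
 shows "nielsen_count M N f1 f2 = (if homotopic_maps M S u2 (%x. - u1 x) then 0 else 1)"
proof -
 let ?E = "coincidence_path_space M N f1 f2" and ?C = "coincidence_set M f1 f2"
 have c: "continuous_on M u1" "continuous_on M u2" using smooth_u by (auto intro: smooth_on_continuous)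
 have comp: "path_component_of ?E (constant_path_lift f1 x) (constant_path_lift f1 y)" if "x \<in> ?C" "y \<in> ?C" for x y
  by (rule coincidence_lifts_connected[OF conn close that])
 have all: "bounded_by_all Q" if Q: "Q \<in> path_components_of ?E" "\<not> inessential M N f1 f2 Q" for Q
 proof -
  obtain x where x: "x \<in> ?C" "constant_path_lift f1 x \<in> Q" using inessential_disjoint[of Q] Q(2) by blast
  obtain q where "Q = path_component_of_set ?E q" using Q(1) unfolding path_components_of_def by blast
  then have "constant_path_lift f1 y \<in> Q" if "y \<in> ?C" for y
   using comp[OF x(1) that] x(2) path_component_of_trans by (metis mem_Collect_eq)
  then show ?thesis unfolding bounded_by_all_def by auto
 qed
 show ?thesis
 proof (cases "homotopic_maps M S u2 (%x. - u1 x)")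
  case True
  then obtain H where H: "continuous_on ({0..1::real} \<times> M) H" "H ` ({0..1} \<times> M) <= S"
   "!!x. H (0, x) = u2 x" "!!x. H (1, x) = - u1 x" by (rule homotopic_mapsE) (rule that)
  have "- u1 x ~= u1 x" if "x \<in> M" for x using unit_neq_uminus[of "u1 x"] u_S(1)[OF that] by auto
  then have "inessential M N f1 f2 Q" if "bounded_by_all Q" for Q
   using inessential_from_continuous_homotopy[OF tr H(1,2) H(3) _ that] H(4) by simp
  then have e: "{Q \<in> path_components_of ?E. \<not> inessential M N f1 f2 Q} = {}" using all by blast
  show ?thesis unfolding nielsen_count_def e using True by (simp add: cardinality_def zero_enat_def)
 next
  case False
  have "?C ~= {}"
  proof
   assume "?C = {}"
   then have ne: "u1 x ~= u2 x" if "x \<in> M" for x using that coincidence_u by auto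
   have "homotopic_maps M S u2 (%x. - u1 x)"
    by (rule homotopic_maps_nonopposite)
     (use c u_sphere ne in \<open>auto intro: continuous_intros simp: image_subset_iff, metis mem_sphere_0\<close>)
   then show False using False by contradiction
  qed
  then obtain x where x: "x \<in> ?C" by blast
  let ?Q = "path_component_of_set ?E (constant_path_lift f1 x)"
  have Q: "?Q \<in> path_components_of ?E"
   using comp[OF x x] path_component_in_topspace by (fastforce simp: path_components_of_def)
  have b: "bounded_by_all ?Q" unfolding bounded_by_all_def using comp[OF x] by auto
  have "\<not> inessential M N f1 f2 ?Q" using inessential_loose[OF b _ close] False by blast
  moreover have "Q = ?Q" if "Q \<in> path_components_of ?E" "\<not> inessential M N f1 f2 Q" for Q
  proof -
   have "constant_path_lift f1 x \<in> Q" using all[OF that] x unfolding bounded_by_all_def by blast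
   then show ?thesis using that(1) unfolding path_components_of_def
    by (auto simp: path_component_of_equiv)
  qed
  ultimately have e: "{Q \<in> path_components_of ?E. \<not> inessential M N f1 f2 Q} = {?Q}" using Q by blast
  show ?thesis unfolding nielsen_count_def e using False by (simp add: cardinality_def one_enat_def)
 qed
qed

end

context spherical_cover
begin

text \<open>
 Generic pairs near \<open>(f, f)\<close> lift to pairs near \<open>(u, u)\<close>, and looseness of the latter is
 invariant under homotopy. So all of them have the same count.
\<close>

theorem nielsen_number_self:
 fixes u :: "'m::euclidean_space => 'f"
 assumes conn: "path_connected (usphere :: 'm set)"
  and u: "continuous_on usphere u" "u ` usphere <= S"
 shows "nielsen_number usphere N (%x. p (u x)) (%x. p (u x)) = (if loose usphere S u u then 0 else 1)"
proof -
 let ?M = "usphere :: 'm set" and ?f = "%x. p (u x)"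
 define de where "de = min (et / 2) (1 / 2)"
 have de: "0 < de" "de <= et / 2" "de <= 1 / 2" using et_pos by (auto simp: de_def)
 obtain ep where ep: "0 < ep" and lift: "!!f1. small_homotopic ep ?M N ?f f1 ==>
  \<exists>u1. continuous_on ?M u1 \<and> u1 ` ?M <= S \<and> (\<forall>x\<in>?M. p (u1 x) = f1 x \<and> dist (u x) (u1 x) < de) \<and>
   homotopic_with_canon (%_. True) ?M S u u1"
  using small_homotopy_lift[OF de(1,2), where 'm = 'm] u by metis
 have count: "nielsen_count ?M N f1 f2 = (if loose ?M S u u then 0 else 1)"
  if f: "small_homotopic ep ?M N ?f f1" "small_homotopic ep ?M N ?f f2" "generic_pair ?M N f1 f2" for f1 f2
 proof -
  obtain u1 where u1: "continuous_on ?M u1" "u1 ` ?M <= S" "\<forall>x\<in>?M. p (u1 x) = f1 x \<and> dist (u x) (u1 x) < de"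
   "homotopic_with_canon (%_. True) ?M S u u1" using lift[OF f(1)] by auto
  obtain u2 where u2: "continuous_on ?M u2" "u2 ` ?M <= S" "\<forall>x\<in>?M. p (u2 x) = f2 x \<and> dist (u x) (u2 x) < de"
   "homotopic_with_canon (%_. True) ?M S u u2" using lift[OF f(2)] by auto
  have sf: "smooth_on ?M f1" "smooth_on ?M f2" using f(3) unfolding generic_pair_def by auto
  have s: "smooth_on ?M u1" "smooth_on ?M u2"
   using smooth_lift[OF u1(1,2) sf(1)] smooth_lift[OF u2(1,2) sf(2)] u1(3) u2(3) by auto
  have d: "dist (u1 x) (u2 x) < 2 * de" if "x \<in> ?M" for x
   using u1(3) u2(3) that dist_triangle3[of "u1 x" "u2 x" "u x"] by fastforce
  have det: "dist (u1 x) (u2 x) < et" if "x \<in> ?M" for x using d[OF that] de(2) by auto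
  interpret sm: sphere_maps p N et u1 u2
   by unfold_locales (fact s u1(2) u2(2) | rule det, assumption)+
  have "sm.transverse_u"
   using generic_pair_cong[OF _ _ f(3), of sm.f1 sm.f2] u1(3) u2(3) sm.generic_iff
   by (simp add: sm.f1_def sm.f2_def)
  from sm.nielsen_count_generic[OF conn this] d de(3)
  have n: "nielsen_count ?M N sm.f1 sm.f2 = (if homotopic_maps ?M S u2 (%x. - u1 x) then 0 else 1)" by force
  have h: "homotopic_maps ?M S u u1" "homotopic_maps ?M S u u2" using u1(4) u2(4) unfolding homotopic_maps_def .
  show ?thesis
   using homotopic_maps_trans[OF h(2) homotopic_maps_trans[OF _ homotopic_maps_uminus[OF homotopic_maps_sym[OF h(1)]]]] homotopic_maps_trans[OF homotopic_maps_sym[OF h(2)] homotopic_maps_trans[OF _ homotopic_maps_uminus[OF h(1)]]] n nielsen_count_cong[of ?M f1 sm.f1 f2 sm.f2 N] u1(3) u2(3) by (fastforce simp: loose_antipodal[OF u] sm.f1_def sm.f2_def)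
 qed
 show ?thesis unfolding nielsen_number_def
 proof (rule the_equality)
  show "\<exists>ep>0. \<forall>f1' f2'. small_homotopic ep ?M N ?f f1' \<and> small_homotopic ep ?M N ?f f2' \<and>
    generic_pair ?M N f1' f2' --> (if loose ?M S u u then 0 else 1) = nielsen_count ?M N f1' f2'"
   using ep count by metis
 next
  fix k assume "\<exists>ep>0. \<forall>f1' f2'. small_homotopic ep ?M N ?f f1' \<and> small_homotopic ep ?M N ?f f2' \<and>
    generic_pair ?M N f1' f2' --> k = nielsen_count ?M N f1' f2'"
  then obtain e where e: "0 < e" "!!f1' f2'. small_homotopic e ?M N ?f f1' ==> small_homotopic e ?M N ?f f2' ==>
    generic_pair ?M N f1' f2' ==> k = nielsen_count ?M N f1' f2'" by blast
  obtain g1 g2 where g: "small_homotopic (min e ep) ?M N ?f g1" "small_homotopic (min e ep) ?M N ?f g2" "generic_pair ?M N g1 g2"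
   using generic_pairs_exist[OF u, of "min e ep"] e(1) ep by auto
  have mono: "small_homotopic r ?M N ?f g" if "small_homotopic (min e ep) ?M N ?f g" "min e ep <= r" for g r
   using that(1) unfolding small_homotopic_def
   by (rule homotopic_with_mono) (use that(2) in \<open>auto intro: order.strict_trans2\<close>)
  show "k = (if loose ?M S u u then 0 else 1)"
   using e(2)[of g1 g2] count[of g1 g2] mono[OF g(1)] mono[OF g(2)] g(3) by simp
 qed
qed

end

section \<open>Parallel transport on spheres\<close>

text \<open>
 Families of linear isometries together with their inverses, both jointly continuous.
\<close>

definition isometry_family :: "'x::topological_space set => ('x => 'f::real_inner => 'f) => ('x => 'f => 'f) => bool" where
 "isometry_family X T T' \<longleftrightarrow> continuous_on (X \<times> UNIV) (%z. T (fst z) (snd z)) \<and>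
   continuous_on (X \<times> UNIV) (%z. T' (fst z) (snd z)) \<and>
   (\<forall>x\<in>X. linear (T x) \<and> linear (T' x) \<and> (\<forall>v w. T' x (T x v) = v \<and> T x (T' x v) = v \<and> T x v \<bullet> T x w = v \<bullet> w))"

lemma isometry_familyD:
 assumes "isometry_family X T T'" "x \<in> X"
 shows "linear (T x)" "linear (T' x)" "T' x (T x v) = v" "T x (T' x v) = v" "T x v \<bullet> T x w = v \<bullet> w" "T' x v \<bullet> T' x w = v \<bullet> w"
  "norm (T x v) = norm v" "norm (T' x v) = norm v"
proof -
 note * = assms(1)[unfolded isometry_family_def, THEN conjunct2, THEN conjunct2, rule_format, OF assms(2)]
 show "linear (T x)" "linear (T' x)" "T' x (T x v) = v" "T x (T' x v) = v" "T x v \<bullet> T x w = v \<bullet> w" for v w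
  using * by auto
 then show "T' x v \<bullet> T' x w = v \<bullet> w" for v w by metis
 then show "norm (T x v) = norm v" "norm (T' x v) = norm v" using * by (simp_all add: norm_eq_sqrt_inner)
qed

lemma isometry_family_continuous:
 assumes T: "isometry_family X T T'" and gh: "continuous_on Y g" "continuous_on Y h" "!!y. y \<in> Y ==> g y \<in> X"
 shows "continuous_on Y (%y. T (g y) (h y))" "continuous_on Y (%y. T' (g y) (h y))"
proof -
 have c: "continuous_on Y (%y. (g y, h y))" "(%y. (g y, h y)) ` Y <= X \<times> UNIV" using gh by (auto intro: continuous_intros)
 have "continuous_on (X \<times> UNIV) (%z. T (fst z) (snd z))" "continuous_on (X \<times> UNIV) (%z. T' (fst z) (snd z))"
  using T unfolding isometry_family_def by auto
 from continuous_on_compose2[OF this(1) c] continuous_on_compose2[OF this(2) c]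
 show "continuous_on Y (%y. T (g y) (h y))" "continuous_on Y (%y. T' (g y) (h y))" by auto
qed

lemma isometry_family_compose:
 assumes "isometry_family X T T'" "isometry_family X U U'"
 shows "isometry_family X (%x v. U x (T x v)) (%x v. T' x (U' x v))"
 unfolding isometry_family_def
 using isometry_familyD[OF assms(1)] isometry_familyD[OF assms(2)]
 by (auto intro!: isometry_family_continuous[OF assms(1)] isometry_family_continuous[OF assms(2)] continuous_intros
   linear_compose[of "T _" "U _", unfolded o_def] linear_compose[of "U' _" "T' _", unfolded o_def])

lemma isometry_family_reflect:
 assumes "continuous_on X a" "!!x. x \<in> X ==> a x ~= 0"
 shows "isometry_family X (%x. reflect (a x)) (%x. reflect (a x))"
proof -
 have "continuous_on (X \<times> UNIV) (%z. reflect (a (fst z)) (snd z))"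
  unfolding reflect_def using assms(2)
  by (intro continuous_intros continuous_on_compose2[OF assms(1)]) auto
 then show ?thesis unfolding isometry_family_def by (simp add: reflect_inner linear_reflect)
qed

text \<open>The product of the reflections along \<open>a\<close> and along \<open>a + b\<close> is a rotation which takes \<open>a\<close> to
 \<open>b\<close>. It is the identity if \<open>a = b\<close>.\<close>

lemma rotation_family:
 fixes a b :: "'x::topological_space => 'f::real_inner"
 assumes "continuous_on X a" "continuous_on X b" "!!x. x \<in> X ==> norm (a x) = 1" "!!x. x \<in> X ==> norm (b x) = 1"
  and "!!x. x \<in> X ==> a x + b x ~= 0"
 obtains T T' where "isometry_family X T T'" "!!x. x \<in> X ==> T x (a x) = b x"
  "!!x v. x \<in> X ==> a x = b x ==> T x v = v"
proof -
 have "isometry_family X (%x v. reflect (a x + b x) (reflect (a x) v)) (%x v. reflect (a x) (reflect (a x + b x) v))"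
 proof (rule isometry_family_compose[OF isometry_family_reflect isometry_family_reflect])
  show "a x ~= 0" if "x \<in> X" for x using assms(3)[OF that] by auto
 qed (use assms in \<open>auto intro: continuous_on_add\<close>)
 moreover have "reflect (a x + b x) (reflect (a x) (a x)) = b x" if "x \<in> X" for x
  using reflect_sum[of "a x" "b x"] assms(3-5)[OF that] by (simp add: reflect_self linear_neg[OF linear_reflect])
 moreover have "reflect (a x + b x) (reflect (a x) v) = v" if "x \<in> X" "a x = b x" for x v
 proof -
  have "reflect (a x + b x) w = reflect (a x) w" for w
   using that(2) by (simp add: reflect_def flip: scaleR_2)
  then show ?thesis by (simp add: reflect_reflect)
 qed
 ultimately show thesis by (rule that)
qed

lemma unit_near_nonopposite:
 fixes a b :: "'a::real_normed_vector"
 assumes "norm a = 1" "dist b a < 1"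
 shows "a + b ~= 0"
proof
 assume "a + b = 0"
 then have "a - b = 2 *R a" by (simp add: add_eq_0_iff scaleR_2)
 then show False using assms(1) assms(2) by (simp add: dist_norm norm_minus_commute[of b])
qed

text \<open>
 On a compact set the homotopy is divided into steps which move points by less than 1. In
 each step the point does not meet the antipode of its predecessor, so that rotations can be
 used, and the rotations are composed.
\<close>

lemma transport_exists:
 fixes H :: "real \<times> 'x::metric_space => 'f::real_inner"
 assumes "compact X" and H: "continuous_on ({0..1} \<times> X) H" "!!t x. t \<in> {0..1} ==> x \<in> X ==> norm (H (t, x)) = 1"
 obtains T T' where "isometry_family X T T'" "!!x. x \<in> X ==> T x (H (0, x)) = H (1, x)"
  "!!x v. x \<in> X ==> (\<forall>t\<in>{0..1}. H (t, x) = H (0, x)) ==> T x v = v"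
proof -
 obtain d where d: "0 < d" "!!z z'. z \<in> {0..1} \<times> X ==> z' \<in> {0..1} \<times> X ==> dist z' z < d ==> dist (H z') (H z) < 1"
  by (metis zero_less_one uniformly_continuous_on_def compact_uniformly_continuous H(1) compact_Times compact_Icc assms(1))
 obtain n :: nat where n: "1 / d < real n" using reals_Archimedean2 by blast
 have n0: "0 < real n" using less_trans[OF divide_pos_pos[OF zero_less_one d(1)] n] .
 have "\<exists>T T'. isometry_family X T T' \<and> (\<forall>x\<in>X. T x (H (0, x)) = H (real k / real n, x)) \<and>
   (\<forall>x\<in>X. \<forall>v. (\<forall>t\<in>{0..1}. H (t, x) = H (0, x)) --> T x v = v)" if "k <= n" for k
  using that
 proof (induction k)
  case 0
  have "isometry_family X (%x v. v) (%x v. v)" unfolding isometry_family_def by (auto intro: continuous_intros linear_ident)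
  then show ?case by auto
 next
  case (Suc k)
  from Suc.IH[OF Suc_leD[OF Suc.prems]]
  obtain T T' where T: "isometry_family X T T'" "\<forall>x\<in>X. T x (H (0, x)) = H (real k / real n, x)"
   "\<forall>x\<in>X. \<forall>v. (\<forall>t\<in>{0..1}. H (t, x) = H (0, x)) --> T x v = v"
   by auto
  have I: "real k / real n \<in> {0..1}" "real (Suc k) / real n \<in> {0..1}" using Suc.prems n0 by auto
  obtain U U' where U: "isometry_family X U U'" "!!x. x \<in> X ==> U x (H (real k / real n, x)) = H (real (Suc k) / real n, x)"
   "!!x v. x \<in> X ==> H (real k / real n, x) = H (real (Suc k) / real n, x) ==> U x v = v"
  proof (rule rotation_family)
   show "continuous_on X (%x. H (real k / real n, x))" "continuous_on X (%x. H (real (Suc k) / real n, x))"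
    using I by (auto intro!: continuous_intros continuous_on_compose2[OF H(1)])
   fix x assume x: "x \<in> X"
   show u: "norm (H (real k / real n, x)) = 1" "norm (H (real (Suc k) / real n, x)) = 1" using H(2) I x by auto
   have "dist (real (Suc k) / real n, x) (real k / real n, x) = 1 / real n"
    by (simp add: dist_Pair_Pair dist_real_def flip: diff_divide_distrib)
   also have "\<dots> < d" using n d(1) n0 by (simp add: field_simps)
   finally show "H (real k / real n, x) + H (real (Suc k) / real n, x) ~= 0"
    using d(2) I x by (auto intro!: unit_near_nonopposite[OF u(1)])
  qed (rule that)
  show ?case
  proof (intro exI conjI ballI allI impI)
   show "isometry_family X (%x v. U x (T x v)) (%x v. T' x (U' x v))" by (rule isometry_family_compose[OF T(1) U(1)])
   fix x assume x: "x \<in> X"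
   show "U x (T x (H (0, x))) = H (real (Suc k) / real n, x)" using T(2) U(2) x by simp
   show "U x (T x v) = v" if "\<forall>t\<in>{0..1}. H (t, x) = H (0, x)" for v
   proof -
    have "H (real k / real n, x) = H (real (Suc k) / real n, x)"
     using bspec[OF that I(1)] bspec[OF that I(2)] by auto
    moreover have "T x v = v" using T(3) x that by blast
    ultimately show ?thesis using U(3)[OF x] by simp
   qed
  qed
 qed
 from this[OF order_refl] obtain T T' where T: "isometry_family X T T'" "\<forall>x\<in>X. T x (H (0, x)) = H (real n / real n, x)"
  "\<forall>x\<in>X. \<forall>v. (\<forall>t\<in>{0..1}. H (t, x) = H (0, x)) --> T x v = v"
  by auto
 show thesis by (rule that[OF T(1)]) (use T(2,3) n0 in \<open>simp, blast\<close>)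
qed

text \<open>A field along \<open>u\<close> is the same as a map into the tangent bundle of the sphere over \<open>u\<close>.\<close>

definition tangent_field :: "'x::topological_space set => ('x => 'f::real_inner) => ('x => 'f) => bool" where
 "tangent_field X u s \<longleftrightarrow> continuous_on X s \<and> (\<forall>x\<in>X. s x \<bullet> u x = 0 \<and> s x ~= 0)"

definition has_field :: "'x::topological_space set => ('x => 'f::real_inner) => bool" where
 "has_field X u \<longleftrightarrow> (\<exists>s. tangent_field X u s)"

lemma tangent_field_transport:
 assumes T: "isometry_family X T T'" "!!x. x \<in> X ==> T x (u x) = u' x" and s: "tangent_field X u s"
 shows "tangent_field X u' (%x. T x (s x))"
 unfolding tangent_field_def
proof (intro conjI ballI)
 show "continuous_on X (%x. T x (s x))"
  by (rule isometry_family_continuous[OF T(1) continuous_on_id]) (use s in \<open>auto simp: tangent_field_def\<close>)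
 fix x assume x: "x \<in> X"
 show "T x (s x) \<bullet> u' x = 0" "T x (s x) ~= 0"
  using isometry_familyD(5)[OF T(1) x, of "s x" "u x"] isometry_familyD(7)[OF T(1) x, of "s x"] T(2)[OF x] s x
  by (auto simp: tangent_field_def)
qed

lemma has_field_homotopic:
 fixes u u' :: "'x::metric_space => 'f::euclidean_space"
 assumes "compact X" "homotopic_maps X usphere u u'" "has_field X u"
 shows "has_field X u'"
proof -
 obtain H where H: "continuous_on ({0..1::real} \<times> X) H" "H ` ({0..1} \<times> X) <= usphere"
  "!!x. H (0, x) = u x" "!!x. H (1, x) = u' x" using assms(2) by (rule homotopic_mapsE) (rule that)
 have "norm (H (t, x)) = 1" if "t \<in> {0..1}" "x \<in> X" for t x using H(2) that by (auto simp: image_subset_iff)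
 from transport_exists[OF assms(1) H(1) this] obtain T T' where
  T: "isometry_family X T T'" "!!x. x \<in> X ==> T x (u x) = u' x" unfolding H(3,4) by metis
 from assms(3) show ?thesis unfolding has_field_def using tangent_field_transport[OF T] by blast
qed

text \<open>Moving along a field turns a map into its antipode.\<close>

lemma has_field_antipodal:
 fixes u :: "'x::topological_space => 'f::euclidean_space"
 assumes u: "continuous_on X u" "u ` X <= usphere" and "has_field X u"
 shows "homotopic_maps X usphere u (%x. - u x)"
proof -
 obtain s where s: "continuous_on X s" "!!x. x \<in> X ==> s x \<bullet> u x = 0 \<and> s x ~= 0"
  using assms(3) unfolding has_field_def tangent_field_def by blast
 have n: "norm (u x) = 1" if "x \<in> X" for x using u(2) that by auto
 have v: "continuous_on X (%x. sgn (s x))" "(%x. sgn (s x)) ` X <= usphere"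
  using s by (auto intro!: continuous_intros simp: norm_sgn)
 have ne: "c *R u x ~= sgn (s x)" if "x \<in> X" for x c
 proof
  assume "c *R u x = sgn (s x)"
  then have "sgn (s x) \<bullet> s x = 0" using s(2)[OF that] by (metis inner_commute inner_scaleR_left mult_zero_right)
  then show False using s(2)[OF that] by (simp add: sgn_div_norm)
 qed
 have "homotopic_maps X usphere u (%x. sgn (s x))"
  by (rule homotopic_maps_nonopposite[OF u v]) (use ne[of _ "-1"] in \<open>auto, metis minus_minus\<close>)
 also have "homotopic_maps X usphere (%x. sgn (s x)) (%x. - u x)"
  by (rule homotopic_maps_nonopposite[OF v]) (use u ne[of _ 1] in \<open>auto intro: continuous_intros, metis\<close>)
 finally show ?thesis .
qed

text \<open>
 A map into a sphere of larger dimension is homotopic to a constant map.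
\<close>

lemma has_field_low_dimension:
 fixes u :: "'d::euclidean_space => 'f::euclidean_space"
 assumes "DIM('d) < DIM('f)" "2 <= DIM('f)" and u: "continuous_on usphere u" "u ` usphere <= usphere"
 shows "has_field usphere u"
proof -
 obtain c where c: "homotopic_maps usphere usphere u (%x. c)"
  using inessential_spheremap_lowdim[OF assms(1) u(1), of 0 1] u(2) unfolding homotopic_maps_def image_subset_iff_funcset by metis
 obtain v where v: "v ~= 0" "orthogonal c v" using orthogonal_to_vector_exists[OF assms(2)] by metis
 have "tangent_field usphere (%x :: 'd. c) (%x. v)"
  using v by (auto simp: tangent_field_def orthogonal_def inner_commute)
 then show ?thesis using has_field_homotopic[OF compact_sphere homotopic_maps_sym[OF c]] unfolding has_field_def by blast
qed

text \<open>
 A circle has a tangent field of its own.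
\<close>

lemma has_field_circle:
 fixes u :: "'x::topological_space => 'e::euclidean_space \<times> real"
 assumes "DIM('e) = 1" and u: "continuous_on X u" "u ` X <= usphere"
 shows "has_field X u"
proof -
 obtain e :: 'e where B: "Basis = {e}" using assms(1) card_1_singletonE by blast
 have a: "v = (v \<bullet> e) *R e" for v :: 'e using euclidean_representation[of v] unfolding B by simp
 have e: "e \<bullet> e = 1" using B by (metis inner_Basis singletonI)
 let ?s = "%x. (- snd (u x) *R e, fst (u x) \<bullet> e)"
 have "?s x \<bullet> u x = 0" "?s x ~= 0" if "x \<in> X" for x
 proof -
  show "?s x \<bullet> u x = 0" by (simp add: inner_prod_def inner_commute)
  show "?s x ~= 0"
  proof
   assume "?s x = 0"
   then have "snd (u x) = 0" "fst (u x) = 0" using e a[of "fst (u x)"] by (auto simp: zero_prod_def)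
   then show False using u(2) that by (auto simp: norm_prod_def)
  qed
 qed
 then show ?thesis unfolding has_field_def tangent_field_def
  by (intro exI[of _ ?s]) (auto intro!: continuous_intros u(1))
qed

section \<open>Maps on quotients of disks and cylinders\<close>

lemma continuous_on_descend:
 fixes q :: "'a::t2_space => 'b::t2_space" and f :: "'a => 'c::topological_space"
 assumes "compact K" "continuous_on K q" "continuous_on K f" "!!x. x \<in> K ==> g (q x) = f x"
 shows "continuous_on (q ` K) g"
proof -
 have "closed (g -` C \<inter> q ` K)" if "closed C" for C
 proof -
  have "closed (q ` (K \<inter> (f -` C \<inter> K)))"
   using continuous_on_closed_vimage[OF compact_imp_closed[OF assms(1)]] assms(3) that by (fastforce intro: assms(1) compact_imp_closed compact_continuous_image continuous_on_subset[OF assms(2)])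
  moreover have "g -` C \<inter> q ` K = q ` (K \<inter> (f -` C \<inter> K))" using assms(4) by auto
  ultimately show ?thesis by simp
 qed
 then show ?thesis
  using continuous_on_closed_vimage[OF compact_imp_closed[OF compact_continuous_image[OF assms(2,1)]]] by blast
qed

lemma descend:
 fixes q :: "'a::t2_space => 'b::t2_space" and f :: "'a => 'c::topological_space"
 assumes "compact K" "continuous_on K q" "continuous_on K f" "!!x y. x \<in> K ==> y \<in> K ==> q x = q y ==> f x = f y"
 obtains g where "continuous_on (q ` K) g" "!!x. x \<in> K ==> g (q x) = f x"
proof -
 define g where "g y = f (SOME x. x \<in> K \<and> q x = y)" for y
 have g: "g (q x) = f x" if "x \<in> K" for x
  using someI[of "%z. z \<in> K \<and> q z = q x" x] that assms(4) unfolding g_def by metis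
 show thesis by (rule that[OF continuous_on_descend[OF assms(1-3) g] g])
qed

lemma e0_Basis: "(e0 :: 'd::euclidean_space) \<in> Basis"
 unfolding e0_def using nonempty_Basis by (simp add: some_in_eq)

lemma norm_e0 [simp]: "norm (e0 :: 'd::euclidean_space) = 1"
 by (rule norm_Basis[OF e0_Basis])

lemma norm_collapse:
 assumes "norm x <= 1"
 shows "norm (collapse x) = 1"
using assms norm_ge_zero not_one_le_zero neg_0_le_iff_le order_trans zero_le_one by (simp add: power_le_one collapse_def norm_prod_def power_mult_distrib power2_diff algebra_simps flip : power_mult power2_eq_1_iff)

lemma continuous_collapse: "continuous_on X collapse"
 unfolding collapse_def by (intro continuous_intros)

lemma collapse_north: "norm x = 1 ==> collapse x = north"
 by (simp add: collapse_def)

lemma collapse_eq: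
 assumes "norm x <= 1" "norm y <= 1" "collapse x = collapse y"
 shows "x = y \<or> norm x = 1 \<and> norm y = 1"
proof -
 have n: "norm x = norm y" using assms(3) by (auto simp: collapse_def)
 show ?thesis
 proof (cases "norm x = 1")
  case False
  then have "(norm y)\<^sup>2 < 1"
   using n assms(2) by (simp add: power_less_one_iff)
  then show ?thesis using assms(3) n by (simp add: collapse_def)
 qed (use n in auto)
qed

lemma collapse_image: "collapse ` cball 0 1 = (usphere :: ('d::euclidean_space \<times> real) set)"
proof
 show "collapse ` cball 0 1 <= (usphere :: ('d \<times> real) set)" using norm_collapse by auto
 show "(usphere :: ('d \<times> real) set) <= collapse ` cball 0 1"
 proof
  fix z :: "'d \<times> real" assume "z \<in> usphere"
  then obtain a t where z: "z = (a, t)" "(norm a)\<^sup>2 + t\<^sup>2 = 1" by (cases z) (auto simp: norm_prod_def)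
  then have t: "\<bar>t\<bar> <= 1" by (metis abs_square_le_1 add.commute le_add_same_cancel1 zero_le_power2)
  show "z \<in> collapse ` cball 0 1"
  proof (cases "t = 1")
   case True
   then have "z = collapse e0" using z by (simp add: collapse_north)
   then show ?thesis by auto
  next
   case False
   then have t1: "t < 1" using t by simp
   let ?x = "a /R sqrt (2 * (1 - t))"
   have "(norm ?x)\<^sup>2 = (norm a)\<^sup>2 / (2 * (1 - t))"
    using t1 by (simp add: power_mult_distrib power_inverse divide_inverse)
   also have "(norm a)\<^sup>2 = 1 - t\<^sup>2" using z(2) by simp
   also have "(1 - t\<^sup>2) / (2 * (1 - t)) = (1 + t) / 2" using t1 by (simp add: field_simps power2_eq_square)
   finally have n: "(norm ?x)\<^sup>2 = (1 + t) / 2" .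
   then have "(norm ?x)\<^sup>2 <= 1" using t1 by simp
   then have "norm ?x <= 1" by (simp add: abs_square_le_1)
   moreover have "collapse ?x = z"
   proof -
    have "1 - (norm ?x)\<^sup>2 = (1 - t) / 2" using n by auto
    moreover have "2 * sqrt ((1 - t) / 2) = sqrt (2 * (1 - t))"
     by (rule sym, rule real_sqrt_unique) (use t1 in \<open>auto simp: power_mult_distrib\<close>)
    moreover have "2 * (norm ?x)\<^sup>2 - 1 = t" using n by simp
    ultimately have "2 * sqrt (1 - (norm ?x)\<^sup>2) = sqrt (2 * (1 - t))" "2 * (norm ?x)\<^sup>2 - 1 = t"
     by (simp_all only:)
    then show ?thesis unfolding collapse_def using t1 by (simp only: z(1)) simp
   qed
   ultimately show ?thesis by auto
  qed
 qed
qed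

lemma descend_collapse:
 fixes s :: "'d::euclidean_space => 'c::topological_space"
 assumes "continuous_on (cball 0 1) s" "!!x y. norm x = 1 ==> norm y = 1 ==> s x = s y"
 obtains s' where "continuous_on usphere s'" "!!x. norm x <= 1 ==> s' (collapse x) = s x"
proof -
 have "s x = s y" if "x \<in> cball 0 1" "y \<in> cball 0 1" "collapse x = collapse y" for x y
  using collapse_eq[of x y] that assms(2) by auto
 from descend[OF compact_cball continuous_collapse assms(1) this] obtain s' where
  "continuous_on usphere s'" "!!x. x \<in> cball 0 1 ==> s' (collapse x) = s x"
  unfolding collapse_image by metis
 then show thesis by (intro that[of s']) auto
qed

lemma descend_collapse_homotopy:
 fixes h :: "'d::euclidean_space \<times> real => 'c::topological_space"
 assumes "continuous_on (cball 0 1 \<times> {0..1}) h" "!!x y t. norm x = 1 ==> norm y = 1 ==> h (x, t) = h (y, t)"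
 obtains h' where "continuous_on ({0..1} \<times> usphere) h'" "!!x t. norm x <= 1 ==> t \<in> {0..1} ==> h' (t, collapse x) = h (x, t)"
proof -
 let ?q = "%z :: 'd \<times> real. (snd z, collapse (fst z))"
 have "continuous_on (cball 0 1 \<times> {0..1}) ?q"
  by (intro continuous_intros continuous_on_compose2[OF continuous_collapse[of UNIV]]) auto
 moreover have "h z = h z'" if "z \<in> cball 0 1 \<times> {0..1}" "z' \<in> cball 0 1 \<times> {0..1}" "?q z = ?q z'" for z z'
  using collapse_eq[of "fst z" "fst z'"] that assms(2)[of "fst z" "fst z'" "snd z"] by auto
 ultimately obtain h' where h': "continuous_on (?q ` (cball 0 1 \<times> {0..1})) h'" "!!z. z \<in> cball 0 1 \<times> {0..1} ==> h' (?q z) = h z"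
  by (rule descend[OF compact_Times[OF compact_cball compact_Icc] _ assms(1)]) (assumption | rule that)+
 have "?q ` (cball 0 1 \<times> {0..1}) = {0..1} \<times> usphere"
  unfolding collapse_image[symmetric] by force
 with h'(1) show thesis using h'(2) by (auto intro!: that[of h'])
qed

definition polar :: "'d::real_normed_vector \<times> real => 'd \<times> real" where
 "polar z = (sin (pi * snd z) *R fst z, cos (pi * snd z))"

lemma continuous_polar: "continuous_on X polar"
 unfolding polar_def by (intro continuous_intros)

lemma polar_image: "polar ` (usphere \<times> {0..1}) = (usphere :: ('d::euclidean_space \<times> real) set)"
proof
 have "(norm (polar (x, s)))\<^sup>2 = 1" if "norm x = 1" for x :: 'd and s
  using that by (simp add: polar_def norm_prod_def)
 then show "polar ` (usphere \<times> {0..1}) <= (usphere :: ('d \<times> real) set)"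
  by (auto simp: power2_eq_1_iff) (smt (verit) norm_ge_zero)
 show "(usphere :: ('d \<times> real) set) <= polar ` (usphere \<times> {0..1})"
 proof
  fix z :: "'d \<times> real" assume "z \<in> usphere"
  then obtain a t where z: "z = (a, t)" "(norm a)\<^sup>2 + t\<^sup>2 = 1" by (cases z) (auto simp: norm_prod_def)
  then have t: "\<bar>t\<bar> <= 1" by (metis abs_square_le_1 add.commute le_add_same_cancel1 zero_le_power2)
  define x where "x = (if a = 0 then e0 else sgn a)"
  have x: "norm x = 1" "norm a *R x = a" by (auto simp: x_def sgn_div_norm)
  have "sin (arccos t) = sqrt (1 - t\<^sup>2)" using t by (simp add: sin_arccos)
  also have "\<dots> = norm a" by (simp flip: z(2))
  finally show "z \<in> polar ` (usphere \<times> {0..1})"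
   using x(2) t arccos_bounded[of t] x(1) by (auto simp: polar_def z(1) intro!: image_eqI[of _ _ "(x, arccos t / pi)"])
 qed
qed

lemma polar_eq:
 assumes "s \<in> {0..1}" "s' \<in> {0..1}" "polar (x, s) = polar (x', s')"
 shows "s = s' \<and> (x = x' \<or> s = 0 \<or> s = 1)"
proof -
 have "pi * s = pi * s'" using assms by (fastforce simp: polar_def intro: cos_inj_pi)
 moreover have "sin (pi * s) ~= 0" if "s ~= 0" "s ~= 1"
  using assms(1) that sin_gt_zero[of "pi * s"] by auto
 ultimately show ?thesis using assms(3) by (auto simp: polar_def)
qed

lemma suspend_polar:
 assumes "norm x = 1" "s \<in> {0..1}"
 shows "suspend g (polar (x, s)) = (sin (pi * s) *R g x, cos (pi * s))"
using assms(2) assms(1) sin_ge_zero by (auto simp: mult_left_le suspend_def polar_def)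

text \<open>A homotopy on a cylinder which is independent of \<open>x\<close> at both ends passes to the suspension.\<close>

lemma descend_polar:
 fixes k l :: "'d::euclidean_space \<times> real => 'c::topological_space"
 assumes "homotopic_with_canon (%h. \<forall>x y. norm x = 1 --> norm y = 1 --> h (x, 0) = h (y, 0) \<and> h (x, 1) = h (y, 1))
   (usphere \<times> {0..1}) Y k l"
  and "!!x s. norm x = 1 ==> s \<in> {0..1} ==> k' (polar (x, s)) = k (x, s)"
  and "!!x s. norm x = 1 ==> s \<in> {0..1} ==> l' (polar (x, s)) = l (x, s)"
 shows "homotopic_maps usphere Y k' l'"
proof -
 obtain h where h: "continuous_on ({0..1::real} \<times> (usphere \<times> {0..1})) h" "h ` ({0..1} \<times> (usphere \<times> {0..1})) <= Y"
  "!!z. h (0, z) = k z" "!!z. h (1, z) = l z" and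
  ends: "!!t. t \<in> {0..1} ==> \<forall>x y. norm x = 1 --> norm y = 1 --> h (t, x, 0) = h (t, y, 0) \<and> h (t, x, 1) = h (t, y, 1)"
  using assms(1) by (rule homotopic_withE) (rule that)
 let ?K = "{0..1::real} \<times> (sphere (0 :: 'd) 1 \<times> {0..1::real})" and ?q = "%z :: real \<times> 'd \<times> real. (fst z, polar (snd z))"
 have cq: "continuous_on ?K ?q" by (intro continuous_intros continuous_on_compose2[OF continuous_polar[of UNIV]]) auto
 have fib: "h z = h z'" if z: "z \<in> ?K" "z' \<in> ?K" "?q z = ?q z'" for z z'
 proof -
  obtain t x s t' x' s' where [simp]: "z = (t, x, s)" "z' = (t', x', s')" by (metis prod.collapse)
  show ?thesis using z ends[of t] polar_eq[of s s' x x'] by auto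
 qed
 have img: "?q ` ?K = {0..1} \<times> usphere" unfolding polar_image[symmetric] by force
 have cK: "compact ?K" by (intro compact_Times compact_Icc compact_sphere)
 obtain h' where h'0: "continuous_on (?q ` ?K) h'" and h'2: "!!z. z \<in> ?K ==> h' (?q z) = h z"
  by (rule descend[OF cK cq h(1)], erule (2) fib, rule that)
 note h' = h'0[unfolded img] h'2
 have pt: "\<exists>x s. norm x = 1 \<and> s \<in> {0..1} \<and> y = polar (x, s)" if "y \<in> usphere" for y :: "'d \<times> real"
 using that by (fastforce simp: polar_image[symmetric])
 show ?thesis
 proof (rule homotopic_mapsI[OF h'(1)])
  show "h' ` ({0..1} \<times> usphere) <= Y"
  proof clarify
   fix t :: real and y :: "'d \<times> real" assume ty: "t \<in> {0..1}" "y \<in> usphere"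
   then obtain x s where xs: "norm x = 1" "s \<in> {0..1}" "y = polar (x, s)" using pt by blast
   then show "h' (t, y) \<in> Y" using ty h'(2)[of "(t, x, s)"] h(2) xs(3) by auto
  qed
  fix y :: "'d \<times> real" assume "y \<in> usphere"
  then obtain x s where xs: "norm x = 1" "s \<in> {0..1}" "y = polar (x, s)" using pt by blast
  then show "h' (0, y) = k' y" "h' (1, y) = l' y"
   using h'(2)[of "(0, x, s)"] h'(2)[of "(1, x, s)"] h(3,4) assms(2,3) by auto
 qed
qed

lemma based_class_eq_iff:
 assumes "continuous_on S f" "f ` S <= X" "f s = g s"
 shows "based_class S s X f = based_class S s X g \<longleftrightarrow> homotopic_with_canon (%h. h s = f s) S X f g"
using assms(1,2) by (auto simp: based_class_def assms(3) homotopic_with_refl image_subset_iff_funcset intro: homotopic_with_trans homotopic_with_symD)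

text \<open>A null homotopic map extends to the disk, and the contraction of the disk to a boundary point
 gives a based null homotopy.\<close>

lemma based_null_homotopy:
 fixes f :: "'a::euclidean_space => 'b::real_normed_vector"
 assumes "homotopic_maps usphere Y f (%_. c)" "norm a = 1"
 shows "homotopic_with_canon (%h. h a = f a) usphere Y f (%_. f a)"
proof -
 obtain g where g: "continuous_on (cball 0 1) g" "g ` cball 0 1 <= Y" "\<forall>x\<in>usphere. g x = f x"
  using nullhomotopic_from_sphere_extension[of 0 1 Y f] assms(1) unfolding homotopic_maps_def image_subset_iff_funcset by metis
 have m: "(1 - t) *R x + t *R a \<in> cball 0 1" if "t \<in> {0..1}" "x \<in> usphere" for t x
  using convexD[OF convex_cball[of 0 1], of x a "1 - t" t] that assms(2) by auto
 show ?thesis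
 proof (rule homotopic_withI[where h = "%z. if snd z = a then f a else g ((1 - fst z) *R snd z + fst z *R a)"])
  have e: "(if snd z = a then f a else g ((1 - fst z) *R snd z + fst z *R a)) = g ((1 - fst z) *R snd z + fst z *R a)" for z
   using g(3) assms(2) by auto
  show "continuous_on ({0..1} \<times> usphere) (%z. if snd z = a then f a else g ((1 - fst z) *R snd z + fst z *R a))"
   unfolding e by (intro continuous_on_compose2[OF g(1)] continuous_intros) (use m in auto)
  show "(%z. if snd z = a then f a else g ((1 - fst z) *R snd z + fst z *R a)) ` ({0..1} \<times> usphere) <= Y"
   unfolding e using g(2) m by (auto simp: image_subset_iff)
 qed (use g(3) assms(2) in auto)
qed

section \<open>Clutching maps\<close>

text \<open>
 \<open>R x\<close> transports from \<open>x\<close> to the base point of the boundary of the disk. The boundary values of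
 a field along \<open>fh \<circ> collapse\<close>, read in the coordinates \<open>L\<close>, are determined up to homotopy by
 the inverse transport of a fixed vector.
\<close>

locale clutching =
 fixes fh :: "'d::euclidean_space \<times> real => 'e::euclidean_space \<times> real" and L :: "'e => 'e \<times> real"
  and R R' :: "'d => 'e \<times> real => 'e \<times> real"
 assumes continuous_fh: "continuous_on usphere fh" and fh_sphere: "fh ` usphere <= usphere"
  and linear_L: "linear L" and L_orthogonal: "L v \<bullet> fh north = 0" and L_inj: "L v = 0 ==> v = 0"
  and R: "isometry_family (cball 0 1) R R'" and R_u: "norm x <= 1 ==> R x (fh (collapse x)) = fh north"
  and R_e0: "R e0 w = w"
begin

abbreviation "yt \<equiv> fh north"
abbreviation "v0 \<equiv> L e0"

lemma yt: "yt \<bullet> yt = 1" "norm yt = 1"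
using fh_sphere by (auto simp: norm_prod_def image_subset_iff dot_square_norm)

lemma R_D: assumes "norm x <= 1"
 shows "linear (R x)" "linear (R' x)" "R' x (R x v) = v" "R x (R' x v) = v" "R x v \<bullet> R x w = v \<bullet> w" "norm (R x v) = norm v" "norm (R' x v) = norm v"
  "R x v \<bullet> yt = v \<bullet> fh (collapse x)" "R' x v \<bullet> fh (collapse x) = v \<bullet> yt"
  "R' x yt = fh (collapse x)"
proof -
 have x: "x \<in> cball 0 1" using assms by simp
 note * = isometry_familyD[OF R x]
 show "linear (R x)" "linear (R' x)" "R' x (R x v) = v" "R x (R' x v) = v" "R x v \<bullet> R x w = v \<bullet> w" "norm (R x v) = norm v" "norm (R' x v) = norm v" for v w
  by (rule *)+
 show "R x v \<bullet> yt = v \<bullet> fh (collapse x)" for v using *(5)[of v "fh (collapse x)"] by (simp add: R_u[OF assms])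
 then show "R' x v \<bullet> fh (collapse x) = v \<bullet> yt" using *(4)[of v] by metis
 show "R' x yt = fh (collapse x)" using *(3)[of "fh (collapse x)"] by (simp add: R_u[OF assms])
qed

lemma R_boundary: assumes "norm x = 1"
 shows "R x v \<bullet> yt = v \<bullet> yt" "R' x v \<bullet> yt = v \<bullet> yt" "R x yt = yt" "R' x yt = yt"
 using R_D(8,9)[of x v] R_D(10)[of x] R_u[of x] by (simp_all add: assms collapse_north)

lemma R'_e0: "R' e0 v = v"
 using R_D(3)[of e0 v] by (simp add: R_e0)

lemma continuous_R:
 assumes "continuous_on Y g" "continuous_on Y h" "!!y. y \<in> Y ==> norm (g y) <= 1"
 shows "continuous_on Y (%y. R (g y) (h y))" "continuous_on Y (%y. R' (g y) (h y))"
 using assms by (auto intro!: isometry_family_continuous[OF R])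

definition Lam :: "'e \<times> real => 'e \<times> real" where "Lam z = L (fst z) + snd z *R yt"
definition Lam' :: "'e \<times> real => 'e \<times> real" where "Lam' = inv_into UNIV Lam"
definition Li :: "'e \<times> real => 'e" where "Li w = fst (Lam' w)"

lemma linear_Lam: "linear Lam"
 by (rule linearI) (simp_all add: Lam_def linear_add[OF linear_L] linear_cmul[OF linear_L] algebra_simps)

lemma inj_Lam: "inj Lam"
proof (rule linear_injective_0[OF linear_Lam, THEN iffD2], intro allI impI)
 fix z assume z: "Lam z = 0"
 then have "Lam z \<bullet> yt = 0" by simp
 then have s: "snd z = 0" using yt by (simp add: Lam_def inner_add_left L_orthogonal)
 then show "z = 0" using z s L_inj by (simp add: Lam_def prod_eq_iff)
qed

lemma Lam'_Lam: "Lam' (Lam z) = z" and Lam_Lam': "Lam (Lam' w) = w"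
 unfolding Lam'_def using inj_Lam linear_injective_imp_surjective[OF linear_Lam inj_Lam]
 by (simp_all add: surj_f_inv_f)

lemma linear_Lam': "linear Lam'"
by (metis Lam'_Lam linear_add[OF linear_Lam] linear_cmul[OF linear_Lam] Lam_Lam' linearI)

lemma linear_Li: "linear Li"
 unfolding Li_def by (rule linearI) (simp_all add: linear_add[OF linear_Lam'] linear_cmul[OF linear_Lam'])

lemma continuous_on_linear_compose: "linear l ==> continuous_on Y h ==> continuous_on Y (%y. l (h y))"
 for l :: "'u::euclidean_space => 'w::real_normed_vector"
 by (rule bounded_linear.continuous_on[OF linear_conv_bounded_linear[THEN iffD1]])

lemma Li_L: "Li (L v) = v"
 using Lam'_Lam[of "(v, 0)"] by (simp add: Li_def Lam_def)

lemma L_Li: "w \<bullet> yt = 0 ==> L (Li w) = w"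
proof -
 assume w: "w \<bullet> yt = 0"
 have *: "w = L (Li w) + snd (Lam' w) *R yt" using Lam_Lam'[of w] by (simp add: Lam_def Li_def)
 then have "w \<bullet> yt = snd (Lam' w)" using yt by (metis L_orthogonal inner_add_left inner_scaleR_left add_0 mult.right_neutral)
 then show ?thesis using * w by simp
qed

lemma Li_0: "w \<bullet> yt = 0 ==> Li w = 0 \<longleftrightarrow> w = 0"
 using L_Li[of w] linear_0[OF linear_L] linear_0[OF linear_Li] by auto

lemma v0: "v0 \<bullet> yt = 0" "v0 ~= 0"
 by (rule L_orthogonal) (metis L_inj norm_e0 norm_zero zero_neq_one)

definition gs :: "'d => 'e" where "gs x = sgn (Li (R' x v0))"

lemma gs_e0: "gs e0 = e0"
 by (simp add: gs_def R'_e0 Li_L sgn_div_norm)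

lemma Li_homotopy:
 assumes "continuous_on ({0..1::real} \<times> usphere) W"
  and "!!t x. t \<in> {0..1} ==> norm x = 1 ==> W (t, x) \<bullet> yt = 0 \<and> W (t, x) ~= 0"
  and "!!t. t \<in> {0..1} ==> P (%x. sgn (Li (W (t, x))))"
  and "!!u v. (!!x. norm x = 1 ==> u x = v x) ==> P u \<longleftrightarrow> P v"
 shows "homotopic_with_canon P (sphere (0 :: 'd) 1) usphere (%x. sgn (Li (W (0, x)))) (%x. sgn (Li (W (1, x))))"
proof (rule homotopic_withI[where h = "%z. sgn (Li (W z))"])
 have "Li (W z) ~= 0" if "z \<in> {0..1} \<times> usphere" for z
  using assms(2)[of "fst z" "snd z"] that Li_0[of "W z"] by auto
 then show "continuous_on ({0..1} \<times> usphere) (%z. sgn (Li (W z)))" "(%z. sgn (Li (W z))) ` ({0..1} \<times> usphere) <= usphere"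
  by (auto intro!: continuous_intros continuous_on_linear_compose[OF linear_Li] assms(1) simp: norm_sgn)
qed (rule refl, rule refl, erule assms(3), rule assms(4), simp)

lemma gs_sphere: "continuous_on usphere gs" "gs ` usphere <= usphere"
proof -
 have "Li (R' x v0) ~= 0" if "norm x = 1" for x
  using Li_0[of "R' x v0"] R_boundary[OF that] R_D(7)[of x v0] v0 that by auto
 then show "continuous_on usphere gs" "gs ` usphere <= usphere" unfolding gs_def
  by (auto intro!: continuous_intros continuous_on_linear_compose[OF linear_Li] continuous_R simp: norm_sgn)
qed

lemma segment_disk:
 assumes "t \<in> {0..1::real}" "norm (x :: 'd) <= 1" "norm y <= 1"
 shows "norm ((1 - t) *R x + t *R y) <= 1"
 using convexD[OF convex_cball[of 0 1], of x y "1 - t" t] assms by auto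

text \<open>
 Transported to the base point and contracted along radii towards \<open>e0\<close>, the field \<open>w\<close> joins its value \<open>v0\<close>
 at \<open>e0\<close> to its boundary values.
\<close>

lemma boundary_values_homotopic:
 assumes w: "tangent_field (cball 0 1) (%x. fh (collapse x)) w" "!!x. norm x = 1 ==> w x = L (g x)"
  and g: "g ` usphere <= usphere" "g e0 = e0"
 shows "homotopic_with_canon (%h. h e0 = e0) usphere usphere gs g"
proof -
 define c where "c z = (1 - fst z) *R e0 + fst z *R snd z" for z :: "real \<times> 'd"
 define W where "W z = R' (snd z) (R (c z) (w (c z)))" for z
 have c: "norm (c (t, x)) <= 1" if "t \<in> {0..1}" "norm x = 1" for t x
  unfolding c_def using segment_disk[OF that(1), of e0 x] that(2) by simp
 have cc: "continuous_on Y c" for Y unfolding c_def by (intro continuous_intros)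
 have "homotopic_with_canon (%h. h e0 = e0) usphere usphere (%x. sgn (Li (W (0, x)))) (%x. sgn (Li (W (1, x))))"
 proof (rule Li_homotopy)
  have cw: "continuous_on (cball 0 1) w" using w(1) by (simp add: tangent_field_def)
  have c1: "continuous_on ({0..1} \<times> usphere) (%z. w (c z))" by (rule continuous_on_compose2[OF cw cc]) (use c in auto)
  have c2: "continuous_on ({0..1} \<times> usphere) (%z. R (c z) (w (c z)))" by (rule continuous_R(1)[OF cc c1]) (use c in auto)
  show "continuous_on ({0..1} \<times> usphere) W" unfolding W_def
   by (rule continuous_R(2)[OF continuous_on_snd[OF continuous_on_id] c2]) auto
  fix t :: real and x :: 'd assume tx: "t \<in> {0..1}" "norm x = 1"
  have "W (t, x) \<bullet> yt = 0" "norm (W (t, x)) ~= 0"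
   using w(1) c[OF tx] R_D(6,8)[OF c[OF tx]] R_D(7)[of x] R_boundary(2)[OF tx(2)] tx(2) by (auto simp: tangent_field_def W_def)
  then show "W (t, x) \<bullet> yt = 0 \<and> W (t, x) ~= 0" by auto
 next
  fix t :: real
  show "sgn (Li (W (t, e0))) = e0"
   using g w(2)[of e0] by (simp add: c_def W_def R'_e0 R_e0 Li_L sgn_div_norm)
 qed auto
 moreover have "sgn (Li (W (0, x))) = gs x" for x
  using w(2)[of e0] g(2) by (simp add: W_def c_def gs_def R_e0)
 moreover have "sgn (Li (W (1, x))) = g x" if "norm x = 1" for x
 using g(1) that w(2)[OF that] R_D(3)[of x] by (simp add: image_subset_iff W_def c_def Li_L sgn_div_norm)
 ultimately show ?thesis by (elim homotopic_with_eq) auto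
qed

text \<open>
 If the clutching map is null homotopic, then the vectors \<open>R x v0\<close> on the boundary extend over the
 disk without zeros; transported back they are constant on the boundary and descend to a
 field. Conversely a field gives boundary values as above with a constant vector, which
 after a change of sign can be joined to \<open>v0\<close>.
\<close>

lemma gs_null_iff: "homotopic_with_canon (%h. h e0 = e0) usphere usphere gs (%_. e0) \<longleftrightarrow> has_field usphere fh"
proof
 assume "homotopic_with_canon (%h. h e0 = e0) usphere usphere gs (%_. e0)"
 then obtain h where h: "continuous_on ({0..1::real} \<times> usphere) h" "h ` ({0..1} \<times> usphere) <= usphere"
  "!!x. h (0, x) = gs x" "!!x. h (1, x) = e0" by (rule homotopic_withE) (rule that)
 let ?Y = "{v. v \<bullet> yt = 0 \<and> v ~= 0}"
 let ?k = "%z. sgn (R (snd z) (L (h z)))"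
 have k: "R x (L (h (t, x))) \<bullet> yt = 0 \<and> R x (L (h (t, x))) ~= 0" if "t \<in> {0..1}" "norm x = 1" for t x
 proof -
  have "L (h (t, x)) ~= 0"
   using h(2) that L_inj[of "h (t, x)"] by fastforce
  then show ?thesis using R_boundary[OF that(2)] R_D(6)[of x "L (h (t, x))"] that(2) L_orthogonal by auto
 qed
 have null: "homotopic_maps usphere ?Y (%x. sgn (R x v0)) (%_. sgn v0)"
 proof (rule homotopic_maps_sym, rule homotopic_mapsI[of _ ?k])
  show "continuous_on ({0..1} \<times> usphere) ?k"
   by (intro continuous_R continuous_intros continuous_on_linear_compose[OF linear_L] h(1), use k in auto)
  show "?k ` ({0..1} \<times> usphere) <= ?Y" using k by (auto simp: sgn_div_norm)
  fix x :: 'd assume "x \<in> usphere"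
  then have x: "norm x = 1" by simp
  have o: "R' x v0 \<bullet> yt = 0" using R_boundary[OF x] v0 by simp
  show "?k (0, x) = sgn v0"
   using Li_0[OF o] R_D(7)[of x v0] x R_D(1,4)[of x] by (auto simp: gs_def sgn_div_norm linear_cmul[OF linear_L] L_Li[OF o] linear_cmul h(3))
  show "?k (1, x) = sgn (R x v0)" by (simp add: h(4))
 qed
 from nullhomotopic_from_sphere_extension[THEN iffD1, OF exI, OF null[unfolded homotopic_maps_def]]
 obtain G where G: "continuous_on (cball 0 1) G" "G ` cball 0 1 <= ?Y" "\<forall>x\<in>usphere. G x = sgn (R x v0)"
  by auto
 have c: "continuous_on (cball 0 1) (%x. R' x (G x))" by (intro continuous_R G(1), auto)
 have bnd: "R' x (G x) = sgn v0" if "norm x = 1" for x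
  using G(3) that R_D(2,3,6)[of x] by (simp add: sgn_div_norm linear_cmul)
 obtain s where s: "continuous_on usphere s" "!!x. norm x <= 1 ==> s (collapse x) = R' x (G x)"
  by (rule descend_collapse[OF c], simp add: bnd, rule that)
 have "s y \<bullet> fh y = 0 \<and> s y ~= 0" if "y \<in> usphere" for y
 proof -
  obtain x :: 'd where x: "norm x <= 1" "y = collapse x" using \<open>y \<in> usphere\<close> unfolding collapse_image[symmetric] by auto
  show ?thesis
   using subsetD[OF G(2) imageI, of x] x(1) R_D(9)[OF x(1), of "G x"] R_D(7)[OF x(1), of "G x"] by (auto simp: x(2) s(2)[OF x(1)])
 qed
 then show "has_field usphere fh" unfolding has_field_def tangent_field_def using s(1) by blast
next
 assume "has_field usphere fh"
 then obtain s1 where "tangent_field usphere fh s1" unfolding has_field_def by blast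
 then have s1: "continuous_on usphere s1" "!!y. norm y = 1 ==> s1 y \<bullet> fh y = 0 \<and> s1 y ~= 0"
  by (simp_all add: tangent_field_def)
 define s where "s y = (if s1 north \<bullet> v0 < 0 then - 1 else 1) *R s1 y" for y
 have s: "continuous_on usphere s" "!!y. norm y = 1 ==> s y \<bullet> fh y = 0 \<and> s y ~= 0" "0 <= s north \<bullet> v0"
  using s1 by (auto simp: s_def intro!: continuous_intros)
 define s0 where "s0 = s north"
 have s0: "s0 \<bullet> yt = 0" "s0 ~= 0" using s by (auto simp: s0_def)
 have "homotopic_maps usphere usphere gs (%x. sgn (Li (R' x s0)))"
 proof -
  let ?W = "%z :: real \<times> 'd. R' (snd z) ((1 - fst z) *R v0 + fst z *R s0)"
  have "?W (t, x) \<bullet> yt = 0 \<and> ?W (t, x) ~= 0" if "t \<in> {0..1}" "norm x = 1" for t x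
  proof -
   let ?v = "(1 - t) *R v0 + t *R s0"
   have "?v ~= 0"
   proof
    assume z: "?v = 0"
    have "?v \<bullet> v0 = (1 - t) * (v0 \<bullet> v0) + t * (s0 \<bullet> v0)" by (simp add: inner_add_left)
    moreover have "0 <= t * (s0 \<bullet> v0)" "0 <= (1 - t) * (v0 \<bullet> v0)" using s(3) that(1) by (auto simp: s0_def)
    moreover have "?v \<bullet> v0 = 0" using z by simp
    ultimately have "(1 - t) * (v0 \<bullet> v0) = 0" by linarith
    then show False using v0(2) z s0(2) by simp
   qed
   then show ?thesis using R_boundary[OF that(2)] R_D(7)[of x ?v] that(2) v0 s0 by (auto simp: inner_add_left)
  qed
  then have "homotopic_with_canon (%_. True) usphere usphere (%x. sgn (Li (?W (0, x)))) (%x. sgn (Li (?W (1, x))))"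
   by (intro Li_homotopy[where W = ?W] continuous_R(2)[of _ snd] continuous_intros) auto
  then show ?thesis unfolding homotopic_maps_def gs_def by simp
 qed
 also have "homotopic_maps usphere usphere (%x. sgn (Li (R' x s0))) (%_. sgn (Li s0))"
 proof -
  define c where "c z = (1 - fst z) *R e0 + fst z *R snd z" for z :: "real \<times> 'd"
  define W where "W z = R' (snd z) (R (c z) (s (collapse (c z))))" for z
  have c: "norm (c (t, x)) <= 1" if "t \<in> {0..1}" "norm x = 1" for t x
   unfolding c_def using segment_disk[OF that(1), of e0 x] that(2) by simp
  have cc: "continuous_on Y c" for Y unfolding c_def by (intro continuous_intros)
  have "homotopic_with_canon (%_. True) usphere usphere (%x. sgn (Li (W (0, x)))) (%x. sgn (Li (W (1, x))))"
  proof (rule Li_homotopy)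
   have c1: "continuous_on ({0..1} \<times> usphere) (%z. s (collapse (c z)))"
    by (rule continuous_on_compose2[OF s(1) continuous_on_compose2[OF continuous_collapse[of UNIV] cc]], auto simp: norm_collapse c)
   have c2: "continuous_on ({0..1} \<times> usphere) (%z. R (c z) (s (collapse (c z))))" by (rule continuous_R(1)[OF cc c1]) (use c in auto)
   show "continuous_on ({0..1} \<times> usphere) W" unfolding W_def
    by (rule continuous_R(2)[OF continuous_on_snd[OF continuous_on_id] c2]) auto
   fix t :: real and x :: 'd assume tx: "t \<in> {0..1}" "norm x = 1"
   show "W (t, x) \<bullet> yt = 0 \<and> W (t, x) ~= 0"
    using s(2)[OF norm_collapse[OF c[OF tx]]] R_D(6,8)[OF c[OF tx], of "s (collapse (c (t, x)))"]
     R_D(7)[of x "R (c (t, x)) (s (collapse (c (t, x))))"] R_boundary[OF tx(2)] tx(2) by (auto simp: W_def)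
  qed auto
  then have "homotopic_maps usphere usphere (%x. sgn (Li (W (0, x)))) (%x. sgn (Li (W (1, x))))"
   unfolding homotopic_maps_def .
  then show ?thesis
  proof (rule homotopic_maps_cong)
   fix x :: 'd assume "x \<in> usphere"
   then have x: "norm x = 1" by simp
   show "sgn (Li (W (0, x))) = sgn (Li (R' x s0))"
    by (simp add: W_def c_def R_e0 collapse_north[OF norm_e0] s0_def)
   show "sgn (Li (W (1, x))) = sgn (Li s0)"
    using R_D(3)[of x s0] x by (simp add: W_def c_def collapse_north[OF x] s0_def)
  qed
 qed
 finally have "homotopic_maps usphere usphere gs (%_. sgn (Li s0))" .
 from based_null_homotopy[OF this norm_e0] show "homotopic_with_canon (%h. h e0 = e0) usphere usphere gs (%_. e0)"
  unfolding gs_e0 .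
qed

end

section \<open>Suspensions of clutching maps\<close>

lemma continuous_suspend:
 fixes h :: "real \<times> 'd::euclidean_space => 'e::euclidean_space"
 assumes "continuous_on ({0..1} \<times> usphere) h"
 shows "continuous_on ({0..1} \<times> usphere) (%z. suspend (%x. h (fst z, x)) (snd z))"
proof -
 let ?K = "{0..1::real} \<times> (sphere (0 :: 'd) 1 \<times> {0..1::real})" and ?q = "%z :: real \<times> 'd \<times> real. (fst z, polar (snd z))"
 have "continuous_on (?q ` ?K) (%z. suspend (%x. h (fst z, x)) (snd z))"
 proof (rule continuous_on_descend)
  show "compact ?K" by (intro compact_Times compact_Icc compact_sphere)
  show "continuous_on ?K ?q" by (intro continuous_intros continuous_on_compose2[OF continuous_polar[of UNIV]]) auto
  show "continuous_on ?K (%z. (sin (pi * snd (snd z)) *R h (fst z, fst (snd z)), cos (pi * snd (snd z))))"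
   by (auto intro!: continuous_on_compose2[OF assms] continuous_intros)
  fix z assume z: "z \<in> ?K"
  then show "suspend (%x. h (fst (?q z), x)) (snd (?q z)) = (sin (pi * snd (snd z)) *R h (fst z, fst (snd z)), cos (pi * snd (snd z)))"
   using suspend_polar[of "fst (snd z)" "snd (snd z)" "%x. h (fst z, x)"] by auto
 qed
 moreover have "?q ` ?K = {0..1} \<times> usphere" unfolding polar_image[symmetric] by force
 ultimately show ?thesis by simp
qed

lemma norm_suspend:
 fixes z :: "'d::euclidean_space \<times> real"
 assumes "g ` usphere <= usphere" "norm z = 1"
 shows "norm (suspend g z) = 1"
proof -
 have "z \<in> polar ` (usphere \<times> {0..1})" unfolding polar_image using assms(2) by simp
 then obtain x s where x: "norm x = 1" "s \<in> {0..1}" "z = polar (x, s)" by auto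
 show ?thesis
  using assms(1) x(1) suspend_polar[OF x(1,2), of g] by (simp add: image_subset_iff x(3) norm_prod_def)
qed

lemma suspend_north: "suspend g north = north"
 by (simp add: suspend_def)

lemma suspend_homotopic:
 fixes g g' :: "'d::euclidean_space => 'e::euclidean_space"
 assumes "homotopic_with_canon P usphere usphere g g'"
 shows "homotopic_with_canon (%h. h north = north) usphere usphere (suspend g) (suspend g')"
proof -
 obtain h where h: "continuous_on ({0..1::real} \<times> usphere) h" "h ` ({0..1} \<times> usphere) <= usphere"
  "!!x. h (0, x) = g x" "!!x. h (1, x) = g' x" using assms by (rule homotopic_withE) (rule that)
 have s: "(%x. h (t, x)) ` usphere <= usphere" if "t \<in> {0..1}" for t using h(2) that by auto
 show ?thesis
 using norm_suspend[OF s] by (auto simp: h(3,4) suspend_north intro!: homotopic_withI[OF continuous_suspend[OF h(1)]])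
qed

context clutching
begin

text \<open>Homotopies of maps of the cylinder over the boundary of the disk which keep its ends at \<open>yt\<close>
 and at \<open>- yt\<close>, that is, of families of paths between these two points.\<close>

definition pinned :: "('d \<times> real => 'e \<times> real) => bool" where
 "pinned h \<longleftrightarrow> (\<forall>x. norm x = 1 --> h (x, 0) = yt \<and> h (x, 1) = - yt)"

definition pinned_homotopic :: "('d \<times> real => 'e \<times> real) => ('d \<times> real => 'e \<times> real) => bool" where
 "pinned_homotopic k l \<longleftrightarrow> homotopic_with_canon pinned (usphere \<times> {0..1}) usphere k l"

lemma pinned_homotopicI:
 assumes "continuous_on ({0..1::real} \<times> (usphere \<times> {0..1})) h"
  and "!!t x s. t \<in> {0..1} ==> norm x = 1 ==> s \<in> {0..1} ==> norm (h (t, x, s)) = 1"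
  and "!!x s. norm x = 1 ==> s \<in> {0..1} ==> h (0, x, s) = k (x, s)" "!!x s. norm x = 1 ==> s \<in> {0..1} ==> h (1, x, s) = l (x, s)"
  and "!!t x. t \<in> {0..1} ==> norm x = 1 ==> h (t, x, 0) = yt \<and> h (t, x, 1) = - yt"
 shows "pinned_homotopic k l"
 unfolding pinned_homotopic_def
proof (rule homotopic_withI[OF assms(1)])
 fix u v :: "'d \<times> real => 'e \<times> real" assume "!!z. z \<in> usphere \<times> {0..1} ==> u z = v z"
 then have "u (x, 0) = v (x, 0)" "u (x, 1) = v (x, 1)" if "norm x = 1" for x using that by auto
 then show "pinned u \<longleftrightarrow> pinned v" unfolding pinned_def by metis
qed (use assms(2-5) in \<open>auto simp: pinned_def\<close>)

lemma pinned_homotopicE: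
 assumes "pinned_homotopic k l"
 obtains h where "continuous_on ({0..1::real} \<times> (usphere \<times> {0..1})) h"
  "!!t x s. t \<in> {0..1} ==> norm x = 1 ==> s \<in> {0..1} ==> norm (h (t, x, s)) = 1"
  "!!z. h (0, z) = k z" "!!z. h (1, z) = l z"
  "!!t x. t \<in> {0..1} ==> norm x = 1 ==> h (t, x, 0) = yt \<and> h (t, x, 1) = - yt"
proof -
 obtain h where h: "continuous_on ({0..1::real} \<times> (usphere \<times> {0..1})) h" "h ` ({0..1} \<times> (usphere \<times> {0..1})) <= usphere"
  "!!z. h (0, z) = k z" "!!z. h (1, z) = l z" "!!t. t \<in> {0..1} ==> pinned (%z. h (t, z))"
  using assms unfolding pinned_homotopic_def by (rule homotopic_withE) (rule that)
 show thesis by (rule that[OF h(1) _ h(3,4)]) (use h(2,5) in \<open>auto simp: pinned_def image_subset_iff\<close>)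
qed

lemma pinned_sym: "pinned_homotopic k l ==> pinned_homotopic l k"
 and pinned_trans [trans]: "pinned_homotopic k l ==> pinned_homotopic l o' ==> pinned_homotopic k o'"
 unfolding pinned_homotopic_def by (auto intro: homotopic_with_symD homotopic_with_trans)

lemma pinned_cong:
 assumes "pinned_homotopic k l" "!!x s. norm x = 1 ==> s \<in> {0..1} ==> k (x, s) = k' (x, s)"
  "!!x s. norm x = 1 ==> s \<in> {0..1} ==> l (x, s) = l' (x, s)"
 shows "pinned_homotopic k' l'"
 using assms(1) by (rule pinned_homotopicE) (rule pinned_homotopicI, auto simp: assms(2,3))

lemma pinned_R:
 assumes "pinned_homotopic k l"
 shows "pinned_homotopic (%z. R (fst z) (k z)) (%z. R (fst z) (l z))"
  and "pinned_homotopic (%z. R' (fst z) (k z)) (%z. R' (fst z) (l z))"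
proof -
 obtain h where h: "continuous_on ({0..1::real} \<times> (usphere \<times> {0..1})) h"
  "!!t x s. t \<in> {0..1} ==> norm x = 1 ==> s \<in> {0..1} ==> norm (h (t, x, s)) = 1"
  "!!z. h (0, z) = k z" "!!z. h (1, z) = l z"
  "!!t x. t \<in> {0..1} ==> norm x = 1 ==> h (t, x, 0) = yt \<and> h (t, x, 1) = - yt"
  by (rule pinned_homotopicE[OF assms]) (rule that)
 have c: "continuous_on ({0..1::real} \<times> (sphere (0 :: 'd) 1 \<times> {0..1::real})) (%z. fst (snd z))"
  by (intro continuous_intros)
 have neg: "R x (- yt) = - yt" "R' x (- yt) = - yt" if "norm x = 1" for x
  using R_D(1,2)[of x] R_boundary(3,4)[OF that] that by (simp_all add: linear_neg)
 show "pinned_homotopic (%z. R (fst z) (k z)) (%z. R (fst z) (l z))"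
  by (rule pinned_homotopicI[of "%z. R (fst (snd z)) (h z)"], rule continuous_R(1)[OF c h(1)])
   (use h(2-5) R_D(6) R_boundary(3) neg in auto)
 show "pinned_homotopic (%z. R' (fst z) (k z)) (%z. R' (fst z) (l z))"
  by (rule pinned_homotopicI[of "%z. R' (fst (snd z)) (h z)"], rule continuous_R(2)[OF c h(1)])
   (use h(2-5) R_D(7) R_boundary(4) neg in auto)
qed

lemma pinned_contract:
 assumes E: "continuous_on (cball 0 1 \<times> {0..1}) E" "!!x s. norm x <= 1 ==> s \<in> {0..1} ==> norm (E (x, s)) = 1"
  "!!x. norm x <= 1 ==> E (x, 0) = yt \<and> E (x, 1) = - yt"
 shows "pinned_homotopic E (%z. E (e0, snd z))"
proof -
 let ?c = "%z :: real \<times> 'd \<times> real. (1 - fst z) *R fst (snd z) + fst z *R e0"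
 have c: "norm ((1 - t) *R x + t *R e0) <= 1" if "t \<in> {0..1}" "norm x = 1" for t and x :: 'd
  using segment_disk[OF that(1), of x e0] that(2) by simp
 have cc: "continuous_on ({0..1} \<times> (usphere \<times> {0..1})) (%z. (?c z, snd (snd z)))" by (intro continuous_intros)
 show ?thesis
  by (rule pinned_homotopicI[of "%z. E (?c z, snd (snd z))"], rule continuous_on_compose2[OF E(1) cc])
   (use E(2,3) c in auto)
qed

definition om :: "real => 'e \<times> real" where
 "om s = sgn (cos (pi * s) *R yt + sin (pi * s) *R v0)"

lemma arc_nonzero:
 assumes "v \<bullet> yt = 0" "v ~= 0"
 shows "cos (pi * s) *R yt + sin (pi * s) *R v ~= 0"
proof
 assume z: "cos (pi * s) *R yt + sin (pi * s) *R v = 0"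
 then have "(cos (pi * s) *R yt + sin (pi * s) *R v) \<bullet> yt = 0" by simp
 then have "cos (pi * s) = 0" using yt assms by (simp add: inner_add_left)
 moreover from this have "sin (pi * s) = 0" using z assms by simp
 ultimately show False using sin_cos_squared_add[of "pi * s"] by simp
qed

lemma om: "continuous_on X om" "norm (om s) = 1" "om 0 = yt" "om 1 = - yt"
 using arc_nonzero[OF v0, of s] arc_nonzero[OF v0] unfolding om_def
 by (auto intro!: continuous_intros simp: norm_sgn yt(2) sgn_div_norm)

definition Susp :: "'d \<times> real => 'e \<times> real" where "Susp z = sgn (Lam (suspend gs (polar z)))"

lemma Susp_eq: "norm x = 1 ==> s \<in> {0..1} ==> Susp (x, s) = sgn (cos (pi * s) *R yt + sin (pi * s) *R L (gs x))"
 by (simp add: Susp_def suspend_polar Lam_def linear_cmul[OF linear_L] add.commute)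

lemma Susp_om: "pinned_homotopic Susp (%z. R' (fst z) (om (snd z)))"
proof (rule pinned_homotopicI)
 let ?v = "%z :: real \<times> 'd \<times> real. (1 - fst z) *R L (gs (fst (snd z))) + fst z *R R' (fst (snd z)) v0"
 let ?W = "%z. cos (pi * snd (snd z)) *R yt + sin (pi * snd (snd z)) *R ?v z"
 have nz: "?W (t, x, s) ~= 0" if "t \<in> {0..1}" "norm x = 1" for t x s
 proof -
  have o: "R' x v0 \<bullet> yt = 0" using R_boundary[OF that(2)] v0 by simp
  have v: "R' x v0 ~= 0" using R_D(7)[of x v0] that(2) v0 by auto
  then have "Li (R' x v0) ~= 0" using Li_0[OF o] by simp
  moreover have "L (gs x) = R' x v0 /R norm (Li (R' x v0))"
   unfolding gs_def sgn_div_norm by (simp add: linear_cmul[OF linear_L] L_Li[OF o])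
  ultimately have "?v (t, x, s) = ((1 - t) / norm (Li (R' x v0)) + t) *R R' x v0" "0 < (1 - t) / norm (Li (R' x v0)) + t"
   using that(1) by (auto simp: scaleR_add_left divide_inverse intro: add_nonneg_pos) (cases "t = 0"; auto intro: add_nonneg_pos)
  then show ?thesis using v o arc_nonzero[of "?v (t, x, s)" s] by auto
 qed
 have c1: "continuous_on ({0..1::real} \<times> (usphere \<times> {0..1::real})) (%z. gs (fst (snd z)))"
  by (rule continuous_on_compose2[OF gs_sphere(1)]) (auto intro!: continuous_intros)
 have c2: "continuous_on ({0..1::real} \<times> (usphere \<times> {0..1::real})) (%z. R' (fst (snd z)) v0)"
  by (rule continuous_R(2)) (auto intro!: continuous_intros)
 show "continuous_on ({0..1} \<times> (usphere \<times> {0..1})) (%z. sgn (?W z))"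
  by (intro continuous_intros continuous_on_linear_compose[OF linear_L] c1 c2) (use nz in auto)
 fix t s :: real and x :: 'd
 show "norm (sgn (?W (t, x, s))) = 1" if "t \<in> {0..1}" "norm x = 1" using nz[OF that, of s] by (simp add: norm_sgn)
 show "sgn (?W (0, x, s)) = Susp (x, s)" if "norm x = 1" "s \<in> {0..1}" using Susp_eq[OF that] by simp
 show "sgn (?W (1, x, s)) = R' (fst (x, s)) (om (snd (x, s)))" if x: "norm x = 1"
 proof -
  have x': "norm x <= 1" using x by simp
  have "?W (1, x, s) = R' x (cos (pi * s) *R yt + sin (pi * s) *R v0)"
   using R_boundary(4)[OF x] by (simp add: linear_add[OF R_D(2)[OF x']] linear_cmul[OF R_D(2)[OF x']])
  then show ?thesis unfolding om_def by (simp only: sgn_div_norm R_D(7)[OF x'] linear_cmul[OF R_D(2)[OF x']] fst_conv snd_conv)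
 qed
 show "sgn (?W (t, x, 0)) = yt \<and> sgn (?W (t, x, 1)) = - yt" by (simp add: sgn_div_norm yt(2))
qed

text \<open>
 Transported to the base point, a homotopy from \<open>fh\<close> to \<open>- fh\<close> is a family, over the disk, of paths
 from \<open>yt\<close> to \<open>- yt\<close>. On the boundary these are transports of a single path. As the disk is
 contractible, the transports of the arc \<open>om\<close> form a family homotopic to a constant one; in polar
 coordinates this family is the suspended clutching map (\<open>Susp_om\<close>).
\<close>

lemma suspend_gs_null:
 assumes n: "2 <= DIM('e)" and "homotopic_maps usphere usphere fh (%z. - fh z)"
 shows "\<exists>c. homotopic_maps usphere usphere (suspend gs) (%_. c)"
proof -
 obtain J where J: "continuous_on ({0..1::real} \<times> usphere) J" "J ` ({0..1} \<times> usphere) <= usphere"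
  "!!z. J (0, z) = fh z" "!!z. J (1, z) = - fh z" using assms(2) by (rule homotopic_mapsE) (rule that)
 have Jn: "norm (J (s, z)) = 1" if "s \<in> {0..1}" "norm z = 1" for s z using J(2) that by (auto simp: image_subset_iff)
 have nn: "norm (north :: 'd \<times> real) = 1" by (simp add: norm_prod_def)
 define j where "j s = J (s, north)" for s
 have cj: "continuous_on {0..1} j" unfolding j_def
  by (rule continuous_on_compose2[OF J(1)]) (auto intro!: continuous_intros simp: nn)
 let ?E = "%z :: 'd \<times> real. R (fst z) (J (snd z, collapse (fst z)))"
 have "pinned_homotopic ?E (%z. ?E (e0, snd z))"
 proof (rule pinned_contract)
  show "continuous_on (cball 0 1 \<times> {0..1}) ?E"
   by (auto simp: norm_collapse intro!: continuous_on_compose2[OF J(1)] continuous_intros continuous_on_compose2[OF continuous_collapse[of UNIV]] continuous_R)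
  fix x :: 'd and s :: real assume x: "norm x <= 1"
  show "norm (?E (x, s)) = 1" if "s \<in> {0..1}" using R_D(6)[OF x] Jn[OF that norm_collapse[OF x]] by simp
  show "?E (x, 0) = yt \<and> ?E (x, 1) = - yt"
   by (simp add: J(3,4) R_u[OF x] linear_neg[OF R_D(1)[OF x]])
 qed
 then have "pinned_homotopic (%z. R (fst z) (j (snd z))) (%z. j (snd z))"
  by (rule pinned_cong) (auto simp: j_def collapse_north R_e0)
 from pinned_R(2)[OF this] have jR: "pinned_homotopic (%z. j (snd z)) (%z. R' (fst z) (j (snd z)))"
  by (rule pinned_cong) (simp_all add: R_D(3))
 have "homotopic_paths usphere om j"
 proof -
  have "simply_connected (sphere (0 :: 'e \<times> real) 1)" using n by (intro simply_connected_sphere) simp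
  moreover have "path om" "path_image om <= usphere" "path j" "path_image j <= usphere"
   using om(1,2) cj Jn by (auto simp: path_def path_image_def j_def)
  moreover have "pathstart j = pathstart om" "pathfinish j = pathfinish om"
   by (simp_all add: pathstart_def pathfinish_def om(3,4) j_def J(3,4))
  ultimately show ?thesis unfolding simply_connected_eq_homotopic_paths by blast
 qed
 then obtain h where h: "continuous_on ({0..1::real} \<times> {0..1}) h" "h ` ({0..1} \<times> {0..1}) <= usphere"
  "!!s. h (0, s) = om s" "!!s. h (1, s) = j s" and
  hp: "!!t. t \<in> {0..1} ==> pathstart (%s. h (t, s)) = pathstart om \<and> pathfinish (%s. h (t, s)) = pathfinish om"
  unfolding homotopic_paths_def by (rule homotopic_withE) (rule that)
 have oj: "pinned_homotopic (%z. om (snd z)) (%z. j (snd z))"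
 proof (rule pinned_homotopicI[of "%z. h (fst z, snd (snd z))"])
  show "continuous_on ({0..1} \<times> (usphere \<times> {0..1})) (%z :: real \<times> 'd \<times> real. h (fst z, snd (snd z)))"
   by (rule continuous_on_compose2[OF h(1)]) (auto intro!: continuous_intros)
  fix t s :: real and x :: 'd assume t: "t \<in> {0..1}"
  show "h (fst (t, x, 0), snd (snd (t, x, 0 :: real))) = yt \<and> h (fst (t, x, 1), snd (snd (t, x, 1 :: real))) = - yt"
   using hp[OF t] by (simp add: pathstart_def pathfinish_def om(3,4))
  show "norm (h (fst (t, x, s), snd (snd (t, x, s)))) = 1" if "s \<in> {0..1}"
   using h(2) t that by (auto simp: image_subset_iff)
 qed (simp_all add: h(3,4))
 note Susp_om
 also note pinned_R(2)[OF oj]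
 also note pinned_sym[OF jR]
 finally have Sj: "pinned_homotopic Susp (%z. j (snd z))" .
 let ?P = "%h :: 'd \<times> real => 'e \<times> real. \<forall>x y. norm x = 1 --> norm y = 1 --> h (x, 0) = h (y, 0) \<and> h (x, 1) = h (y, 1)"
 have "homotopic_with_canon ?P (usphere \<times> {0..1}) usphere Susp (%z. j (snd z))"
  using Sj unfolding pinned_homotopic_def by (rule homotopic_with_mono) (auto simp: pinned_def)
 moreover have "homotopic_with_canon ?P (usphere \<times> {0..1}) usphere (%z. j (snd z)) (%_. j 0)"
 proof (rule homotopic_withI[where h = "%z. j ((1 - fst z) * snd (snd z))"])
  have m: "(1 - t) * s \<in> {0..1}" if "t \<in> {0..1}" "s \<in> {0..1}" for t s :: real using that by (auto intro: mult_le_one)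
  show "continuous_on ({0..1} \<times> (usphere \<times> {0..1})) (%z :: real \<times> 'd \<times> real. j ((1 - fst z) * snd (snd z)))"
   by (rule continuous_on_compose2[OF cj]) (use m in \<open>auto intro!: continuous_intros\<close>)
  show "(%z :: real \<times> 'd \<times> real. j ((1 - fst z) * snd (snd z))) ` ({0..1} \<times> (usphere \<times> {0..1})) <= usphere"
   using m Jn by (auto simp: j_def)
  fix u v :: "'d \<times> real => 'e \<times> real" assume "!!z. z \<in> usphere \<times> {0..1} ==> u z = v z"
  then have "u (x, 0) = v (x, 0)" "u (x, 1) = v (x, 1)" if "norm x = 1" for x using that by auto
  then show "?P u \<longleftrightarrow> ?P v" by metis
 qed auto
 ultimately have "homotopic_with_canon ?P (usphere \<times> {0..1}) usphere Susp (%_. j 0)" by (rule homotopic_with_trans)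
 from descend_polar[OF this, of "%z. sgn (Lam (suspend gs z))" "%_. j 0"]
 have "homotopic_maps usphere usphere (%z. sgn (Lam (suspend gs z))) (%_. j 0)" by (simp add: Susp_def)
 moreover have nz: "Lam' w ~= 0" if "norm w = 1" for w using Lam_Lam'[of w] linear_0[OF linear_Lam] that by force
 ultimately have "homotopic_maps usphere usphere (%z. sgn (Lam' (sgn (Lam (suspend gs z))))) (%_. sgn (Lam' (j 0)))"
  by (elim homotopic_maps_compose_left)
   (auto intro!: continuous_intros continuous_on_linear_compose[OF linear_Lam'] simp: norm_sgn)
 then have "homotopic_maps usphere usphere (suspend gs) (%_. sgn (Lam' (j 0)))"
 proof (rule homotopic_maps_cong)
  fix z :: "'d \<times> real" assume "z \<in> usphere"
  then have n1: "norm (suspend gs z) = 1" using norm_suspend[OF gs_sphere(2)] by simp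
  then have "Lam (suspend gs z) ~= 0"
   using inj_Lam linear_injective_0[OF linear_Lam] by fastforce
  then show "sgn (Lam' (sgn (Lam (suspend gs z)))) = suspend gs z"
   by (simp add: sgn_div_norm[of "Lam _"] linear_cmul[OF linear_Lam'] Lam'_Lam, simp add: sgn_div_norm n1)
 qed simp
 then show ?thesis by blast
qed

text \<open>
 Conversely, an extension of the suspended clutching map to the ball is read in polar coordinates as a family, over the disk,
 of paths from \<open>yt\<close> to \<open>- yt\<close>. After a homotopy its boundary values are transports of \<open>om\<close>, so that it descends to
 a homotopy from \<open>fh\<close> to \<open>- fh\<close>.
\<close>

lemma suspend_gs_antipodal:
 assumes "homotopic_maps usphere usphere (suspend gs) (%_. c)"
 shows "homotopic_maps usphere usphere fh (%z. - fh z)"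
proof -
 from nullhomotopic_from_sphere_extension[THEN iffD1, OF exI, OF assms[unfolded homotopic_maps_def]]
 obtain Q where Q: "continuous_on (cball 0 1) Q" "Q ` cball 0 1 <= usphere" "\<forall>z\<in>usphere. Q z = suspend gs z"
  by auto
 have Q': "Q z = suspend gs z" if "norm z = 1" for z using Q(3) that by simp
 have pn: "norm (polar (x, s)) <= 1" if "norm x <= 1" for x :: 'd and s
 proof -
  have "(sin (pi * s))\<^sup>2 * (norm x)\<^sup>2 + (cos (pi * s))\<^sup>2 <= (sin (pi * s))\<^sup>2 * 1 + (cos (pi * s))\<^sup>2"
   using that by (intro add_right_mono mult_left_mono; simp add: abs_square_le_1)
  then show ?thesis by (simp add: polar_def norm_prod_def power_mult_distrib)
 qed
 let ?E = "%z :: 'd \<times> real. sgn (Lam (Q (polar z)))"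
 have nz: "Lam (Q (polar (x, s))) ~= 0" if "norm x <= 1" for x s
 proof -
  have "norm (Q (polar (x, s))) = 1" using Q(2) pn[OF that] by (auto simp: image_subset_iff)
  then show ?thesis using inj_Lam linear_injective_0[OF linear_Lam] by fastforce
 qed
 have "pinned_homotopic ?E (%z. ?E (e0, snd z))"
 proof (rule pinned_contract)
  have "continuous_on (cball 0 1 \<times> {0..1}) (%z :: 'd \<times> real. Q (polar z))"
   by (rule continuous_on_compose2[OF Q(1) continuous_polar]) (use pn in auto)
  then show "continuous_on (cball 0 1 \<times> {0..1}) ?E"
   by (intro continuous_on_sgn continuous_on_linear_compose[OF linear_Lam]) (use nz in auto)
  fix x :: 'd and s :: real assume x: "norm x <= 1"
  show "norm (?E (x, s)) = 1" using nz[OF x] by (simp add: norm_sgn)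
  have "polar (x, 0) = (0, 1)" "polar (x, 1) = (0, - 1)" by (simp_all add: polar_def)
  moreover have "Q (0, 1) = (0, 1)" "Q (0, - 1) = (0, - 1)" using Q' by (simp_all add: suspend_def)
  ultimately show "?E (x, 0) = yt \<and> ?E (x, 1) = - yt"
   by (simp add: Lam_def linear_0[OF linear_L] sgn_div_norm yt(2))
 qed
 then have "pinned_homotopic Susp (%z. om (snd z))"
 proof (rule pinned_cong)
  fix x :: 'd and s :: real assume x: "norm x = 1" and s: "s \<in> {0..1}"
  have E: "?E (y, s) = Susp (y, s)" if "norm y = 1" for y
  proof -
   have "polar (y, s) \<in> usphere" using that s unfolding polar_image[symmetric] by (intro imageI) simp
   then show ?thesis using Q' unfolding Susp_def by simp
  qed
  show "?E (x, s) = Susp (x, s)" by (rule E[OF x])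
  show "?E (e0, snd (x, s)) = om (snd (x, s))"
   using E[OF norm_e0] Susp_eq[OF norm_e0 s] by (simp add: om_def gs_e0)
 qed
 from pinned_R(1)[OF pinned_trans[OF pinned_sym[OF this] Susp_om]]
 have "pinned_homotopic (%z. R (fst z) (om (snd z))) (%z. om (snd z))"
  by (rule pinned_cong) (simp_all add: R_D(4))
 from pinned_sym[OF this] obtain h where h: "continuous_on ({0..1::real} \<times> (usphere \<times> {0..1})) h"
  "!!t x s. t \<in> {0..1} ==> norm x = 1 ==> s \<in> {0..1} ==> norm (h (t, x, s)) = 1"
  "!!z. h (0, z) = om (snd z)" "!!z. h (1, z) = R (fst z) (om (snd z))"
  "!!t x. t \<in> {0..1} ==> norm x = 1 ==> h (t, x, 0) = yt \<and> h (t, x, 1) = - yt"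
  by (rule pinned_homotopicE) (rule that)
 let ?K = "{0..1::real} \<times> (sphere (0 :: 'd) 1 \<times> {0..1::real})" and ?q = "%z :: real \<times> 'd \<times> real. (fst z *R fst (snd z), snd (snd z))"
 have cK: "compact ?K" by (intro compact_Times compact_Icc compact_sphere)
 have cq: "continuous_on ?K ?q" by (intro continuous_intros)
 have fib: "h z = h z'" if z: "z \<in> ?K" "z' \<in> ?K" "?q z = ?q z'" for z z'
 proof -
  obtain t x s t' x' s' where e: "z = (t, x, s)" "z' = (t', x', s')" by (metis prod.collapse)
  have n: "norm x = 1" "norm x' = 1" "0 <= t" "0 <= t'" "t *R x = t' *R x'" "s = s'" using z by (auto simp: e)
  then have "t = t'" by (metis abs_of_nonneg mult.right_neutral norm_scaleR)
  then show ?thesis using n h(3) by (cases "t = 0") (auto simp: e)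
 qed
 obtain E where E: "continuous_on (?q ` ?K) E" "!!z. z \<in> ?K ==> E (?q z) = h z"
  by (rule descend[OF cK cq h(1)], erule (2) fib, rule that)
 have decomp: "\<exists>t y. t \<in> {0..1} \<and> norm y = 1 \<and> x = t *R y \<and> (norm x = 1 --> t = 1)" if "norm x <= 1" for x :: 'd
  using that by (intro exI[of _ "norm x"] exI[of _ "if x = 0 then e0 else sgn x"], auto simp: sgn_div_norm)
 have img: "cball 0 1 \<times> {0..1} <= ?q ` ?K"
 proof clarify
  fix x :: 'd and s :: real assume "x \<in> cball 0 1" "s \<in> {0..1}"
  then obtain t y where "t \<in> {0..1}" "norm y = 1" "x = t *R y" using decomp[of x] by auto
  then show "(x, s) \<in> ?q ` ?K" using \<open>s \<in> {0..1}\<close> by (intro image_eqI[of _ _ "(t, y, s)"]) auto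
 qed
 have E1: "norm (E (x, s)) = 1" "norm x = 1 ==> E (x, s) = R x (om s)" if "norm x <= 1" "s \<in> {0..1}" for x s
 proof -
  obtain t y where ty: "t \<in> {0..1}" "norm y = 1" "x = t *R y" "norm x = 1 --> t = 1" using decomp[OF \<open>norm x \<le> 1\<close>] by blast
  have "E (x, s) = E (?q (t, y, s))" by (simp add: ty(3))
  also have "\<dots> = h (t, y, s)" by (rule E(2)) (use ty(1,2) that(2) in simp)
  finally have e: "E (x, s) = h (t, y, s)" .
  show "norm (E (x, s)) = 1" unfolding e by (rule h(2)[OF ty(1,2) that(2)])
  show "E (x, s) = R x (om s)" if "norm x = 1"
  proof -
   have "t = 1" using ty(4) that by blast
   then have "x = y" using ty(3) by simp
   then show ?thesis unfolding e \<open>t = 1\<close> h(4) by simp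
  qed
 qed
 have E2: "E (x, 0) = yt" "E (x, 1) = - yt" if "norm x <= 1" for x
 proof -
  obtain t y where ty: "t \<in> {0..1}" "norm y = 1" "x = t *R y" using decomp[OF \<open>norm x \<le> 1\<close>] by blast
  have "E (x, 0) = E (?q (t, y, 0))" "E (x, 1) = E (?q (t, y, 1))" by (simp_all add: ty(3))
  moreover have "E (?q (t, y, 0)) = h (t, y, 0)" "E (?q (t, y, 1)) = h (t, y, 1)" by (rule E(2), use ty(1,2) in simp)+
  ultimately show "E (x, 0) = yt" "E (x, 1) = - yt" using h(5)[OF ty(1,2)] by auto
 qed
 have cJ: "continuous_on (cball 0 1 \<times> {0..1}) (%z. R' (fst z) (E z))"
  by (intro continuous_R continuous_on_subset[OF E(1) img]) (auto intro!: continuous_intros)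
 have bnd: "R' x (E (x, s)) = om s" if "norm x = 1" "s \<in> {0..1}" for x s
  using E1(2)[of x s] R_D(3)[of x "om s"] that by simp
 define J0 where "J0 z = (if norm (fst z) = 1 then om (snd z) else R' (fst z) (E z))" for z
 have "continuous_on (cball 0 1 \<times> {0..1}) J0"
  by (rule continuous_on_eq[OF cJ]) (use bnd in \<open>auto simp: J0_def\<close>)
 then obtain J where J: "continuous_on ({0..1} \<times> usphere) J" "!!x t. norm x <= 1 ==> t \<in> {0..1} ==> J (t, collapse x) = J0 (x, t)"
  by (rule descend_collapse_homotopy) (simp add: J0_def, rule that)
 have J0: "J0 (x, t) = R' x (E (x, t))" if "norm x <= 1" "t \<in> {0..1}" for x t
  using bnd that by (auto simp: J0_def)
 have pt: "\<exists>x. norm x <= 1 \<and> y = collapse x" if "y \<in> usphere" for y :: "'d \<times> real"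
  using that unfolding collapse_image[symmetric] by auto
 show ?thesis
 proof (rule homotopic_mapsI[OF J(1)])
  show "J ` ({0..1} \<times> usphere) <= usphere"
  proof (rule image_subsetI)
   fix z :: "real \<times> 'd \<times> real" assume z: "z \<in> {0..1} \<times> usphere"
   then obtain x where x: "norm x <= 1" "snd z = collapse x" using pt[of "snd z"] by auto
   then show "J z \<in> usphere"
    using J(2)[OF x(1), of "fst z"] z J0[OF x(1), of "fst z"] R_D(7)[OF x(1), of "E (x, fst z)"] E1(1)[OF x(1), of "fst z"] SigmaE fst_conv prod.collapse by auto
  qed
  fix y :: "'d \<times> real" assume "y \<in> usphere"
  then obtain x where x: "norm x <= 1" "y = collapse x" using pt by blast
  then show "J (0, y) = fh y" "J (1, y) = - fh y"
   using J(2)[of x 0] J(2)[of x 1] J0[of x 0] J0[of x 1] E2[of x] R_D(10)[of x]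
   by (auto simp: linear_neg[OF R_D(2)])
 qed
qed

theorem freudenthal_gs:
 assumes "2 <= DIM('e)"
 shows "freudenthal (based_class usphere e0 usphere gs) = based_class usphere north usphere (%_. north)
  \<longleftrightarrow> homotopic_maps usphere usphere fh (%z. - fh z)"
proof -
 let ?s = "based_class usphere north usphere (suspend gs)"
 have gs_in: "gs \<in> based_class usphere e0 usphere gs"
  using gs_sphere unfolding based_class_def by (simp add: homotopic_with_refl image_subset_iff_funcset)
 have refl: "homotopic_with_canon (%h. h e0 = gs e0) usphere usphere gs gs"
  using gs_in unfolding based_class_def by simp
 note h = homotopic_with_imp_continuous[OF suspend_homotopic[OF refl]] homotopic_with_imp_subset1[OF suspend_homotopic[OF refl]]
 have "freudenthal (based_class usphere e0 usphere gs) = ?s" unfolding freudenthal_def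
 proof (rule the_equality)
  fix c assume "\<exists>g\<in>based_class usphere e0 usphere gs. c = based_class usphere north usphere (suspend g)"
  then obtain g where g: "homotopic_with_canon (%h. h e0 = gs e0) usphere usphere gs g"
   "c = based_class usphere north usphere (suspend g)" unfolding based_class_def by auto
  show "c = ?s" unfolding g(2)
   by (rule sym, subst based_class_eq_iff) (use h suspend_homotopic[OF g(1)] in \<open>auto simp: suspend_north\<close>)
 qed (use gs_in in blast)
 moreover have "?s = based_class usphere north usphere (%_. north) \<longleftrightarrow>
  homotopic_with_canon (%h. h north = north) usphere usphere (suspend gs) (%_. north)"
  by (subst based_class_eq_iff) (use h in \<open>auto simp: suspend_north\<close>)
 moreover have "\<dots> \<longleftrightarrow> (\<exists>c. homotopic_maps usphere usphere (suspend gs) (%_. c))"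
 proof
  assume "homotopic_with_canon (%h. h north = north) usphere usphere (suspend gs) (%_. north)"
  then show "\<exists>c. homotopic_maps usphere usphere (suspend gs) (%_. c)"
   by (auto simp: homotopic_maps_def intro!: homotopic_with_mono)
 next
  assume "\<exists>c. homotopic_maps usphere usphere (suspend gs) (%_. c)"
  then obtain c where c: "homotopic_maps usphere usphere (suspend gs) (%_. c)" by blast
  show "homotopic_with_canon (%h. h north = north) usphere usphere (suspend gs) (%_. north)"
   using based_null_homotopy[OF c, of north] by (simp add: suspend_north)
 qed
 moreover have "\<dots> \<longleftrightarrow> homotopic_maps usphere usphere fh (%z. - fh z)"
  using suspend_gs_null[OF assms] suspend_gs_antipodal by blast
 ultimately show ?thesis by simp
qed

end

section \<open>The boundary homomorphism\<close>

lemma homotopy_to_boundary: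
 fixes fh :: "'d::euclidean_space \<times> real => 'f::euclidean_space"
 assumes fh: "continuous_on usphere fh" "fh ` usphere <= usphere"
 obtains R R' where "isometry_family (cball (0 :: 'd) 1) R R'" "!!x. norm x <= 1 ==> R x (fh (collapse x)) = fh north"
  "!!w. R e0 w = w"
proof -
 let ?c = "%z :: real \<times> 'd. (1 - fst z) *R snd z + fst z *R e0"
 have c: "norm (?c z) <= 1" if "z \<in> {0..1} \<times> cball 0 1" for z
  using convexD[OF convex_cball[of 0 1], of "snd z" e0 "1 - fst z" "fst z"] that by auto
 have cs: "collapse (?c z) \<in> usphere" if "z \<in> {0..1} \<times> cball 0 1" for z using norm_collapse[OF c[OF that]] by simp
 have cc: "continuous_on ({0..1} \<times> cball 0 1) (%z. collapse (?c z))"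
  by (rule continuous_on_compose2[OF continuous_collapse[of UNIV]]) (auto intro!: continuous_intros)
 have H: "continuous_on ({0..1} \<times> cball 0 1) (%z. fh (collapse (?c z)))"
  by (rule continuous_on_compose2[OF fh(1) cc image_subsetI[OF cs]])
 have n: "norm (fh (collapse (?c (t, x)))) = 1" if "t \<in> {0..1}" "x \<in> cball 0 1" for t x
  using fh(2) norm_collapse[OF c[of "(t, x)"]] that by (auto simp: image_subset_iff)
 obtain R R' where R: "isometry_family (cball (0 :: 'd) 1) R R'"
  "!!x. x \<in> cball 0 1 ==> R x (fh (collapse (?c (0, x)))) = fh (collapse (?c (1, x)))"
  "!!x v. x \<in> cball 0 1 ==> (\<forall>t\<in>{0..1}. fh (collapse (?c (t, x))) = fh (collapse (?c (0, x)))) ==> R x v = v"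
  by (rule transport_exists[OF compact_cball H n]) (assumption, assumption, rule that)
 show thesis
 proof (rule that[OF R(1)])
  show "R x (fh (collapse x)) = fh north" if "norm x <= 1" for x using R(2)[of x] that by (simp add: collapse_north)
  show "R e0 w = w" for w by (rule R(3), simp_all)
 qed
qed

context spherical_cover
begin

text \<open>
 The adjoint of the differential takes tangent vectors of \<open>N\<close> to tangent vectors of the sphere. It
 replaces the inverse of the differential, because only zeros and continuity of the result matter.
\<close>

definition Dp_adjoint :: "'f => 'c => 'f" where
 "Dp_adjoint y v = (\<Sum>i\<in>Basis. (v \<bullet> Dp y i) *R i)"

lemma Dp_adjoint_inner:
 assumes "y \<in> S"
 shows "Dp_adjoint y v \<bullet> ze = v \<bullet> Dp y ze"
proof -
 have "Dp y ze = (\<Sum>i\<in>Basis. (ze \<bullet> i) *R Dp y i)"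
  by (subst euclidean_representation[of ze, symmetric]) (simp add: linear_sum[OF linear_Dp[OF assms]] linear_cmul[OF linear_Dp[OF assms]])
 then show ?thesis by (simp add: Dp_adjoint_def inner_sum_right inner_commute mult.commute)
qed

lemma Dp_adjoint_eq_0:
 assumes "y \<in> S" "v \<in> tangent_space N (p y)" "Dp_adjoint y v = 0"
 shows "v = 0"
proof -
 obtain ze where "Dp y ze = v" using Dp_surj[OF assms(1,2)] by metis
 then show ?thesis using Dp_adjoint_inner[OF assms(1), of v ze] assms(3) by simp
qed

lemma linear_Dp_adjoint: "linear (Dp_adjoint y)"
 by (rule linearI) (simp_all add: Dp_adjoint_def inner_add_left scaleR_add_left sum.distrib scaleR_sum_right)

text \<open>Homotopies lift, and stay constant where the original homotopy is constant.\<close>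

lemma lift_homotopy:
 fixes u :: "'m::euclidean_space => 'f"
 assumes u: "continuous_on X u" "u ` X <= S" and k: "continuous_on ({0..1::real} \<times> X) k" "k ` ({0..1} \<times> X) <= N"
  and k0: "!!x. x \<in> X ==> k (0, x) = p (u x)"
 obtains K where "continuous_on ({0..1::real} \<times> X) K" "K ` ({0..1} \<times> X) <= S" "!!x. x \<in> X ==> K (0, x) = u x"
  "!!t x. t \<in> {0..1} ==> x \<in> X ==> p (K (t, x)) = k (t, x)"
  "!!t x. t \<in> {0..1} ==> x \<in> X ==> (\<forall>s\<in>{0..1}. k (s, x) = k (0, x)) ==> K (t, x) = u x"
proof -
 obtain K where K: "continuous_on ({0..1::real} \<times> X) K" "K \<in> ({0..1} \<times> X) \<rightarrow> S" "!!x. x \<in> X ==> K (0, x) = u x"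
  "!!z. z \<in> {0..1} \<times> X ==> k z = p (K z)"
  using covering_space_lift_homotopy[OF covering k(1) _ k0 u(1)] u(2) k(2) unfolding image_subset_iff_funcset by metis
 show thesis
 proof (rule that[OF K(1) _ K(3)])
  show "K ` ({0..1} \<times> X) <= S" using K(2) unfolding image_subset_iff_funcset .
  show "p (K (t, x)) = k (t, x)" if "t \<in> {0..1}" "x \<in> X" for t x using K(4)[of "(t, x)"] that by simp
  fix t :: real and x assume t: "t \<in> {0..1}" and x: "x \<in> X" and c: "\<forall>s\<in>{0..1}. k (s, x) = k (0, x)"
  have uS: "u x \<in> S" using u(2) x by blast
  show "K (t, x) = u x"
  proof (rule covering_space_lift_unique[OF covering, of "%s. K (s, x)" 0 "%_. u x" "{0..1}" "%_. p (u x)"])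
   show "continuous_on {0..1} (%s. K (s, x))" by (rule continuous_on_compose2[OF K(1)]) (use x in \<open>auto intro!: continuous_intros\<close>)
   show "(%s. K (s, x)) \<in> {0..1} \<rightarrow> S" using K(2) x by auto
   show "p (u x) = p (K (s, x))" if s: "s \<in> {0..1}" for s using K(4)[of "(s, x)"] bspec[OF c s] k0[OF x] s x by simp
  qed (use K(3) x t uS p_in_N in auto)
 qed
qed

end

locale lifted_map = spherical_cover p N et
 for p :: "'e::euclidean_space \<times> real => 'c::euclidean_space" and N et +
 fixes h :: "'c => 'c => 'c => real" and io :: "'e => 'c" and fh :: "'d::euclidean_space \<times> real => 'e \<times> real"
 assumes metric: "riemannian_metric N h" and frame: "tangent_frame N h (p (fh north)) io"
  and fh: "continuous_on usphere fh" "fh ` usphere <= S"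
begin

lemma north: "(north :: 'd \<times> real) \<in> usphere" "fh north \<in> S"
proof -
 show "(north :: 'd \<times> real) \<in> usphere" by (simp add: norm_prod_def)
 then show "fh north \<in> S" using fh(2) by blast
qed

lemma metric_zero: "y \<in> N ==> h y 0 0 = 0"
 and metric_pos: "y \<in> N ==> v \<in> tangent_space N y ==> v ~= 0 ==> 0 < h y v v"
 and metric_scale: "y \<in> N ==> v \<in> tangent_space N y ==> h y (a *R v) (a *R v) = a\<^sup>2 * h y v v"
proof -
 have lin: "h y (a *R u + b *R v) w = a * h y u w + b * h y v w" and sym: "h y v w = h y w v" and pos: "v ~= 0 ==> 0 < h y v v"
  if "y \<in> N" "u \<in> tangent_space N y" "v \<in> tangent_space N y" "w \<in> tangent_space N y" for y u v w a b
  using metric that unfolding riemannian_metric_def by blast+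
 have T: "subspace (tangent_space N y)" for y by (rule subspace_tangent_space)
 show "h y 0 0 = 0" if "y \<in> N" using lin[OF that, of 0 0 0 0 0] subspace_0[OF T] by simp
 show "0 < h y v v" if "y \<in> N" "v \<in> tangent_space N y" "v ~= 0" using pos[of y v v v] that by blast
 show "h y (a *R v) (a *R v) = a\<^sup>2 * h y v v" if y: "y \<in> N" "v \<in> tangent_space N y"
 proof -
  have av: "a *R v \<in> tangent_space N y" by (rule subspace_scale[OF T y(2)])
  have "h y (a *R v) w = a * h y v w" if "w \<in> tangent_space N y" for w
   using lin[OF y y(2) that, of a 0] by simp
  then show ?thesis using sym[OF y av y(2)] av y(2) by (simp add: power2_eq_square)
 qed
qed

lemma frame_props:
 shows linear_io: "linear io" and range_io: "range io = tangent_space N (p (fh north))"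
  and io_isometric: "h (p (fh north)) (io v) (io w) = v \<bullet> w" and inj_io: "io v = io w ==> v = w"
proof -
 show l: "linear io" and "range io = tangent_space N (p (fh north))" and i: "h (p (fh north)) (io v) (io w) = v \<bullet> w" for v w
  using frame unfolding tangent_frame_def by auto
 assume "io v = io w"
 then show "v = w"
  using i[of "v - w" "v - w"] metric_zero[OF p_in_N[OF north(2)]] by (simp add: linear_diff[OF l])
qed

definition L :: "'e => 'e \<times> real" where "L v = Dp_adjoint (fh north) (io v)"

lemma clutching_exists: obtains R R' where "clutching fh L R R'"
proof -
 obtain R R' where R: "isometry_family (cball (0 :: 'd) 1) R R'" "!!x. norm x <= 1 ==> R x (fh (collapse x)) = fh north" "!!w. R e0 w = w"
  by (rule homotopy_to_boundary[OF fh]) (rule that)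
 have "clutching fh L R R'"
 proof (rule clutching.intro)
  show "linear L" unfolding L_def using linear_compose[OF linear_io linear_Dp_adjoint] by (simp add: o_def)
  show "L v \<bullet> fh north = 0" for v by (simp add: L_def Dp_adjoint_inner[OF north(2)] Dp_self[OF north(2)])
  show "v = 0" if "L v = 0" for v
  proof -
   have "io v = 0" using Dp_adjoint_eq_0[OF north(2), of "io v"] that range_io unfolding L_def by blast
   then show ?thesis using inj_io[of v 0] linear_0[OF linear_io] by simp
  qed
 qed (rule fh R | assumption)+
 then show thesis by (rule that)
qed

text \<open>The data in the definition of the boundary homomorphism.\<close>

definition disk_lift :: "('d \<times> real => 'c) => ('d => 'c \<times> 'c) => ('d => 'e) => bool" where
 "disk_lift f F g \<longleftrightarrow> continuous_on (cball 0 1) F \<and> F ` cball 0 1 <= unit_tangent_bundle N h \<and>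
   (\<forall>x\<in>cball 0 1. fst (F x) = f (collapse x)) \<and> g ` usphere <= usphere \<and> g e0 = e0 \<and>
   (\<forall>x\<in>usphere. F x = (p (fh north), io (g x)))"

text \<open>
 The homotopy from \<open>p \<circ> fh\<close> to \<open>f\<close> lifts. The field over the disk, moved back along
 the lift by transport, is a field along \<open>fh \<circ> collapse\<close> with the same boundary values.
\<close>

lemma disk_lift_field:
 assumes f: "homotopic_with_canon (%k. k north = p (fh north)) usphere N (%x. p (fh x)) f" and F: "disk_lift f F g"
 shows "\<exists>w. tangent_field (cball 0 1) (%x. fh (collapse x)) w \<and> (\<forall>x. norm x = 1 --> w x = L (g x))"
proof -
 obtain k where k: "continuous_on ({0..1::real} \<times> usphere) k" "k ` ({0..1} \<times> usphere) <= N"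
  "!!x. k (0, x) = p (fh x)" "!!x. k (1, x) = f x" "!!t. t \<in> {0..1} ==> k (t, north) = p (fh north)"
  using f by (rule homotopic_withE) (rule that)
 obtain K where K: "continuous_on ({0..1::real} \<times> usphere) K" "K ` ({0..1} \<times> usphere) <= S" "!!x. x \<in> usphere ==> K (0, x) = fh x"
  "!!t x. t \<in> {0..1} ==> x \<in> usphere ==> p (K (t, x)) = k (t, x)"
  "!!t x. t \<in> {0..1} ==> x \<in> usphere ==> (\<forall>s\<in>{0..1}. k (s, x) = k (0, x)) ==> K (t, x) = fh x"
  by (rule lift_homotopy[OF fh k(1,2) k(3)]) (rule that)
 have Kn: "K (t, north) = fh north" if "t \<in> {0..1}" for t
  by (rule K(5)[OF that north(1)]) (simp add: k(5))
 have c: "collapse x \<in> usphere" if "x \<in> cball 0 1" for x :: 'd using norm_collapse that by simp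
 have KS: "K (t, collapse x) \<in> S" if "t \<in> {0..1}" "x \<in> cball 0 1" for t and x :: 'd
  using that(1) c[OF that(2)] by (intro subsetD[OF K(2) imageI], auto)
 define w1 where "w1 x = Dp_adjoint (K (1, collapse x)) (snd (F x))" for x
 have FT: "snd (F x) \<in> tangent_space N (p (K (1, collapse x)))" "snd (F x) ~= 0" if x: "x \<in> cball 0 1" for x
 proof -
  have "fst (F x) = p (K (1, collapse x))" using F x K(4)[OF _ c[OF x], of 1] by (simp add: disk_lift_def k(4))
  moreover have u: "F x \<in> unit_tangent_bundle N h" using F x unfolding disk_lift_def by blast
  ultimately show "snd (F x) \<in> tangent_space N (p (K (1, collapse x)))" by (auto simp: unit_tangent_bundle_def)
  show "snd (F x) ~= 0" using u metric_zero by (auto simp: unit_tangent_bundle_def)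
 qed
 have cc: "continuous_on Y (%y. K (q y, collapse (r y)))"
  if "continuous_on Y q" "continuous_on Y r" "!!y. y \<in> Y ==> q y \<in> {0..1} \<and> r y \<in> cball 0 1" for Y :: "'y::topological_space set" and q r
  by (rule continuous_on_compose2[OF K(1) continuous_on_Pair[OF that(1) continuous_on_compose2[OF continuous_collapse[of UNIV] that(2)]]])
   (use that(3) c in auto)
 have cF: "continuous_on (cball 0 1) (%x. snd (F x))" using F unfolding disk_lift_def by (auto intro: continuous_intros)
 have cK1: "continuous_on (cball 0 1) (%x :: 'd. K (1, collapse x))" by (rule cc, auto)
 have w1: "tangent_field (cball 0 1) (%x. K (1, collapse x)) w1"
  unfolding tangent_field_def
 proof (intro conjI ballI)
  show "continuous_on (cball 0 1) w1" unfolding w1_def Dp_adjoint_def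
   by (intro continuous_intros cF continuous_on_Dp_compose cK1) (use KS[of 1] in auto)
  fix x :: 'd assume x: "x \<in> cball 0 1"
  have y: "K (1, collapse x) \<in> S" using KS[of 1 x] x by simp
  show "w1 x \<bullet> K (1, collapse x) = 0" unfolding w1_def by (simp only: Dp_adjoint_inner[OF y] Dp_self[OF y] inner_zero_right)
  show "w1 x ~= 0" unfolding w1_def using Dp_adjoint_eq_0[OF y FT(1)[OF x]] FT(2)[OF x] by blast
 qed
 have H: "continuous_on ({0..1} \<times> cball 0 1) (%z :: real \<times> 'd. K (1 - fst z, collapse (snd z)))"
  by (rule cc) (auto intro!: continuous_intros)
 have Hn: "norm (K (1 - fst (t, x), collapse (snd (t, x)))) = 1" if "t \<in> {0..1}" "x \<in> cball 0 1" for t and x :: 'd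
  using KS[of "1 - t" x] that by simp
 obtain T T' where T: "isometry_family (cball (0 :: 'd) 1) T T'"
  "!!x. x \<in> cball 0 1 ==> T x (K (1 - fst (0, x), collapse (snd (0 :: real, x)))) = K (1 - fst (1, x), collapse (snd (1 :: real, x)))"
  "!!x v. x \<in> cball 0 1 ==> (\<forall>t\<in>{0..1}. K (1 - fst (t, x), collapse (snd (t, x))) = K (1 - fst (0, x), collapse (snd (0 :: real, x)))) ==> T x v = v"
  by (rule transport_exists[OF compact_cball H Hn]) (assumption, assumption, rule that)
 have T2: "T x (K (1, collapse x)) = fh (collapse x)" if "x \<in> cball 0 1" for x
  using T(2)[OF that] K(3)[OF c[OF that]] by simp
 have "T x (w1 x) = L (g x)" if x: "norm x = 1" for x
 proof -
  have "T x v = v" for v by (rule T(3)) (use x Kn in \<open>simp_all add: collapse_north\<close>)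
  moreover have "snd (F x) = io (g x)" using F x by (simp add: disk_lift_def)
  ultimately show ?thesis using Kn[of 1] by (simp add: w1_def L_def collapse_north[OF x])
 qed
 then show ?thesis using tangent_field_transport[OF T(1) T2 w1] by blast
qed

lemma disk_lift_exists: "\<exists>F g. disk_lift (%x. p (fh x)) F g"
proof -
 obtain R R' where "clutching fh L R R'" by (rule clutching_exists)
 then interpret clutching fh L R R' .
 have "io e0 \<in> tangent_space N (p yt)" using range_io by blast
 then obtain b where b: "b \<bullet> yt = 0" "Dp yt b = io e0" by (rule Dp_surj[OF north(2)])
 have y: "fh (collapse x) \<in> S" if "norm x <= 1" for x :: 'd
  using norm_collapse[OF that] by (intro subsetD[OF fh(2) imageI], simp)
 have b0: "b ~= 0"
  using b(2) inj_io[of e0 0] linear_0[OF linear_io] linear_0[OF linear_Dp[OF north(2)]] norm_e0[where 'd = 'e] by force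
 define v where "v x = Dp (fh (collapse x)) (R' x b)" for x
 have v: "v x \<in> tangent_space N (p (fh (collapse x)))" "v x ~= 0" if "norm x <= 1" for x
 proof -
  show "v x \<in> tangent_space N (p (fh (collapse x)))" unfolding v_def by (rule Dp_in[OF y[OF that]])
  show "v x ~= 0"
   using R_D(7,9)[OF that, of b] b(1) b0 Dp_eq_0[OF y[OF that]] by (fastforce simp: v_def)
 qed
 define r where "r x = h (p (fh (collapse x))) (v x) (v x)" for x
 have r: "0 < r x" if "norm x <= 1" for x unfolding r_def by (rule metric_pos[OF p_in_N[OF y[OF that]] v[OF that]])
 have cu: "continuous_on (cball 0 1) (%x :: 'd. fh (collapse x))"
  by (rule continuous_on_compose2[OF fh(1) continuous_collapse]) (use norm_collapse in auto)
 have cp: "continuous_on (cball 0 1) (%x :: 'd. p (fh (collapse x)))"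
  by (rule continuous_on_compose2[OF continuous_p cu]) (use y in auto)
 have cR: "continuous_on (cball 0 1) (%x. R' x b)" by (intro continuous_R, auto)
 have cv: "continuous_on (cball 0 1) v" unfolding v_def
  by (rule continuous_on_Dp_compose[OF cu cR]) (use y in auto)
 have ch: "continuous_on {(y, v, w). y \<in> N \<and> v \<in> tangent_space N y \<and> w \<in> tangent_space N y} (%(y, v, w). h y v w)"
  using metric unfolding riemannian_metric_def by (blast intro: smooth_on_continuous)
 have cr: "continuous_on (cball 0 1) r"
 proof -
  have "continuous_on (cball 0 1) (%x. (%(y, v, w). h y v w) (p (fh (collapse x)), v x, v x))"
   by (rule continuous_on_compose2[OF ch continuous_on_Pair[OF cp continuous_on_Pair[OF cv cv]]])
    (use v p_in_N[OF y] in \<open>auto simp del: mem_sphere mem_sphere_0\<close>)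
  then show ?thesis unfolding r_def by simp
 qed
 define F where "F x = (p (fh (collapse x)), v x /R sqrt (r x))" for x
 have F1: "F x \<in> unit_tangent_bundle N h" if "norm x <= 1" for x
  using metric_scale[OF p_in_N[OF y[OF that]] v(1)[OF that], of "inverse (sqrt (r x))"] r[OF that]
   subspace_scale[OF subspace_tangent_space v(1)[OF that]] p_in_N[OF y[OF that]]
  by (simp add: F_def unit_tangent_bundle_def power_inverse flip: r_def)
 have "\<forall>x. \<exists>e. norm x = 1 --> io e = snd (F x) \<and> norm e = 1"
 proof
  fix x show "\<exists>e. norm x = 1 --> io e = snd (F x) \<and> norm e = 1"
 proof (cases "norm x = 1")
  case True
  then have u: "F x \<in> unit_tangent_bundle N h" "fst (F x) = p yt"
   by (simp add: F1, simp add: F_def collapse_north)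
  then have "snd (F x) \<in> range io" unfolding range_io by (auto simp: unit_tangent_bundle_def)
  then obtain e where e: "snd (F x) = io e" by blast
  then have "e \<bullet> e = 1" using u io_isometric[of e e] by (auto simp: unit_tangent_bundle_def)
  then show ?thesis using e by (auto simp: norm_eq_sqrt_inner)
 qed auto
 qed
 from choice[OF this] obtain g where g: "\<forall>x. norm x = 1 --> io (g x) = snd (F x) \<and> norm (g x) = 1" by blast
 have "snd (F e0) = io e0"
  using b(2) io_isometric[of e0 e0] norm_e0[where 'd = 'e]
  by (simp add: F_def v_def r_def R'_e0 collapse_north dot_square_norm)
 then have "g e0 = e0" using g inj_io by (metis norm_e0)
 then have "disk_lift (%x. p (fh x)) F g" unfolding disk_lift_def
  using g F1 cp cv cr less_imp_neq[OF r] by (auto simp: F_def collapse_north intro!: continuous_intros)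
 then show ?thesis by blast
qed

lemma boundary_hom_clutching:
 assumes "clutching fh L R R'" "DIM('d) ~= 1"
 shows "boundary_hom N h (p (fh north)) io (based_class usphere north N (%x. p (fh x))) =
  based_class usphere e0 usphere (clutching.gs fh L R')"
proof -
 interpret clutching fh L R R' by (rule assms(1))
 let ?al = "based_class usphere north N (%x. p (fh x))"
 have cl: "based_class usphere e0 usphere g = based_class usphere e0 usphere gs"
  if "f \<in> ?al" and F: "disk_lift f F g" for f F g
 proof -
  have f: "homotopic_with_canon (%k. k north = p (fh north)) usphere N (%x. p (fh x)) f"
   using that(1) unfolding based_class_def by simp
  obtain w where "tangent_field (cball 0 1) (%x. fh (collapse x)) w" "\<forall>x. norm x = 1 --> w x = L (g x)"
   using disk_lift_field[OF f F] by blast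
  moreover have g: "g ` usphere <= usphere" "g e0 = e0" using F unfolding disk_lift_def by auto
  ultimately show ?thesis
   using boundary_values_homotopic based_class_eq_iff[OF gs_sphere, of e0 g] by (simp add: gs_e0)
 qed
 have "(%x. p (fh x)) \<in> ?al"
  using continuous_on_compose2[OF continuous_p fh] p_in_N[OF subsetD[OF fh(2) imageI]] by (simp add: based_class_def)
 moreover obtain F g where "disk_lift (%x. p (fh x)) F g" using disk_lift_exists by blast
 ultimately have ex: "\<exists>f\<in>?al. \<exists>F g. disk_lift f F g \<and> based_class usphere e0 usphere gs = based_class usphere e0 usphere g"
  using cl by metis
 have "boundary_hom N h (p (fh north)) io ?al = (THE c. \<exists>f\<in>?al. \<exists>F g. disk_lift f F g \<and> c = based_class usphere e0 usphere g)"
  using assms(2) unfolding boundary_hom_def disk_lift_def by (simp add: conj_assoc)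
 also have "\<dots> = based_class usphere e0 usphere gs"
  by (rule the_equality) (use ex cl in blast)+
 finally show ?thesis .
qed

theorem boundary_hom_zero_iff:
 assumes "DIM('d) ~= 1"
 shows "boundary_hom N h (p (fh north)) io (based_class usphere north N (%x. p (fh x))) = based_class usphere e0 usphere (%_. e0)
  \<longleftrightarrow> has_field usphere fh"
proof -
 obtain R R' where c: "clutching fh L R R'" by (rule clutching_exists)
 then interpret clutching fh L R R' .
 show ?thesis unfolding boundary_hom_clutching[OF c assms] gs_null_iff[symmetric]
  using based_class_eq_iff[OF gs_sphere, of e0 "%_. e0"] by (simp add: gs_e0)
qed

theorem suspension_zero_iff:
 assumes "DIM('d) ~= 1" "2 <= DIM('e)"
 shows "freudenthal (boundary_hom N h (p (fh north)) io (based_class usphere north N (%x. p (fh x)))) =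
   based_class usphere north usphere (%_. north) \<longleftrightarrow> homotopic_maps usphere S fh (%z. - fh z)"
proof -
 obtain R R' where c: "clutching fh L R R'" by (rule clutching_exists)
 then interpret clutching fh L R R' .
 show ?thesis unfolding boundary_hom_clutching[OF c assms(1)] by (rule freudenthal_gs[OF assms(2)])
qed

end

section \<open>Coincidences and tangent fields\<close>

text \<open>The inversion at \<open>u x\<close> maps the rest of the sphere to a hyperplane parallel to the tangent
 space, so that the difference of the images of two points is a tangent vector.\<close>

lemma three_maps_field:
 fixes u z q :: "'x::topological_space => 'f::euclidean_space"
 assumes c: "continuous_on X u" "continuous_on X z" "continuous_on X q"
  and n: "!!x. x \<in> X ==> norm (u x) = 1 \<and> norm (z x) = 1 \<and> norm (q x) = 1"
  and ne: "!!x. x \<in> X ==> z x ~= u x \<and> q x ~= u x \<and> z x ~= q x"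
 shows "has_field X u"
proof -
 let ?i = "%a y :: 'f. (1 / ((a - y) \<bullet> (a - y))) *R (a - y)"
 have inner: "?i a y \<bullet> y = - (1 / 2)" if "norm a = 1" "norm y = 1" "a ~= y" for a y :: 'f
 proof -
  have "(a - y) \<bullet> (a - y) = - 2 * ((a - y) \<bullet> y)"
   by (smt (verit) that dot_square_norm inner_diff_left inner_commute)
  moreover have "(a - y) \<bullet> (a - y) ~= 0" using that(3) by simp
  ultimately show ?thesis by auto
 qed
 have inj: "a = b" if "?i a y = ?i b y" "a ~= y" "b ~= y" for a b y :: 'f
 proof -
  have sq: "?i a y \<bullet> ?i a y = 1 / ((a - y) \<bullet> (a - y))" if "a ~= y" for a using that by simp
  show ?thesis using sq[OF that(2)] sq[OF that(3)] that by simp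
 qed
 have "tangent_field X u (%x. ?i (z x) (u x) - ?i (q x) (u x))"
  unfolding tangent_field_def
 proof (intro conjI ballI)
  show "continuous_on X (%x. ?i (z x) (u x) - ?i (q x) (u x))" by (intro continuous_intros c) (use ne in auto)
  fix x assume x: "x \<in> X"
  show "(?i (z x) (u x) - ?i (q x) (u x)) \<bullet> u x = 0"
   using inner[of "z x" "u x"] inner[of "q x" "u x"] n[OF x] ne[OF x] by (simp only: inner_diff_left) simp
  show "?i (z x) (u x) - ?i (q x) (u x) ~= 0"
   using inj[of "z x" "u x" "q x"] ne[OF x] by auto
 qed
 then show ?thesis unfolding has_field_def by blast
qed

text \<open>
 The point \<open>u x + e s x\<close>, with a small \<open>e\<close>, is normalised.
\<close>

lemma push_along:
 fixes u s :: "'x::topological_space => 'f::euclidean_space"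
 assumes X: "compact X" and u: "continuous_on X u" "u ` X <= usphere" and s: "continuous_on X s" "!!x. x \<in> X ==> s x \<bullet> u x = 0"
  and "0 < de"
 obtains u' where "homotopic_maps X usphere u u'" "!!x. x \<in> X ==> dist (u x) (u' x) < de \<and> (u' x = u x \<longleftrightarrow> s x = 0)"
proof -
 obtain K where K: "0 < K" "!!x. x \<in> X ==> norm (s x) <= K"
  using compact_imp_bounded[OF compact_continuous_image[OF s(1) X]] unfolding bounded_pos by auto
 define e where "e = min de 1 / (4 * K)"
 have e: "0 < e" using \<open>0 < de\<close> K(1) by (simp add: e_def)
 define w where "w x = u x + e *R s x" for x
 have n: "norm (u x) = 1" "u x \<bullet> u x = 1" if "x \<in> X" for x using u(2) that by (auto simp: dot_square_norm)
 have w0: "w x ~= 0" if "x \<in> X" for x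
 proof
  assume "w x = 0"
  then have "w x \<bullet> u x = 0" by simp
  then show False using n[OF that] s(2)[OF that] by (simp add: w_def inner_add_left)
 qed
 have d: "dist (u x) (sgn (w x)) < min de 1" if "x \<in> X" for x
 proof -
  have "norm (w x /R norm (w x) - u x) <= 2 * norm (e *R s x)"
   using normalise_near[OF n(1)[OF that] w0[OF that]] by (simp add: w_def)
  also have "\<dots> <= 2 * (e * K)" using K(2)[OF that] e by simp
  also have "2 * (e * K) = min de 1 / 2" using K(1) by (simp add: e_def)
  also have "\<dots> < min de 1" using \<open>0 < de\<close> by auto
  finally show ?thesis by (simp add: sgn_div_norm dist_norm norm_minus_commute)
 qed
 show thesis
 proof (rule that[of "%x. sgn (w x)"])
  show "homotopic_maps X usphere u (%x. sgn (w x))"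
  proof (rule homotopic_maps_nonopposite[OF u])
   show "continuous_on X (%x. sgn (w x))" unfolding w_def
    by (intro continuous_intros u s) (use w0 in \<open>auto simp: w_def\<close>)
   show "(%x. sgn (w x)) ` X <= usphere" using w0 by (auto simp: norm_sgn)
   show "u x ~= - sgn (w x)" if "x \<in> X" for x
    using unit_near_nonopposite[OF n(1)[OF that], of "sgn (w x)"] d[OF that] by (auto simp: dist_commute)
  qed
  fix x assume x: "x \<in> X"
  have "s x = 0" if "sgn (w x) = u x"
  proof -
   have "w x \<bullet> s x = norm (w x) * (u x \<bullet> s x)"
    using w0[OF x] by (simp add: sgn_div_norm flip : that)
   then show ?thesis
    using s(2)[OF x] e by (simp add: w_def inner_add_left inner_commute[of "u x"])
  qed
  moreover have "sgn (w x) = u x" if "s x = 0" using n[OF x] that by (simp add: w_def sgn_div_norm)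
  ultimately show "dist (u x) (sgn (w x)) < de \<and> (sgn (w x) = u x \<longleftrightarrow> s x = 0)" using d[OF x] by auto
 qed
qed

lemma compact_metric_uniform:
 fixes S :: "'a::metric_space set"
 assumes S: "compact S" and M: "Metric_space S d" and top: "Metric_space.mtopology S d = top_of_set S" and "0 < ep"
 shows "\<exists>de>0. \<forall>y\<in>S. \<forall>y'\<in>S. dist y y' < de --> d y y' < ep"
proof (rule ccontr)
 interpret Metric_space S d by (rule M)
 assume "\<not> ?thesis"
 moreover have "0 < 1 / real (Suc n)" for n by simp
 ultimately have "\<forall>n. \<exists>y y'. y \<in> S \<and> y' \<in> S \<and> dist y y' < 1 / real (Suc n) \<and> ep <= d y y'" by (meson not_less)
 then obtain y y' where y: "!!n. y n \<in> S" "!!n. y' n \<in> S" "!!n. dist (y n) (y' n) < 1 / real (Suc n)" "!!n. ep <= d (y n) (y' n)"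
  by metis
 obtain l r where l: "l \<in> S" "(%n. y (r n)) \<longlonglongrightarrow> l" "(%n. y' (r n)) \<longlonglongrightarrow> l"
  using compact_pair_limit[OF S y(1) dist_inverse_Suc_tendsto[OF y(3)]] by metis
 have "\<forall>\<^sub>F n in sequentially. d (w (r n)) l < ep / 2" if "!!n. w n \<in> S" "(%n. w (r n)) \<longlonglongrightarrow> l" for w
 proof -
  have "limitin mtopology (%n. w (r n)) l sequentially" unfolding top limitin_subtopology using that l(1) by simp
  then have "\<forall>\<^sub>F n in sequentially. w (r n) \<in> S \<and> d (w (r n)) l < ep / 2"
   using \<open>0 < ep\<close> half_gt_zero unfolding limitin_metric by blast
  then show ?thesis by eventually_elim blast
 qed
 from eventually_conj[OF this[OF y(1) l(2)] this[OF y(2) l(3)]]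
 obtain n where "d (y (r n)) l < ep / 2" "d (y' (r n)) l < ep / 2" using eventually_happens'[OF sequentially_bot] by blast
 moreover have "d (y (r n)) (y' (r n)) <= d (y (r n)) l + d (y' (r n)) l"
  using triangle[OF y(1) l(1) y(2)] commute by metis
 ultimately show False using y(4)[of "r n"] by auto
qed

text \<open>
 The tangential component at \<open>u x\<close> of a nearby point of the sphere vanishes only if this is \<open>u x\<close>
 itself. In the other direction compactness makes small Euclidean distances small with respect to any metric.
\<close>

theorem small_deformation_iff_field:
 fixes u :: "'x::t2_space => 'f::euclidean_space"
 assumes X: "compact X" and u: "continuous_on X u" "u ` X <= usphere"
 shows "loose_by_small_deformation X usphere u \<longleftrightarrow> has_field X u"
proof
 have n: "norm (u x) = 1" if "x \<in> X" for x using u(2) that by auto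
 assume "loose_by_small_deformation X usphere u"
 moreover have "Metric_space (sphere (0 :: 'f) 1) dist" by (rule Met_TC.subspace) simp
 moreover have "Metric_space.mtopology (sphere (0 :: 'f) 1) dist = top_of_set usphere"
  using Submetric.mtopology_submetric[of UNIV dist "sphere (0 :: 'f) 1"]
  by (simp add: Submetric_def Submetric_axioms_def Met_TC.Metric_space_axioms)
 ultimately obtain v where v: "continuous_map (top_of_set X) (top_of_set usphere) v"
  "!!x. x \<in> X ==> dist (u x) (v x) < 1" "!!x. x \<in> X ==> v x ~= u x"
  unfolding loose_by_small_deformation_def by (metis zero_less_one)
 then have v': "continuous_on X v" "v ` X <= usphere" by auto
 have nv: "norm (v x) = 1" if "x \<in> X" for x using v'(2) that by auto
 have "- u x ~= v x" if "x \<in> X" for x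
  using unit_near_nonopposite[OF n[OF that], of "v x"] v(2)[OF that] by (metis add.right_inverse dist_commute)
 moreover have "- u x ~= u x" if "x \<in> X" for x using unit_neq_uminus[OF n[OF that]] by metis
 ultimately show "has_field X u"
  using v(3) n nv by (intro three_maps_field[OF u(1) v'(1) continuous_on_minus[OF u(1)]]) (simp, metis)
next
 assume "has_field X u"
 then obtain s where "tangent_field X u s" unfolding has_field_def by blast
 then have s: "continuous_on X s" "!!x. x \<in> X ==> s x \<bullet> u x = 0" "!!x. x \<in> X ==> s x ~= 0" by (simp_all add: tangent_field_def)
 show "loose_by_small_deformation X usphere u" unfolding loose_by_small_deformation_def
 proof (intro allI impI, elim conjE)
  fix d and ep :: real assume d: "Metric_space usphere d" "Metric_space.mtopology usphere d = top_of_set (sphere (0 :: 'f) 1)" "0 < ep"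
  obtain de where de: "0 < de" "\<forall>y\<in>usphere. \<forall>y'\<in>usphere. dist y y' < de --> d y y' < ep"
   using compact_metric_uniform[OF compact_sphere d] by blast
  obtain u' where u': "homotopic_maps X usphere u u'" "!!x. x \<in> X ==> dist (u x) (u' x) < de \<and> (u' x = u x \<longleftrightarrow> s x = 0)"
   by (rule push_along[OF X u s(1,2) de(1)]) (assumption, rule that)
  note im = homotopic_maps_imp[OF u'(1)]
  show "\<exists>f'. continuous_map (top_of_set X) (top_of_set usphere) f' \<and> (\<forall>x\<in>X. d (u x) (f' x) < ep) \<and> (\<forall>x\<in>X. f' x ~= u x)"
  proof (intro exI conjI ballI)
   show "continuous_map (top_of_set X) (top_of_set usphere) u'" using im by auto
   fix x assume x: "x \<in> X"
   show "u' x ~= u x" using u'(2)[OF x] s(3)[OF x] by blast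
   show "d (u x) (u' x) < ep" using im x de(2) u'(2)[OF x] by auto
  qed
 qed
qed

lemma cardinality_eq_0: "cardinality A = 0 \<longleftrightarrow> A = {}"
 by (auto simp: cardinality_def zero_enat_def)

lemma cardinality_le_1: "A <= {a} ==> cardinality A <= 1"
 by (auto simp: cardinality_def one_enat_def subset_singleton_iff)

lemma Inf_enat_eq_0: "Inf (A :: enat set) = 0 \<longleftrightarrow> 0 \<in> A"
proof (cases "A = {}")
 case False
 then obtain a where "a \<in> A" by blast
 then have "(LEAST x. x \<in> A) \<in> A" by (rule LeastI)
 moreover have "(LEAST x. x \<in> A) <= 0" if "0 \<in> A" using that by (rule Least_le)
 ultimately show ?thesis using False unfolding Inf_enat_def by auto
qed (simp add: Inf_enat_def)

lemma MC_eq_0: "MC X N f1 f2 = 0 \<longleftrightarrow> loose X N f1 f2"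
 and MCC_eq_0: "MCC X N f1 f2 = 0 \<longleftrightarrow> loose X N f1 f2"
proof -
 have c: "coincidence_set X a b = {} \<longleftrightarrow> (\<forall>x\<in>X. a x ~= b x)" for a b :: "'a => 'b" by (auto simp: coincidence_set_def)
 have e: "top_of_set A = trivial_topology \<longleftrightarrow> A = {}" for A :: "'a set"
  by (metis subtopology_eq_discrete_topology_empty topspace_euclidean_subtopology)
 have z: "0 = cardinality A \<longleftrightarrow> A = {}" for A :: "'z set" using cardinality_eq_0[of A] by auto
 show "MC X N f1 f2 = 0 \<longleftrightarrow> loose X N f1 f2" unfolding MC_def Inf_enat_eq_0 loose_def
  by (simp only: mem_Collect_eq z c) blast
 show "MCC X N f1 f2 = 0 \<longleftrightarrow> loose X N f1 f2" unfolding MCC_def Inf_enat_eq_0 loose_def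
  by (simp only: mem_Collect_eq z path_components_of_eq_empty e c) blast
qed

context spherical_cover
begin

lemma lift_homotopic:
 fixes u :: "'m::euclidean_space => 'f"
 assumes "continuous_on X u" "u ` X <= S" "homotopic_maps X N (%x. p (u x)) g"
 obtains u' where "homotopic_maps X S u u'" "!!x. x \<in> X ==> p (u' x) = g x"
proof -
 obtain k where k: "continuous_on ({0..1::real} \<times> X) k" "k ` ({0..1} \<times> X) <= N" "!!x. k (0, x) = p (u x)" "!!x. k (1, x) = g x"
  using assms(3) by (rule homotopic_mapsE) (rule that)
 obtain K where K: "continuous_on ({0..1::real} \<times> X) K" "K ` ({0..1} \<times> X) <= S" "!!x. x \<in> X ==> K (0, x) = u x"
  "!!t x. t \<in> {0..1} ==> x \<in> X ==> p (K (t, x)) = k (t, x)"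
  by (rule lift_homotopy[OF assms(1,2) k(1,2) k(3)]) (rule that)
 show thesis
  by (rule, rule homotopic_mapsI[OF K(1,2,3)], use K(4)[of 1] k(4) in auto)
qed

lemma homotopic_project: "homotopic_maps X S u u' ==> homotopic_maps X N (%x. p (u x)) (%x. p (u' x))"
 by (rule homotopic_maps_compose_left[OF _ continuous_p]) (use p_in_N in auto)

lemma has_field_push:
 fixes u :: "'m::euclidean_space => 'f"
 assumes X: "compact X" and u: "continuous_on X u" "u ` X <= S" and "has_field X u"
 shows "loose X N (%x. p (u x)) (%x. p (u x))"
proof -
 obtain s where "tangent_field X u s" using assms(4) unfolding has_field_def by blast
 then have s: "continuous_on X s" "!!x. x \<in> X ==> s x \<bullet> u x = 0" "!!x. x \<in> X ==> s x ~= 0" by (simp_all add: tangent_field_def)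
 obtain u' where u': "homotopic_maps X S u u'" "!!x. x \<in> X ==> dist (u x) (u' x) < et \<and> (u' x = u x \<longleftrightarrow> s x = 0)"
  by (rule push_along[OF X u s(1,2) et_pos]) (assumption, rule that)
 have "p (u x) ~= p (u' x)" if x: "x \<in> X" for x
  using sheets[of "u x" "u' x"] u'(2)[OF x] s(3)[OF x] subsetD[OF u(2) imageI[OF x]] subsetD[OF homotopic_maps_imp(4)[OF u'(1)] imageI[OF x]] by auto
 then show ?thesis unfolding loose_def
  using homotopic_project[OF homotopic_maps_refl[OF u]] homotopic_project[OF u'(1)] by blast
qed

text \<open>Outside the boundary of the disk, the inverse transport of a tangent vector gives a field.
 Damped towards the boundary, it leaves a single coincidence.\<close>

lemma single_coincidence:
 fixes fh :: "'d::euclidean_space \<times> real => 'f"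
 assumes fh: "continuous_on usphere fh" "fh ` usphere <= S" and dim: "2 <= DIM('f)"
 obtains u' where "homotopic_maps usphere S fh u'" "coincidence_set usphere (%x. p (fh x)) (%x. p (u' x)) <= {north}"
proof -
 obtain R R' where R: "isometry_family (cball (0 :: 'd) 1) R R'" "!!x. norm x <= 1 ==> R x (fh (collapse x)) = fh north"
  by (rule homotopy_to_boundary[OF fh]) (rule that)
 obtain b where b: "b ~= 0" "orthogonal (fh north) b" using orthogonal_to_vector_exists[OF dim] by metis
 have "continuous_on (cball 0 1) (%x. (1 - norm x) *R R' x b)"
  by (intro continuous_intros isometry_family_continuous[OF R(1)]) auto
 then obtain s where s: "continuous_on usphere s" "!!x. norm x <= 1 ==> s (collapse x) = (1 - norm x) *R R' x b"
  by (rule descend_collapse) (simp, rule that)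
 have st: "s y \<bullet> fh y = 0" "s y = 0 ==> y = north" if y: "y \<in> usphere" for y
 proof -
  obtain x :: 'd where x: "norm x <= 1" "y = collapse x" using y unfolding collapse_image[symmetric] by auto
  note i = isometry_familyD[OF R(1), of x]
  show "s y \<bullet> fh y = 0"
   using i(4)[of b] i(5)[of "R' x b" "fh y"] R(2)[OF x(1)] x b(2) s(2)[OF x(1)] by (simp add: orthogonal_def inner_commute)
  assume "s y = 0"
  moreover have "R' x b ~= 0" using i(8)[of b] b(1) x(1) by auto
  ultimately show "y = north" using s(2)[OF x(1)] by (simp add: x(2) collapse_north)
 qed
 obtain u' where u': "homotopic_maps usphere S fh u'"
  "!!x. x \<in> usphere ==> dist (fh x) (u' x) < et \<and> (u' x = fh x \<longleftrightarrow> s x = 0)"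
  by (rule push_along[OF compact_sphere fh s(1) st(1) et_pos]) (assumption, rule that)
 have "x = north" if x: "x \<in> usphere" "p (fh x) = p (u' x)" for x
 using fh(2) homotopic_maps_imp(4)[OF u'(1)] x(1) sheets[OF _ _ x(2)] u'(2)[OF x(1)] st(2)[OF x(1)] by fastforce
 then show thesis by (intro that[OF u'(1)]) (auto simp: coincidence_set_def)
qed

lemma minimum_numbers_le_1:
 fixes fh :: "'d::euclidean_space \<times> real => 'f"
 assumes fh: "continuous_on usphere fh" "fh ` usphere <= S" and dim: "2 <= DIM('f)"
 shows "MC usphere N (%x. p (fh x)) (%x. p (fh x)) <= 1" "MCC usphere N (%x. p (fh x)) (%x. p (fh x)) <= 1"
proof -
 let ?f = "%x. p (fh x)"
 obtain u' where u': "homotopic_maps usphere S fh u'" "coincidence_set usphere ?f (%x. p (u' x)) <= {north}"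
  by (rule single_coincidence[OF assms]) (rule that)
 let ?C = "coincidence_set usphere ?f (%x. p (u' x))"
 have h: "homotopic_maps usphere N ?f ?f" "homotopic_maps usphere N ?f (%x. p (u' x))"
  by (rule homotopic_project[OF homotopic_maps_refl[OF fh]], rule homotopic_project[OF u'(1)])
 have "MC usphere N ?f ?f <= cardinality ?C" unfolding MC_def by (rule Inf_lower) (use h in blast)
 also have "\<dots> <= 1" by (rule cardinality_le_1[OF u'(2)])
 finally show "MC usphere N ?f ?f <= 1" .
 have "path_components_of (top_of_set ?C) <= {path_component_of_set (top_of_set ?C) north}"
  unfolding path_components_of_def using u'(2) by auto
 then have c: "cardinality (path_components_of (top_of_set ?C)) <= 1" by (rule cardinality_le_1)
 have "MCC usphere N ?f ?f <= cardinality (path_components_of (top_of_set ?C))"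
  unfolding MCC_def by (rule Inf_lower) (use h in blast)
 then show "MCC usphere N ?f ?f <= 1" using c by (rule order_trans)
qed

end

locale deck_cover = spherical_cover p N et
 for p :: "'f::euclidean_space => 'c::euclidean_space" and N et +
 fixes ta :: "'f => 'f"
 assumes continuous_ta: "continuous_on S ta" and ta_S: "ta ` S <= S"
  and ta_free: "y \<in> S ==> ta y ~= y" and p_ta: "y \<in> S ==> p (ta y) = p y"
begin

lemma disjoint_field:
 fixes u z :: "'m::euclidean_space => 'f"
 assumes u: "continuous_on X u" "u ` X <= S" and z: "continuous_on X z" "z ` X <= S"
  and d: "!!x. x \<in> X ==> p (z x) ~= p (u x)"
 shows "has_field X u"
proof (rule three_maps_field[OF u(1) z(1) continuous_on_compose2[OF continuous_ta u]])
 fix x assume x: "x \<in> X"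
 have S: "u x \<in> S" "z x \<in> S" using u(2) z(2) x by blast+
 have "ta (u x) \<in> S" using ta_S S(1) by blast
 then show "norm (u x) = 1 \<and> norm (z x) = 1 \<and> norm (ta (u x)) = 1" using S by simp
 show "z x ~= u x \<and> ta (u x) ~= u x \<and> z x ~= ta (u x)" using d[OF x] ta_free[OF S(1)] p_ta[OF S(1)] by metis
qed

theorem loose_iff_field:
 fixes u :: "'m::euclidean_space => 'f"
 assumes X: "compact X" and u: "continuous_on X u" "u ` X <= S"
 shows "loose X N (%x. p (u x)) (%x. p (u x)) \<longleftrightarrow> has_field X u"
proof
 assume "loose X N (%x. p (u x)) (%x. p (u x))"
 then obtain g1 g2 where g: "homotopic_maps X N (%x. p (u x)) g1" "homotopic_maps X N (%x. p (u x)) g2" "\<forall>x\<in>X. g1 x ~= g2 x"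
  unfolding loose_def by blast
 obtain u1 where u1: "homotopic_maps X S u u1" "!!x. x \<in> X ==> p (u1 x) = g1 x" by (rule lift_homotopic[OF u g(1)]) (rule that)
 obtain u2 where u2: "homotopic_maps X S u u2" "!!x. x \<in> X ==> p (u2 x) = g2 x" by (rule lift_homotopic[OF u g(2)]) (rule that)
 have "has_field X u1"
  by (rule disjoint_field[OF homotopic_maps_imp(2,4)[OF u1(1)] homotopic_maps_imp(2,4)[OF u2(1)]]) (use u1(2) u2(2) g(3) in metis)
 then show "has_field X u" by (rule has_field_homotopic[OF X homotopic_maps_sym[OF u1(1)]])
qed (rule has_field_push[OF X u])

theorem coincidence_producing_iff_no_field:
 fixes u :: "'m::euclidean_space => 'f"
 assumes u: "continuous_on usphere u" "u ` usphere <= S" and dim: "3 <= DIM('m) \<or> has_field usphere u"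
 shows "coincidence_producing usphere N (%x. p (u x)) \<longleftrightarrow> \<not> has_field usphere u"
proof
 assume "coincidence_producing usphere N (%x. p (u x))"
 moreover have "continuous_map (top_of_set usphere) (top_of_set N) (%x. p (u x))"
  using homotopic_maps_imp[OF homotopic_project[OF homotopic_maps_refl[OF u]]] by auto
 ultimately show "\<not> has_field usphere u"
  using has_field_push[OF compact_sphere u] unfolding coincidence_producing_def by blast
next
 assume no: "\<not> has_field usphere u"
 show "coincidence_producing usphere N (%x. p (u x))" unfolding coincidence_producing_def
 proof (intro allI impI notI)
  fix f' assume "loose usphere N (%x. p (u x)) f'"
  then obtain g1 g2 where g: "homotopic_maps usphere N (%x. p (u x)) g1" "homotopic_maps usphere N f' g2" "\<forall>x\<in>usphere. g1 x ~= g2 x"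
   unfolding loose_def by blast
  obtain u1 where u1: "homotopic_maps usphere S u u1" "!!x. x \<in> usphere ==> p (u1 x) = g1 x"
   by (rule lift_homotopic[OF u g(1)]) (rule that)
  obtain z where z: "continuous_on usphere z" "z \<in> usphere \<rightarrow> S" "!!x. x \<in> usphere ==> p (z x) = g2 x"
   using dim no covering_space_lift[OF covering _ locally_path_connected_sphere homotopic_maps_imp(2)[OF g(2)]] homotopic_maps_imp(4)[OF g(2)] by (auto intro!: simply_connected_sphere)
  have "has_field usphere u1"
   by (rule disjoint_field[OF homotopic_maps_imp(2,4)[OF u1(1)] z(1)]) (use z(2) in blast, use u1(2) z(3) g(3) in metis)
  then show False using has_field_homotopic[OF compact_sphere homotopic_maps_sym[OF u1(1)]] no by blast
 qed
qed

end

section \<open>Orbit manifolds of free actions on spheres\<close>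

locale free_orbit_map =
 fixes G :: "('g, 'r) monoid_scheme" and ph :: "'g => 'f::euclidean_space => 'f"
  and n :: nat and N :: "'c::euclidean_space set" and p :: "'f => 'c"
 assumes group: "group G" and finite_G: "finite (carrier G)"
  and action: "free_smooth_action G usphere ph" and orbit: "orbit_manifold G n usphere ph N p"
begin

abbreviation "S \<equiv> usphere :: 'f set"

lemma group_action: "group_action G S ph"
 using action unfolding free_smooth_action_def by blast

lemma act_S: "g \<in> carrier G ==> y \<in> S ==> ph g y \<in> S"
 using group_action.element_image[OF group_action] by blast

lemma act_compose: "y \<in> S ==> g \<in> carrier G ==> k \<in> carrier G ==> ph (g \<otimes>\<^bsub>G\<^esub> k) y = ph g (ph k y)"
 by (rule group_action.composition_rule[OF group_action])

lemma act_inv: "g \<in> carrier G ==> y \<in> S ==> ph (m_inv G g) (ph g y) = y"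
 by (rule group_action.orbit_sym_aux[OF group_action]) auto

lemma inv_carrier: "g \<in> carrier G ==> m_inv G g \<in> carrier G"
 by (rule group.inv_closed[OF group])

lemma act_free: "y \<in> S ==> g \<in> carrier G ==> ph g y = y ==> g = \<one>\<^bsub>G\<^esub>"
using action by (auto simp: stabilizer_def free_smooth_action_def)

lemma continuous_act: "g \<in> carrier G ==> continuous_on S (ph g)"
 using action unfolding free_smooth_action_def by (blast intro: smooth_on_continuous)

lemma p_smooth: "smooth_on S p" and p_image: "p ` S = N" and continuous_p: "continuous_on S p"
 using orbit smooth_on_continuous unfolding orbit_manifold_def by blast+

lemma p_eq_iff:
 assumes y: "y \<in> S" "y' \<in> S"
 shows "p y = p y' \<longleftrightarrow> (\<exists>g\<in>carrier G. y' = ph g y)"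
proof -
 note ga = group_action
 have "p y = p y' \<longleftrightarrow> orbit G ph y = orbit G ph y'" using orbit y unfolding orbit_manifold_def by blast
 also have "\<dots> \<longleftrightarrow> y' \<in> orbit G ph y"
 proof
  assume "orbit G ph y = orbit G ph y'"
  then show "y' \<in> orbit G ph y" using group_action.orbit_refl[OF ga y(2)] by simp
 next
  assume *: "y' \<in> orbit G ph y"
  have S: "z \<in> S" if "z \<in> orbit G ph w" "w \<in> S" for z w using that act_S unfolding orbit_def by blast
  show "orbit G ph y = orbit G ph y'"
   using group_action.orbit_trans[OF ga y(1) y(2) _ *] group_action.orbit_trans[OF ga y(2) y(1) _ group_action.orbit_sym[OF ga y *]] S y by auto
 qed
 also have "\<dots> \<longleftrightarrow> (\<exists>g\<in>carrier G. y' = ph g y)" unfolding orbit_def by blast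
 finally show ?thesis .
qed

lemma displacement: "\<exists>et>0. \<forall>y\<in>S. \<forall>g\<in>carrier G. g ~= \<one>\<^bsub>G\<^esub> --> et <= dist y (ph g y)"
proof -
 have "\<exists>e>0. \<forall>y\<in>S. e <= dist y (ph g y)" if g: "g \<in> carrier G" "g ~= \<one>\<^bsub>G\<^esub>" for g
 proof (cases "S = {}")
  case False
  obtain y0 where y0: "y0 \<in> S" "!!y. y \<in> S ==> dist y0 (ph g y0) <= dist y (ph g y)"
   using continuous_attains_inf[OF compact_sphere False continuous_on_dist[OF continuous_on_id continuous_act[OF g(1)]]] by blast
  have "0 < dist y0 (ph g y0)" using act_free[OF y0(1) g(1)] g(2) by force
  then show ?thesis using y0(2) by blast
 qed (use zero_less_one in blast)
 then have "\<forall>g\<in>carrier G - {\<one>\<^bsub>G\<^esub>}. \<exists>e. 0 < e \<and> (\<forall>y\<in>S. e <= dist y (ph g y))" by blast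
 from bchoice[OF this] obtain e where e: "\<forall>g\<in>carrier G - {\<one>\<^bsub>G\<^esub>}. 0 < e g \<and> (\<forall>y\<in>S. e g <= dist y (ph g y))" by blast
 let ?E = "insert 1 (e ` (carrier G - {\<one>\<^bsub>G\<^esub>}))"
 have fin: "finite ?E" using finite_G by simp
 have "0 < Min ?E" using e fin by auto
 moreover have "Min ?E <= dist y (ph g y)" if "y \<in> S" "g \<in> carrier G" "g ~= \<one>\<^bsub>G\<^esub>" for y g
 proof -
  have "Min ?E <= e g" using that fin by auto
  also have "e g <= dist y (ph g y)" using e that by blast
  finally show ?thesis .
 qed
 ultimately show ?thesis by blast
qed

lemma open_act: assumes g: "g \<in> carrier G" and U: "openin (top_of_set S) U"
 shows "openin (top_of_set S) (ph g ` U)"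
proof -
 have "ph g ` U = S \<inter> ph (m_inv G g) -` U"
 proof (intro equalityI subsetI)
  fix y assume "y \<in> ph g ` U"
  then show "y \<in> S \<inter> ph (m_inv G g) -` U"
   using U openin_imp_subset act_S[OF g] act_inv[OF g] by fastforce
 next
  fix y assume y: "y \<in> S \<inter> ph (m_inv G g) -` U"
  then have "ph g (ph (m_inv G g) y) = y" using act_inv[OF inv_carrier[OF g], of y] group.inv_inv[OF group g] by simp
  then show "y \<in> ph g ` U" using y by (metis IntD2 imageI vimage_eq)
 qed
 moreover have "openin (top_of_set S) (S \<inter> ph (m_inv G g) -` U)"
  using continuous_openin_preimage[OF continuous_act[OF inv_carrier[OF g]] _ U] act_S[OF inv_carrier[OF g]] by blast
 ultimately show ?thesis by simp
qed

lemma saturation: assumes "U <= S" shows "S \<inter> p -` (p ` U) = (\<Union>g\<in>carrier G. ph g ` U)"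
proof (intro equalityI subsetI)
 fix y assume y: "y \<in> S \<inter> p -` (p ` U)"
 then obtain a where a: "a \<in> U" "p y = p a" by auto
 then obtain g where "g \<in> carrier G" "y = ph g a" using p_eq_iff[of a y] assms y by (metis IntD1 subsetD)
 then show "y \<in> (\<Union>g\<in>carrier G. ph g ` U)" using a(1) by blast
next
 fix y assume "y \<in> (\<Union>g\<in>carrier G. ph g ` U)"
 then obtain g a where ga: "g \<in> carrier G" "a \<in> U" "y = ph g a" by blast
 have aS: "a \<in> S" using ga(2) assms by blast
 have yS: "y \<in> S" using act_S[OF ga(1) aS] ga(3) by simp
 moreover have "p a = p y" using p_eq_iff[OF aS yS] ga by blast
 ultimately show "y \<in> S \<inter> p -` (p ` U)" using ga(2) by (metis IntI imageI vimageI)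
qed

lemma open_p: assumes U: "openin (top_of_set S) U" shows "openin (top_of_set N) (p ` U)"
proof -
 have US: "U <= S" using U openin_imp_subset by blast
 have "openin (top_of_set S) (S \<inter> p -` (p ` U))" unfolding saturation[OF US]
  by (intro openin_Union) (auto intro: open_act U)
 then have "openin (top_of_set N) (N - p ` (S - S \<inter> p -` (p ` U)))"
  using closedin_compact[OF compact_sphere] by (fastforce simp: closedin_diff Diff_eq[of N] intro: compact_continuous_image continuous_on_subset[OF continuous_p] compact_imp_closed)
 moreover have "N - p ` (S - S \<inter> p -` (p ` U)) = p ` U"
 using US p_image[symmetric] by blast
 ultimately show ?thesis by simp
qed

text \<open>
 The preimage of the image of a small ball \<open>U\<close> is the disjoint union of the translates of \<open>U\<close>.
\<close>

lemma covering: "covering_space S p N"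
proof -
 obtain et where et: "0 < et" "!!y g. y \<in> S ==> g \<in> carrier G ==> g ~= \<one>\<^bsub>G\<^esub> ==> et <= dist y (ph g y)"
  using displacement by blast
 have "\<exists>T. x \<in> T \<and> openin (top_of_set N) T \<and> (\<exists>v. \<Union>v = S \<inter> p -` T \<and> (\<forall>u\<in>v. openin (top_of_set S) u) \<and>
   pairwise disjnt v \<and> (\<forall>u\<in>v. \<exists>q. homeomorphism u T p q))" if "x \<in> N" for x
 proof -
  obtain y0 where y0: "y0 \<in> S" "p y0 = x" using \<open>x \<in> N\<close> unfolding p_image[symmetric] by blast
  define U where "U = S \<inter> ball y0 (et / 2)"
  have U: "openin (top_of_set S) U" "U <= S" "y0 \<in> U" using et(1) y0(1) by (auto simp: U_def)
  have one: "g = \<one>\<^bsub>G\<^esub>" if "a \<in> U" "ph g a \<in> U" "g \<in> carrier G" for a g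
  proof (rule ccontr)
   assume "g ~= \<one>\<^bsub>G\<^esub>"
   then have "et <= dist a (ph g a)" using et(2) that U(2) by blast
   moreover have "dist a (ph g a) <= dist y0 a + dist y0 (ph g a)" by (metis dist_commute dist_triangle2)
   ultimately show False using that(1,2) unfolding U_def by auto
  qed
  have inj: "a = b" if ab: "a \<in> U" "b \<in> U" "p a = p b" for a b
  by (metis p_eq_iff[of a b] ab U(2) one[OF ab(1)] ab(2) group_action.id_eq_one[OF group_action] ab(1) restrict_apply' subsetD)
  have pg: "p (ph g a) = p a" if ga: "g \<in> carrier G" "a \<in> U" for g a
  proof -
   have aS: "a \<in> S" using ga(2) U(2) by blast
   show ?thesis by (metis ga(1) p_eq_iff[OF aS act_S[OF ga(1) aS]])
  qed
  have "pairwise disjnt ((%g. ph g ` U) ` carrier G)"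
   unfolding pairwise_def
  proof (intro ballI impI)
   fix A B assume "A \<in> (%g. ph g ` U) ` carrier G" "B \<in> (%g. ph g ` U) ` carrier G" and AB: "A ~= B"
   then obtain g k where gk: "g \<in> carrier G" "k \<in> carrier G" "A = ph g ` U" "B = ph k ` U" by blast
   show "disjnt A B" unfolding disjnt_def
   proof (rule ccontr)
    assume "A \<inter> B ~= {}"
    then obtain a b where ab: "a \<in> U" "b \<in> U" "ph g a = ph k b" unfolding gk by blast
    then have "a = b" using inj[of a b] pg[OF gk(1) ab(1)] pg[OF gk(2) ab(2)] by simp
    have aS: "a \<in> S" using ab(1) U(2) by blast
    show False
     by (metis act_compose[OF aS inv_carrier[OF gk(2)] gk(1)] act_inv[OF gk(2) aS] ab(3) \<open>a = b\<close> act_free[OF aS] AB gk group.inv_inv[OF group gk(1)] group.inv_inv[OF group gk(2)] group.inv_equality[OF group _ gk(1) inv_carrier[OF gk(2)]] arg_cong monoid.m_closed[OF group.is_monoid[OF group] inv_carrier[OF gk(2)] gk(1)])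
   qed
  qed
  moreover have "\<exists>q. homeomorphism (ph g ` U) (p ` U) p q" if g: "g \<in> carrier G" for g
  proof -
   have V: "openin (top_of_set S) (ph g ` U)" "ph g ` U <= S" using open_act[OF g U(1)] openin_imp_subset by blast+
   have im: "p ` ph g ` U = p ` U" using pg[OF g] by (simp add: image_image)
   have "inj_on p (ph g ` U)" using pg[OF g] by (auto intro!: inj_onI arg_cong[of _ _ "ph g"] inj)
   moreover have "openin (top_of_set (p ` U)) (p ` W)" if "openin (top_of_set (ph g ` U)) W" for W
   proof -
    have "openin (top_of_set S) W" using that V(1) openin_trans by blast
    moreover have "p ` W <= p ` U" using openin_imp_subset[OF that] im by blast
    ultimately show ?thesis using open_p openin_subset_trans[of N "p ` W" "p ` U"] U(2) p_image by blast
   qed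
   ultimately show ?thesis
    using homeomorphism_injective_open_map[OF continuous_on_subset[OF continuous_p V(2)] im] by metis
  qed
  ultimately show ?thesis using y0 U(3) open_p[OF U(1)] open_act[OF _ U(1)] saturation[OF U(2)] by (intro exI[of _ "p ` U"], auto)
 qed
 then show ?thesis unfolding covering_space_def using continuous_p p_image by blast
qed

theorem deck_cover:
 assumes g: "g \<in> carrier G" "g ~= \<one>\<^bsub>G\<^esub>"
 shows "\<exists>et. deck_cover p N et (ph g)"
proof -
 obtain et where et: "0 < et" "!!y g. y \<in> S ==> g \<in> carrier G ==> g ~= \<one>\<^bsub>G\<^esub> ==> et <= dist y (ph g y)"
  using displacement by blast
 have "deck_cover p N et (ph g)"
 proof unfold_locales
  show "smooth_on S p" "p ` S = N" "covering_space S p N" "0 < et" by (fact p_smooth p_image covering et)+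
  show "y = y' \<or> et <= dist y y'" if y: "y \<in> S" "y' \<in> S" "p y = p y'" for y y'
  proof -
   obtain k where k: "k \<in> carrier G" "y' = ph k y" using p_eq_iff y by blast
   show ?thesis
   proof (cases "k = \<one>\<^bsub>G\<^esub>")
    case True
    then show ?thesis using k group_action.id_eq_one[OF group_action] y(1) by (metis restrict_apply')
   qed (use et(2)[OF y(1) k(1)] k(2) in simp)
  qed
  show "bij_betw (differential S p y) (tangent_space S y) (tangent_space N (p y))" if "y \<in> S" for y
   using orbit that unfolding orbit_manifold_def by blast
  show "continuous_on S (ph g)" "ph g ` S <= S" using continuous_act[OF g(1)] act_S[OF g(1)] by blast+
  show "ph g y ~= y" if "y \<in> S" for y using act_free[OF that g(1)] g(2) by blast
  show "p (ph g y) = p y" if "y \<in> S" for y using p_eq_iff[OF that act_S[OF g(1) that]] g(1) by metis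
 qed
 then show ?thesis ..
qed

end

section \<open>The equivalence of the seven conditions\<close>

lemma all_equivalentI: "(!!P. P \<in> set Ps ==> P \<longleftrightarrow> Q) ==> all_equivalent Ps"
 unfolding all_equivalent_def by blast

lemma homotopic_with_canon_cong:
 assumes "!!x. x \<in> X ==> f x = f' x" and "!!u v. (!!x. x \<in> X ==> u x = v x) ==> P u \<longleftrightarrow> P v"
 shows "homotopic_with_canon P X Y f g \<longleftrightarrow> homotopic_with_canon P X Y f' g"
proof -
 have "homotopic_with_canon P X Y k' g" if "homotopic_with_canon P X Y k g" "!!x. x \<in> X ==> k x = k' x" for k k'
  by (rule homotopic_with_eq[OF that(1)]) (use that(2) in simp, simp, rule assms(2), simp)
 from this[of f f'] this[of f' f] show ?thesis using assms(1) by auto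
qed

theorem corollary1p21:
 fixes G :: "('g, 'r) monoid_scheme"
  and \<phi> :: "'g \<Rightarrow> 'e::euclidean_space \<times> real \<Rightarrow> 'e \<times> real"
  and N :: "'c::euclidean_space set"
  and p :: "'e \<times> real \<Rightarrow> 'c"
  and h :: "'c \<Rightarrow> 'c \<Rightarrow> 'c \<Rightarrow> real"
  and \<iota> :: "'e \<Rightarrow> 'c"
  and f :: "'d::euclidean_space \<times> real \<Rightarrow> 'c"
  and f_lift :: "'d \<times> real \<Rightarrow> 'e \<times> real"
  and m n :: nat
  and Sm :: "('d \<times> real) set"
  and Sn :: "('e \<times> real) set"
 defines "Sm \<equiv> usphere" and "Sn \<equiv> usphere"
 assumes "DIM('d) = m" and "DIM('e) = n" and "m \<ge> 1" and "n \<ge> 1"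
  and "group G" and "finite (carrier G)" and "carrier G \<noteq> {\<one>\<^bsub>G\<^esub>}"
  and "free_smooth_action G Sn \<phi>"
  and "orbit_manifold G n Sn \<phi> N p"
  and "riemannian_metric N h"
  and "tangent_frame N h (f north) \<iota>"
  and "continuous_map (top_of_set Sm) (top_of_set N) f"
  and "continuous_map (top_of_set Sm) (top_of_set Sn) f_lift"
  and "based_class Sm north N (p \<circ> f_lift) = based_class Sm north N f"
 shows "all_equivalent
  [boundary_hom N h (f north) \<iota> (based_class Sm north N f)
    \<noteq> based_class usphere e0 usphere (\<lambda>_. e0) \<and>
    freudenthal (boundary_hom N h (f north) \<iota> (based_class Sm north N f))
    = based_class Sm north Sn (\<lambda>_. north),
   MCC Sm N f f \<noteq> nielsen_number Sm N f f,
   nielsen_number Sm N f f = 0 \<and> coincidence_producing Sm N f,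
   MCC Sm N f f > MCC Sm Sn f_lift f_lift,
   MC Sm N f f > MC Sm Sn f_lift f_lift,
   loose Sm Sn f_lift f_lift \<and> \<not> loose Sm N f f,
   loose Sm Sn f_lift f_lift \<and> \<not> loose_by_small_deformation Sm Sn f_lift]"
proof -
 have group: "group G" and fin: "finite (carrier G)" and nontrivial: "carrier G \<noteq> {\<one>\<^bsub>G\<^esub>}"
  and act: "free_smooth_action G Sn \<phi>" and orb: "orbit_manifold G n Sn \<phi> N p"
  and metric: "riemannian_metric N h" and frame: "tangent_frame N h (f north) \<iota>"
  and f: "continuous_on Sm f" "f ` Sm \<subseteq> N" and fl: "continuous_on Sm f_lift" "f_lift ` Sm \<subseteq> Sn"
  and cls: "based_class Sm north N (p \<circ> f_lift) = based_class Sm north N f"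
  using assms by (auto simp: image_subset_iff_funcset)
 note Sdefs = Sm_def Sn_def
 interpret orbit: free_orbit_map G \<phi> n N p
  by (rule free_orbit_map.intro) (use group fin act orb in \<open>simp_all add: Sn_def\<close>)
 obtain g where g: "g \<in> carrier G" "g \<noteq> \<one>\<^bsub>G\<^esub>"
  using nontrivial by (auto intro!: monoid.one_closed[OF group.is_monoid[OF group]])
 obtain \<eta> where "deck_cover p N \<eta> (\<phi> g)" using orbit.deck_cover[OF g] by blast
 then interpret deck_cover p N \<eta> "\<phi> g" .
 have nn: "(north :: 'd \<times> real) \<in> Sm" by (simp add: Sm_def)
 have X: "compact Sm" by (simp add: Sm_def)

 \<comment> \<open>The class of \<open>f_lift\<close> has a representative which lifts \<open>f\<close> itself.\<close>
 have "f \<in> based_class Sm north N f" using f unfolding based_class_def by (simp add: image_subset_iff_funcset)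
 then have "homotopic_with_canon (\<lambda>h. h north = (p \<circ> f_lift) north) Sm N (p \<circ> f_lift) f"
  unfolding cls[symmetric] by (simp add: based_class_def)
 then obtain fh where fh: "homotopic_maps Sm Sn f_lift fh" "\<And>x. x \<in> Sm \<Longrightarrow> p (fh x) = f x"
  by (force simp: homotopic_maps_def o_def Sn_def intro: homotopic_with_mono lift_homotopic[OF fl[unfolded Sn_def]] that)
 note fh' = homotopic_maps_imp(2,4)[OF fh(1)]
 define F where "F = (\<lambda>x. p (fh x))"
 have F: "\<And>x. x \<in> Sm \<Longrightarrow> f x = F x" using fh(2) by (simp add: F_def)
 have hF: "homotopic_maps Sm N f = homotopic_maps Sm N F"
  unfolding homotopic_maps_def by (intro ext homotopic_with_canon_cong F) auto
 have loose_F: "loose Sm N f = loose Sm N F" "loose Sm N f f = loose Sm N F F"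
  unfolding loose_def hF by (intro ext refl)+
 have MC_F: "MC Sm N f f = MC Sm N F F" "MCC Sm N f f = MCC Sm N F F" unfolding MC_def MCC_def hF by simp_all
 have cp_F: "coincidence_producing Sm N f = coincidence_producing Sm N F"
  unfolding coincidence_producing_def loose_F ..
 have "small_homotopic \<epsilon> Sm N f k \<longleftrightarrow> small_homotopic \<epsilon> Sm N F k" for \<epsilon> k
  unfolding small_homotopic_def using F by (subst homotopic_with_canon_cong[of Sm f F]) auto
 then have nielsen_F: "nielsen_number Sm N f f = nielsen_number Sm N F F" unfolding nielsen_number_def by simp
 have class_F: "based_class Sm north N f = based_class Sm north N F"
  unfolding based_class_def F[OF nn] using nn by (intro Collect_cong homotopic_with_canon_cong F) auto
 have north_F: "f north = F north" by (rule F[OF nn])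

 define NZ where "NZ \<longleftrightarrow> has_field Sm f_lift"
 define lo where "lo \<longleftrightarrow> loose Sm Sn f_lift f_lift"
 have NZ_fh: "NZ \<longleftrightarrow> has_field Sm fh"
  unfolding NZ_def using has_field_homotopic[OF X] fh(1) homotopic_maps_sym unfolding Sn_def by blast
 have dims: "DIM('d \<times> real) = m + 1" "DIM('e \<times> real) = n + 1" using assms by simp_all
 have dim2: "2 \<le> DIM('e \<times> real)" using dims assms by simp
 have lo_anti: "lo \<longleftrightarrow> homotopic_maps Sm Sn f_lift (\<lambda>x. - f_lift x)"
  unfolding lo_def Sn_def by (rule loose_antipodal[OF fl[unfolded Sn_def]])
 have neg: "homotopic_maps Sm Sn (\<lambda>x. - f_lift x) (\<lambda>x. - fh x)"
  unfolding Sn_def by (rule homotopic_maps_uminus[OF fh(1)[unfolded Sn_def]])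
 have lo_fh: "lo \<longleftrightarrow> homotopic_maps Sm Sn fh (\<lambda>x. - fh x)" unfolding lo_anti
  using homotopic_maps_trans[OF homotopic_maps_sym[OF fh(1)] homotopic_maps_trans[OF _ neg]]
   homotopic_maps_trans[OF fh(1) homotopic_maps_trans[OF _ homotopic_maps_sym[OF neg]]] by blast
 have NZ_lo: "lo" if NZ unfolding lo_anti Sn_def
  by (rule has_field_antipodal[OF fl[unfolded Sn_def]]) (use that NZ_def in simp)
 have low: "NZ" if "m = 1 \<or> n = 1"
 proof (cases "n = 1")
  case True
  then show ?thesis unfolding NZ_def using assms by (intro has_field_circle fl[unfolded Sn_def]) simp
 next
  case False
  then have "DIM('d \<times> real) < DIM('e \<times> real)" using that dims assms by simp
  then show ?thesis unfolding NZ_def Sm_def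
   by (rule has_field_low_dimension[OF _ dim2]) (use fl in \<open>simp_all add: Sdefs\<close>)
 qed

 have N_loose: "loose Sm N f f \<longleftrightarrow> NZ"
  unfolding loose_F(2) NZ_fh F_def by (rule loose_iff_field[OF X fh'[unfolded Sn_def]])
 have cp: "coincidence_producing Sm N f \<longleftrightarrow> \<not> NZ"
 proof -
  have "3 \<le> DIM('d \<times> real) \<or> has_field Sm fh" using low NZ_fh dims assms by auto
  then show ?thesis unfolding cp_F NZ_fh unfolding F_def Sm_def
   by (intro coincidence_producing_iff_no_field) (use fh' in \<open>simp_all add: Sdefs\<close>)
 qed
 have nielsen: "nielsen_number Sm N f f = (if lo then 0 else 1)"
 proof -
  have "path_connected Sm" unfolding Sm_def using dims assms by (intro path_connected_sphere) simp
  from nielsen_number_self[OF this[unfolded Sm_def] fh'[unfolded Sdefs]]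
  show ?thesis unfolding nielsen_F lo_fh unfolding F_def Sdefs by (simp add: loose_antipodal fh'[unfolded Sdefs])
 qed
 have le1: "x = 0 \<or> x = 1" if "x \<le> 1" for x :: enat
  using that by (cases x) (auto simp: one_enat_def zero_enat_def)
 have "MC Sm N f f \<le> 1" "MCC Sm N f f \<le> 1"
  unfolding MC_F unfolding F_def Sm_def by (rule minimum_numbers_le_1[OF _ _ dim2]; use fh' in \<open>simp add: Sdefs\<close>)+
 then have MC: "MC Sm N f f = (if NZ then 0 else 1)" "MCC Sm N f f = (if NZ then 0 else 1)"
  using le1 N_loose MC_eq_0[of Sm N f f] MCC_eq_0[of Sm N f f] by auto
 have lt1: "x < 1 \<longleftrightarrow> x = 0" for x :: enat
  by (cases x) (auto simp: one_enat_def zero_enat_def)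

 have boundary: "(boundary_hom N h (f north) \<iota> (based_class Sm north N f) \<noteq> based_class usphere e0 usphere (\<lambda>_. e0) \<and>
    freudenthal (boundary_hom N h (f north) \<iota> (based_class Sm north N f)) = based_class Sm north Sn (\<lambda>_. north)) \<longleftrightarrow> lo \<and> \<not> NZ"
 proof (cases "m = 1")
  case True
  then show ?thesis using assms low by (simp add: boundary_hom_def)
 next
  case False
  then have m: "DIM('d) \<noteq> 1" using assms by simp
  interpret lifted_map p N \<eta> h \<iota> fh
   by (intro lifted_map.intro lifted_map_axioms.intro spherical_cover_axioms)
    (use metric frame fh' in \<open>simp_all add: Sdefs north_F F_def\<close>)
  have 1: "boundary_hom N h (f north) \<iota> (based_class Sm north N f) = based_class usphere e0 usphere (\<lambda>_. e0) \<longleftrightarrow> NZ"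
   unfolding class_F north_F NZ_fh unfolding F_def Sm_def by (rule boundary_hom_zero_iff[OF m])
  show ?thesis
  proof (cases "n = 1")
   case True
   then show ?thesis using 1 low by simp
  next
   case False
   then have "2 \<le> DIM('e)" using assms by simp
   then have "freudenthal (boundary_hom N h (f north) \<iota> (based_class Sm north N f)) = based_class Sm north Sn (\<lambda>_. north) \<longleftrightarrow> lo"
    unfolding class_F north_F lo_fh unfolding F_def Sdefs by (rule suspension_zero_iff[OF m])
   then show ?thesis using 1 by blast
  qed
 qed
 show ?thesis
  using NZ_lo small_deformation_iff_field[OF X fl[unfolded Sn_def]] boundary MC_eq_0 MCC_eq_0 by (fastforce simp: MC nielsen cp lo_def MC_eq_0[of Sm Sn f_lift f_lift, symmetric] MCC_eq_0[of Sm Sn f_lift f_lift, symmetric] lt1 NZ_def Sn_def N_loose list.set insert_iff empty_iff intro: all_equivalentI[of _ "lo \<and> \<not> NZ"])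
qed

end
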